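(* Assume the following reverse square function estimate: for every $\epsilon>0$ there is $C_\epsilon$ such that for all $R\ge1$ and all Schwartz $F:\mathbb{R}^3\to\mathbb{C}$ whose Fourier transform is supported on $\mathcal{N}_{\mathbb{C}o^2}(R^{-1})$, $$\|F\|_{L^4(\mathbb{R}^3)}\le C_\epsilon R^\epsilon\Big\|\Big(\sum_{\theta\in\Theta_{\mathbb{C}o^2}(R^{-1})}|\mathcal{P}_\theta F|^2\Big)^{\frac12}\Big\|_{L^4(\mathbb{R}^3)}.$$ Then the small cap decoupling for the cone holds: for every $2\le p\le4$ and every $\epsilon>0$ there is $C_{\epsilon,p}$ such that for all $R\ge1$ and all Schwartz $F:\mathbb{R}^3\to\mathbb{C}$ whose Fourier transform is supported inside $\mathcal{N}_{\mathbb{C}o^2}(R^{-1})$, $$\|F\|_{L^p(\mathbb{R}^3)}\le C_{\epsilon,p}R^{\frac12-\frac1p+\epsilon}\Big(\sum_{\gamma\in\Gamma(R^{-1})}\|\mathcal{P}_\gamma F\|_{L^p(\mathbb{R}^3)}^p\Big)^{\frac1p}.$$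
   Context: $e(z)=e^{2\pi iz}$. $\mathbb{C}o^2=\{(\xi_1,\xi_2,\sqrt{\xi_1^2+\xi_2^2}):1\le\xi_1^2+\xi_2^2\le2\}$ is the truncated cone and $\mathcal{N}_{\mathbb{C}o^2}(\delta)$ is its $\delta$-neighborhood. $\Theta_{\mathbb{C}o^2}(\delta)$ is a partition of $\mathcal{N}_{\mathbb{C}o^2}(\delta)$ into almost rectangular boxes $\theta$ with dimensions $\sim(\delta^{1/2},\delta,1)$ (angular, normal, and null/radial direction of the cone). Each $\theta$ is partitioned into almost rectangular boxes $\gamma$ with dimensions $\sim(\delta^{1/2},\delta,\delta^{1/2})$; $\Gamma(\delta)$ is the collection of all these $\gamma$. A set $B$ is an almost rectangular box if $C^{-1}R_0\subset B\subset CR_0$ for a genuine rectangular box $R_0$ and $C=O(1)$. $\mathcal{P}_BF(x)=\int_B\widehat F(\xi)e(\xi\cdot x)\,d\xi$. *)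

theory Defs
  imports "HOL-Analysis.Analysis" "HOL-Library.Disjoint_Sets"
begin

section \<open>Schwartz functions, Fourier transform, norms\<close>

definition e :: "complex \<Rightarrow> complex" where
  "e z = exp (2 * of_real pi * \<i> * z)"

definition partial_deriv :: "3 \<Rightarrow> (real^3 \<Rightarrow> complex) \<Rightarrow> real^3 \<Rightarrow> complex" where
  "partial_deriv i f x = frechet_derivative f (at x) (axis i 1)"

text \<open>A list of coordinates encodes an iterated partial derivative. Differentiability of all
  of them is \<open>C\<^sup>\<infinity>\<close>-smoothness.\<close>

fun iter_partial :: "3 list \<Rightarrow> (real^3 \<Rightarrow> complex) \<Rightarrow> real^3 \<Rightarrow> complex" where
  "iter_partial [] f = f"
| "iter_partial (i # is) f = partial_deriv i (iter_partial is f)"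

definition schwartz :: "(real^3 \<Rightarrow> complex) \<Rightarrow> bool" where
  "schwartz F \<longleftrightarrow>
     (\<forall>is. (\<forall>x. iter_partial is F differentiable (at x)) \<and>
        (\<forall>N::nat. \<exists>A::real. \<forall>x. (1 + norm x) ^ N * norm (iter_partial is F x) \<le> A))"

definition fourier :: "(real^3 \<Rightarrow> complex) \<Rightarrow> real^3 \<Rightarrow> complex" where
  "fourier F \<xi> = (LINT x|lborel. F x * e (- of_real (\<xi> \<bullet> x)))"

definition fourier_supp :: "(real^3 \<Rightarrow> complex) \<Rightarrow> (real^3) set" where
  "fourier_supp F = closure {\<xi>. fourier F \<xi> \<noteq> 0}"

definition freq_proj :: "(real^3) set \<Rightarrow> (real^3 \<Rightarrow> complex) \<Rightarrow> real^3 \<Rightarrow> complex" where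
  "freq_proj B F x = (LINT \<xi>:B|lebesgue. fourier F \<xi> * e (of_real (\<xi> \<bullet> x)))"

text \<open>The Bochner integral is \<open>0\<close> for non-integrable functions. This convention is never active
  below: for Schwartz \<open>F\<close>, bounded measurable \<open>B\<close> and \<open>p \<ge> 2\<close>, the function
  \<open>freq_proj B F\<close> is continuous and lies in \<open>L\<^sup>2 \<inter> L\<^sup>\<infinity>\<close>.\<close>

definition Lp_norm :: "real \<Rightarrow> (real^3 \<Rightarrow> 'b::real_normed_vector) \<Rightarrow> real" where
  "Lp_norm p f = (LINT x|lborel. norm (f x) powr p) powr (1 / p)"

section \<open>The truncated cone and its plank decompositions\<close>

definition trunc_cone :: "(real^3) set" where
  "trunc_cone = {\<xi>. \<xi>$3 = sqrt ((\<xi>$1)\<^sup>2 + (\<xi>$2)\<^sup>2) \<and>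
                     1 \<le> (\<xi>$1)\<^sup>2 + (\<xi>$2)\<^sup>2 \<and> (\<xi>$1)\<^sup>2 + (\<xi>$2)\<^sup>2 \<le> 2}"

text \<open>The neighborhood is closed, so that it contains the (closed) Fourier support of a function
  iff it contains all points where the Fourier transform is nonzero.\<close>

definition cone_nbhd :: "real \<Rightarrow> (real^3) set" where
  "cone_nbhd \<delta> = {\<xi>. infdist \<xi> trunc_cone \<le> \<delta>}"

text \<open>The orthonormal frame of the cone along the light ray at angle \<open>t\<close>.\<close>

definition angular_dir :: "real \<Rightarrow> real^3" where
  "angular_dir t = vector [- sin t, cos t, 0]"

definition normal_dir :: "real \<Rightarrow> real^3" where
  "normal_dir t = (1 / sqrt 2) *\<^sub>R vector [cos t, sin t, -1]"

definition null_dir :: "real \<Rightarrow> real^3" where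
  "null_dir t = (1 / sqrt 2) *\<^sub>R vector [cos t, sin t, 1]"

text \<open>The rectangular box with center \<open>c\<close> and full side lengths \<open>a1\<close>, \<open>a2\<close>, \<open>a3\<close> in the
  angular, normal and null direction at angle \<open>t\<close>.\<close>

definition cone_box :: "real^3 \<Rightarrow> real \<Rightarrow> real \<Rightarrow> real \<Rightarrow> real \<Rightarrow> (real^3) set" where
  "cone_box c t a1 a2 a3 =
     {\<xi>. \<bar>(\<xi> - c) \<bullet> angular_dir t\<bar> \<le> a1 / 2 \<and>
         \<bar>(\<xi> - c) \<bullet> normal_dir t\<bar> \<le> a2 / 2 \<and>
         \<bar>(\<xi> - c) \<bullet> null_dir t\<bar> \<le> a3 / 2}"

text \<open>\<open>K\<close> is the implied constant in all of \<open>\<sim>\<close> and \<open>O(1)\<close>. The frame is taken at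
  the angle of the center \<open>c\<close>. The two inclusions are \<open>K\<^sup>-\<^sup>1 R\<^sub>0 \<subseteq> B \<subseteq> K R\<^sub>0\<close>, with dilations
  about \<open>c\<close>. Measurability of \<open>B\<close> is implicit in integrating over \<open>B\<close>.\<close>

definition almost_cone_box :: "real \<Rightarrow> real \<Rightarrow> real \<Rightarrow> real \<Rightarrow> (real^3) set \<Rightarrow> bool" where
  "almost_cone_box K d1 d2 d3 B \<longleftrightarrow>
     B \<in> sets lebesgue \<and>
     (\<exists>c t \<rho> a1 a2 a3.
        \<rho> \<ge> 0 \<and> c$1 = \<rho> * cos t \<and> c$2 = \<rho> * sin t \<and>
        a1 \<in> {d1 / K..K * d1} \<and> a2 \<in> {d2 / K..K * d2} \<and> a3 \<in> {d3 / K..K * d3} \<and>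
        cone_box c t (a1 / K) (a2 / K) (a3 / K) \<subseteq> B \<and>
        B \<subseteq> cone_box c t (K * a1) (K * a2) (K * a3))"

definition plank_partition :: "real \<Rightarrow> real \<Rightarrow> (real^3) set set \<Rightarrow> bool" where
  "plank_partition K \<delta> T \<longleftrightarrow>
     partition_on (cone_nbhd \<delta>) T \<and>
     (\<forall>\<theta>\<in>T. almost_cone_box K (sqrt \<delta>) \<delta> 1 \<theta>)"

text \<open>\<open>G\<close> is the collection of all small caps, \<open>Q \<theta>\<close> being those that partition \<open>\<theta>\<close>.\<close>

definition small_cap_partition ::
    "real \<Rightarrow> real \<Rightarrow> (real^3) set set \<Rightarrow> (real^3) set set \<Rightarrow> bool" where
  "small_cap_partition K \<delta> T G \<longleftrightarrow>
     (\<exists>Q. (\<forall>\<theta>\<in>T. partition_on \<theta> (Q \<theta>)) \<and> G = (\<Union>\<theta>\<in>T. Q \<theta>)) \<and>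
     (\<forall>\<gamma>\<in>G. almost_cone_box K (sqrt \<delta>) \<delta> (sqrt \<delta>) \<gamma>)"

end

theory Submission
  imports Defs "HOL-Probability.Characteristic_Functions" "HOL-Probability.Sinc_Integral"
begin

text \<open>
  Write \<open>s\<close> for \<open>R\<^sup>-\<^sup>1\<^sup>/\<^sup>2\<close>, so that the small caps \<open>\<gamma>\<close> have dimensions about \<open>s \<times> s\<^sup>2 \<times> s\<close> and there are about
  \<open>s\<^sup>-\<^sup>2 = R\<close> of them. The argument bounds \<open>F\<close> by the pieces \<open>P\<^sub>\<gamma> F\<close> in \<open>L\<^sup>2\<close> without loss and in \<open>L\<^sup>4\<close> with
  the loss \<open>R\<^sup>1\<^sup>+\<^sup>\<epsilon>\<close> on the level of fourth powers, and interpolates; the exponent \<open>(p - 2) / 2\<close> of this loss, divided by \<open>p\<close>, is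
  \<open>1/2 - 1/p\<close>.

  The caps are arbitrary measurable sets between two boxes, so the projections to them need not be
  bounded on any \<open>L\<^sup>p\<close> other than \<open>L\<^sup>2\<close>, and interpolation cannot use them directly. Therefore every cap gets
  a Schwartz kernel \<open>u\<^sub>\<gamma>\<close> whose Fourier transform is \<open>1\<close> on the outer box of \<open>\<gamma>\<close> and \<open>0\<close> off the double
  of that box (\<open>box_kernel_exists\<close>). All kernels are rotated, rescaled and modulated copies of one function and have the same
  \<open>L\<^sup>1\<close> norm. The linear operator \<open>superpose\<close>, which sends a family \<open>f\<^sub>\<gamma>\<close> to \<open>\<Sum>\<^sub>\<gamma> f\<^sub>\<gamma> * u\<^sub>\<gamma>\<close>, reproduces \<open>F\<close>
  from \<open>f\<^sub>\<gamma> = P\<^sub>\<gamma> F\<close> (\<open>superpose_freq_proj\<close>), and it is this operator that is bounded and interpolated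
  (\<open>marcinkiewicz_superpose\<close>, \<open>superpose_bounded_extension\<close>).

  In \<open>L\<^sup>2\<close> the doubled boxes overlap boundedly often, because disjoint caps contain disjoint boxes of comparable size
  (\<open>packing\<close>), and almost orthogonality applies (\<open>superpose_L2\<close>).

  In \<open>L\<^sup>4\<close> the hypothesis is applied at the coarser scale \<open>s' = 100 K\<^sup>4 s\<close>. The hypothesis only sees sharp projections
  to planks, and the double box of a cap may straddle several of them. However, a rotation about the axis, a dilation and a vertical translation
  carry this box into the core of some plank, and boundedly many parameters
  suffice for these three motions (\<open>alignment\<close>). All three preserve the form of the estimate
  (\<open>transformed_reverse_square_function\<close>). After the caps are split into boundedly many classes with common
  parameters, the square function of every class is that of the sums over the caps in a common plank. Its \<open>L\<^sup>4\<close>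
  norm expands into integrals of products over quadruples of caps. Such an integral vanishes unless \<open>c\<^sub>i - c\<^sub>j = c\<^sub>k - c\<^sub>l\<close> up
  to \<open>O(s)\<close> for the centres of the caps, where \<open>i, j\<close> lie on nearly the same light ray, and also \<open>k, l\<close>. Two light rays at
  angle \<open>\<alpha>\<close> are transversal, so this forces both differences to have length \<open>O(s / \<alpha>)\<close>, and for fixed \<open>i\<close> only
  \<open>O(s\<^sup>-\<^sup>2 log (1/s))\<close> quadruples remain (\<open>card_quads\<close>). This count is the loss \<open>R\<^sup>1\<^sup>+\<^sup>\<epsilon>\<close> (\<open>square_function_L4\<close>, \<open>superpose_L4\<close>). When \<open>s'\<close> is too large
  for the coarser scale to make sense, the number of caps is bounded and the triangle inequality suffices
  (\<open>superpose_L4_crude\<close>).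
\<close>

section \<open>Characters, Gaussians and the Fourier transform\<close>

definition ch :: "real \<Rightarrow> complex" where
  "ch t = e (of_real t)"

lemma ch_cis: "ch t = cis (2 * pi * t)"
  unfolding ch_def e_def cis_conv_exp by (simp add: mult_ac)

lemma norm_ch [simp]: "norm (ch t) = 1"
  unfolding ch_cis by simp

lemma ch_0 [simp]: "ch 0 = 1"
  unfolding ch_cis by simp

lemma ch_add: "ch (a + b) = ch a * ch b"
  unfolding ch_cis by (simp add: cis_mult ring_distribs)

lemma ch_minus: "ch (- t) = cnj (ch t)"
  unfolding ch_cis by (simp add: cis_cnj)

lemma ch_diff: "ch (a - b) = ch a * ch (- b)"
  by (simp flip: ch_add)

lemma ch_cancel: "ch t * ch (- t) = 1"
  by (simp flip: ch_add)

lemma ch_sum: "finite A \<Longrightarrow> ch (\<Sum>b\<in>A. f b) = (\<Prod>b\<in>A. ch (f b))"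
  by (induction A rule: finite_induct) (auto simp: ch_add)

lemma continuous_on_ch [continuous_intros]:
  "continuous_on A f \<Longrightarrow> continuous_on A (\<lambda>x. ch (f x))"
  unfolding ch_cis by (intro continuous_intros)

lemma isCont_ch: "isCont ch t"
  using continuous_on_ch[OF continuous_on_id, of UNIV] by (simp add: continuous_on_eq_continuous_at)

lemma borel_measurable_ch [measurable]: "ch \<in> borel_measurable borel"
  by (intro borel_measurable_continuous_onI continuous_intros)

lemma tendsto_ch [tendsto_intros]: "(f \<longlongrightarrow> a) F \<Longrightarrow> ((\<lambda>x. ch (f x)) \<longlongrightarrow> ch a) F"
  by (rule isCont_tendsto_compose[OF isCont_ch])

lemma
  fixes f :: "'a::euclidean_space \<Rightarrow> real \<Rightarrow> complex"
  assumes f: "\<And>b. b \<in> Basis \<Longrightarrow> integrable lborel (f b)"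
  shows integrable_lborel_prod: "integrable lborel (\<lambda>x::'a. \<Prod>b\<in>Basis. f b (x \<bullet> b))"
    and integral_lborel_prod: "(LINT x|lborel. (\<Prod>b\<in>Basis. f b (x \<bullet> b))) = (\<Prod>b\<in>Basis. LINT x|lborel. f b x)"
proof -
  interpret product_sigma_finite "\<lambda>_::'a. lborel :: real measure"
    by (simp add: product_sigma_finite_def lborel.sigma_finite_measure_axioms)
  have [measurable]: "\<And>b. b \<in> Basis \<Longrightarrow> f b \<in> borel_measurable borel"
    using f by auto
  have m: "(\<lambda>f. \<Sum>b\<in>Basis. f b *\<^sub>R b) \<in> measurable (\<Pi>\<^sub>M b\<in>(Basis::'a set). lborel) borel"
    by measurable
  have m2: "(\<lambda>x::'a. \<Prod>b\<in>Basis. f b (x \<bullet> b)) \<in> borel_measurable borel"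
    by measurable
  have eq: "(\<Prod>b\<in>Basis. f b ((\<Sum>c\<in>Basis. y c *\<^sub>R c) \<bullet> b)) = (\<Prod>b\<in>Basis. f b (y b))" for y :: "'a \<Rightarrow> real"
    by (intro prod.cong) auto
  show "integrable lborel (\<lambda>x::'a. \<Prod>b\<in>Basis. f b (x \<bullet> b))"
    by (subst lborel_eq, subst integrable_distr_eq[OF m m2]) (simp add: eq product_integrable_prod f)
  show "(LINT x|lborel. (\<Prod>b\<in>(Basis::'a set). f b (x \<bullet> b))) = (\<Prod>b\<in>(Basis::'a set). LINT x|lborel. f b x)"
    by (subst lborel_eq, subst integral_distr[OF m m2]) (simp add: eq product_integral_prod f)
qed

definition ft :: "('a::euclidean_space \<Rightarrow> complex) \<Rightarrow> 'a \<Rightarrow> complex" where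
  "ft f \<xi> = (LINT x|lborel. f x * ch (- (\<xi> \<bullet> x)))"

definition ift :: "('a::euclidean_space \<Rightarrow> complex) \<Rightarrow> 'a \<Rightarrow> complex" where
  "ift h x = (LINT \<xi>|lborel. h \<xi> * ch (\<xi> \<bullet> x))"

definition gauss_density :: "real \<Rightarrow> 'a::euclidean_space \<Rightarrow> real" where
  "gauss_density \<sigma> x = (\<Prod>b\<in>Basis. normal_density 0 \<sigma> (x \<bullet> b))"

definition gauss_weight :: "real \<Rightarrow> 'a::euclidean_space \<Rightarrow> real" where
  "gauss_weight \<sigma> x = exp (- (2 * pi\<^sup>2 * \<sigma>\<^sup>2 * (norm x)\<^sup>2))"

lemma ch_inner_prod: "ch (\<xi> \<bullet> x) = (\<Prod>b\<in>Basis. ch ((\<xi> \<bullet> b) * (x \<bullet> b)))"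
  for x :: "'a::euclidean_space"
  by (subst euclidean_inner) (simp add: ch_sum)

lemma gauss_density_nonneg [simp]: "gauss_density \<sigma> x \<ge> 0"
  by (auto simp: gauss_density_def intro!: prod_nonneg)

lemma gauss_density_measurable [measurable]: "gauss_density \<sigma> \<in> borel_measurable borel"
  unfolding gauss_density_def by measurable

lemma gauss_weight_measurable [measurable]: "gauss_weight \<sigma> \<in> borel_measurable borel"
  unfolding gauss_weight_def by measurable

lemma gauss_weight_prod:
  "gauss_weight \<sigma> x = (\<Prod>b\<in>Basis. exp (- (2 * pi\<^sup>2 * \<sigma>\<^sup>2 * (x \<bullet> b)\<^sup>2)))"
  for x :: "'a::euclidean_space"
proof -
  have "(norm x)\<^sup>2 = (\<Sum>b\<in>Basis. (x \<bullet> b)\<^sup>2)"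
    unfolding power2_norm_eq_inner by (subst euclidean_inner) (simp add: power2_eq_square)
  then show ?thesis
    unfolding gauss_weight_def by (simp add: exp_sum[symmetric] sum_negf sum_distrib_left)
qed

lemma gauss_weight_bounds: "0 \<le> gauss_weight \<sigma> x" "gauss_weight \<sigma> x \<le> 1"
  by (auto simp: gauss_weight_def)

lemma integrable_normal_density_e:
  "\<sigma> > 0 \<Longrightarrow> integrable lborel (\<lambda>x. of_real (normal_density 0 \<sigma> x) * ch (t * x))"
  by (rule Bochner_Integration.integrable_bound[OF integrable_normal_density[of \<sigma> 0]])
     (auto simp: norm_mult)

lemma integral_normal_density_e:
  assumes "\<sigma> > 0"
  shows "(LINT x|lborel. of_real (normal_density 0 \<sigma> x) * ch (t * x))
           = of_real (exp (- (2 * pi\<^sup>2 * \<sigma>\<^sup>2 * t\<^sup>2)))"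
proof -
  have "(LINT x|lborel. of_real (normal_density 0 \<sigma> x) * ch (t * x))
      = \<sigma> *\<^sub>R (LINT x|lborel. of_real (normal_density 0 \<sigma> (\<sigma> * x)) * ch (t * (\<sigma> * x)))"
    using assms by (subst lborel_integral_real_affine[where c=\<sigma> and t=0]) auto
  also have "\<dots> = (LINT x|lborel. std_normal_density x *\<^sub>R iexp ((2 * pi * \<sigma> * t) * x))"
  proof -
    have 1: "\<sigma> * normal_density 0 \<sigma> (\<sigma> * x) = std_normal_density x" for x
      using assms by (simp add: normal_density_def real_sqrt_mult field_simps power_mult_distrib)
    have 2: "ch (t * (\<sigma> * x)) = iexp ((2 * pi * \<sigma> * t) * x)" for x
      unfolding ch_cis cis_conv_exp by (simp add: mult_ac)
    show ?thesis
      unfolding integral_scaleR_right[symmetric] 2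
      by (intro Bochner_Integration.integral_cong refl)
         (simp add: scaleR_conv_of_real flip: 1)
  qed
  also have "\<dots> = char std_normal_distribution (2 * pi * \<sigma> * t)"
    unfolding char_def by (subst integral_density) auto
  also have "\<dots> = of_real (exp (- (2 * pi\<^sup>2 * \<sigma>\<^sup>2 * t\<^sup>2)))"
    unfolding char_std_normal_distribution
    by (rule arg_cong[of _ _ of_real]) (simp add: power_mult_distrib power2_eq_square)
  finally show ?thesis .
qed

lemma integrable_gauss_density: "\<sigma> > 0 \<Longrightarrow> integrable lborel (gauss_density \<sigma> :: 'a::euclidean_space \<Rightarrow> real)"
proof -
  assume "\<sigma> > 0"
  then have "integrable lborel (\<lambda>x::'a. \<Prod>b\<in>Basis. complex_of_real (normal_density 0 \<sigma> (x \<bullet> b)))"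
    by (intro integrable_lborel_prod integrable_of_real) auto
  then have "integrable lborel (\<lambda>x::'a. complex_of_real (gauss_density \<sigma> x))"
    by (simp add: gauss_density_def)
  then show ?thesis by (rule iffD1[OF complex_of_real_integrable_eq])
qed

lemma integral_gauss_density_e:
  fixes \<xi> :: "'a::euclidean_space"
  assumes "\<sigma> > 0"
  shows "(LINT x|lborel. of_real (gauss_density \<sigma> x) * ch (\<xi> \<bullet> x)) = of_real (gauss_weight \<sigma> \<xi>)"
proof -
  have "(LINT x|lborel. of_real (gauss_density \<sigma> x) * ch (\<xi> \<bullet> x))
      = (LINT x::'a|lborel. (\<Prod>b\<in>Basis. of_real (normal_density 0 \<sigma> (x \<bullet> b)) * ch ((\<xi> \<bullet> b) * (x \<bullet> b))))"
    unfolding gauss_density_def ch_inner_prod[of \<xi>] prod.distrib of_real_prod ..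
  also have "\<dots> = (\<Prod>b\<in>(Basis::'a set). LINT x|lborel. of_real (normal_density 0 \<sigma> x) * ch ((\<xi> \<bullet> b) * x))"
    by (rule integral_lborel_prod) (rule integrable_normal_density_e[OF assms])
  also have "\<dots> = (\<Prod>b\<in>(Basis::'a set). of_real (exp (- (2 * pi\<^sup>2 * \<sigma>\<^sup>2 * (\<xi> \<bullet> b)\<^sup>2))))"
    unfolding integral_normal_density_e[OF assms] ..
  also have "\<dots> = of_real (gauss_weight \<sigma> \<xi>)"
    unfolding gauss_weight_prod of_real_prod ..
  finally show ?thesis .
qed

lemma integral_gauss_density: "\<sigma> > 0 \<Longrightarrow> (LINT x::'a::euclidean_space|lborel. gauss_density \<sigma> x) = 1"
proof -
  assume "\<sigma> > 0"
  from integral_gauss_density_e[OF this, of "0::'a"]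
  have "complex_of_real (LINT x::'a|lborel. gauss_density \<sigma> x) = 1"
    by (simp add: gauss_weight_def)
  then show ?thesis by (simp only: of_real_eq_1_iff)
qed

lemma gauss_weight_eq_density:
  fixes x :: "'a::euclidean_space"
  assumes "\<sigma> > 0"
  shows "gauss_weight \<sigma> x = (sqrt (2 * pi) / (2 * pi * \<sigma>)) ^ DIM('a) * gauss_density (1 / (2 * pi * \<sigma>)) x"
proof -
  have "exp (- (2 * pi\<^sup>2 * \<sigma>\<^sup>2 * (x \<bullet> b)\<^sup>2)) = (sqrt (2 * pi) / (2 * pi * \<sigma>)) * normal_density 0 (1 / (2 * pi * \<sigma>)) (x \<bullet> b)" for b
    using assms by (simp add: normal_density_def real_sqrt_mult real_sqrt_divide power2_eq_square field_simps)
  then show ?thesis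
    by (simp only: gauss_weight_prod gauss_density_def prod.distrib prod_constant)
qed

lemma integrable_gauss_weight: "\<sigma> > 0 \<Longrightarrow> integrable lborel (gauss_weight \<sigma> :: 'a::euclidean_space \<Rightarrow> real)"
proof -
  assume \<sigma>: "\<sigma> > 0"
  have "gauss_weight \<sigma> = (\<lambda>x::'a. (sqrt (2 * pi) / (2 * pi * \<sigma>)) ^ DIM('a) * gauss_density (1 / (2 * pi * \<sigma>)) x)"
    by (rule ext) (rule gauss_weight_eq_density[OF \<sigma>])
  then show ?thesis
    using integrable_gauss_density[where 'a='a, of "1 / (2 * pi * \<sigma>)"] \<sigma> by simp
qed

lemma integral_gauss_weight_e:
  fixes \<xi> :: "'a::euclidean_space"
  assumes "\<sigma> > 0"
  shows "(LINT x|lborel. of_real (gauss_weight \<sigma> x) * ch (\<xi> \<bullet> x)) = of_real (gauss_density \<sigma> \<xi>)"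
proof -
  define \<tau> where "\<tau> = 1 / (2 * pi * \<sigma>)"
  have \<tau>: "\<tau> > 0" "1 / (2 * pi * \<tau>) = \<sigma>" using assms by (auto simp: \<tau>_def)
  let ?c = "(sqrt (2 * pi) / (2 * pi * \<sigma>)) ^ DIM('a)"
  have "(LINT x|lborel. of_real (gauss_weight \<sigma> x) * ch (\<xi> \<bullet> x))
     = of_real ?c * (LINT x|lborel. of_real (gauss_density \<tau> x) * ch (\<xi> \<bullet> x))"
    unfolding integral_mult_right_zero[symmetric]
    by (simp add: gauss_weight_eq_density assms \<tau>_def mult_ac)
  also have "\<dots> = of_real (?c * gauss_weight \<tau> \<xi>)"
    by (simp add: integral_gauss_density_e \<tau>)
  also have "?c * gauss_weight \<tau> \<xi> = (sqrt (2*pi) / (2 * pi * \<sigma>) * (sqrt (2*pi) / (2 * pi * \<tau>)))^DIM('a) * gauss_density \<sigma> \<xi>"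
    unfolding gauss_weight_eq_density[OF \<tau>(1)] \<tau>(2) power_mult_distrib by (simp only: mult.assoc)
  also have "sqrt (2*pi) / (2 * pi * \<sigma>) * (sqrt (2*pi) / (2 * pi * \<tau>)) = 1"
    using assms by (simp add: \<tau>_def field_simps)
  finally show ?thesis by simp
qed

lemma
  fixes f :: "'a::euclidean_space \<Rightarrow> 'b::{banach, second_countable_topology}"
  assumes c: "c \<noteq> 0" and f [measurable]: "f \<in> borel_measurable borel"
  shows lborel_integral_affine: "(LINT x|lborel. f x) = \<bar>c\<bar> ^ DIM('a) *\<^sub>R (LINT x|lborel. f (t + c *\<^sub>R x))"
    and lborel_integrable_affine: "integrable lborel f \<Longrightarrow> integrable lborel (\<lambda>x. f (t + c *\<^sub>R x))"
proof -
  show "(LINT x|lborel. f x) = \<bar>c\<bar> ^ DIM('a) *\<^sub>R (LINT x|lborel. f (t + c *\<^sub>R x))"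
    by (subst lborel_affine[OF c, of t]) (simp add: integral_density integral_distr)
  assume "integrable lborel f"
  then have "integrable (density (distr lborel borel (\<lambda>x. t + c *\<^sub>R x)) (\<lambda>_. ennreal (\<bar>c\<bar> ^ DIM('a)))) f"
    using lborel_affine[OF c, of t] by (simp add: ennreal_power)
  then have "integrable lborel (\<lambda>x. \<bar>c\<bar> ^ DIM('a) *\<^sub>R f (t + c *\<^sub>R x))"
    by (subst (asm) integrable_density) (auto simp: integrable_distr_eq)
  then have "integrable lborel (\<lambda>x. (1 / \<bar>c\<bar> ^ DIM('a)) *\<^sub>R \<bar>c\<bar> ^ DIM('a) *\<^sub>R f (t + c *\<^sub>R x))"
    by (rule integrable_scaleR_right)
  then show "integrable lborel (\<lambda>x. f (t + c *\<^sub>R x))"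
    using c by simp
qed

lemma
  fixes f :: "'a::euclidean_space \<Rightarrow> 'b::{banach, second_countable_topology}"
  assumes f [measurable]: "f \<in> borel_measurable borel"
  shows lborel_integral_reflect: "(LINT y|lborel. f (x - y)) = (LINT y|lborel. f y)"
    and lborel_integrable_reflect: "integrable lborel f \<Longrightarrow> integrable lborel (\<lambda>y. f (x - y))"
  using lborel_integral_affine[of "-1" f x] lborel_integrable_affine[of "-1" f x] by auto

lemma
  fixes f g :: "'a::euclidean_space \<Rightarrow> complex"
  assumes f: "integrable lborel f" and g: "integrable lborel g"
    and k [measurable]: "case_prod k \<in> borel_measurable (borel \<Otimes>\<^sub>M borel)"
    and bd: "\<And>x y. norm (k x y) \<le> 1"
  shows integrable_lborel_kernel: "integrable (lborel \<Otimes>\<^sub>M lborel) (\<lambda>(x, y). f x * g y * k x y)"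
    and fubini_lborel_kernel:
      "(LINT x|lborel. f x * (LINT y|lborel. g y * k x y)) = (LINT y|lborel. g y * (LINT x|lborel. f x * k x y))"
proof -
  have [measurable]: "f \<in> borel_measurable borel" "g \<in> borel_measurable borel"
    using f g by auto
  have gk: "integrable lborel (\<lambda>y. g y * k x y)" for x
    by (rule Bochner_Integration.integrable_bound[OF g]) (auto simp: norm_mult intro!: AE_I2 mult_right_le_one_le bd)
  show i: "integrable (lborel \<Otimes>\<^sub>M lborel) (\<lambda>(x, y). f x * g y * k x y)"
  proof (rule lborel_pair.Fubini_integrable)
    show "(\<lambda>(x, y). f x * g y * k x y) \<in> borel_measurable (lborel \<Otimes>\<^sub>M lborel)"
      by measurable
    show "integrable lborel (\<lambda>x. LINT y|lborel. norm (case (x, y) of (x, y) \<Rightarrow> f x * g y * k x y))"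
    proof (rule Bochner_Integration.integrable_bound[of _ "\<lambda>x. norm (f x) * (LINT y|lborel. norm (g y))"])
      show "integrable lborel (\<lambda>x. norm (f x) * (LINT y|lborel. norm (g y)))"
        using f by (auto intro: integrable_norm)
      have "norm (LINT y|lborel. norm (f x * g y * k x y)) \<le> norm (norm (f x) * (LINT y|lborel. norm (g y)))" for x
      proof -
        have "(LINT y|lborel. norm (f x * g y * k x y)) \<le> (LINT y|lborel. norm (f x) * norm (g y))"
        proof (rule integral_mono)
          show "integrable lborel (\<lambda>y. norm (f x * g y * k x y))"
            using gk[of x] by (auto intro!: integrable_norm simp: mult.assoc)
          show "integrable lborel (\<lambda>y. norm (f x) * norm (g y))"
            using g by (auto intro: integrable_norm)
          show "norm (f x * g y * k x y) \<le> norm (f x) * norm (g y)" for y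
            using bd[of x y] by (simp add: norm_mult mult_right_le_one_le)
        qed
        then show ?thesis by (simp add: abs_mult)
      qed
      then show "AE x in lborel. norm (LINT y|lborel. norm (case (x, y) of (x, y) \<Rightarrow> f x * g y * k x y))
          \<le> norm (norm (f x) * (LINT y|lborel. norm (g y)))"
        by simp
    qed measurable
    show "AE x in lborel. integrable lborel (\<lambda>y. case (x, y) of (x, y) \<Rightarrow> f x * g y * k x y)"
      using gk by (simp add: mult.assoc)
  qed
  have "(LINT x|lborel. f x * (LINT y|lborel. g y * k x y)) = (LINT x|lborel. LINT y|lborel. f x * g y * k x y)"
    by (simp add: mult.assoc)
  also have "\<dots> = (LINT y|lborel. LINT x|lborel. f x * g y * k x y)"
    using lborel_pair.Fubini_integral[OF i] by simp
  also have "\<dots> = (LINT y|lborel. LINT x|lborel. g y * (f x * k x y))"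
    by (simp add: mult_ac)
  also have "\<dots> = (LINT y|lborel. g y * (LINT x|lborel. f x * k x y))"
    by simp
  finally show "(LINT x|lborel. f x * (LINT y|lborel. g y * k x y)) = (LINT y|lborel. g y * (LINT x|lborel. f x * k x y))" .
qed

lemma integrable_mult_bounded:
  fixes f g :: "'a \<Rightarrow> complex"
  assumes f: "integrable M f" and [measurable]: "g \<in> borel_measurable M" and bd: "\<And>x. norm (g x) \<le> B"
  shows "integrable M (\<lambda>x. f x * g x)"
proof (rule Bochner_Integration.integrable_bound[of _ "\<lambda>x. B * norm (f x)"])
  show "AE x in M. norm (f x * g x) \<le> norm (B * norm (f x))"
  proof (rule AE_I2)
    fix x
    have "norm (f x) * norm (g x) \<le> norm (f x) * B" by (intro mult_left_mono bd) auto
    moreover have "B \<ge> 0" using order_trans[OF norm_ge_zero bd] .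
    ultimately show "norm (f x * g x) \<le> norm (B * norm (f x))"
      by (simp add: norm_mult abs_mult mult.commute)
  qed
qed (use f in \<open>auto intro: integrable_norm\<close>)

lemma integrable_mult_ch: "integrable lborel h \<Longrightarrow> integrable lborel (\<lambda>\<xi>. h \<xi> * ch (\<xi> \<bullet> x))"
  by (rule integrable_mult_bounded[of _ _ _ 1]) auto

lemma integrable_mult_ch_minus: "integrable lborel h \<Longrightarrow> integrable lborel (\<lambda>x. h x * ch (- (\<xi> \<bullet> x)))"
  by (rule integrable_mult_bounded[of _ _ _ 1]) auto

lemma ft_eq_ift: "ft f \<xi> = ift f (- \<xi>)"
  by (simp add: ft_def ift_def inner_commute)

lemma norm_ift_le: "norm (ift h x) \<le> (LINT \<xi>|lborel. norm (h \<xi>))"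
  unfolding ift_def by (rule order_trans[OF integral_norm_bound]) (simp add: norm_mult)

lemma norm_ft_le: "norm (ft h x) \<le> (LINT \<xi>|lborel. norm (h \<xi>))"
  unfolding ft_eq_ift by (rule norm_ift_le)

lemma borel_measurable_ift:
  assumes "h \<in> borel_measurable borel"
  shows "ift h \<in> borel_measurable borel"
proof -
  have [measurable]: "h \<in> borel_measurable borel" by fact
  show ?thesis unfolding ift_def by measurable
qed

lemma borel_measurable_ft:
  assumes "h \<in> borel_measurable borel"
  shows "ft h \<in> borel_measurable borel"
proof -
  have [measurable]: "h \<in> borel_measurable borel" by fact
  show ?thesis unfolding ft_def by measurable
qed

text \<open>The multiplication formula. With a Gaussian as one of the functions, it turns damped integrals in space into
  smoothed values in frequency.\<close>

lemma ift_exchange: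
  fixes h v :: "'a::euclidean_space \<Rightarrow> complex"
  assumes "integrable lborel h" "integrable lborel v"
  shows "(LINT x|lborel. v x * ift h x) = (LINT \<xi>|lborel. h \<xi> * ift v \<xi>)"
proof -
  have "(\<lambda>(x::'a, y). ch (y \<bullet> x)) \<in> borel_measurable (borel \<Otimes>\<^sub>M borel)"
    by measurable
  from fubini_lborel_kernel[OF assms(2,1) this]
  show ?thesis by (simp add: ift_def inner_commute)
qed

lemma gauss_weight_ift: "\<sigma> > 0 \<Longrightarrow> ift (\<lambda>x. of_real (gauss_weight \<sigma> x)) \<xi> = of_real (gauss_density \<sigma> \<xi>)"
  using integral_gauss_weight_e[of \<sigma> \<xi>] by (simp add: ift_def inner_commute)

lemma gauss_weight_tendsto: "(\<lambda>n. gauss_weight (inverse (real (Suc n))) x) \<longlonglongrightarrow> 1"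
proof -
  have "(\<lambda>n. exp (- (2 * pi\<^sup>2 * (inverse (real (Suc n)))\<^sup>2 * (norm x)\<^sup>2))) \<longlonglongrightarrow> exp (- (2 * pi\<^sup>2 * 0\<^sup>2 * (norm x)\<^sup>2))"
    by (intro tendsto_intros LIMSEQ_inverse_real_of_nat)
  then show ?thesis by (simp add: gauss_weight_def)
qed

lemma gauss_density_eq:
  fixes x :: "'a::euclidean_space"
  assumes "\<sigma> > 0"
  shows "gauss_density \<sigma> x = (1 / (sqrt (2 * pi) * \<sigma>)) ^ DIM('a) * exp (- ((norm x)\<^sup>2 / (2 * \<sigma>\<^sup>2)))"
proof -
  have "(norm x)\<^sup>2 = (\<Sum>b\<in>Basis. (x \<bullet> b)\<^sup>2)"
    unfolding power2_norm_eq_inner by (subst euclidean_inner) (simp add: power2_eq_square)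
  then have "exp (- ((norm x)\<^sup>2 / (2 * \<sigma>\<^sup>2))) = (\<Prod>b\<in>Basis. exp (- ((x \<bullet> b)\<^sup>2 / (2 * \<sigma>\<^sup>2))))"
    by (simp add: exp_sum[symmetric] sum_negf sum_divide_distrib)
  moreover have "normal_density 0 \<sigma> t = 1 / (sqrt (2 * pi) * \<sigma>) * exp (- (t\<^sup>2 / (2 * \<sigma>\<^sup>2)))" for t
    using assms by (simp add: normal_density_def real_sqrt_mult)
  ultimately show ?thesis
    by (simp only: gauss_density_def prod.distrib prod_constant)
qed

lemma power_div_fact_le_exp: "x \<ge> 0 \<Longrightarrow> x ^ n / fact n \<le> exp (x::real)"
proof -
  assume x: "x \<ge> 0"
  have "(\<Sum>k\<in>{n}. x ^ k /\<^sub>R fact k) \<le> (\<Sum>k. x ^ k /\<^sub>R fact k)"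
    using x by (intro sum_le_suminf summable_exp_generic) auto
  then show ?thesis by (simp add: exp_def divide_inverse mult.commute)
qed

text \<open>The bound \<open>x\<^sup>n / n! \<le> e\<^sup>x\<close> with a large \<open>n\<close> outweighs the factor \<open>\<sigma>\<^sup>-\<^sup>d\<close> of the normalisation. The bound serves for
  the convergence to \<open>0\<close> as \<open>\<sigma> \<rightarrow> 0\<close>.\<close>

lemma gauss_density_off_ball:
  assumes r: "r > 0"
  shows "\<exists>C. \<forall>\<sigma> x. \<sigma> > 0 \<longrightarrow> norm (x::'a::euclidean_space) \<ge> r \<longrightarrow> gauss_density \<sigma> x \<le> C * \<sigma>"
proof -
  let ?n = "DIM('a)"
  define C where "C = (1 / sqrt (2 * pi)) ^ ?n * (fact (?n + 1) * (2 / r\<^sup>2) ^ (?n + 1))"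
  have small: "gauss_density \<sigma> x \<le> C * \<sigma> ^ (?n + 2)" if \<sigma>: "\<sigma> > 0" and x: "norm x \<ge> r" for \<sigma> and x :: 'a
  proof -
    define y where "y = r\<^sup>2 / (2 * \<sigma>\<^sup>2)"
    have y: "y > 0" using \<sigma> r by (simp add: y_def)
    have "exp (- ((norm x)\<^sup>2 / (2 * \<sigma>\<^sup>2))) \<le> exp (- y)"
      using x r \<sigma> by (auto simp: y_def intro!: divide_right_mono power_mono)
    also have "\<dots> \<le> fact (?n + 1) / y ^ (?n + 1)"
      using power_div_fact_le_exp[of y "?n + 1"] y
      by (simp add: exp_minus field_simps del: power_Suc fact_Suc)
    also have "\<dots> = fact (?n + 1) * (2 / r\<^sup>2) ^ (?n + 1) * \<sigma> ^ (2 * (?n + 1))"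
    proof -
      have "1 / y = 2 / r\<^sup>2 * \<sigma>\<^sup>2" by (simp add: y_def)
      then have "(1 / y) ^ (?n + 1) = (2 / r\<^sup>2) ^ (?n + 1) * \<sigma> ^ (2 * (?n + 1))"
        by (simp only: power_mult_distrib power_mult)
      then show ?thesis by (simp add: power_one_over divide_inverse mult.assoc power_inverse del: power_Suc fact_Suc)
    qed
    finally have 1: "exp (- ((norm x)\<^sup>2 / (2 * \<sigma>\<^sup>2))) \<le> fact (?n + 1) * (2 / r\<^sup>2) ^ (?n + 1) * \<sigma> ^ (2 * (?n + 1))" .
    have "gauss_density \<sigma> x \<le> (1 / (sqrt (2 * pi) * \<sigma>)) ^ ?n * (fact (?n + 1) * (2 / r\<^sup>2) ^ (?n + 1) * \<sigma> ^ (2 * (?n + 1)))"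
      unfolding gauss_density_eq[OF \<sigma>] using \<sigma> by (intro mult_left_mono 1) auto
    also have "\<dots> = C * ((1 / \<sigma>) ^ ?n * \<sigma> ^ (?n + (?n + 2)))"
    proof -
      have "2 * (?n + 1) = ?n + (?n + 2)" by simp
      moreover have "(1 / (sqrt (2 * pi) * \<sigma>)) ^ ?n = (1 / sqrt (2 * pi)) ^ ?n * (1 / \<sigma>) ^ ?n"
        by (simp add: power_mult_distrib[symmetric])
      ultimately show ?thesis unfolding C_def by (simp only: ac_simps)
    qed
    also have "(1 / \<sigma>) ^ ?n * \<sigma> ^ (?n + (?n + 2)) = \<sigma> ^ (?n + 2)"
      using \<sigma> by (simp add: power_add power_divide)
    finally show ?thesis .
  qed
  define D where "D = (1 / sqrt (2 * pi)) ^ ?n"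
  have C0: "C \<ge> 0" by (auto simp: C_def)
  have big: "gauss_density \<sigma> x \<le> D * \<sigma>" if \<sigma>: "\<sigma> \<ge> 1" for \<sigma> and x :: 'a
  proof -
    have "gauss_density \<sigma> x \<le> (1 / (sqrt (2 * pi) * \<sigma>)) ^ ?n * 1"
      using \<sigma> by (subst gauss_density_eq) (auto intro!: mult_left_mono)
    also have "\<dots> \<le> D * 1"
      unfolding D_def using \<sigma> by (auto intro!: power_mono divide_left_mono)
    also have "\<dots> \<le> D * \<sigma>" using \<sigma> by (intro mult_left_mono) (auto simp: D_def)
    finally show ?thesis .
  qed
  show ?thesis
  proof (intro exI[of _ "max C D"] allI impI)
    fix \<sigma> :: real and x :: 'a assume \<sigma>: "0 < \<sigma>" and x: "r \<le> norm x"
    show "gauss_density \<sigma> x \<le> max C D * \<sigma>"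
    proof (cases "\<sigma> \<ge> 1")
      case True
      have "D * \<sigma> \<le> max C D * \<sigma>" using \<sigma> by (intro mult_right_mono) auto
      with big[OF True, of x] show ?thesis by linarith
    next
      case False
      have "\<sigma> ^ (?n + 2) \<le> \<sigma> ^ 1" using False \<sigma> by (intro power_decreasing) auto
      then have "C * \<sigma> ^ (?n + 2) \<le> C * \<sigma>" using C0 by (intro mult_left_mono) auto
      moreover have "C * \<sigma> \<le> max C D * \<sigma>" using \<sigma> by (intro mult_right_mono) auto
      ultimately show ?thesis using small[OF \<sigma> x] by linarith
    qed
  qed
qed

text \<open>The integral is the value at frequency \<open>0\<close> of the Fourier transform of \<open>ift h\<close>. Since \<open>h\<close> need not be continuous,
  this value is reached through Gaussian weights: the damped integrals are averages of \<open>h\<close> against narrow Gaussians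
  centred at \<open>0\<close>, where \<open>h\<close> vanishes.\<close>

lemma integral_ift_eq_0:
  fixes h :: "'a::euclidean_space \<Rightarrow> complex"
  assumes h: "integrable lborel h" and u: "integrable lborel (ift h)" and r: "r > 0"
    and h0: "\<And>\<xi>. norm \<xi> < r \<Longrightarrow> h \<xi> = 0"
  shows "(LINT x|lborel. ift h x) = 0"
proof -
  have [measurable]: "h \<in> borel_measurable borel" using h by auto
  note [measurable] = borel_measurable_ift
  define \<sigma> where "\<sigma> n = inverse (real (Suc n))" for n
  have \<sigma>: "\<sigma> n > 0" for n by (simp add: \<sigma>_def)
  obtain C where C: "\<And>\<sigma> x. \<sigma> > 0 \<Longrightarrow> norm (x::'a) \<ge> r \<Longrightarrow> gauss_density \<sigma> x \<le> C * \<sigma>"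
    using gauss_density_off_ball[OF r, where 'a='a] by blast
  have eq: "(LINT x|lborel. of_real (gauss_weight (\<sigma> n) x) * ift h x) = (LINT \<xi>|lborel. h \<xi> * of_real (gauss_density (\<sigma> n) \<xi>))" for n
    using ift_exchange[OF h, of "\<lambda>x. of_real (gauss_weight (\<sigma> n) x)"] integrable_gauss_weight[OF \<sigma>[of n], where 'a='a]
    by (simp add: gauss_weight_ift \<sigma>)
  have "(\<lambda>n. LINT x|lborel. of_real (gauss_weight (\<sigma> n) x) * ift h x) \<longlonglongrightarrow> (LINT x|lborel. ift h x)"
  proof (rule integral_dominated_convergence[of _ _ _ "\<lambda>x. norm (ift h x)"])
    have "(\<lambda>n. of_real (gauss_weight (\<sigma> n) x) * ift h x) \<longlonglongrightarrow> of_real 1 * ift h x" for x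
      unfolding \<sigma>_def by (intro tendsto_intros gauss_weight_tendsto)
    then show "AE x in lborel. (\<lambda>n. of_real (gauss_weight (\<sigma> n) x) * ift h x) \<longlonglongrightarrow> ift h x" by simp
    show "AE x in lborel. norm (of_real (gauss_weight (\<sigma> n) x) * ift h x) \<le> norm (ift h x)" for n
      using gauss_weight_bounds by (auto simp: norm_mult abs_of_nonneg[OF gauss_weight_bounds(1)] intro!: AE_I2 mult_left_le_one_le)
  qed (use u in \<open>auto intro: integrable_norm\<close>)
  moreover have "(\<lambda>n. LINT x|lborel. of_real (gauss_weight (\<sigma> n) x) * ift h x) \<longlonglongrightarrow> 0"
  proof (rule Lim_null_comparison)
    show "\<forall>\<^sub>F n in sequentially. norm (LINT x|lborel. of_real (gauss_weight (\<sigma> n) x) * ift h x) \<le> C * (LINT \<xi>|lborel. norm (h \<xi>)) * \<sigma> n"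
    proof (intro always_eventually allI)
      fix n
      have "norm (LINT \<xi>|lborel. h \<xi> * of_real (gauss_density (\<sigma> n) \<xi>)) \<le> (LINT \<xi>|lborel. norm (h \<xi>) * (C * \<sigma> n))"
      proof (rule Bochner_Integration.integral_norm_bound_integral)
        show "integrable lborel (\<lambda>\<xi>. norm (h \<xi>) * (C * \<sigma> n))" using h by (auto intro: integrable_norm)
        have "norm (h \<xi> * of_real (gauss_density (\<sigma> n) \<xi>)) \<le> norm (h \<xi>) * (C * \<sigma> n)" for \<xi>
          using h0[of \<xi>] C[OF \<sigma>, of \<xi> n] by (cases "norm \<xi> < r") (auto simp: norm_mult intro: mult_left_mono)
        then show *: "norm (h \<xi> * of_real (gauss_density (\<sigma> n) \<xi>)) \<le> norm (h \<xi>) * (C * \<sigma> n)" for \<xi> .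
        show "integrable lborel (\<lambda>\<xi>. h \<xi> * of_real (gauss_density (\<sigma> n) \<xi>))"
          by (rule Bochner_Integration.integrable_bound[of _ "\<lambda>\<xi>. norm (h \<xi>) * (C * \<sigma> n)"])
             (use h in \<open>auto intro!: integrable_norm AE_I2 order_trans[OF * abs_ge_self]\<close>)
      qed
      then show "norm (LINT x|lborel. of_real (gauss_weight (\<sigma> n) x) * ift h x) \<le> C * (LINT \<xi>|lborel. norm (h \<xi>)) * \<sigma> n"
        unfolding eq by (simp add: mult_ac)
    qed
    have "(\<lambda>n. C * (LINT \<xi>|lborel. norm (h \<xi>)) * \<sigma> n) \<longlonglongrightarrow> C * (LINT \<xi>|lborel. norm (h \<xi>)) * 0"
      unfolding \<sigma>_def by (intro tendsto_intros LIMSEQ_inverse_real_of_nat)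
    then show "(\<lambda>n. C * (LINT \<xi>|lborel. norm (h \<xi>)) * \<sigma> n) \<longlonglongrightarrow> 0" by simp
  qed
  ultimately show ?thesis by (rule LIMSEQ_unique)
qed

section \<open>Fourier inversion and the energy bound\<close>

lemma integral_gauss_density_shift: "\<sigma> > 0 \<Longrightarrow> (LINT \<xi>|lborel. gauss_density \<sigma> (\<xi> - a)) = 1"
  for a :: "'a::euclidean_space"
  using lborel_integral_affine[of 1 "gauss_density \<sigma>" "- a"] integral_gauss_density[of \<sigma>, where 'a='a]
  by simp

lemma integrable_gauss_density_shift: "\<sigma> > 0 \<Longrightarrow> integrable lborel (\<lambda>\<xi>. gauss_density \<sigma> (\<xi> - a))"
  for a :: "'a::euclidean_space"
  using lborel_integrable_affine[of 1 "gauss_density \<sigma>" "- a"] integrable_gauss_density[of \<sigma>, where 'a='a]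
  by simp

lemma gauss_density_scale:
  fixes z :: "'a::euclidean_space"
  assumes "\<sigma> > 0"
  shows "\<sigma> ^ DIM('a) * gauss_density \<sigma> (\<sigma> *\<^sub>R z) = gauss_density 1 z"
  using assms by (simp add: gauss_density_eq power_mult_distrib power_divide)

lemma gauss_density_minus: "\<sigma> > 0 \<Longrightarrow> gauss_density \<sigma> (- x) = gauss_density \<sigma> x"
  by (simp add: gauss_density_eq)

text \<open>The Gaussian damping of the inversion integral is the average of \<open>u\<close> around \<open>x\<close> against a Gaussian of width
  \<open>\<sigma>\<close>. As \<open>\<sigma> \<rightarrow> 0\<close>, dominated convergence applies on both sides.\<close>

theorem fourier_inversion:
  fixes u :: "'a::euclidean_space \<Rightarrow> complex"
  assumes u: "integrable lborel u" and cont: "continuous_on UNIV u" and bd: "\<And>x. norm (u x) \<le> B"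
    and ftu: "integrable lborel (ft u)"
  shows "ift (ft u) x = u x"
proof -
  have [measurable]: "u \<in> borel_measurable borel" "ft u \<in> borel_measurable borel"
    using u ftu by auto
  define \<sigma> where "\<sigma> n = inverse (real (Suc n))" for n
  have \<sigma>: "\<sigma> n > 0" for n by (simp add: \<sigma>_def)
  \<comment> \<open>Substituting \<open>y = x + \<sigma> z\<close> moves the width of the Gaussian into the argument of \<open>u\<close>.\<close>
  have eq: "(LINT \<xi>|lborel. of_real (gauss_weight (\<sigma> n) \<xi>) * (ft u \<xi> * ch (\<xi> \<bullet> x)))
      = (LINT z|lborel. of_real (gauss_density 1 z) * u (x + \<sigma> n *\<^sub>R z))" for n
  proof -
    define v where "v \<xi> = of_real (gauss_weight (\<sigma> n) \<xi>) * ch (\<xi> \<bullet> x)" for \<xi> :: 'a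
    have v: "integrable lborel v"
      unfolding v_def by (intro integrable_mult_ch integrable_of_real integrable_gauss_weight \<sigma>)
    have m: "(\<lambda>(\<xi>, y). ch (- (\<xi> \<bullet> y))) \<in> borel_measurable ((borel :: 'a measure) \<Otimes>\<^sub>M borel)"
      by measurable
    have inner_eq: "(LINT \<xi>|lborel. v \<xi> * ch (- (\<xi> \<bullet> y))) = of_real (gauss_density (\<sigma> n) (y - x))" for y
    proof -
      have "v \<xi> * ch (- (\<xi> \<bullet> y)) = of_real (gauss_weight (\<sigma> n) \<xi>) * ch ((x - y) \<bullet> \<xi>)" for \<xi>
      proof -
        have "(x - y) \<bullet> \<xi> = \<xi> \<bullet> x + - (\<xi> \<bullet> y)"
          by (simp add: inner_diff_left inner_diff_right inner_commute)
        then show ?thesis by (simp only: v_def ch_add mult.assoc)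
      qed
      then have "(LINT \<xi>|lborel. v \<xi> * ch (- (\<xi> \<bullet> y))) = of_real (gauss_density (\<sigma> n) (x - y))"
        by (simp add: integral_gauss_weight_e \<sigma>)
      then show ?thesis using gauss_density_minus[OF \<sigma>, of n "x - y"] by simp
    qed
    have "(LINT \<xi>|lborel. v \<xi> * ft u \<xi>) = (LINT y|lborel. u y * (LINT \<xi>|lborel. v \<xi> * ch (- (\<xi> \<bullet> y))))"
      using fubini_lborel_kernel[OF v u m] by (simp add: ft_def inner_commute)
    also have "\<dots> = (LINT y|lborel. u y * of_real (gauss_density (\<sigma> n) (y - x)))"
      by (simp only: inner_eq)
    also have "\<dots>
        = (\<sigma> n) ^ DIM('a) *\<^sub>R (LINT z|lborel. u (x + \<sigma> n *\<^sub>R z) * of_real (gauss_density (\<sigma> n) (\<sigma> n *\<^sub>R z)))"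
      using \<sigma>[of n] by (subst lborel_integral_affine[of "\<sigma> n" _ x]) auto
    also have "\<dots> = (LINT z|lborel. of_real (gauss_density 1 z) * u (x + \<sigma> n *\<^sub>R z))"
      unfolding integral_scaleR_right[symmetric] gauss_density_scale[OF \<sigma>[of n], symmetric]
      by (simp add: scaleR_conv_of_real mult_ac)
    finally show ?thesis by (simp add: v_def mult_ac)
  qed
  have "(\<lambda>n. LINT \<xi>|lborel. of_real (gauss_weight (\<sigma> n) \<xi>) * (ft u \<xi> * ch (\<xi> \<bullet> x))) \<longlonglongrightarrow> (LINT \<xi>|lborel. ft u \<xi> * ch (\<xi> \<bullet> x))"
  proof (rule integral_dominated_convergence[of _ _ _ "\<lambda>x. norm (ft u x)"])
    have "(\<lambda>n. of_real (gauss_weight (\<sigma> n) \<xi>) * (ft u \<xi> * ch (\<xi> \<bullet> x))) \<longlonglongrightarrow> of_real 1 * (ft u \<xi> * ch (\<xi> \<bullet> x))" for \<xi>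
      unfolding \<sigma>_def by (intro tendsto_intros gauss_weight_tendsto)
    then show "AE \<xi> in lborel. (\<lambda>n. of_real (gauss_weight (\<sigma> n) \<xi>) * (ft u \<xi> * ch (\<xi> \<bullet> x))) \<longlonglongrightarrow> ft u \<xi> * ch (\<xi> \<bullet> x)" by simp
    show "AE \<xi> in lborel. norm (of_real (gauss_weight (\<sigma> n) \<xi>) * (ft u \<xi> * ch (\<xi> \<bullet> x))) \<le> norm (ft u \<xi>)" for n
      using gauss_weight_bounds by (auto simp: norm_mult abs_of_nonneg[OF gauss_weight_bounds(1)] intro!: AE_I2 mult_left_le_one_le)
  qed (use ftu in \<open>auto intro: integrable_norm\<close>)
  moreover have "(\<lambda>n. LINT z|lborel. of_real (gauss_density 1 z) * u (x + \<sigma> n *\<^sub>R z)) \<longlonglongrightarrow> (LINT z|lborel. of_real (gauss_density 1 (z::'a)) * u x)"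
  proof (rule integral_dominated_convergence[of _ _ _ "\<lambda>z::'a. gauss_density 1 z * B"])
    have "(\<lambda>n. of_real (gauss_density 1 z) * u (x + \<sigma> n *\<^sub>R z)) \<longlonglongrightarrow> of_real (gauss_density 1 z) * u (x + 0 *\<^sub>R z)" for z
    proof (intro tendsto_intros)
      have "isCont u (x + 0 *\<^sub>R z)" using cont by (simp add: continuous_on_eq_continuous_at)
      moreover have "(\<lambda>n. x + \<sigma> n *\<^sub>R z) \<longlonglongrightarrow> x + 0 *\<^sub>R z"
        unfolding \<sigma>_def by (intro tendsto_intros LIMSEQ_inverse_real_of_nat)
      ultimately show "(\<lambda>n. u (x + \<sigma> n *\<^sub>R z)) \<longlonglongrightarrow> u (x + 0 *\<^sub>R z)"
        by (rule isCont_tendsto_compose)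
    qed
    then show "AE z in lborel. (\<lambda>n. of_real (gauss_density 1 z) * u (x + \<sigma> n *\<^sub>R z)) \<longlonglongrightarrow> of_real (gauss_density 1 z) * u x" by simp
    show "AE z in lborel. norm (of_real (gauss_density 1 z) * u (x + \<sigma> n *\<^sub>R z)) \<le> gauss_density 1 z * B" for n
      using bd by (auto simp: norm_mult intro!: AE_I2 mult_left_mono)
    show "integrable lborel (\<lambda>z::'a. gauss_density 1 z * B)"
      using integrable_gauss_density[of 1, where 'a='a] by auto
  qed auto
  ultimately have "ift (ft u) x = (LINT z|lborel. of_real (gauss_density 1 (z::'a)) * u x)"
    unfolding eq ift_def by (rule LIMSEQ_unique)
  also have "\<dots> = u x"
    using integral_gauss_density[of 1, where 'a='a] by simp
  finally show ?thesis .
qed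

lemma borel_measurable_cnj_id [measurable]: "cnj \<in> borel_measurable borel"
  by (intro borel_measurable_continuous_onI continuous_intros)

text \<open>A form of Plancherel's inequality for a bounded frequency density: the damped energy equals the pairing of \<open>h\<close>
  with a smoothing of its conjugate, which is at most \<open>B\<close>. Fatou's lemma removes the damping. The sharp projections of \<open>F\<close> to caps are
  of this kind, and the inequality puts them into \<open>L\<^sup>p\<close> for all \<open>p \<ge> 2\<close>.\<close>

lemma nn_integral_ift_square:
  fixes h :: "'a::euclidean_space \<Rightarrow> complex"
  assumes h: "integrable lborel h" and bd: "\<And>\<xi>. norm (h \<xi>) \<le> B"
  shows "(\<integral>\<^sup>+x. ennreal ((norm (ift h x))\<^sup>2) \<partial>lborel) \<le> ennreal (B * (LINT \<xi>|lborel. norm (h \<xi>)))"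
proof -
  have [measurable]: "h \<in> borel_measurable borel" using h by auto
  then have [measurable]: "ift h \<in> borel_measurable borel" by (rule borel_measurable_ift)
  define \<sigma> where "\<sigma> n = inverse (real (Suc n))" for n
  have \<sigma>: "\<sigma> n > 0" for n by (simp add: \<sigma>_def)
  let ?w = "\<lambda>n x::'a. gauss_weight (\<sigma> n) x"
  have B: "B \<ge> 0" using order_trans[OF norm_ge_zero bd] .
  have wint: "integrable lborel (\<lambda>x. complex_of_real (?w n x))" for n
    by (intro integrable_of_real integrable_gauss_weight \<sigma>)
  define v where "v n x = of_real (?w n x) * cnj (ift h x)" for n x
  have v: "integrable lborel (v n)" for n
    unfolding v_def by (rule integrable_mult_bounded[OF wint, of _ "LINT \<xi>|lborel. norm (h \<xi>)"]) (auto simp: norm_ift_le)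
  have v_bd: "norm (ift (v n) \<xi>) \<le> B" for n \<xi>
  proof -
    have g: "integrable lborel (\<lambda>x. of_real (?w n x) * ch (- (\<xi> \<bullet> x)))"
      by (rule integrable_mult_ch_minus[OF wint])
    have "cnj (ift (v n) \<xi>) = (LINT x|lborel. cnj (v n x * ch (x \<bullet> \<xi>)))"
      unfolding ift_def[of "v n"] by (simp del: complex_cnj_mult)
    also have "\<dots> = (LINT x|lborel. of_real (?w n x) * ch (- (\<xi> \<bullet> x)) * ift h x)"
      by (intro Bochner_Integration.integral_cong refl) (simp add: v_def ch_minus inner_commute mult_ac)
    also have "\<dots> = (LINT \<eta>|lborel. h \<eta> * ift (\<lambda>x. of_real (?w n x) * ch (- (\<xi> \<bullet> x))) \<eta>)"
      by (rule ift_exchange[OF h g])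
    also have "\<dots> = (LINT \<eta>|lborel. h \<eta> * of_real (gauss_density (\<sigma> n) (\<eta> - \<xi>)))"
    proof -
      have "ift (\<lambda>x. of_real (?w n x) * ch (- (\<xi> \<bullet> x))) \<eta> = of_real (gauss_density (\<sigma> n) (\<eta> - \<xi>))" for \<eta>
        unfolding gauss_weight_ift[OF \<sigma>, symmetric] ift_def
        by (simp add: inner_diff_right ch_diff inner_commute mult_ac)
      then show ?thesis by simp
    qed
    finally have "norm (ift (v n) \<xi>) = norm (LINT \<eta>|lborel. h \<eta> * of_real (gauss_density (\<sigma> n) (\<eta> - \<xi>)))"
      by (metis complex_mod_cnj)
    also have "\<dots> \<le> (LINT \<eta>|lborel. B * gauss_density (\<sigma> n) (\<eta> - \<xi>))"
    proof (rule Bochner_Integration.integral_norm_bound_integral)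
      show "integrable lborel (\<lambda>\<eta>. B * gauss_density (\<sigma> n) (\<eta> - \<xi>))"
        using integrable_gauss_density_shift[OF \<sigma>[of n], of \<xi>] by auto
      show *: "norm (h \<eta> * of_real (gauss_density (\<sigma> n) (\<eta> - \<xi>))) \<le> B * gauss_density (\<sigma> n) (\<eta> - \<xi>)" for \<eta>
        using bd[of \<eta>] by (auto simp: norm_mult intro!: mult_right_mono)
      show "integrable lborel (\<lambda>\<eta>. h \<eta> * of_real (gauss_density (\<sigma> n) (\<eta> - \<xi>)))"
        by (rule Bochner_Integration.integrable_bound[of _ "\<lambda>\<eta>. B * gauss_density (\<sigma> n) (\<eta> - \<xi>)"])
           (use integrable_gauss_density_shift[OF \<sigma>[of n], of \<xi>] * B in \<open>auto intro!: AE_I2\<close>)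
    qed
    also have "\<dots> = B" using integral_gauss_density_shift[OF \<sigma>[of n], of \<xi>] by simp
    finally show ?thesis .
  qed
  have bound: "(\<integral>\<^sup>+x. ennreal (?w n x * (norm (ift h x))\<^sup>2) \<partial>lborel) \<le> ennreal (B * (LINT \<xi>|lborel. norm (h \<xi>)))" for n
  proof -
    have vh: "v n x * ift h x = of_real (?w n x * (norm (ift h x))\<^sup>2)" for x
      unfolding v_def by (simp add: complex_norm_square[of "ift h x", unfolded of_real_power] mult_ac)
    have i: "integrable lborel (\<lambda>x. complex_of_real (?w n x * (norm (ift h x))\<^sup>2))"
      unfolding vh[symmetric] by (rule integrable_mult_bounded[OF v _ norm_ift_le]) simp
    then have i': "integrable lborel (\<lambda>x. ?w n x * (norm (ift h x))\<^sup>2)"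
      by (rule iffD1[OF complex_of_real_integrable_eq])
    have nn: "(\<integral>\<^sup>+x. ennreal (?w n x * (norm (ift h x))\<^sup>2) \<partial>lborel) = ennreal (LINT x|lborel. ?w n x * (norm (ift h x))\<^sup>2)"
      by (intro nn_integral_eq_integral[OF i'] AE_I2 mult_nonneg_nonneg gauss_weight_bounds) auto
    have "(LINT x|lborel. ?w n x * (norm (ift h x))\<^sup>2) = norm (LINT x|lborel. v n x * ift h x)"
    proof -
      have "(LINT x|lborel. v n x * ift h x) = of_real (LINT x|lborel. ?w n x * (norm (ift h x))\<^sup>2)"
        unfolding vh by (rule integral_complex_of_real)
      moreover have "(LINT x|lborel. ?w n x * (norm (ift h x))\<^sup>2) \<ge> 0"
        by (intro integral_nonneg_AE AE_I2 mult_nonneg_nonneg gauss_weight_bounds) auto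
      ultimately show ?thesis by simp
    qed
    also have "\<dots> = norm (LINT \<xi>|lborel. h \<xi> * ift (v n) \<xi>)"
      unfolding ift_exchange[OF h v] ..
    also have "\<dots> \<le> (LINT \<xi>|lborel. norm (h \<xi>) * B)"
    proof (rule Bochner_Integration.integral_norm_bound_integral)
      have [measurable]: "v n \<in> borel_measurable borel" using v by auto
      have [measurable]: "ift (v n) \<in> borel_measurable borel" by (rule borel_measurable_ift) simp
      show "integrable lborel (\<lambda>\<xi>. h \<xi> * ift (v n) \<xi>)"
        by (rule integrable_mult_bounded[OF h _ v_bd]) simp
      show "integrable lborel (\<lambda>\<xi>. norm (h \<xi>) * B)" using h by (auto intro: integrable_norm)
      show "norm (h \<xi> * ift (v n) \<xi>) \<le> norm (h \<xi>) * B" for \<xi>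
        using v_bd[of n \<xi>] by (auto simp: norm_mult intro!: mult_left_mono)
    qed
    also have "\<dots> = B * (LINT \<xi>|lborel. norm (h \<xi>))" by simp
    finally show ?thesis unfolding nn by (rule ennreal_leI)
  qed
  have lim: "(\<lambda>n. ennreal (?w n x * (norm (ift h x))\<^sup>2)) \<longlonglongrightarrow> ennreal (1 * (norm (ift h x))\<^sup>2)" for x
    unfolding \<sigma>_def by (intro tendsto_intros gauss_weight_tendsto)
  have "(\<integral>\<^sup>+x. ennreal ((norm (ift h x))\<^sup>2) \<partial>lborel) = (\<integral>\<^sup>+x. liminf (\<lambda>n. ennreal (?w n x * (norm (ift h x))\<^sup>2)) \<partial>lborel)"
    using lim_imp_Liminf[OF _ lim] by simp
  also have "\<dots> \<le> liminf (\<lambda>n. \<integral>\<^sup>+x. ennreal (?w n x * (norm (ift h x))\<^sup>2) \<partial>lborel)"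
    by (rule nn_integral_liminf) measurable
  also have "\<dots> \<le> ennreal (B * (LINT \<xi>|lborel. norm (h \<xi>)))"
    by (rule order_trans[OF Liminf_le_Limsup Limsup_bounded]) (use bound in auto)
  finally show ?thesis .
qed

section \<open>Convolution and frequency localisation\<close>

definition conv :: "('a::euclidean_space \<Rightarrow> complex) \<Rightarrow> ('a \<Rightarrow> complex) \<Rightarrow> 'a \<Rightarrow> complex" where
  "conv f g x = (LINT y|lborel. f y * g (x - y))"

lemma conv_commute:
  assumes "f \<in> borel_measurable borel" "g \<in> borel_measurable borel"
  shows "conv f g = conv g f"
proof
  fix x
  have [measurable]: "f \<in> borel_measurable borel" "g \<in> borel_measurable borel" by fact+
  have "(LINT y|lborel. f (x - y) * g (x - (x - y))) = (LINT y|lborel. f y * g (x - y))"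
    by (rule lborel_integral_reflect[where f="\<lambda>y. f y * g (x - y)"]) measurable
  then show "conv f g x = conv g f x" by (simp add: conv_def mult.commute)
qed

lemma borel_measurable_conv:
  assumes "f \<in> borel_measurable borel" "g \<in> borel_measurable borel"
  shows "conv f g \<in> borel_measurable borel"
proof -
  have [measurable]: "f \<in> borel_measurable borel" "g \<in> borel_measurable borel" by fact+
  show ?thesis unfolding conv_def by measurable
qed

text \<open>Only the second factor has a frequency representation, so the first may be an arbitrary integrable function. The formula
  says that convolution with \<open>ift h\<close> is the Fourier multiplier \<open>h\<close>.\<close>

lemma conv_ift:
  assumes f: "integrable lborel f" and h: "integrable lborel h"
  shows "conv f (ift h) = ift (\<lambda>\<xi>. h \<xi> * ft f \<xi>)"
proof
  fix x :: 'a
  have m: "(\<lambda>(y, \<xi>). ch (\<xi> \<bullet> (x - y))) \<in> borel_measurable (borel \<Otimes>\<^sub>M borel)"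
    by measurable
  have inner_eq: "(LINT y|lborel. f y * ch (\<xi> \<bullet> (x - y))) = ft f \<xi> * ch (\<xi> \<bullet> x)" for \<xi>
  proof -
    have "f y * ch (\<xi> \<bullet> (x - y)) = f y * ch (- (\<xi> \<bullet> y)) * ch (\<xi> \<bullet> x)" for y
      by (simp add: inner_diff_right ch_diff mult_ac)
    then have "(LINT y|lborel. f y * ch (\<xi> \<bullet> (x - y))) = (LINT y|lborel. f y * ch (- (\<xi> \<bullet> y)) * ch (\<xi> \<bullet> x))"
      by (simp only:)
    then show ?thesis by (simp add: ft_def)
  qed
  have "conv f (ift h) x = (LINT \<xi>|lborel. h \<xi> * (LINT y|lborel. f y * ch (\<xi> \<bullet> (x - y))))"
    unfolding conv_def ift_def using fubini_lborel_kernel[OF f h m] by simp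
  then show "conv f (ift h) x = ift (\<lambda>\<xi>. h \<xi> * ft f \<xi>) x"
    unfolding inner_eq by (simp add: ift_def mult.assoc)
qed

lemma
  fixes f g :: "'a::euclidean_space \<Rightarrow> complex"
  assumes f: "integrable lborel f" and g: "integrable lborel g"
  shows integrable_conv: "integrable lborel (conv f g)"
    and ift_conv: "ift (conv f g) \<xi> = ift f \<xi> * ift g \<xi>"
proof -
  have [measurable]: "f \<in> borel_measurable borel" "g \<in> borel_measurable borel"
    using f g by auto
  have gs: "integrable lborel (\<lambda>x. g (x - y))" for y
    using lborel_integrable_affine[of 1 g "- y"] g by simp
  have gn: "(LINT x|lborel. norm (g (x - y))) = (LINT x|lborel. norm (g x))" for y
    using lborel_integral_affine[of 1 "\<lambda>x. norm (g x)" "- y"] by simp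
  have gi: "(LINT x|lborel. g (x - y) * ch ((x - y) \<bullet> \<xi>)) = ift g \<xi>" for y
    using lborel_integral_affine[of 1 "\<lambda>x. g x * ch (x \<bullet> \<xi>)" "- y"] by (simp add: ift_def)
  have i: "integrable (lborel \<Otimes>\<^sub>M lborel) (\<lambda>(y, x). f y * g (x - y) * ch (x \<bullet> \<zeta>))" for \<zeta>
  proof (rule lborel_pair.Fubini_integrable)
    have eq: "(LINT x|lborel. norm (case (y, x) of (y, x) \<Rightarrow> f y * g (x - y) * ch (x \<bullet> \<zeta>)))
        = norm (f y) * (LINT x|lborel. norm (g x))" for y
      by (simp add: norm_mult gn)
    show "integrable lborel (\<lambda>y. LINT x|lborel. norm (case (y, x) of (y, x) \<Rightarrow> f y * g (x - y) * ch (x \<bullet> \<zeta>)))"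
      unfolding eq using f by (auto intro: integrable_norm)
    show "AE y in lborel. integrable lborel (\<lambda>x. case (y, x) of (y, x) \<Rightarrow> f y * g (x - y) * ch (x \<bullet> \<zeta>))"
      using integrable_mult_ch[OF gs] by (simp add: mult.assoc)
  qed measurable
  have i0: "integrable (lborel \<Otimes>\<^sub>M lborel) (\<lambda>(x, y). f y * g (x - y))"
    using lborel_pair.integrable_product_swap[OF i[of 0]] by (simp add: case_prod_beta)
  show "integrable lborel (conv f g)"
    unfolding conv_def using lborel_pair.integrable_fst'[OF i0] by simp
  have "ift (conv f g) \<xi> = (LINT x|lborel. LINT y|lborel. f y * g (x - y) * ch (x \<bullet> \<xi>))"
    by (simp add: ift_def conv_def)
  also have "\<dots> = (LINT y|lborel. LINT x|lborel. f y * g (x - y) * ch (x \<bullet> \<xi>))"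
    using lborel_pair.Fubini_integral[OF i[of \<xi>]] by simp
  also have "\<dots> = (LINT y|lborel. LINT x|lborel. (f y * ch (y \<bullet> \<xi>)) * (g (x - y) * ch ((x - y) \<bullet> \<xi>)))"
    by (simp add: inner_diff_left ch_diff mult_ac ch_cancel[simplified mult_ac])
  also have "\<dots> = ift f \<xi> * ift g \<xi>"
    unfolding integral_mult_right_zero gi integral_mult_left_zero by (simp add: ift_def)
  finally show "ift (conv f g) \<xi> = ift f \<xi> * ift g \<xi>" .
qed

lemma ft_conv: "integrable lborel f \<Longrightarrow> integrable lborel g \<Longrightarrow> ft (conv f g) \<xi> = ft f \<xi> * ft g \<xi>"
  by (simp add: ft_eq_ift ift_conv)

text \<open>Frequency support in a ball, expressed by a representation rather than by the Fourier transform, so that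
  it passes to products and conjugates without any appeal to inversion.\<close>

definition spec :: "'a::euclidean_space \<Rightarrow> real \<Rightarrow> ('a \<Rightarrow> complex) \<Rightarrow> bool" where
  "spec c r u \<longleftrightarrow> (\<exists>h. integrable lborel h \<and> (\<forall>\<xi>. h \<xi> \<noteq> 0 \<longrightarrow> dist \<xi> c \<le> r) \<and> u = ift h)"

text \<open>A product has the convolution of the two densities as its density, supported in the sum of the two balls.\<close>

lemma spec_mult:
  assumes "spec c r u" "spec d s v"
  shows "spec (c + d) (r + s) (\<lambda>x. u x * v x)"
proof -
  obtain h where h: "integrable lborel h" "\<And>\<xi>. h \<xi> \<noteq> 0 \<Longrightarrow> dist \<xi> c \<le> r" "u = ift h"
    using assms(1) by (auto simp: spec_def)
  obtain k where k: "integrable lborel k" "\<And>\<xi>. k \<xi> \<noteq> 0 \<Longrightarrow> dist \<xi> d \<le> s" "v = ift k"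
    using assms(2) by (auto simp: spec_def)
  have "dist \<xi> (c + d) \<le> r + s" if "conv h k \<xi> \<noteq> 0" for \<xi>
  proof (rule ccontr)
    assume far: "\<not> dist \<xi> (c + d) \<le> r + s"
    have "h y * k (\<xi> - y) = 0" for y
    proof (rule ccontr)
      assume "h y * k (\<xi> - y) \<noteq> 0"
      then have "dist y c \<le> r" "dist (\<xi> - y) d \<le> s" using h(2)[of y] k(2)[of "\<xi> - y"] by auto
      moreover have "dist \<xi> (c + d) \<le> dist y c + dist (\<xi> - y) d"
        using norm_triangle_ineq[of "y - c" "\<xi> - y - d"] by (simp add: dist_norm algebra_simps)
      ultimately show False using far by linarith
    qed
    then have "(\<lambda>y. h y * k (\<xi> - y)) = (\<lambda>_. 0)" by (rule ext)
    then have "conv h k \<xi> = 0" by (simp only: conv_def Bochner_Integration.integral_zero)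
    then show False using that by simp
  qed
  then show ?thesis
    unfolding spec_def using h k integrable_conv[OF h(1) k(1)] ift_conv[OF h(1) k(1)]
    by (intro exI[of _ "conv h k"]) auto
qed

lemma spec_cnj:
  assumes "spec c r u"
  shows "spec (- c) r (\<lambda>x. cnj (u x))"
proof -
  obtain h where h: "integrable lborel h" "\<And>\<xi>. h \<xi> \<noteq> 0 \<Longrightarrow> dist \<xi> c \<le> r" "u = ift h"
    using assms(1) by (auto simp: spec_def)
  have [measurable]: "h \<in> borel_measurable borel" using h by auto
  have i: "integrable lborel (\<lambda>\<xi>. h (- \<xi>))"
    using lborel_integrable_reflect[of h 0] h by simp
  have "cnj (ift h x) = ift (\<lambda>\<xi>. cnj (h (- \<xi>))) x" for x
  proof -
    have "ift (\<lambda>\<xi>. cnj (h (- \<xi>))) x = (LINT \<xi>|lborel. cnj (h (0 - \<xi>) * ch ((0 - \<xi>) \<bullet> x)))"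
      by (simp add: ift_def ch_minus)
    also have "\<dots> = (LINT \<xi>|lborel. cnj (h \<xi> * ch (\<xi> \<bullet> x)))"
      by (rule lborel_integral_reflect[where f="\<lambda>\<xi>. cnj (h \<xi> * ch (\<xi> \<bullet> x))"]) measurable
    finally show ?thesis by (simp add: ift_def integral_cnj del: complex_cnj_mult)
  qed
  moreover have "dist \<xi> (- c) \<le> r" if "h (- \<xi>) \<noteq> 0" for \<xi>
    using h(2)[OF that] norm_minus_cancel[of "\<xi> + c"] by (simp add: dist_norm)
  ultimately show ?thesis
    unfolding spec_def using h i
    by (intro exI[of _ "\<lambda>\<xi>. cnj (h (- \<xi>))"]) (auto simp: fun_eq_iff)
qed

text \<open>The orthogonality principle behind all expansions below: the integral is the density at frequency \<open>0\<close>, and \<open>0\<close> is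
  outside the ball.\<close>

lemma spec_integral_eq_0:
  assumes "spec c r u" "integrable lborel u" "norm c > r"
  shows "(LINT x|lborel. u x) = 0"
proof -
  obtain h where h: "integrable lborel h" "\<And>\<xi>. h \<xi> \<noteq> 0 \<Longrightarrow> dist \<xi> c \<le> r" "u = ift h"
    using assms(1) by (auto simp: spec_def)
  have "h \<xi> = 0" if "norm \<xi> < norm c - r" for \<xi>
    using h(2)[of \<xi>] norm_triangle_ineq2[of c \<xi>] that by (cases "h \<xi> = 0") (auto simp: dist_norm norm_minus_commute)
  then show ?thesis
    using integral_ift_eq_0[OF h(1), of "norm c - r"] assms h(3) by auto
qed

section \<open>A smooth plateau function on the line\<close>

text \<open>The derivatives of \<open>exp (-1 / (x (1 - x)))\<close> on the unit interval all have this form. The parameters are a polynomial and the order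
  of the poles at \<open>0\<close> and \<open>1\<close>.\<close>

definition bump_fun :: "real poly \<Rightarrow> nat \<Rightarrow> real \<Rightarrow> real" where
  "bump_fun p m x = (if 0 < x \<and> x < 1 then poly p x / (x * (1 - x)) ^ m * exp (- 1 / (x * (1 - x))) else 0)"

text \<open>The numerator of the derivative of \<open>bump_fun p m\<close> when it is brought over the denominator with exponent \<open>m + 2\<close>.\<close>

definition bump_deriv_poly :: "real poly \<Rightarrow> nat \<Rightarrow> real poly" where
  "bump_deriv_poly p m = pderiv p * [:0, 1, -1:] ^ 2 - smult (real m) (p * [:1, -2:] * [:0, 1, -1:]) + p * [:1, -2:]"

text \<open>The exponential beats every pole, and a quadratic bound is all that is needed for differentiability at the two end points.\<close>

lemma bump_fun_quadratic_bound:
  "\<exists>C. \<forall>x. \<bar>bump_fun p m x\<bar> \<le> C * x\<^sup>2 \<and> \<bar>bump_fun p m x\<bar> \<le> C * (x - 1)\<^sup>2"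
proof -
  have "compact ((\<lambda>x. poly p x) ` {0..1})"
    by (intro compact_continuous_image continuous_intros) auto
  then have "bounded ((\<lambda>x. poly p x) ` {0..1})" by (rule compact_imp_bounded)
  then obtain B where "\<forall>x\<in>{0..1}. \<bar>poly p x\<bar> \<le> B"
    unfolding bounded_iff by auto
  then have B: "\<And>x. x \<in> {0..1} \<Longrightarrow> \<bar>poly p x\<bar> \<le> B" by blast
  have B0: "B \<ge> 0" using B[of 0] by auto
  have main: "\<bar>bump_fun p m x\<bar> \<le> B * fact (m + 2) * (x * (1 - x))\<^sup>2" if x: "0 < x" "x < 1" for x
  proof -
    define t where "t = 1 / (x * (1 - x))"
    have t: "t > 0" using x by (simp add: t_def)
    have "t ^ m * exp (- t) \<le> fact (m + 2) * (1 / t)\<^sup>2"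
    proof -
      have "t ^ (m + 2) \<le> fact (m + 2) * exp t"
        using power_div_fact_le_exp[of t "m + 2"] t by (simp add: field_simps del: fact_Suc power_Suc)
      then have "t ^ (m + 2) * exp (- t) \<le> fact (m + 2) * exp t * exp (- t)"
        by (intro mult_right_mono) auto
      also have "\<dots> = fact (m + 2)" by (simp add: exp_minus del: fact_Suc)
      finally have "t ^ (m + 2) * exp (- t) * (1 / t)\<^sup>2 \<le> fact (m + 2) * (1 / t)\<^sup>2"
        by (intro mult_right_mono) auto
      moreover have "t ^ (m + 2) * exp (- t) * (1 / t)\<^sup>2 = t ^ m * exp (- t)"
      proof -
        have "t ^ (m + 2) * exp (- t) * (1 / t)\<^sup>2 = t ^ m * exp (- t) * (t * (1 / t))\<^sup>2"
          by (simp only: power_add power_mult_distrib ac_simps)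
        then show ?thesis using t by simp
      qed
      ultimately show ?thesis by (simp only:)
    qed
    moreover have "bump_fun p m x = poly p x * (t ^ m * exp (- t))"
    proof -
      have "bump_fun p m x = poly p x / (x * (1 - x)) ^ m * exp (- 1 / (x * (1 - x)))"
        using x by (simp add: bump_fun_def)
      then show ?thesis unfolding t_def power_one_over by simp
    qed
    ultimately have "\<bar>bump_fun p m x\<bar> \<le> B * (fact (m + 2) * (1 / t)\<^sup>2)"
      using B[of x] x t B0 by (auto simp: abs_mult intro!: mult_mono)
    then show ?thesis by (simp add: t_def)
  qed
  show ?thesis
  proof (intro exI[of _ "B * fact (m + 2)"] allI)
    fix x :: real
    show "\<bar>bump_fun p m x\<bar> \<le> B * fact (m + 2) * x\<^sup>2 \<and> \<bar>bump_fun p m x\<bar> \<le> B * fact (m + 2) * (x - 1)\<^sup>2"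
    proof (cases "0 < x \<and> x < 1")
      case True
      have "(x * (1 - x))\<^sup>2 \<le> x\<^sup>2" "(x * (1 - x))\<^sup>2 \<le> (x - 1)\<^sup>2"
        using True by (auto simp: power_mult_distrib power2_commute[of x 1] power_le_one mult_right_le_one_le mult_left_le_one_le)
      then show ?thesis
        using main[of x] True B0 by (meson fact_ge_zero mult_left_mono mult_nonneg_nonneg order_trans)
    next
      case False
      then have "bump_fun p m x = 0" by (auto simp: bump_fun_def)
      then show ?thesis using B0 by simp
    qed
  qed
qed

lemma DERIV_zero_quadratic:
  fixes f :: "real \<Rightarrow> real"
  assumes "\<And>y. \<bar>f y\<bar> \<le> C * (y - x)\<^sup>2"
  shows "(f has_real_derivative 0) (at x)"
proof -
  have fx: "f x = 0" using assms[of x] by simp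
  have "((\<lambda>h. f (x + h) / h) \<longlongrightarrow> 0) (at 0)"
  proof (rule Lim_null_comparison)
    show "\<forall>\<^sub>F h in at 0. norm (f (x + h) / h) \<le> C * \<bar>h\<bar>"
    proof (rule eventually_at_topological[THEN iffD2], intro exI[of _ UNIV] conjI ballI impI)
      fix h :: real assume "h \<noteq> 0"
      then have "\<bar>f (x + h)\<bar> / \<bar>h\<bar> \<le> C * h\<^sup>2 / \<bar>h\<bar>"
        using assms[of "x + h"] by (intro divide_right_mono) auto
      also have "C * h\<^sup>2 / \<bar>h\<bar> = C * \<bar>h\<bar>"
        using \<open>h \<noteq> 0\<close> by (simp add: power2_eq_square abs_if)
      finally show "norm (f (x + h) / h) \<le> C * \<bar>h\<bar>" by simp
    qed auto
    have "((\<lambda>h::real. C * \<bar>h\<bar>) \<longlongrightarrow> C * \<bar>0\<bar>) (at 0)" by (intro tendsto_intros)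
    then show "((\<lambda>h::real. C * \<bar>h\<bar>) \<longlongrightarrow> 0) (at 0)" by simp
  qed
  then show ?thesis by (simp add: DERIV_def fx)
qed

lemma bump_fun_deriv: "(bump_fun p m has_real_derivative bump_fun (bump_deriv_poly p m) (m + 2) x) (at x)"
proof -
  obtain C where C: "\<And>x. \<bar>bump_fun p m x\<bar> \<le> C * x\<^sup>2" "\<And>x. \<bar>bump_fun p m x\<bar> \<le> C * (x - 1)\<^sup>2"
    using bump_fun_quadratic_bound by blast
  consider "x = 0" | "x = 1" | "x < 0 \<or> x > 1" | "0 < x" "x < 1" by linarith
  then show ?thesis
  proof cases
    case 1
    with DERIV_zero_quadratic[of "bump_fun p m" C 0] C show ?thesis by (simp add: bump_fun_def)
  next
    case 2
    with DERIV_zero_quadratic[of "bump_fun p m" C 1] C show ?thesis by (simp add: bump_fun_def)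
  next
    case 3
    have "((\<lambda>_. 0) has_real_derivative 0) (at x)" by simp
    then have "(bump_fun p m has_real_derivative 0) (at x)"
    proof (rule has_field_derivative_transform_within_open)
      show "open ({..<0} \<union> {1<..} :: real set)" by auto
      show "x \<in> {..<0} \<union> {1<..}" using 3 by auto
      show "\<And>y. y \<in> {..<0} \<union> {1<..} \<Longrightarrow> 0 = bump_fun p m y" by (auto simp: bump_fun_def)
    qed
    moreover have "bump_fun (bump_deriv_poly p m) (m + 2) x = 0" using 3 by (auto simp: bump_fun_def)
    ultimately show ?thesis by simp
  next
    case 4
    define q where "q = x * (1 - x)"
    have q: "q > 0" using 4 by (simp add: q_def)
    have "((\<lambda>y. poly p y * inverse (y * (1 - y)) ^ m * exp (- inverse (y * (1 - y)))) has_real_derivative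
       (poly (pderiv p) x * inverse q ^ m * exp (- inverse q)
        + poly p x * (real m * inverse q ^ (m - 1) * (- ((1 - 2 * x) * inverse q ^ 2))) * exp (- inverse q)
        + poly p x * inverse q ^ m * (exp (- inverse q) * ((1 - 2 * x) * inverse q ^ 2)))) (at x)"
    proof -
      define r where "r y = inverse (y * (1 - y))" for y :: real
      have "((\<lambda>y. y * (1 - y)) has_real_derivative (1 - 2 * x)) (at x)"
        by (auto intro!: derivative_eq_intros)
      moreover have "x * (1 - x) \<noteq> 0" using 4 by simp
      ultimately have "(r has_real_derivative - ((1 - 2 * x) * inverse (q ^ Suc (Suc 0)))) (at x)"
        unfolding r_def[abs_def] q_def by (rule DERIV_inverse_fun)
      moreover have "inverse (q ^ Suc (Suc 0)) = inverse q ^ 2"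
        by (simp only: power_inverse numeral_2_eq_2)
      ultimately have r': "(r has_real_derivative - ((1 - 2 * x) * inverse q ^ 2)) (at x)"
        by (simp only:)
      have rx: "r x = inverse q" by (simp add: r_def q_def)
      have "((\<lambda>y. poly p y * r y ^ m * exp (- r y)) has_real_derivative
       (poly (pderiv p) x * r x ^ m * exp (- r x)
        + poly p x * (real m * r x ^ (m - 1) * (- ((1 - 2 * x) * inverse q ^ 2))) * exp (- r x)
        + poly p x * r x ^ m * (exp (- r x) * ((1 - 2 * x) * inverse q ^ 2)))) (at x)"
        by (auto intro!: derivative_eq_intros r' simp: algebra_simps)
      then show ?thesis unfolding rx by (simp add: r_def)
    qed
    also have "(poly (pderiv p) x * inverse q ^ m * exp (- inverse q)
        + poly p x * (real m * inverse q ^ (m - 1) * (- ((1 - 2 * x) * inverse q ^ 2))) * exp (- inverse q)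
        + poly p x * inverse q ^ m * (exp (- inverse q) * ((1 - 2 * x) * inverse q ^ 2)))
        = bump_fun (bump_deriv_poly p m) (m + 2) x"
    proof -
      have qx: "poly [:0, 1, -1:] x = q" by (simp add: q_def algebra_simps)
      have lx: "poly [:1, -2:] x = 1 - 2 * x" by simp
      have P: "poly (bump_deriv_poly p m) x = poly (pderiv p) x * q\<^sup>2 - real m * (poly p x * (1 - 2 * x) * q) + poly p x * (1 - 2 * x)"
        unfolding bump_deriv_poly_def poly_add poly_diff poly_mult poly_smult poly_power qx lx by simp
      have "real m * inverse q ^ (m - 1) = real m * (inverse q ^ m * q)"
        using q by (cases m) auto
      note E = this
      have 1: "poly p x * (real m * inverse q ^ (m - 1) * (- ((1 - 2 * x) * inverse q ^ 2))) = - (real m * (poly p x * (1 - 2 * x) * q)) * inverse q ^ (m + 2)"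
        unfolding E by (simp only: power_add mult_ac mult_minus_left mult_minus_right)
      have 2: "poly (pderiv p) x * inverse q ^ m = poly (pderiv p) x * q\<^sup>2 * inverse q ^ (m + 2)"
      proof -
        have "q * inverse q = 1" using q by simp
        then have "inverse q ^ m = (q * inverse q)\<^sup>2 * inverse q ^ m" by simp
        then show ?thesis by (simp only: power_add power_mult_distrib ac_simps)
      qed
      have 3: "bump_fun (bump_deriv_poly p m) (m + 2) x = poly (bump_deriv_poly p m) x * inverse q ^ (m + 2) * exp (- inverse q)"
        using 4 by (simp add: bump_fun_def q_def divide_inverse power_inverse[symmetric])
      show ?thesis unfolding 3 P 1 2 by (simp add: algebra_simps power_add power2_eq_square)
    qed
    finally show ?thesis
    proof (rule has_field_derivative_transform_within_open)
      show "open {0<..<1::real}" by auto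
      show "x \<in> {0<..<1}" using 4 by auto
      show "\<And>y. y \<in> {0<..<1} \<Longrightarrow> poly p y * inverse (y * (1 - y)) ^ m * exp (- inverse (y * (1 - y))) = bump_fun p m y"
        by (auto simp: bump_fun_def divide_inverse power_inverse simp del: inverse_mult_distrib)
    qed
  qed
qed

text \<open>Smooth functions supported in \<open>[-2, 2]\<close>. The witness \<open>G\<close> is the sequence of all derivatives, which keeps
  iterated derivatives out of the statements.\<close>

definition test_fun :: "(real \<Rightarrow> complex) \<Rightarrow> bool" where
  "test_fun g \<longleftrightarrow> (\<exists>G. G 0 = g \<and> (\<forall>n x. (G n has_vector_derivative G (Suc n) x) (at x)) \<and>
      (\<forall>n x. \<bar>x\<bar> \<ge> 2 \<longrightarrow> G n x = 0))"

lemma test_fun_support: "test_fun g \<Longrightarrow> \<bar>x\<bar> \<ge> 2 \<Longrightarrow> g x = 0"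
  unfolding test_fun_def by metis

lemma test_fun_deriv:
  assumes "test_fun g"
  obtains g' where "test_fun g'" "\<And>x. (g has_vector_derivative g' x) (at x)"
proof -
  obtain G where G: "G 0 = g" "\<And>n x. (G n has_vector_derivative G (Suc n) x) (at x)"
      "\<And>n x. \<bar>x\<bar> \<ge> 2 \<Longrightarrow> G n x = 0"
    using assms unfolding test_fun_def by blast
  have "test_fun (G 1)"
    unfolding test_fun_def by (intro exI[of _ "\<lambda>n. G (Suc n)"]) (use G in auto)
  then show ?thesis using that[of "G 1"] G(1) G(2)[of 0] by auto
qed

lemma test_fun_mult_id:
  assumes "test_fun g"
  shows "test_fun (\<lambda>x. c * of_real x * g x)"
proof -
  obtain G where G: "G 0 = g" "\<And>n x. (G n has_vector_derivative G (Suc n) x) (at x)"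
      "\<And>n x. \<bar>x\<bar> \<ge> 2 \<Longrightarrow> G n x = 0"
    using assms unfolding test_fun_def by blast
  define H where "H n x = c * of_real x * G n x + c * of_nat n * G (n - 1) x" for n x
  have "(H n has_vector_derivative H (Suc n) x) (at x)" for n x
  proof -
    have "((\<lambda>x. complex_of_real x) has_vector_derivative 1) (at x)"
      using has_vector_derivative_of_real[OF DERIV_ident] by simp
    then have "((\<lambda>x. c * of_real x) has_vector_derivative c * 1) (at x)"
      by (rule has_vector_derivative_mult_right)
    from has_vector_derivative_mult[OF this G(2)[of n x]]
    have A: "((\<lambda>x. c * of_real x * G n x) has_vector_derivative (c * of_real x * G (Suc n) x + c * G n x)) (at x)"
      by simp
    have B: "((\<lambda>x. c * of_nat n * G (n - 1) x) has_vector_derivative c * of_nat n * G n x) (at x)"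
    proof (cases n)
      case (Suc k)
      show ?thesis unfolding Suc using has_vector_derivative_mult_right[OF G(2)[of k x]] by simp
    qed simp
    from has_vector_derivative_add[OF A B] show ?thesis
      unfolding H_def by (simp add: algebra_simps)
  qed
  then show ?thesis
    unfolding test_fun_def using G by (intro exI[of _ H]) (auto simp: H_def fun_eq_iff)
qed

lemma continuous_test_fun: "test_fun g \<Longrightarrow> continuous_on A g"
  by (metis test_fun_deriv has_vector_derivative_continuous continuous_at_imp_continuous_on)

text \<open>The integral of a bump over \<open>(0, 1)\<close>, normalised, is a smooth step. The plateau is the difference of two translates of this step, rising on
  \<open>[-2, -1]\<close> and on \<open>[1, 2]\<close>.\<close>

theorem plateau_exists:
  obtains \<phi> :: "real \<Rightarrow> real" where "test_fun (\<lambda>x. of_real (\<phi> x))"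
    "\<And>x. \<bar>x\<bar> \<le> 1 \<Longrightarrow> \<phi> x = 1" "\<And>x. \<bar>x\<bar> \<ge> 2 \<Longrightarrow> \<phi> x = 0"
proof -
  define P where "P n = ((\<lambda>(p, m). (bump_deriv_poly p m, m + 2)) ^^ n) ([:1:], 0)" for n
  define b where "b n = bump_fun (fst (P n)) (snd (P n))" for n
  have bd: "(b n has_real_derivative b (Suc n) x) (at x)" for n x
    unfolding b_def P_def using bump_fun_deriv by (simp add: case_prod_beta)
  have b_out: "b n x = 0" if "x \<le> 0 \<or> x \<ge> 1" for n x
    using that by (auto simp: b_def bump_fun_def)
  have b_pos: "b 0 x > 0" if "0 < x" "x < 1" for x
    using that by (simp add: b_def bump_fun_def P_def)
  have bc: "continuous_on A (b 0)" for A
    using bd[of 0] by (meson DERIV_isCont continuous_at_imp_continuous_on)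
  define S where "S u = (LBINT y=ereal 0..ereal u. b 0 y)" for u
  have S': "(S has_real_derivative b 0 x) (at x)" for x
  proof -
    define a c where "a = - \<bar>x\<bar> - 1" and "c = \<bar>x\<bar> + 1"
    have "(S has_vector_derivative b 0 x) (at x within {a..c})"
      unfolding S_def by (rule interval_integral_FTC2) (auto simp: a_def c_def intro: bc)
    moreover have "at x within {a..c} = at x"
      by (rule at_within_Icc_at) (auto simp: a_def c_def)
    ultimately show ?thesis by (simp add: has_real_derivative_iff_has_vector_derivative)
  qed
  have S0: "S 0 = 0" by (simp add: S_def zero_ereal_def[symmetric])
  have S_left: "S x = 0" if "x \<le> 0" for x
  proof (cases "x = 0")
    case False
    with that have "x < 0" by simp
    have "S 0 = S x"
    proof (rule DERIV_isconst_end[where f=S, OF \<open>x < 0\<close>])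
      show "continuous_on {x..0} S" using S' by (meson DERIV_isCont continuous_at_imp_continuous_on)
      show "(S has_real_derivative 0) (at y)" if "x < y" "y < 0" for y using S'[of y] b_out[of y 0] that by simp
    qed
    then show ?thesis using S0 by simp
  qed (simp add: S0)
  have S_right: "S x = S 1" if "x \<ge> 1" for x
  proof (cases "x = 1")
    case False
    with that have "1 < x" by simp
    show ?thesis
    proof (rule DERIV_isconst_end[where f=S, OF \<open>1 < x\<close>])
      show "continuous_on {1..x} S" using S' by (meson DERIV_isCont continuous_at_imp_continuous_on)
      show "(S has_real_derivative 0) (at y)" if "1 < y" "y < x" for y using S'[of y] b_out[of y 0] that by simp
    qed
  qed simp
  have S1: "S 1 > 0"
  proof -
    have "S 0 < S 1"
    proof (rule DERIV_pos_imp_increasing_open[where f=S])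
      show "\<exists>y. (S has_real_derivative y) (at x) \<and> 0 < y" if "0 < x" "x < 1" for x
        using S'[of x] b_pos[of x] that by blast
      show "continuous_on {0..1} S" using S' by (meson DERIV_isCont continuous_at_imp_continuous_on)
    qed simp
    then show ?thesis by (simp add: S0)
  qed
  define \<phi> where "\<phi> x = (S (x + 2) - S (x - 1)) / S 1" for x
  define G where "G n = (case n of 0 \<Rightarrow> (\<lambda>x. complex_of_real (\<phi> x)) | Suc k \<Rightarrow> (\<lambda>x. complex_of_real ((b k (x + 2) - b k (x - 1)) / S 1)))" for n
  have 1: "(\<phi> has_real_derivative (b 0 (x + 2) - b 0 (x - 1)) / S 1) (at x)" for x
  proof -
    have "((\<lambda>x. S (x + 2)) has_real_derivative b 0 (x + 2)) (at x)" "((\<lambda>x. S (x - 1)) has_real_derivative b 0 (x - 1)) (at x)"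
      using DERIV_shift[of "S" _ x 2] DERIV_shift[of "S" _ x "-1"] S'[of "x + 2"] S'[of "x - 1"] by simp_all
    from DERIV_cdivide[OF DERIV_diff[OF this], of "S 1"] show ?thesis by (simp add: \<phi>_def[abs_def])
  qed
  have 2: "((\<lambda>x. (b n (x + 2) - b n (x - 1)) / S 1) has_real_derivative (b (Suc n) (x + 2) - b (Suc n) (x - 1)) / S 1) (at x)" for n x
  proof -
    have "((\<lambda>x. b n (x + 2)) has_real_derivative b (Suc n) (x + 2)) (at x)" "((\<lambda>x. b n (x - 1)) has_real_derivative b (Suc n) (x - 1)) (at x)"
      using DERIV_shift[of "b n" _ x 2] DERIV_shift[of "b n" _ x "-1"] bd[of n "x + 2"] bd[of n "x - 1"] by simp_all
    from DERIV_cdivide[OF DERIV_diff[OF this], of "S 1"] show ?thesis .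
  qed
  show thesis
  proof (rule that[of \<phi>])
    show out: "\<phi> x = 0" if "\<bar>x\<bar> \<ge> 2" for x
      using that S_left[of "x + 2"] S_left[of "x - 1"] S_right[of "x + 2"] S_right[of "x - 1"]
      by (auto simp: \<phi>_def abs_if split: if_splits)
    show "\<phi> x = 1" if "\<bar>x\<bar> \<le> 1" for x
      using that S_left[of "x - 1"] S_right[of "x + 2"] S1 by (auto simp: \<phi>_def)
    show "test_fun (\<lambda>x. of_real (\<phi> x))"
      unfolding test_fun_def
    proof (intro exI[of _ G] conjI allI impI)
      show "G 0 = (\<lambda>x. of_real (\<phi> x))" by (simp add: G_def)
      show "(G n has_vector_derivative G (Suc n) x) (at x)" for n x
        using 1[of x] 2[of _ x]
        by (cases n) (auto simp: G_def has_real_derivative_iff_has_vector_derivative simp del: of_real_diff of_real_divide intro!: has_vector_derivative_of_real)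
      show "G n x = 0" if "\<bar>x\<bar> \<ge> 2" for n x
        using that out[of x] b_out[of "x + 2"] b_out[of "x - 1"]
        by (cases n) (auto simp: G_def abs_if split: if_splits)
    qed
  qed
qed

section \<open>From test functions to Schwartz functions\<close>

lemma ift_test_fun_integral:
  assumes g: "continuous_on UNIV g" and g0: "\<And>x. \<bar>x\<bar> \<ge> 2 \<Longrightarrow> g x = 0"
  shows "integrable lborel g" "((\<lambda>\<xi>. g \<xi> * ch (\<xi> * x)) has_integral ift g x) {-2..2}"
proof -
  have c: "continuous_on {-2..2} g" using g continuous_on_subset by blast
  have eq: "(\<lambda>x. indicator {-2..2} x *\<^sub>R g x) = g"
    using g0 by (fastforce simp: fun_eq_iff indicator_def)
  from borel_integrable_atLeastAtMost'[OF c]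
  show "integrable lborel g" unfolding set_integrable_def eq .
  have c2: "continuous_on {-2..2} (\<lambda>\<xi>. g \<xi> * ch (\<xi> * x))" by (intro continuous_intros c)
  have eq2: "(\<lambda>\<xi>. indicator {-2..2} \<xi> *\<^sub>R (g \<xi> * ch (\<xi> * x))) = (\<lambda>\<xi>. g \<xi> * ch (\<xi> * x))"
    using g0 by (fastforce simp: fun_eq_iff indicator_def)
  from has_integral_set_lebesgue has_integral_integral_lborel
  show "((\<lambda>\<xi>. g \<xi> * ch (\<xi> * x)) has_integral ift g x) {-2..2}"
    using set_borel_integral_eq_integral[OF borel_integrable_atLeastAtMost'[OF c2]]
    by (auto simp: set_lebesgue_integral_def eq2 ift_def has_integral_iff)
qed

lemma integrable_test_fun: "test_fun g \<Longrightarrow> integrable lborel g"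
  by (rule ift_test_fun_integral) (auto simp: continuous_test_fun test_fun_support)

lemma ch_deriv: "((\<lambda>x. ch (a * x)) has_vector_derivative 2 * pi * \<i> * a * ch (a * x)) (at x within A)"
proof -
  have "((\<lambda>x. exp (\<i> * complex_of_real (2 * pi * a * x))) has_vector_derivative
      (\<i> * complex_of_real (2 * pi * a)) * exp (\<i> * complex_of_real (2 * pi * a * x))) (at x within A)"
  proof -
    have "((\<lambda>x. complex_of_real (2 * pi * a * x)) has_vector_derivative of_real (2 * pi * a)) (at x within A)"
      by (rule has_vector_derivative_of_real) (auto intro!: derivative_eq_intros)
    then have "((\<lambda>x. \<i> * complex_of_real (2 * pi * a * x)) has_vector_derivative \<i> * of_real (2 * pi * a)) (at x within A)"
      by (rule has_vector_derivative_mult_right)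
    from field_vector_diff_chain_within[OF this, of exp "exp (\<i> * complex_of_real (2 * pi * a * x))"]
    show ?thesis by (simp add: comp_def DERIV_exp has_field_derivative_at_within)
  qed
  then show ?thesis by (simp add: ch_cis cis_conv_exp mult_ac)
qed

lemma ift_test_fun_deriv:
  assumes g: "test_fun g"
  shows "(ift g has_vector_derivative ift (\<lambda>\<xi>. (2 * pi * \<i>) * of_real \<xi> * g \<xi>) x) (at x)"
proof -
  have g': "test_fun (\<lambda>\<xi>. (2 * pi * \<i>) * of_real \<xi> * g \<xi>)" by (rule test_fun_mult_id[OF g])
  note gi = ift_test_fun_integral[OF continuous_test_fun[OF g] test_fun_support[OF g]]
  note gi' = ift_test_fun_integral[OF continuous_test_fun[OF g'] test_fun_support[OF g']]
  have "((\<lambda>x. integral (cbox (-2) 2) (\<lambda>\<xi>. g \<xi> * ch (\<xi> * x))) has_vector_derivative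
      integral (cbox (-2) 2) (\<lambda>\<xi>. (2 * pi * \<i>) * of_real \<xi> * g \<xi> * ch (\<xi> * x))) (at x within UNIV)"
  proof (rule leibniz_rule_vector_derivative)
    show "((\<lambda>x. g \<xi> * ch (\<xi> * x)) has_vector_derivative (2 * pi * \<i>) * of_real \<xi> * g \<xi> * ch (\<xi> * x)) (at x within UNIV)"
      for x \<xi>
      using has_vector_derivative_mult_right[OF ch_deriv, of "g \<xi>" \<xi> x UNIV] by (simp add: mult_ac)
    show "(\<lambda>\<xi>. g \<xi> * ch (\<xi> * x)) integrable_on cbox (-2) 2" for x
      using gi(2) by (auto simp: integrable_on_def)
    have [continuous_intros]: "continuous_on A (\<lambda>p. g (f p))" if "continuous_on A f" for A and f :: "real \<times> real \<Rightarrow> real"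
      using continuous_on_compose2[OF continuous_test_fun[OF g, of UNIV] that] by auto
    show "continuous_on (UNIV \<times> cbox (-2) 2) (\<lambda>(x, \<xi>). (2 * pi * \<i>) * of_real \<xi> * g \<xi> * ch (\<xi> * x))"
      unfolding case_prod_beta by (intro continuous_intros)
  qed auto
  moreover have "integral (cbox (-2) 2) (\<lambda>\<xi>. g \<xi> * ch (\<xi> * x)) = ift g x" for x
    using gi(2)[of x] by (simp add: integral_unique)
  moreover have "integral (cbox (-2) 2) (\<lambda>\<xi>. (2 * pi * \<i>) * of_real \<xi> * g \<xi> * ch (\<xi> * x)) = ift (\<lambda>\<xi>. (2 * pi * \<i>) * of_real \<xi> * g \<xi>) x"
    using gi'(2)[of x] by (simp add: integral_unique)
  ultimately show ?thesis by (simp only:)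
qed

lemma ift_by_parts:
  assumes g: "test_fun g" and g': "test_fun g'" and d: "\<And>x. (g has_vector_derivative g' x) (at x)"
  shows "ift g' x = - (2 * pi * \<i>) * of_real x * ift g x"
proof -
  note gi = ift_test_fun_integral(2)[OF continuous_test_fun[OF g] test_fun_support[OF g], of x]
  note gi' = ift_test_fun_integral(2)[OF continuous_test_fun[OF g'] test_fun_support[OF g'], of x]
  have "((\<lambda>\<xi>. g \<xi> * (2 * pi * \<i> * x * ch (x * \<xi>)) + g' \<xi> * ch (x * \<xi>)) has_integral
      (g 2 * ch (x * 2) - g (- 2) * ch (x * - 2))) {-2..2}"
  proof (rule fundamental_theorem_of_calculus)
    fix \<xi> :: real
    show "((\<lambda>\<xi>. g \<xi> * ch (x * \<xi>)) has_vector_derivative g \<xi> * (2 * pi * \<i> * x * ch (x * \<xi>)) + g' \<xi> * ch (x * \<xi>)) (at \<xi> within {-2..2})"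
      by (rule has_vector_derivative_mult[OF has_vector_derivative_at_within[OF d] ch_deriv])
  qed simp
  then have 1: "((\<lambda>\<xi>. g \<xi> * (2 * pi * \<i> * x * ch (x * \<xi>)) + g' \<xi> * ch (x * \<xi>)) has_integral 0) {-2..2}"
    using test_fun_support[OF g] by simp
  have "((\<lambda>\<xi>. (2 * pi * \<i> * x) * (g \<xi> * ch (\<xi> * x)) + g' \<xi> * ch (\<xi> * x)) has_integral
      ((2 * pi * \<i> * x) * ift g x + ift g' x)) {-2..2}"
    by (intro has_integral_add has_integral_mult_right gi gi')
  then have "((\<lambda>\<xi>. g \<xi> * (2 * pi * \<i> * x * ch (x * \<xi>)) + g' \<xi> * ch (x * \<xi>)) has_integral
      ((2 * pi * \<i> * x) * ift g x + ift g' x)) {-2..2}"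
    by (simp add: mult_ac)
  from has_integral_unique[OF this 1] show ?thesis by (simp add: eq_neg_iff_add_eq_0 add.commute)
qed

text \<open>Every integration by parts trades a derivative of \<open>g\<close> for a power of \<open>x\<close>.\<close>

lemma ift_test_fun_decay:
  assumes "test_fun g"
  shows "\<exists>C. \<forall>x. \<bar>x\<bar> ^ N * norm (ift g x) \<le> C"
  using assms
proof (induction N arbitrary: g)
  case 0
  then show ?case using norm_ift_le by auto
next
  case (Suc N)
  obtain g' where g': "test_fun g'" "\<And>x. (g has_vector_derivative g' x) (at x)"
    using test_fun_deriv[OF Suc.prems] by blast
  obtain C where C: "\<And>x. \<bar>x\<bar> ^ N * norm (ift g' x) \<le> C" using Suc.IH[OF g'(1)] by blast
  have "\<bar>x\<bar> ^ Suc N * norm (ift g x) \<le> C / (2 * pi)" for x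
  proof -
    have "norm (ift g' x) = 2 * pi * \<bar>x\<bar> * norm (ift g x)"
      unfolding ift_by_parts[OF Suc.prems g'] by (simp add: norm_mult)
    then show ?thesis using C[of x] by (simp add: field_simps)
  qed
  then show ?case by blast
qed

lemma ift_test_fun_rapid:
  assumes "test_fun g"
  shows "\<exists>C\<ge>0. \<forall>x. (1 + \<bar>x\<bar>) ^ N * norm (ift g x) \<le> C"
proof -
  obtain A B where A: "\<And>x. \<bar>x\<bar> ^ 0 * norm (ift g x) \<le> A" and B: "\<And>x. \<bar>x\<bar> ^ N * norm (ift g x) \<le> B"
    using ift_test_fun_decay[OF assms] by metis
  have A0: "A \<ge> 0" using order_trans[OF _ A, of 0 0] by simp
  have B0: "B \<ge> 0" using order_trans[OF _ B, of 0 0] by simp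
  have "(1 + \<bar>x\<bar>) ^ N * norm (ift g x) \<le> 2 ^ N * (A + B)" for x
  proof (cases "\<bar>x\<bar> \<le> 1")
    case True
    then have "(1 + \<bar>x\<bar>) ^ N \<le> 2 ^ N" by (intro power_mono) auto
    then have "(1 + \<bar>x\<bar>) ^ N * norm (ift g x) \<le> 2 ^ N * A" using A[of x] by (intro mult_mono) auto
    then show ?thesis using B0 by (simp add: distrib_left add_increasing2)
  next
    case False
    then have "(1 + \<bar>x\<bar>) ^ N \<le> (2 * \<bar>x\<bar>) ^ N" by (intro power_mono) auto
    then have "(1 + \<bar>x\<bar>) ^ N * norm (ift g x) \<le> (2 * \<bar>x\<bar>) ^ N * norm (ift g x)" by (intro mult_right_mono) auto
    also have "\<dots> = 2 ^ N * (\<bar>x\<bar> ^ N * norm (ift g x))" by (simp add: power_mult_distrib)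
    also have "\<dots> \<le> 2 ^ N * B" using B by (intro mult_left_mono) auto
    finally show ?thesis using A0 by (simp add: distrib_left add_increasing)
  qed
  then show ?thesis using A0 B0 by (intro exI[of _ "2 ^ N * (A + B)"]) auto
qed

text \<open>Coinduction in the style of bisimulation: a class of differentiable, rapidly decreasing functions that is closed under
  partial derivatives consists of Schwartz functions. This avoids formulas for iterated derivatives.\<close>

lemma schwartz_coinduct:
  assumes "C F"
    and diff: "\<And>F x. C F \<Longrightarrow> F differentiable (at x)"
    and pd: "\<And>F i. C F \<Longrightarrow> C (partial_deriv i F)"
    and decay: "\<And>F N. C F \<Longrightarrow> \<exists>A. \<forall>x. (1 + norm x) ^ N * norm (F x) \<le> A"
  shows "schwartz F"
proof -
  have "C (iter_partial is F)" for "is"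
    by (induction "is") (auto intro: assms(1) pd)
  then show ?thesis unfolding schwartz_def using diff decay by blast
qed

lemma norm_le_prod_3: "1 + norm (x::real^3) \<le> (1 + \<bar>x$1\<bar>) * (1 + \<bar>x$2\<bar>) * (1 + \<bar>x$3\<bar>)"
proof -
  have "norm x \<le> \<bar>x$1\<bar> + \<bar>x$2\<bar> + \<bar>x$3\<bar>"
    using norm_le_l1_cart[of x] by (simp add: sum_3)
  moreover have "0 \<le> \<bar>x$1\<bar> * \<bar>x$2\<bar>" "0 \<le> \<bar>x$1\<bar> * \<bar>x$3\<bar>" "0 \<le> \<bar>x$2\<bar> * \<bar>x$3\<bar>" "0 \<le> \<bar>x$1\<bar> * \<bar>x$2\<bar> * \<bar>x$3\<bar>"
    by auto
  moreover have "(1 + \<bar>x$1\<bar>) * (1 + \<bar>x$2\<bar>) * (1 + \<bar>x$3\<bar>) = 1 + \<bar>x$1\<bar> + \<bar>x$2\<bar> + \<bar>x$3\<bar>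
      + \<bar>x$1\<bar> * \<bar>x$2\<bar> + \<bar>x$1\<bar> * \<bar>x$3\<bar> + \<bar>x$2\<bar> * \<bar>x$3\<bar> + \<bar>x$1\<bar> * \<bar>x$2\<bar> * \<bar>x$3\<bar>"
    by (simp add: distrib_left distrib_right)
  ultimately show ?thesis by linarith
qed

definition tensor3 :: "(real \<Rightarrow> complex) \<Rightarrow> (real \<Rightarrow> complex) \<Rightarrow> (real \<Rightarrow> complex) \<Rightarrow> real^3 \<Rightarrow> complex" where
  "tensor3 f g h x = f (x$1) * g (x$2) * h (x$3)"

lemma has_derivative_component:
  assumes "(f has_vector_derivative f') (at (x$i))"
  shows "((\<lambda>x::real^3. f (x$i)) has_derivative (\<lambda>v. of_real (v$i) * f')) (at x)"
proof -
  have "(f has_derivative (\<lambda>t. t *\<^sub>R f')) (at (x$i))"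
    using assms by (simp add: has_vector_derivative_def)
  moreover have "((\<lambda>x::real^3. x$i) has_derivative (\<lambda>v. v$i)) (at x)"
    by (intro bounded_linear_imp_has_derivative bounded_linear_vec_nth)
  ultimately show ?thesis
    using has_derivative_compose[of "\<lambda>x. x$i" "\<lambda>v. v$i" x UNIV f] by (simp add: scaleR_conv_of_real)
qed

text \<open>The class of the coinduction consists of the tensor products of inverse transforms of test functions; a partial derivative acts on one
  factor and multiplies its density by the frequency variable.\<close>

lemma schwartz_tensor3:
  assumes "test_fun f" "test_fun g" "test_fun h"
  shows "schwartz (tensor3 (ift f) (ift g) (ift h))"
proof (rule schwartz_coinduct[where C="\<lambda>F. \<exists>f g h. test_fun f \<and> test_fun g \<and> test_fun h \<and> F = tensor3 (ift f) (ift g) (ift h)"])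
  define D where "D f = (\<lambda>\<xi>. (2 * pi * \<i>) * of_real \<xi> * f \<xi>)" for f :: "real \<Rightarrow> complex"
  have D: "test_fun (D f)" if "test_fun f" for f using test_fun_mult_id[OF that] by (simp add: D_def)
  have v: "(ift f has_vector_derivative ift (D f) x) (at x)" if "test_fun f" for f x
    unfolding D_def by (rule ift_test_fun_deriv[OF that])
  have der: "(tensor3 (ift f) (ift g) (ift h) has_derivative
     (\<lambda>v. of_real (v$1) * tensor3 (ift (D f)) (ift g) (ift h) x + of_real (v$2) * tensor3 (ift f) (ift (D g)) (ift h) x
        + of_real (v$3) * tensor3 (ift f) (ift g) (ift (D h)) x)) (at x)"
    if "test_fun f" "test_fun g" "test_fun h" for f g h x
  proof -
    have 1: "((\<lambda>x. ift f (x$1)) has_derivative (\<lambda>v. of_real (v$1) * ift (D f) (x$1))) (at x)"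
      "((\<lambda>x. ift g (x$2)) has_derivative (\<lambda>v. of_real (v$2) * ift (D g) (x$2))) (at x)"
      "((\<lambda>x. ift h (x$3)) has_derivative (\<lambda>v. of_real (v$3) * ift (D h) (x$3))) (at x)"
      by (intro has_derivative_component v that)+
    from has_derivative_mult[OF has_derivative_mult[OF 1(1,2)] 1(3)]
    show ?thesis unfolding tensor3_def[abs_def] by (rule has_derivative_eq_rhs) (simp add: fun_eq_iff algebra_simps)
  qed
  fix F assume "\<exists>f g h. test_fun f \<and> test_fun g \<and> test_fun h \<and> F = tensor3 (ift f) (ift g) (ift h)"
  then obtain f g h where F: "test_fun f" "test_fun g" "test_fun h" "F = tensor3 (ift f) (ift g) (ift h)" by blast
  show "F differentiable (at x)" for x
    using der[OF F(1-3)] unfolding F(4) differentiable_def by blast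
  have pd: "partial_deriv i F = (\<lambda>x. of_real (axis i 1 $ 1) * tensor3 (ift (D f)) (ift g) (ift h) x + of_real (axis i 1 $ 2) * tensor3 (ift f) (ift (D g)) (ift h) x
        + of_real (axis i 1 $ 3) * tensor3 (ift f) (ift g) (ift (D h)) x)" for i
    unfolding partial_deriv_def F(4) frechet_derivative_at[OF der[OF F(1-3)], symmetric] ..
  show "\<exists>f g h. test_fun f \<and> test_fun g \<and> test_fun h \<and> partial_deriv i F = tensor3 (ift f) (ift g) (ift h)" for i
  proof -
    consider "i = 1" | "i = 2" | "i = 3" using exhaust_3[of i] by blast
    then show ?thesis
    proof cases
      case 1 then show ?thesis using F D pd by (intro exI[of _ "D f"] exI[of _ g] exI[of _ h]) (auto simp: axis_def)
    next
      case 2 then show ?thesis using F D pd by (intro exI[of _ f] exI[of _ "D g"] exI[of _ h]) (auto simp: axis_def)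
    next
      case 3 then show ?thesis using F D pd by (intro exI[of _ f] exI[of _ g] exI[of _ "D h"]) (auto simp: axis_def)
    qed
  qed
  show "\<exists>A. \<forall>x. (1 + norm x) ^ N * norm (F x) \<le> A" for N
  proof -
    obtain A B C where A: "A \<ge> 0" "\<And>x. (1 + \<bar>x\<bar>) ^ N * norm (ift f x) \<le> A"
      and B: "B \<ge> 0" "\<And>x. (1 + \<bar>x\<bar>) ^ N * norm (ift g x) \<le> B"
      and C: "C \<ge> 0" "\<And>x. (1 + \<bar>x\<bar>) ^ N * norm (ift h x) \<le> C"
      using ift_test_fun_rapid F(1-3) by metis
    have "(1 + norm x) ^ N * norm (F x) \<le> A * B * C" for x
    proof -
      have "(1 + norm x) ^ N \<le> ((1 + \<bar>x$1\<bar>) * (1 + \<bar>x$2\<bar>) * (1 + \<bar>x$3\<bar>)) ^ N"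
        by (intro power_mono norm_le_prod_3) auto
      then have "(1 + norm x) ^ N * norm (F x) \<le> ((1 + \<bar>x$1\<bar>) * (1 + \<bar>x$2\<bar>) * (1 + \<bar>x$3\<bar>)) ^ N * norm (F x)"
        by (intro mult_right_mono) auto
      also have "\<dots> = ((1 + \<bar>x$1\<bar>) ^ N * norm (ift f (x$1))) * ((1 + \<bar>x$2\<bar>) ^ N * norm (ift g (x$2))) * ((1 + \<bar>x$3\<bar>) ^ N * norm (ift h (x$3)))"
        by (simp add: F(4) tensor3_def norm_mult power_mult_distrib)
      also have "\<dots> \<le> A * B * C"
        by (intro mult_mono A B C mult_nonneg_nonneg) auto
      finally show ?thesis .
    qed
    then show ?thesis by blast
  qed
qed (use assms in blast)

section \<open>Closure properties of Schwartz functions\<close>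

lemma schwartz_differentiable: "schwartz F \<Longrightarrow> F differentiable (at x)"
  unfolding schwartz_def by (metis iter_partial.simps(1))

lemma schwartz_decay: "schwartz F \<Longrightarrow> \<exists>A. \<forall>x. (1 + norm x) ^ N * norm (F x) \<le> A"
  unfolding schwartz_def by (metis iter_partial.simps(1))

lemma iter_partial_append: "iter_partial (is @ js) F = iter_partial is (iter_partial js F)"
  by (induction "is") auto

lemma schwartz_iter_partial: "schwartz F \<Longrightarrow> schwartz (iter_partial is F)"
  unfolding schwartz_def iter_partial_append[symmetric] by blast

lemma schwartz_partial_deriv: "schwartz F \<Longrightarrow> schwartz (partial_deriv i F)"
  using schwartz_iter_partial[of F "[i]"] by simp

lemma schwartz_continuous: "schwartz F \<Longrightarrow> continuous_on UNIV F"
  by (meson schwartz_differentiable differentiable_imp_continuous_within continuous_at_imp_continuous_on)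

lemma schwartz_measurable: "schwartz F \<Longrightarrow> F \<in> borel_measurable borel"
  by (intro borel_measurable_continuous_onI schwartz_continuous)

lemma schwartz_bounded: "schwartz F \<Longrightarrow> \<exists>B. \<forall>x. norm (F x) \<le> B"
  using schwartz_decay[of F 0] by simp

lemma integrable_inverse_quadratic: "integrable lborel (\<lambda>x::real. inverse (1 + x\<^sup>2))"
  using integrable_inverse_1_plus_square by (simp add: set_integrable_def)

text \<open>Decay of order \<open>6\<close> dominates the function by the product of three integrable functions \<open>1 / (1 + x\<^sub>i\<^sup>2)\<close>.\<close>

lemma schwartz_integrable:
  assumes "schwartz F"
  shows "integrable lborel F"
proof -
  obtain A where A: "\<And>x. (1 + norm x) ^ 6 * norm (F x) \<le> A" using schwartz_decay[OF assms] by blast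
  have A0: "A \<ge> 0" using order_trans[OF _ A, of 0 0] by simp
  define w where "w x = (\<Prod>b\<in>Basis. complex_of_real (inverse (1 + (x \<bullet> b)\<^sup>2)))" for x :: "real^3"
  have w: "integrable lborel w"
    unfolding w_def by (intro integrable_lborel_prod integrable_of_real integrable_inverse_quadratic)
  have "norm (F x) \<le> A * norm (w x)" for x
  proof -
    have "(\<Prod>b\<in>Basis. 1 + (x \<bullet> b)\<^sup>2) \<le> (\<Prod>b\<in>(Basis::(real^3) set). (1 + norm x)\<^sup>2)"
    proof (rule prod_mono)
      fix b :: "real^3" assume "b \<in> Basis"
      then have "\<bar>x \<bullet> b\<bar> \<le> norm x" by (rule Basis_le_norm)
      then have "(x \<bullet> b)\<^sup>2 \<le> (norm x)\<^sup>2" by (simp add: abs_le_square_iff[symmetric])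
      moreover have "(1 + norm x)\<^sup>2 = 1 + 2 * norm x + (norm x)\<^sup>2" by (simp add: power2_sum)
      ultimately show "0 \<le> 1 + (x \<bullet> b)\<^sup>2 \<and> 1 + (x \<bullet> b)\<^sup>2 \<le> (1 + norm x)\<^sup>2"
        using norm_ge_zero[of x] zero_le_power2[of "x \<bullet> b"] by linarith
    qed
    also have "\<dots> = (1 + norm x) ^ 6" by (simp add: power_mult[symmetric])
    finally have le: "(\<Prod>b\<in>Basis. 1 + (x \<bullet> b)\<^sup>2) \<le> (1 + norm x) ^ 6" .
    have pos: "(\<Prod>b\<in>Basis. 1 + (x \<bullet> b)\<^sup>2) > 0" by (intro prod_pos) (auto intro: add_pos_nonneg)
    have nw: "norm (w x) = inverse (\<Prod>b\<in>Basis. 1 + (x \<bullet> b)\<^sup>2)"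
    proof -
      have "w x = of_real (\<Prod>b\<in>Basis. inverse (1 + (x \<bullet> b)\<^sup>2))"
        unfolding w_def of_real_prod ..
      also have "(\<Prod>b\<in>Basis. inverse (1 + (x \<bullet> b)\<^sup>2)) = inverse (\<Prod>b\<in>Basis. 1 + (x \<bullet> b)\<^sup>2)"
        using prod_inversef[of "\<lambda>b. 1 + (x \<bullet> b)\<^sup>2" Basis] by (simp add: comp_def)
      finally show ?thesis using pos by (simp only: norm_of_real) simp
    qed
    have "(\<Prod>b\<in>Basis. 1 + (x \<bullet> b)\<^sup>2) * norm (F x) \<le> (1 + norm x) ^ 6 * norm (F x)"
      by (intro mult_right_mono le) auto
    also have "\<dots> \<le> A" by (rule A)
    finally show ?thesis unfolding nw using pos by (simp add: field_simps)
  qed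
  then have "AE x in lborel. norm (F x) \<le> norm (A * norm (w x))"
    using A0 by (auto simp: abs_mult)
  moreover have "integrable lborel (\<lambda>x. A * norm (w x))" using w by (auto intro: integrable_norm)
  ultimately show ?thesis
    using schwartz_measurable[OF assms] by (intro Bochner_Integration.integrable_bound[of lborel "\<lambda>x. A * norm (w x)" F]) auto
qed

lemma vec3_expand: "(v::real^3) = (v$1) *\<^sub>R axis 1 1 + (v$2) *\<^sub>R axis 2 1 + (v$3) *\<^sub>R axis 3 1"
  by (simp add: vec_eq_iff forall_3 axis_def)

lemma has_derivative_partials:
  assumes "F differentiable (at x)"
  shows "(F has_derivative (\<lambda>v. \<Sum>j\<in>UNIV. of_real (v$j) * partial_deriv j F x)) (at x)"
proof -
  have d: "(F has_derivative frechet_derivative F (at x)) (at x)"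
    using assms by (simp add: frechet_derivative_works)
  interpret bounded_linear "frechet_derivative F (at x)" using d by (rule has_derivative_bounded_linear)
  have "frechet_derivative F (at x) v = (\<Sum>j\<in>UNIV. of_real (v$j) * partial_deriv j F x)" for v
    by (subst vec3_expand[of v]) (simp only: add scaleR, simp only: sum_3 partial_deriv_def scaleR_conv_of_real)
  then show ?thesis using d by (metis (no_types, lifting) ext)
qed

lemma partial_deriv_eqI:
  assumes "(F has_derivative F') (at x)"
  shows "partial_deriv i F x = F' (axis i 1)"
  unfolding partial_deriv_def frechet_derivative_at[OF assms, symmetric] ..

lemma partial_deriv_add:
  assumes "\<And>x. F differentiable (at x)" "\<And>x. G differentiable (at x)"
  shows "partial_deriv i (\<lambda>x. F x + G x) = (\<lambda>x. partial_deriv i F x + partial_deriv i G x)"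
proof
  fix x
  have "(F has_derivative frechet_derivative F (at x)) (at x)" "(G has_derivative frechet_derivative G (at x)) (at x)"
    using assms by (simp_all add: frechet_derivative_works)
  from partial_deriv_eqI[OF has_derivative_add[OF this]]
  show "partial_deriv i (\<lambda>x. F x + G x) x = partial_deriv i F x + partial_deriv i G x"
    by (simp add: partial_deriv_def)
qed

lemma partial_deriv_cmult:
  assumes "\<And>x. F differentiable (at x)"
  shows "partial_deriv i (\<lambda>x. c * F x) = (\<lambda>x. c * partial_deriv i F x)"
proof
  fix x
  have "(F has_derivative frechet_derivative F (at x)) (at x)"
    using assms by (simp_all add: frechet_derivative_works)
  from partial_deriv_eqI[OF has_derivative_mult_right[OF this, of c]]
  show "partial_deriv i (\<lambda>x. c * F x) x = c * partial_deriv i F x"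
    by (simp add: partial_deriv_def)
qed

text \<open>The closure of the modulated and transformed derivatives of \<open>F\<close> under linear combinations. It is stable under partial
  derivatives by the product and chain rules.\<close>

inductive affine_class :: "(real^3 \<Rightarrow> complex) \<Rightarrow> real^3 \<Rightarrow> (real^3 \<Rightarrow> real^3) \<Rightarrow> (real^3 \<Rightarrow> complex) \<Rightarrow> bool"
  for F a A where
  base: "affine_class F a A (\<lambda>x. ch (a \<bullet> x) * iter_partial is F (A x))"
| add: "affine_class F a A G \<Longrightarrow> affine_class F a A H \<Longrightarrow> affine_class F a A (\<lambda>x. G x + H x)"
| cmult: "affine_class F a A G \<Longrightarrow> affine_class F a A (\<lambda>x. c * G x)"

text \<open>The lower bound on \<open>A\<close> keeps the decay of \<open>F\<close> after the substitution.\<close>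

lemma schwartz_affine:
  assumes F: "schwartz F" and A: "linear A" and m: "\<And>x. norm x \<le> m * norm (A x)"
  shows "schwartz (\<lambda>x. c * (ch (a \<bullet> x) * F (A x)))"
proof (rule schwartz_coinduct[where C="affine_class F a A"])
  show "affine_class F a A (\<lambda>x. c * (ch (a \<bullet> x) * F (A x)))"
    using base[of F a A "[]"] by (simp add: cmult)
  have A': "bounded_linear A" using A by (simp add: linear_conv_bounded_linear)
  have base_deriv: "((\<lambda>x. ch (a \<bullet> x) * iter_partial is F (A x)) has_derivative
      (\<lambda>v. (2 * pi * \<i>) * of_real (a \<bullet> v) * (ch (a \<bullet> x) * iter_partial is F (A x))
         + (\<Sum>j\<in>UNIV. of_real (A v $ j) * (ch (a \<bullet> x) * iter_partial (j # is) F (A x))))) (at x)" for "is" x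
  proof -
    have 1: "((\<lambda>x. iter_partial is F (A x)) has_derivative (\<lambda>v. \<Sum>j\<in>UNIV. of_real (A v $ j) * partial_deriv j (iter_partial is F) (A x))) (at x)"
      using has_derivative_compose[OF bounded_linear_imp_has_derivative[OF A'] has_derivative_partials[OF schwartz_differentiable[OF schwartz_iter_partial[OF F]]]]
      by simp
    have "((\<lambda>t. ch (1 * t)) has_derivative (\<lambda>h. h *\<^sub>R (2 * pi * \<i> * ch (a \<bullet> x)))) (at (a \<bullet> x))"
      using ch_deriv[of 1 "a \<bullet> x" UNIV] by (simp add: has_vector_derivative_def)
    from has_derivative_compose[where f="\<lambda>x. a \<bullet> x" and f'="\<lambda>v. a \<bullet> v" and x=x and s=UNIV
        and g="\<lambda>t. ch (1 * t)", OF bounded_linear_imp_has_derivative[OF bounded_linear_inner_right] this]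
    have 2: "((\<lambda>x. ch (a \<bullet> x)) has_derivative (\<lambda>v. (a \<bullet> v) *\<^sub>R (2 * pi * \<i> * ch (a \<bullet> x)))) (at x)"
      by simp
    from has_derivative_mult[OF 2 1] show ?thesis
      by (rule has_derivative_eq_rhs) (simp add: fun_eq_iff sum_distrib_left scaleR_conv_of_real algebra_simps)
  qed
  have diff: "G differentiable (at x)" if "affine_class F a A G" for G x
    using that
  proof induction
    case (base "is")
    then show ?case using base_deriv differentiable_def by blast
  qed (auto intro: differentiable_add differentiable_mult)
  show "G differentiable (at x)" if "affine_class F a A G" for G x by (rule diff[OF that])
  show "affine_class F a A (partial_deriv i G)" if "affine_class F a A G" for G i
    using that
  proof induction
    case (base "is")
    have eq: "partial_deriv i (\<lambda>x. ch (a \<bullet> x) * iter_partial is F (A x)) = 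
      (\<lambda>x. ((2 * pi * \<i>) * of_real (a \<bullet> axis i 1)) * (ch (a \<bullet> x) * iter_partial is F (A x))
         + ((of_real (A (axis i 1) $ 1) * (ch (a \<bullet> x) * iter_partial (1 # is) F (A x)) +
           of_real (A (axis i 1) $ 2) * (ch (a \<bullet> x) * iter_partial (2 # is) F (A x))) +
           of_real (A (axis i 1) $ 3) * (ch (a \<bullet> x) * iter_partial (3 # is) F (A x))))"
      by (rule ext, subst partial_deriv_eqI[OF base_deriv]) (simp only: sum_3)
    show ?case unfolding eq by (intro affine_class.intros)
  next
    case (add G H)
    then show ?case by (simp add: partial_deriv_add diff affine_class.add)
  next
    case (cmult G c)
    then show ?case by (simp add: partial_deriv_cmult diff affine_class.cmult)
  qed
  show "\<exists>B. \<forall>x. (1 + norm x) ^ N * norm (G x) \<le> B" if "affine_class F a A G" for G N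
    using that
  proof induction
    case (base "is")
    obtain B where B: "\<And>x. (1 + norm x) ^ N * norm (iter_partial is F x) \<le> B"
      using schwartz_decay[OF schwartz_iter_partial[OF F]] by blast
    have "(1 + norm x) ^ N * norm (ch (a \<bullet> x) * iter_partial is F (A x)) \<le> (max 1 m) ^ N * B" for x
    proof -
      have "m * norm (A x) \<le> max 1 m * norm (A x)" by (intro mult_right_mono) auto
      then have "1 + norm x \<le> max 1 m * (1 + norm (A x))" using m[of x] by (simp add: distrib_left)
      then have "(1 + norm x) ^ N \<le> (max 1 m * (1 + norm (A x))) ^ N" by (intro power_mono) auto
      then have "(1 + norm x) ^ N * norm (iter_partial is F (A x)) \<le> (max 1 m * (1 + norm (A x))) ^ N * norm (iter_partial is F (A x))"
        by (intro mult_right_mono) auto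
      also have "\<dots> = (max 1 m) ^ N * ((1 + norm (A x)) ^ N * norm (iter_partial is F (A x)))"
        by (simp add: power_mult_distrib)
      also have "\<dots> \<le> (max 1 m) ^ N * B" by (intro mult_left_mono B) auto
      finally show ?thesis by (simp add: norm_mult)
    qed
    then show ?case by blast
  next
    case (add G H)
    then obtain B C where B: "\<And>x. (1 + norm x) ^ N * norm (G x) \<le> B" and C: "\<And>x. (1 + norm x) ^ N * norm (H x) \<le> C" by blast
    have "(1 + norm x) ^ N * norm (G x + H x) \<le> B + C" for x
    proof -
      have "(1 + norm x) ^ N * norm (G x + H x) \<le> (1 + norm x) ^ N * (norm (G x) + norm (H x))"
        by (intro mult_left_mono norm_triangle_ineq) auto
      then show ?thesis using B[of x] C[of x] by (simp add: distrib_left)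
    qed
    then show ?case by blast
  next
    case (cmult G c)
    then obtain B where B: "\<And>x. (1 + norm x) ^ N * norm (G x) \<le> B" by blast
    have "(1 + norm x) ^ N * norm (c * G x) \<le> norm c * B" for x
      using mult_left_mono[OF B[of x], of "norm c"] by (simp add: norm_mult mult_ac)
    then show ?case by blast
  qed
qed

lemma schwartz_add:
  assumes "schwartz F" "schwartz G"
  shows "schwartz (\<lambda>x. F x + G x)"
proof (rule schwartz_coinduct[where C="\<lambda>H. \<exists>F G. schwartz F \<and> schwartz G \<and> H = (\<lambda>x. F x + G x)"])
  fix H assume "\<exists>F G. schwartz F \<and> schwartz G \<and> H = (\<lambda>x. F x + G x)"
  then obtain F G where H: "schwartz F" "schwartz G" "H = (\<lambda>x. F x + G x)" by blast
  show "H differentiable (at x)" for x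
    unfolding H(3) by (intro differentiable_add schwartz_differentiable H)
  show "\<exists>F G. schwartz F \<and> schwartz G \<and> partial_deriv i H = (\<lambda>x. F x + G x)" for i
    unfolding H(3) using H(1,2) by (auto simp: partial_deriv_add schwartz_differentiable intro: schwartz_partial_deriv)
  show "\<exists>A. \<forall>x. (1 + norm x) ^ N * norm (H x) \<le> A" for N
  proof -
    obtain B C where B: "\<And>x. (1 + norm x) ^ N * norm (F x) \<le> B" and C: "\<And>x. (1 + norm x) ^ N * norm (G x) \<le> C"
      using schwartz_decay H(1,2) by metis
    have "(1 + norm x) ^ N * norm (F x + G x) \<le> B + C" for x
    proof -
      have "(1 + norm x) ^ N * norm (F x + G x) \<le> (1 + norm x) ^ N * (norm (F x) + norm (G x))"
        by (intro mult_left_mono norm_triangle_ineq) auto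
      then show ?thesis using B[of x] C[of x] by (simp add: distrib_left)
    qed
    then show ?thesis unfolding H(3) by blast
  qed
qed (use assms in blast)

lemma schwartz_zero: "schwartz (\<lambda>x. 0)"
proof (rule schwartz_coinduct[where C="\<lambda>H. H = (\<lambda>x. 0)"])
  show "partial_deriv i H = (\<lambda>x. 0)" if "H = (\<lambda>x. 0)" for i H
    unfolding that by (rule ext) (simp add: partial_deriv_def)
qed auto

lemma schwartz_sum: "finite I \<Longrightarrow> (\<And>i. i \<in> I \<Longrightarrow> schwartz (F i)) \<Longrightarrow> schwartz (\<lambda>x. \<Sum>i\<in>I. F i x)"
  by (induction I rule: finite_induct) (auto intro: schwartz_zero schwartz_add)

lemma schwartz_lipschitz:
  assumes "schwartz F"
  shows "\<exists>L\<ge>0. \<forall>x y. norm (F x - F y) \<le> L * norm (x - y)"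
proof -
  have "\<exists>B. \<forall>j x. norm (partial_deriv j F x) \<le> B j" by (intro choice allI schwartz_bounded[OF schwartz_partial_deriv[OF assms]]) 
  then obtain B where B: "\<And>j x. norm (partial_deriv j F x) \<le> B j" by blast
  have B0: "B j \<ge> 0" for j using order_trans[OF norm_ge_zero B] .
  show ?thesis
  proof (intro exI[of _ "\<Sum>j\<in>UNIV. B j"] conjI allI)
    show "norm (F x - F y) \<le> (\<Sum>j\<in>UNIV. B j) * norm (x - y)" for x y
    proof (rule differentiable_bound[OF convex_UNIV])
      show "(F has_derivative (\<lambda>v. \<Sum>j\<in>UNIV. of_real (v$j) * partial_deriv j F x)) (at x within UNIV)" for x
        using has_derivative_partials[OF schwartz_differentiable[OF assms]] by simp
      show "onorm (\<lambda>v. \<Sum>j\<in>UNIV. of_real (v$j) * partial_deriv j F x) \<le> (\<Sum>j\<in>UNIV. B j)" for x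
      proof (rule onorm_le)
        fix v :: "real^3"
        have "norm (\<Sum>j\<in>UNIV. of_real (v$j) * partial_deriv j F x) \<le> (\<Sum>j\<in>UNIV. B j * norm v)"
          by (rule sum_norm_le) (auto simp: norm_mult mult.commute[of "B _"] intro!: mult_mono B component_le_norm_cart)
        then show "norm (\<Sum>j\<in>UNIV. of_real (v$j) * partial_deriv j F x) \<le> (\<Sum>j\<in>UNIV. B j) * norm v"
          by (simp add: sum_distrib_right)
      qed
    qed auto
  qed (auto intro: sum_nonneg B0)
qed

text \<open>A remainder that is quadratic with a constant uniform in \<open>x\<close> allows differentiation under a convolution integral with a merely integrable function.\<close>

lemma schwartz_taylor:
  assumes "schwartz F"
  shows "\<exists>L\<ge>0. \<forall>x h. norm (F (x + h) - F x - (\<Sum>j\<in>UNIV. of_real (h$j) * partial_deriv j F x)) \<le> L * (norm h)\<^sup>2"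
proof -
  have "\<exists>L. \<forall>j. L j \<ge> 0 \<and> (\<forall>x y. norm (partial_deriv j F x - partial_deriv j F y) \<le> L j * norm (x - y))"
    using schwartz_lipschitz[OF schwartz_partial_deriv[OF assms]] by (intro choice) blast
  then obtain L where L: "\<And>j. L j \<ge> 0" "\<And>j x y. norm (partial_deriv j F x - partial_deriv j F y) \<le> L j * norm (x - y)" by blast
  show ?thesis
  proof (intro exI[of _ "\<Sum>j\<in>UNIV. L j"] conjI allI)
    fix x h
    let ?D = "\<lambda>y v. (\<Sum>j\<in>UNIV. of_real (v$j) * partial_deriv j F y) :: complex"
    let ?f = "\<lambda>w. F (x + w) - ?D x w"
    have lin: "bounded_linear (?D x)"
      by (rule has_derivative_bounded_linear[OF has_derivative_partials[OF schwartz_differentiable[OF assms]]])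
    have "norm (?f h - ?f 0) \<le> ((\<Sum>j\<in>UNIV. L j) * norm h) * norm (h - 0)"
    proof (rule differentiable_bound[where S="cball (0::real^3) (norm h)"])
      show "convex (cball (0::real^3) (norm h))" by simp
      show "(?f has_derivative (\<lambda>v. ?D (x + w) v - ?D x v)) (at w within cball (0::real^3) (norm h))" for w
      proof -
        have "((\<lambda>w. F (x + w)) has_derivative ?D (x + w)) (at w within cball (0::real^3) (norm h))"
        proof -
          have "((\<lambda>w. x + w) has_derivative (\<lambda>v. v)) (at w within cball (0::real^3) (norm h))"
            by (auto intro!: derivative_eq_intros)
          from has_derivative_compose[OF this has_derivative_partials[OF schwartz_differentiable[OF assms]]]
          show ?thesis .
        qed
        then show ?thesis
          by (rule has_derivative_diff[OF _ bounded_linear_imp_has_derivative[OF lin]])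
      qed
      show "onorm (\<lambda>v. ?D (x + w) v - ?D x v) \<le> (\<Sum>j\<in>UNIV. L j) * norm h" if w: "w \<in> cball (0::real^3) (norm h)" for w
      proof (rule onorm_le)
        fix v :: "real^3"
        have "?D (x + w) v - ?D x v = (\<Sum>j\<in>UNIV. of_real (v$j) * (partial_deriv j F (x + w) - partial_deriv j F x))"
          by (simp add: sum_subtractf right_diff_distrib)
        also have "norm \<dots> \<le> (\<Sum>j\<in>UNIV. norm v * (L j * norm h))"
        proof (rule sum_norm_le)
          fix j
          have "norm (partial_deriv j F (x + w) - partial_deriv j F x) \<le> L j * norm w"
            using L(2)[of j "x + w" x] by simp
          also have "\<dots> \<le> L j * norm h" using w L(1) by (intro mult_left_mono) auto
          finally show "norm (of_real (v$j) * (partial_deriv j F (x + w) - partial_deriv j F x)) \<le> norm v * (L j * norm h)"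
            by (auto simp: norm_mult intro!: mult_mono component_le_norm_cart)
        qed
        also have "\<dots> = (\<Sum>j\<in>UNIV. L j) * norm h * norm v" by (simp add: sum_distrib_left sum_distrib_right mult_ac)
        finally show "norm (?D (x + w) v - ?D x v) \<le> (\<Sum>j\<in>UNIV. L j) * norm h * norm v" .
      qed
    qed auto
    then show "norm (F (x + h) - F x - ?D x h) \<le> (\<Sum>j\<in>UNIV. L j) * (norm h)\<^sup>2"
      by (simp add: power2_eq_square mult.assoc algebra_simps)
  qed (auto intro: sum_nonneg L)
qed

text \<open>The derivatives fall on \<open>u\<close> by the uniform Taylor bound, and decay survives because \<open>f\<close> lives in a bounded set.\<close>

lemma schwartz_conv:
  assumes u: "schwartz u" and f: "integrable lborel f" and M: "\<And>y. f y \<noteq> 0 \<Longrightarrow> norm y \<le> M"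
  shows "schwartz (conv f u)"
proof (rule schwartz_coinduct[where C="\<lambda>G. \<exists>u. schwartz u \<and> G = conv f u"])
  have [measurable]: "f \<in> borel_measurable borel" using f by auto
  have int: "integrable lborel (\<lambda>y. f y * u (x - y))" if su: "schwartz u" for u x
  proof -
    have [measurable]: "u \<in> borel_measurable borel" by (rule schwartz_measurable[OF su])
    obtain B where "\<And>x. norm (u x) \<le> B" using schwartz_bounded[OF su] by blast
    then show ?thesis by (intro integrable_mult_bounded[OF f]) auto
  qed
  fix G assume "\<exists>u. schwartz u \<and> G = conv f u"
  then obtain u where u: "schwartz u" "G = conv f u" by blast
  have [measurable]: "u \<in> borel_measurable borel" by (rule schwartz_measurable[OF u(1)])
  have der: "(G has_derivative (\<lambda>v. \<Sum>j\<in>UNIV. of_real (v$j) * conv f (partial_deriv j u) x)) (at x)" for x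
  proof -
    obtain L where L: "L \<ge> 0" "\<And>x h. norm (u (x + h) - u x - (\<Sum>j\<in>UNIV. of_real (h$j) * partial_deriv j u x)) \<le> L * (norm h)\<^sup>2"
      using schwartz_taylor[OF u(1)] by blast
    define K where "K = (LINT y|lborel. norm (f y)) * L"
    let ?D = "\<lambda>h. (\<Sum>j\<in>UNIV. of_real (h$j) * conv f (partial_deriv j u) x) :: complex"
    have bd: "norm (G (x + h) - G x - ?D h) \<le> K * (norm h)\<^sup>2" for h
    proof -
      let ?r = "\<lambda>y. f y * (u (x - y + h) - u (x - y) - (\<Sum>j\<in>UNIV. of_real (h$j) * partial_deriv j u (x - y)))"
      have i1: "integrable lborel (\<lambda>y. f y * u (x - y + h))" using int[OF u(1), of "x + h"] by (simp add: algebra_simps)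
      have i2: "integrable lborel (\<lambda>y. f y * u (x - y))" by (rule int[OF u(1)])
      have i3: "integrable lborel (\<lambda>y. of_real (h$j) * (f y * partial_deriv j u (x - y)))" for j
        using int[OF schwartz_partial_deriv[OF u(1)]] by auto
      have r: "?r y = f y * u (x - y + h) - f y * u (x - y) - (\<Sum>j\<in>UNIV. of_real (h$j) * (f y * partial_deriv j u (x - y)))" for y
        by (simp add: right_diff_distrib sum_distrib_left mult_ac)
      have i: "integrable lborel ?r"
        unfolding r using i1 i2 i3 by auto
      have "(LINT y|lborel. ?r y) = (LINT y|lborel. f y * u (x - y + h)) - (LINT y|lborel. f y * u (x - y))
           - (\<Sum>j\<in>UNIV. of_real (h$j) * (LINT y|lborel. f y * partial_deriv j u (x - y)))"
        unfolding r using i1 i2 i3 by simp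
      also have "\<dots> = G (x + h) - G x - ?D h"
        unfolding u(2) conv_def by (simp add: algebra_simps)
      finally have eq: "G (x + h) - G x - ?D h = (LINT y|lborel. ?r y)" ..
      have "norm (LINT y|lborel. ?r y) \<le> (LINT y|lborel. norm (f y) * (L * (norm h)\<^sup>2))"
      proof (rule Bochner_Integration.integral_norm_bound_integral[OF i])
        show "integrable lborel (\<lambda>y. norm (f y) * (L * (norm h)\<^sup>2))" using f by (auto intro: integrable_norm)
        show "norm (?r y) \<le> norm (f y) * (L * (norm h)\<^sup>2)" for y
          unfolding norm_mult by (intro mult_left_mono L) auto
      qed
      then show ?thesis unfolding eq K_def by (simp add: mult_ac)
    qed
    have K0: "K \<ge> 0" using L by (auto simp: K_def)
    have lin: "bounded_linear ?D"
      by (intro bounded_linear_sum bounded_linear_mult_const bounded_linear_compose[OF bounded_linear_of_real bounded_linear_vec_nth])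
    have "((\<lambda>h. norm (G (x + h) - G x - ?D h) / norm h) \<longlongrightarrow> 0) (at 0)"
    proof (rule Lim_null_comparison)
      show "\<forall>\<^sub>F h in at 0. norm (norm (G (x + h) - G x - ?D h) / norm h) \<le> K * norm h"
      proof (rule eventually_at_topological[THEN iffD2], intro exI[of _ UNIV] conjI ballI impI)
        fix h :: "real^3" assume "h \<noteq> 0"
        then show "norm (norm (G (x + h) - G x - ?D h) / norm h) \<le> K * norm h"
          using bd[of h] by (simp add: field_simps power2_eq_square)
      qed auto
      have "((\<lambda>h::real^3. K * norm h) \<longlongrightarrow> K * norm (0::real^3)) (at 0)" by (intro tendsto_intros)
      then show "((\<lambda>h::real^3. K * norm h) \<longlongrightarrow> 0) (at 0)" by simp
    qed
    then show ?thesis unfolding has_derivative_at using lin by blast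
  qed
  show "G differentiable (at x)" for x using der differentiable_def by blast
  show "\<exists>u. schwartz u \<and> partial_deriv i G = conv f u" for i
  proof (intro exI[of _ "partial_deriv i u"] conjI)
    show "partial_deriv i G = conv f (partial_deriv i u)"
    proof
      fix x
      have "partial_deriv i G x = (\<Sum>j\<in>UNIV. of_real (axis i 1 $ j) * conv f (partial_deriv j u) x)"
        by (rule partial_deriv_eqI[OF der])
      also have "\<dots> = (\<Sum>j\<in>UNIV. if j = i then conv f (partial_deriv j u) x else 0)"
        by (rule sum.cong) (auto simp: axis_def)
      finally show "partial_deriv i G x = conv f (partial_deriv i u) x" by simp
    qed
  qed (rule schwartz_partial_deriv[OF u(1)])
  show "\<exists>A. \<forall>x. (1 + norm x) ^ N * norm (G x) \<le> A" for N
  proof -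
    obtain A where A: "\<And>x. (1 + norm x) ^ N * norm (u x) \<le> A" using schwartz_decay[OF u(1)] by blast
    define M' where "M' = max 0 M"
    have "(1 + norm x) ^ N * norm (G x) \<le> (LINT y|lborel. norm (f y)) * ((1 + M') ^ N * A)" for x
    proof -
      have "norm ((1 + norm x) ^ N * G x) = norm (LINT y|lborel. f y * ((1 + norm x) ^ N * u (x - y)))"
        unfolding u(2) conv_def by (subst integral_mult_right_zero[symmetric]) (simp add: mult_ac)
      also have "\<dots> \<le> (LINT y|lborel. norm (f y) * ((1 + M') ^ N * A))"
      proof (rule Bochner_Integration.integral_norm_bound_integral)
        show "integrable lborel (\<lambda>y. f y * ((1 + norm x) ^ N * u (x - y)))"
          using integrable_mult_right[OF int[OF u(1)], of "of_real ((1 + norm x) ^ N)" x] by (simp add: mult_ac)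
        show "integrable lborel (\<lambda>y. norm (f y) * ((1 + M') ^ N * A))" using f by (auto intro: integrable_norm)
        show "norm (f y * ((1 + norm x) ^ N * u (x - y))) \<le> norm (f y) * ((1 + M') ^ N * A)" for y
        proof (cases "f y = 0")
          case False
          then have y: "norm y \<le> M'" using M by (fastforce simp: M'_def)
          have "1 + norm x \<le> 1 + (norm y + norm (x - y))" using norm_triangle_sub[of x y] by simp
          also have "\<dots> \<le> (1 + M') * (1 + norm (x - y))"
          proof -
            have "0 \<le> M' * norm (x - y)" by (simp add: M'_def)
            moreover have "(1 + M') * (1 + norm (x - y)) = 1 + M' + norm (x - y) + M' * norm (x - y)"
              by (simp add: distrib_left distrib_right)
            ultimately show ?thesis using y by linarith
          qed
          finally have "(1 + norm x) ^ N \<le> ((1 + M') * (1 + norm (x - y))) ^ N" by (intro power_mono) auto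
          then have "(1 + norm x) ^ N * norm (u (x - y)) \<le> ((1 + M') * (1 + norm (x - y))) ^ N * norm (u (x - y))"
            by (intro mult_right_mono) auto
          also have "\<dots> = (1 + M') ^ N * ((1 + norm (x - y)) ^ N * norm (u (x - y)))" by (simp add: power_mult_distrib)
          also have "\<dots> \<le> (1 + M') ^ N * A" by (intro mult_left_mono A) (auto simp: M'_def)
          finally have "(1 + norm x) ^ N * norm (u (x - y)) \<le> (1 + M') ^ N * A" .
          moreover have "norm (f y * ((1 + norm x) ^ N * u (x - y))) = norm (f y) * ((1 + norm x) ^ N * norm (u (x - y)))"
            using norm_of_real[of "(1 + norm x) ^ N", where 'a=complex] by (simp add: norm_mult norm_power del: of_real_add)
          ultimately show ?thesis by (simp add: mult_left_mono)
        qed simp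
      qed
      finally show ?thesis
        using norm_of_real[of "(1 + norm x) ^ N", where 'a=complex] by (simp add: norm_mult norm_power del: of_real_add)
    qed
    then show ?thesis by blast
  qed
qed (use u in blast)

section \<open>Linear changes of variables and the model kernel\<close>

context
  fixes A :: "real^3 \<Rightarrow> real^3" and J :: real
  assumes A: "linear A" "inj A" and J: "J = \<bar>det (matrix A)\<bar>"
begin

lemma linear_jacobian_pos: "J > 0"
  using det_nz_iff_inj[OF A(1)] A(2) J by auto

lemma linear_measurable [measurable]: "A \<in> borel_measurable borel"
  using A(1) by (intro borel_measurable_continuous_onI linear_continuous_on) (simp add: linear_conv_bounded_linear)

lemma lborel_linear: "lborel = density (distr lborel borel A) (\<lambda>_. ennreal J)"
proof (rule lborel_eqI)
  fix l u :: "real^3" assume le: "\<And>b. b \<in> Basis \<Longrightarrow> l \<bullet> b \<le> u \<bullet> b"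
  obtain B where B: "linear B" "B \<circ> A = id"
    using linear_injective_left_inverse[OF A] by blast
  have AB: "A \<circ> B = id" using linear_inverse_left[OF B(1) A(1)] B(2) by simp
  have pre: "A -` box l u = B ` box l u"
  proof -
    have i: "B (A x) = x" "A (B x) = x" for x
      using B(2) AB by (metis comp_apply id_apply)+
    show ?thesis
    proof (intro set_eqI iffI)
      fix x assume "x \<in> A -` box l u"
      then have "B (A x) \<in> B ` box l u" by blast
      then show "x \<in> B ` box l u" by (simp only: i)
    qed (auto simp: i)
  qed
  have "matrix (B \<circ> A) = matrix B ** matrix A" by (rule matrix_compose[OF A(1) B(1)])
  then have "det (matrix B) * det (matrix A) = 1"
    using B(2) by (metis det_I det_mul matrix_id_mat_1)
  then have detB: "J * \<bar>det (matrix B)\<bar> = 1"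
    unfolding J by (simp add: abs_mult[symmetric] mult.commute)
  have lm: "B ` box l u \<in> lmeasurable" by (rule measurable_linear_image[OF B(1)]) auto
  have meas: "A -` box l u \<in> sets borel" using measurable_sets[OF linear_measurable, of "box l u"] by simp
  have "emeasure lborel (A -` box l u) = emeasure lebesgue (A -` box l u)" using meas by simp
  also have "\<dots> = ennreal (measure lebesgue (B ` box l u))"
    unfolding pre by (rule emeasure_eq_measure2[OF lm])
  also have "\<dots> = ennreal (\<bar>det (matrix B)\<bar> * measure lebesgue (box l u))"
    by (subst measure_linear_image[OF B(1)]) auto
  finally have em: "emeasure lborel (A -` box l u) = ennreal (\<bar>det (matrix B)\<bar> * measure lebesgue (box l u))" .
  have "emeasure (density (distr lborel borel A) (\<lambda>_. ennreal J)) (box l u) = ennreal J * emeasure lborel (A -` box l u)"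
    by (simp add: emeasure_density nn_integral_cmult emeasure_distr)
  also have "\<dots> = ennreal (J * \<bar>det (matrix B)\<bar> * measure lebesgue (box l u))"
    unfolding em using linear_jacobian_pos by (simp add: ennreal_mult'[symmetric] mult.assoc)
  also have "\<dots> = (\<Prod>b\<in>Basis. (u - l) \<bullet> b)"
    unfolding detB using le by (simp add: measure_lborel_box_eq)
  finally show "emeasure (density (distr lborel borel A) (\<lambda>_. ennreal J)) (box l u) = (\<Prod>b\<in>Basis. (u - l) \<bullet> b)" .
qed simp

lemma lborel_integral_linear:
  fixes f :: "real^3 \<Rightarrow> 'b::{banach, second_countable_topology}"
  assumes [measurable]: "f \<in> borel_measurable borel"
  shows "(LINT x|lborel. f x) = J *\<^sub>R (LINT x|lborel. f (A x))"
  by (subst lborel_linear) (use linear_jacobian_pos in \<open>simp add: integral_density integral_distr\<close>)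

lemma nn_integral_linear:
  assumes [measurable]: "f \<in> borel_measurable borel"
  shows "(\<integral>\<^sup>+x. f x \<partial>lborel) = ennreal J * (\<integral>\<^sup>+x. f (A x) \<partial>lborel)"
  by (subst lborel_linear) (simp add: nn_integral_density nn_integral_distr nn_integral_cmult)

text \<open>Modulation translates the frequency variable, and a linear substitution \<open>A\<close> acts on it by the inverse transpose; the map \<open>B\<close> is
  given by this duality. The factor \<open>J\<close> compensates the Jacobian.\<close>

lemma ft_affine:
  assumes B: "\<And>\<xi> x. \<xi> \<bullet> x = B \<xi> \<bullet> A x" and u: "u \<in> borel_measurable borel"
  shows "ft (\<lambda>x. of_real J * (ch (c \<bullet> x) * u (A x))) \<xi> = ft u (B (\<xi> - c))"
proof -
  have [measurable]: "u \<in> borel_measurable borel" by fact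
  have "ft u (B (\<xi> - c)) = J *\<^sub>R (LINT x|lborel. u (A x) * ch (- (B (\<xi> - c) \<bullet> A x)))"
    unfolding ft_def by (rule lborel_integral_linear) measurable
  also have "\<dots> = (LINT x|lborel. of_real J * (ch (c \<bullet> x) * u (A x)) * ch (- (\<xi> \<bullet> x)))"
  proof -
    have "J *\<^sub>R (u (A x) * ch (- (B (\<xi> - c) \<bullet> A x))) = of_real J * (ch (c \<bullet> x) * u (A x)) * ch (- (\<xi> \<bullet> x))" for x
    proof -
      have "- (B (\<xi> - c) \<bullet> A x) = c \<bullet> x + - (\<xi> \<bullet> x)"
        unfolding B[symmetric] by (simp add: inner_diff_left)
      then show ?thesis by (simp only: ch_add scaleR_conv_of_real mult_ac)
    qed
    then show ?thesis unfolding integral_scaleR_right[symmetric] by (simp only:)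
  qed
  finally show ?thesis by (simp add: ft_def)
qed

end

lemma integrable_bounded_support:
  fixes h :: "real^3 \<Rightarrow> complex"
  assumes "h \<in> borel_measurable borel" "\<And>\<xi>. norm (h \<xi>) \<le> B" "\<And>\<xi>. h \<xi> \<noteq> 0 \<Longrightarrow> dist \<xi> c \<le> r"
  shows "integrable lborel h"
proof -
  have "integrable lborel (\<lambda>\<xi>. indicator (cball c r) \<xi> * B :: real)"
    by (intro integrable_mult_left integrable_real_indicator) (auto intro: emeasure_bounded_finite[unfolded infinity_ennreal_def])
  moreover have "norm (h \<xi>) \<le> norm (indicator (cball c r) \<xi> * B)" for \<xi>
    using assms(2,3)[of \<xi>] by (cases "h \<xi> = 0") (auto simp: indicator_def dist_commute)
  ultimately show ?thesis
    using assms(1) by (intro Bochner_Integration.integrable_bound[of lborel "\<lambda>\<xi>. indicator (cball c r) \<xi> * B :: real" h]) auto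
qed

lemma integrable_ift_test_fun:
  assumes "test_fun g"
  shows "integrable lborel (ift g)"
proof -
  obtain C where C: "C \<ge> 0" "\<And>x. (1 + \<bar>x\<bar>) ^ 2 * norm (ift g x) \<le> C"
    using ift_test_fun_rapid[OF assms] by blast
  have [measurable]: "ift g \<in> borel_measurable borel"
    using integrable_test_fun[OF assms] by (intro borel_measurable_ift) auto
  have "norm (ift g x) \<le> norm (C * inverse (1 + x\<^sup>2))" for x
  proof -
    have "1 + x\<^sup>2 \<le> (1 + \<bar>x\<bar>) ^ 2" by (simp add: power2_sum)
    then have "(1 + x\<^sup>2) * norm (ift g x) \<le> (1 + \<bar>x\<bar>) ^ 2 * norm (ift g x)" by (intro mult_right_mono) auto
    then have "(1 + x\<^sup>2) * norm (ift g x) \<le> C" using C(2)[of x] by linarith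
    moreover have "1 + x\<^sup>2 > 0" by (rule add_pos_nonneg) auto
    ultimately show ?thesis using C(1) by (simp add: abs_mult field_simps)
  qed
  then show ?thesis
    by (intro Bochner_Integration.integrable_bound[of lborel "\<lambda>x. C * inverse (1 + x\<^sup>2)" "ift g"] integrable_mult_right integrable_inverse_quadratic) auto
qed

text \<open>Inversion in this order follows by reflection from \<open>fourier_inversion\<close> for \<open>g\<close> itself, since \<open>ft g\<close> is the reflected \<open>ift g\<close>
  and hence integrable.\<close>

lemma ft_ift_test_fun:
  assumes "test_fun g"
  shows "ft (ift g) \<xi> = g \<xi>"
proof -
  have g: "integrable lborel g" "continuous_on UNIV g" using assms by (auto intro: integrable_test_fun continuous_test_fun)
  have ft: "ft g = (\<lambda>x. ift g (0 - x))" by (simp add: fun_eq_iff ft_eq_ift)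
  have [measurable]: "ift g \<in> borel_measurable borel" using g by (intro borel_measurable_ift) auto
  have i: "integrable lborel (ft g)"
    unfolding ft by (intro lborel_integrable_reflect integrable_ift_test_fun assms) simp
  obtain B where B: "\<And>x. norm (g x) \<le> B"
  proof -
    have "compact (g ` {-2..2})" using assms by (intro compact_continuous_image continuous_test_fun) auto
    then have "bounded (g ` {-2..2})" by (rule compact_imp_bounded)
    then obtain B where "\<forall>x\<in>{-2..2}. norm (g x) \<le> B" unfolding bounded_iff by auto
    moreover have "g x = 0" if "x \<notin> {-2..2}" for x using that by (intro test_fun_support[OF assms]) auto
    ultimately have "norm (g x) \<le> max 0 B" for x by (cases "x \<in> {-2..2}") fastforce+
    then show thesis using that by blast
  qed
  have "ft (ift g) \<xi> = (LINT x|lborel. ift g (0 - x) * ch (- (\<xi> \<bullet> (0 - x))))"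
    unfolding ft_def by (rule lborel_integral_reflect[symmetric]) measurable
  also have "\<dots> = ift (ft g) \<xi>" by (simp add: ft ift_def inner_commute mult.commute)
  also have "\<dots> = g \<xi>" by (rule fourier_inversion[OF g B i])
  finally show ?thesis .
qed

lemma Basis_real3: "(Basis :: (real^3) set) = range (\<lambda>i. axis i 1)"
  by (auto simp: Basis_vec_def)

lemma prod_Basis_real3:
  fixes f :: "real^3 \<Rightarrow> complex"
  shows "(\<Prod>b\<in>Basis. f b) = f (axis 1 1) * f (axis 2 1) * f (axis 3 1)"
proof -
  have "inj (\<lambda>i::3. axis i (1::real))" by (auto simp: inj_on_def axis_eq_axis)
  from prod.reindex[OF this, of f]
  have "(\<Prod>b\<in>Basis. f b) = (\<Prod>i\<in>(UNIV::3 set). f (axis i 1))"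
    by (simp only: Basis_real3 comp_def)
  also have "\<dots> = f (axis 1 1) * f (axis 2 1) * f (axis 3 1)"
    unfolding UNIV_3 by (simp add: mult.assoc)
  finally show ?thesis .
qed

lemma ft_tensor3:
  assumes "integrable lborel f" "integrable lborel g" "integrable lborel h"
  shows "ft (tensor3 f g h) \<xi> = ft f (\<xi>$1) * ft g (\<xi>$2) * ft h (\<xi>$3)"
proof -
  define q where "q b = (if b = axis (1::3) (1::real) then f else if b = axis 2 1 then g else h)" for b
  have q: "q (axis 1 1) = f" "q (axis 2 1) = g" "q (axis 3 1) = h"
    by (auto simp: q_def axis_eq_axis)
  have i: "integrable lborel (\<lambda>t. q b t * ch (- ((\<xi> \<bullet> b) * t)))" for b
    using assms by (intro integrable_mult_bounded[of _ _ _ 1]) (auto simp: q_def)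
  have "ft (tensor3 f g h) \<xi> = (LINT x|lborel. (\<Prod>b\<in>Basis. q b (x \<bullet> b) * ch (- ((\<xi> \<bullet> b) * (x \<bullet> b)))))"
  proof -
    have "ch (- (\<xi> \<bullet> x)) = (\<Prod>b\<in>Basis. ch (- ((\<xi> \<bullet> b) * (x \<bullet> b))))" for x
      using ch_inner_prod[of "- \<xi>" x] by simp
    moreover have "tensor3 f g h x = (\<Prod>b\<in>Basis. q b (x \<bullet> b))" for x
      unfolding prod_Basis_real3 q by (simp add: tensor3_def inner_axis)
    ultimately show ?thesis unfolding ft_def by (simp only: prod.distrib)
  qed
  also have "\<dots> = (\<Prod>b\<in>Basis. LINT t|lborel. q b t * ch (- ((\<xi> \<bullet> b) * t)))"
    by (rule integral_lborel_prod) (rule i)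
  also have "\<dots> = ft f (\<xi>$1) * ft g (\<xi>$2) * ft h (\<xi>$3)"
    unfolding prod_Basis_real3 q by (simp add: ft_def inner_axis)
  finally show ?thesis .
qed

text \<open>The tensor product of three inverse transforms of the plateau function.\<close>

theorem mother_kernel_exists:
  obtains w :: "real^3 \<Rightarrow> complex" where "schwartz w"
    "\<And>\<xi>. (\<And>i. \<bar>\<xi>$i\<bar> \<le> 1) \<Longrightarrow> ft w \<xi> = 1"
    "\<And>\<xi> i. \<bar>\<xi>$i\<bar> \<ge> 2 \<Longrightarrow> ft w \<xi> = 0"
proof -
  have "\<exists>\<phi> :: real \<Rightarrow> real. test_fun (\<lambda>x. of_real (\<phi> x)) \<and> (\<forall>x. \<bar>x\<bar> \<le> 1 \<longrightarrow> \<phi> x = 1) \<and> (\<forall>x. \<bar>x\<bar> \<ge> 2 \<longrightarrow> \<phi> x = 0)"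
  proof (rule plateau_exists)
    fix \<phi> :: "real \<Rightarrow> real" assume "test_fun (\<lambda>x. of_real (\<phi> x))"
      "\<And>x. \<bar>x\<bar> \<le> 1 \<Longrightarrow> \<phi> x = 1" "\<And>x. \<bar>x\<bar> \<ge> 2 \<Longrightarrow> \<phi> x = 0"
    then show ?thesis by (intro exI[of _ \<phi>]) simp
  qed
  then obtain \<phi> :: "real \<Rightarrow> real" where \<phi>: "test_fun (\<lambda>x. of_real (\<phi> x))"
    "\<And>x. \<bar>x\<bar> \<le> 1 \<Longrightarrow> \<phi> x = 1" "\<And>x. \<bar>x\<bar> \<ge> 2 \<Longrightarrow> \<phi> x = 0"
    by blast
  let ?k = "ift (\<lambda>x. complex_of_real (\<phi> x))"
  have ft: "ft (tensor3 ?k ?k ?k) \<xi> = of_real (\<phi> (\<xi>$1)) * of_real (\<phi> (\<xi>$2)) * of_real (\<phi> (\<xi>$3))" for \<xi>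
    by (simp add: ft_tensor3 integrable_ift_test_fun ft_ift_test_fun \<phi>(1))
  show thesis
  proof (rule that[of "tensor3 ?k ?k ?k"])
    show "schwartz (tensor3 ?k ?k ?k)" by (intro schwartz_tensor3 \<phi>(1))
    show "ft (tensor3 ?k ?k ?k) \<xi> = 1" if "\<And>i. \<bar>\<xi>$i\<bar> \<le> 1" for \<xi>
    proof -
      have "\<phi> (\<xi>$1) = 1" "\<phi> (\<xi>$2) = 1" "\<phi> (\<xi>$3) = 1" by (intro \<phi>(2) that)+
      then show ?thesis unfolding ft by simp
    qed
    show "ft (tensor3 ?k ?k ?k) \<xi> = 0" if "\<bar>\<xi>$i\<bar> \<ge> 2" for \<xi> i
    proof -
      have "\<phi> (\<xi>$i) = 0" by (intro \<phi>(3) that)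
      then show ?thesis unfolding ft using exhaust_3[of i] by (elim disjE) simp_all
    qed
  qed
qed

lemma schwartz_ft_inversion:
  assumes "schwartz u" "integrable lborel (ft u)"
  shows "ift (ft u) = u"
proof
  fix x
  obtain B where "\<And>x. norm (u x) \<le> B" using schwartz_bounded[OF assms(1)] by blast
  then show "ift (ft u) x = u x"
    by (intro fourier_inversion[of u B] schwartz_integrable schwartz_continuous assms)
qed

text \<open>Outside the context above \<open>linear_measurable\<close> has a bare variable as its subject, so as a
  measurability rule it would unify with every function.\<close>

declare linear_measurable [measurable del]

section \<open>Boxes in the frame of the cone\<close>

lemma inner_3: "(x::real^3) \<bullet> y = x$1 * y$1 + x$2 * y$2 + x$3 * y$3"
  by (simp add: inner_vec_def sum_3)

lemma norm_3: "norm (x::real^3) = sqrt ((x$1)\<^sup>2 + (x$2)\<^sup>2 + (x$3)\<^sup>2)"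
  by (simp add: norm_eq_sqrt_inner inner_3 power2_eq_square)

lemma frame_components [simp]:
  "angular_dir t $ 1 = - sin t" "angular_dir t $ 2 = cos t" "angular_dir t $ 3 = 0"
  "normal_dir t $ 1 = cos t / sqrt 2" "normal_dir t $ 2 = sin t / sqrt 2" "normal_dir t $ 3 = - 1 / sqrt 2"
  "null_dir t $ 1 = cos t / sqrt 2" "null_dir t $ 2 = sin t / sqrt 2" "null_dir t $ 3 = 1 / sqrt 2"
  by (simp_all add: angular_dir_def normal_dir_def null_dir_def vector_3)

text \<open>Coordinates in the orthonormal frame at angle \<open>t\<close>, in the order angular, normal, null.\<close>

definition frame :: "real \<Rightarrow> real^3 \<Rightarrow> real^3" where
  "frame t x = vector [x \<bullet> angular_dir t, x \<bullet> normal_dir t, x \<bullet> null_dir t]"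

lemma frame_components' [simp]:
  "frame t x $ 1 = x \<bullet> angular_dir t" "frame t x $ 2 = x \<bullet> normal_dir t" "frame t x $ 3 = x \<bullet> null_dir t"
  by (simp_all add: frame_def vector_3)

lemma linear_frame: "linear (frame t)"
  by (rule linearI) (simp_all add: vec_eq_iff forall_3 inner_add_left)

lemma frame_inner: "frame t x \<bullet> frame t y = x \<bullet> y"
proof -
  have half: "(a / sqrt 2) * (b / sqrt 2) = a * b / 2" for a b :: real
    by simp
  define S C where "S = sin t" and "C = cos t"
  have SC: "S\<^sup>2 + C\<^sup>2 = 1" by (simp add: S_def C_def)
  let ?q = "\<lambda>z::real^3. C * z$1 + S * z$2"
  have nor: "z \<bullet> normal_dir t = (?q z - z$3) / sqrt 2" and nul: "z \<bullet> null_dir t = (?q z + z$3) / sqrt 2" for z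
    by (simp_all add: inner_3 S_def C_def add_divide_distrib diff_divide_distrib mult.commute)
  have "frame t x \<bullet> frame t y = (x \<bullet> angular_dir t) * (y \<bullet> angular_dir t) + (?q x - x$3) * (?q y - y$3) / 2 + (?q x + x$3) * (?q y + y$3) / 2"
    unfolding inner_3[of "frame t x"] frame_components' nor nul half ..
  also have "\<dots> = (C * x$2 - S * x$1) * (C * y$2 - S * y$1) + ?q x * ?q y + x$3 * y$3"
  proof -
    have "(p - a) * (q - b) / 2 + (p + a) * (q + b) / 2 = p * q + a * b" for p q a b :: real
      by (simp add: field_simps)
    then show ?thesis by (simp add: inner_3 S_def C_def mult.commute)
  qed
  also have "\<dots> = (S\<^sup>2 + C\<^sup>2) * (x$1 * y$1 + x$2 * y$2) + x$3 * y$3"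
    by (simp add: power2_eq_square algebra_simps)
  finally show ?thesis unfolding SC by (simp add: inner_3)
qed

lemma frame_norm: "norm (frame t x) = norm x"
  by (simp add: norm_eq_sqrt_inner frame_inner)

lemma orthogonal_frame: "orthogonal_transformation (frame t)"
  by (simp add: orthogonal_transformation_def linear_frame frame_inner)

lemma inj_frame: "inj (frame t)"
  using orthogonal_frame orthogonal_transformation_inj by blast

lemma cone_box_frame:
  "\<xi> \<in> cone_box c t a1 a2 a3 \<longleftrightarrow> \<bar>frame t (\<xi> - c) $ 1\<bar> \<le> a1 / 2 \<and> \<bar>frame t (\<xi> - c) $ 2\<bar> \<le> a2 / 2 \<and> \<bar>frame t (\<xi> - c) $ 3\<bar> \<le> a3 / 2"
  by (simp add: cone_box_def)

lemma cone_box_mono: "a1 \<le> b1 \<Longrightarrow> a2 \<le> b2 \<Longrightarrow> a3 \<le> b3 \<Longrightarrow> cone_box c t a1 a2 a3 \<subseteq> cone_box c t b1 b2 b3"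
  by (auto simp: cone_box_def)

lemma closed_cone_box: "closed (cone_box c t a1 a2 a3)"
  unfolding cone_box_def by (intro closed_Collect_conj closed_Collect_le continuous_intros)

lemma cone_box_measurable: "cone_box c t a1 a2 a3 \<in> sets borel"
  using closed_cone_box by auto

lemma cone_box_norm:
  assumes "\<xi> \<in> cone_box c t a1 a2 a3"
  shows "norm (\<xi> - c) \<le> (a1 + a2 + a3) / 2"
proof -
  have "norm (\<xi> - c) = norm (frame t (\<xi> - c))" by (simp add: frame_norm)
  also have "\<dots> \<le> \<bar>frame t (\<xi> - c) $ 1\<bar> + \<bar>frame t (\<xi> - c) $ 2\<bar> + \<bar>frame t (\<xi> - c) $ 3\<bar>"
    using norm_le_l1_cart[of "frame t (\<xi> - c)"] by (simp add: sum_3)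
  finally have "norm (\<xi> - c) \<le> \<bar>frame t (\<xi> - c) $ 1\<bar> + \<bar>frame t (\<xi> - c) $ 2\<bar> + \<bar>frame t (\<xi> - c) $ 3\<bar>" .
  moreover have "\<bar>frame t (\<xi> - c) $ 1\<bar> \<le> a1 / 2" "\<bar>frame t (\<xi> - c) $ 2\<bar> \<le> a2 / 2" "\<bar>frame t (\<xi> - c) $ 3\<bar> \<le> a3 / 2"
    using assms unfolding cone_box_frame by blast+
  moreover have "(a1 + a2 + a3) / 2 = a1 / 2 + a2 / 2 + a3 / 2" by simp
  ultimately show ?thesis by linarith
qed

text \<open>The box is the preimage of an axis-parallel box under the orthogonal map \<open>frame t\<close>.\<close>

lemma emeasure_cone_box:
  assumes "a1 \<ge> 0" "a2 \<ge> 0" "a3 \<ge> 0"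
  shows "emeasure lborel (cone_box c t a1 a2 a3) = ennreal (a1 * a2 * a3)"
proof -
  let ?v = "vector [a1 / 2, a2 / 2, a3 / 2] :: real^3"
  have J: "\<bar>det (matrix (frame t))\<bar> = 1"
    using orthogonal_transformation_det[OF orthogonal_frame] .
  have fm [measurable]: "frame t \<in> borel_measurable borel"
    using linear_frame by (intro borel_measurable_continuous_onI linear_continuous_on) (simp add: linear_conv_bounded_linear)
  have mem: "x \<in> cone_box c t a1 a2 a3 \<longleftrightarrow> frame t x \<in> cbox (frame t c - ?v) (frame t c + ?v)" for x
  proof -
    have gen: "\<bar>x - y\<bar> \<le> a / 2 \<longleftrightarrow> y - a / 2 \<le> x \<and> x \<le> y + a / 2" for x y a :: real
      by (safe; linarith)
    show ?thesis
      unfolding cone_box_frame mem_box_cart forall_3 linear_diff[OF linear_frame] vector_minus_component vector_add_component vector_3 gen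
      by blast
  qed
  have "emeasure lborel (cone_box c t a1 a2 a3) = (\<integral>\<^sup>+x. indicator (cone_box c t a1 a2 a3) x \<partial>lborel)"
    using cone_box_measurable by simp
  also have "\<dots> = (\<integral>\<^sup>+x. indicator (cbox (frame t c - ?v) (frame t c + ?v)) (frame t x) \<partial>lborel)"
    by (intro nn_integral_cong) (simp add: indicator_def mem)
  also have "\<dots> = (\<integral>\<^sup>+x. indicator (cbox (frame t c - ?v) (frame t c + ?v)) x \<partial>lborel)"
    by (subst nn_integral_linear[OF linear_frame inj_frame refl, of _ t]) (simp_all add: J)
  also have "\<dots> = emeasure lborel (cbox (frame t c - ?v) (frame t c + ?v))" by simp
  also have "\<dots> = (\<Prod>b\<in>Basis. (frame t c + ?v - (frame t c - ?v)) \<bullet> b)"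
  proof (rule emeasure_lborel_cbox)
    fix b :: "real^3" assume "b \<in> Basis"
    then obtain i where "b = axis i 1" unfolding Basis_real3 by blast
    then show "(frame t c - ?v) \<bullet> b \<le> (frame t c + ?v) \<bullet> b"
      using assms exhaust_3[of i] by (auto simp: inner_axis vector_3)
  qed
  also have "(\<Prod>b\<in>Basis. (frame t c + ?v - (frame t c - ?v)) \<bullet> b) = a1 * a2 * a3"
  proof -
    have "inj (\<lambda>i::3. axis i (1::real))" by (auto simp: inj_on_def axis_eq_axis)
    from prod.reindex[OF this, of "\<lambda>b. (frame t c + ?v - (frame t c - ?v)) \<bullet> b"]
    have "(\<Prod>b\<in>Basis. (frame t c + ?v - (frame t c - ?v)) \<bullet> b) = (\<Prod>i\<in>(UNIV::3 set). (frame t c + ?v - (frame t c - ?v)) $ i)"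
      by (simp only: Basis_real3 comp_def inner_axis) simp
    also have "\<dots> = a1 * a2 * a3" unfolding UNIV_3 by (simp add: vector_3)
    finally show ?thesis .
  qed
  finally show ?thesis .
qed

text \<open>Rotate the model kernel \<open>w\<close> into the frame, rescale it by the side lengths and modulate to the centre. The normalising Jacobian keeps the
  \<open>L\<^sup>1\<close> norm equal to that of \<open>w\<close>, so convolution bounds are uniform over all boxes.\<close>

theorem box_kernel_exists:
  assumes w: "schwartz w" "\<And>\<xi>. (\<And>i. \<bar>\<xi>$i\<bar> \<le> 1) \<Longrightarrow> ft w \<xi> = 1" "\<And>\<xi> i. \<bar>\<xi>$i\<bar> \<ge> 2 \<Longrightarrow> ft w \<xi> = 0"
    and a: "a1 > 0" "a2 > 0" "a3 > 0"
  shows "\<exists>u. schwartz u \<and> (\<forall>\<xi>\<in>cone_box c t a1 a2 a3. ft u \<xi> = 1) \<and>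
      (\<forall>\<xi>. ft u \<xi> \<noteq> 0 \<longrightarrow> \<xi> \<in> cone_box c t (2 * a1) (2 * a2) (2 * a3)) \<and>
      (LINT x|lborel. norm (u x)) = (LINT x|lborel. norm (w x))"
proof -
  define l where "l = (vector [a1 / 2, a2 / 2, a3 / 2] :: real^3)"
  have l: "l$1 = a1 / 2" "l$2 = a2 / 2" "l$3 = a3 / 2" by (simp_all add: l_def vector_3)
  define A where "A x = (\<chi> i. l$i * frame t x $ i)" for x
  define B where "B x = (\<chi> i. frame t x $ i / l$i)" for x
  have lin: "linear A"
    by (rule linearI) (simp_all add: A_def vec_eq_iff linear_add[OF linear_frame] linear_scale[OF linear_frame] algebra_simps)
  have lpos: "l$i > 0" for i using exhaust_3[of i] a l by auto
  have dual: "\<xi> \<bullet> x = B \<xi> \<bullet> A x" for \<xi> x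
  proof -
    have "B \<xi> \<bullet> A x = frame t \<xi> \<bullet> frame t x"
      unfolding inner_vec_def A_def B_def using lpos[THEN less_imp_neq] by (intro sum.cong) (auto simp: less_imp_neq[symmetric])
    then show ?thesis by (simp add: frame_inner)
  qed
  define \<mu> where "\<mu> = Min (range (\<lambda>i. l$i))"
  have \<mu>_pos: "\<mu> > 0" unfolding \<mu>_def by (subst Min_gr_iff) (auto simp: lpos)
  have \<mu>_le: "\<mu> \<le> l$i" for i unfolding \<mu>_def by simp
  define m where "m = 1 / \<mu>"
  have m: "norm x \<le> m * norm (A x)" for x
  proof -
    have "\<mu> * norm x = norm (\<mu> *\<^sub>R frame t x)"
      using \<mu>_pos by (simp add: frame_norm)
    also have "\<dots> \<le> norm (A x)"
    proof (rule norm_le_componentwise_cart)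
      show "norm ((\<mu> *\<^sub>R frame t x) $ i) \<le> norm (A x $ i)" for i
        using \<mu>_pos \<mu>_le[of i] by (auto simp: A_def abs_mult intro!: mult_right_mono)
    qed
    finally show ?thesis using \<mu>_pos by (simp add: m_def field_simps)
  qed
  have inj: "inj A"
    using m linear_injective_0[OF lin] by (metis mult_zero_right norm_le_zero_iff norm_zero)
  define J where "J = \<bar>det (matrix A)\<bar>"
  have J: "J > 0" by (rule linear_jacobian_pos[OF lin inj J_def])
  define u where "u x = of_real J * (ch (c \<bullet> x) * w (A x))" for x
  have ftu: "ft u \<xi> = ft w (B (\<xi> - c))" for \<xi>
    unfolding u_def by (rule ft_affine[OF lin inj J_def dual schwartz_measurable[OF w(1)]])
  show ?thesis
  proof (intro exI[of _ u] conjI ballI allI impI)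
    show "schwartz u" unfolding u_def by (rule schwartz_affine[OF w(1) lin m])
    show "ft u \<xi> = 1" if "\<xi> \<in> cone_box c t a1 a2 a3" for \<xi>
    proof -
      have "\<bar>B (\<xi> - c) $ i\<bar> \<le> 1" for i
        using that lpos[of i] exhaust_3[of i] l a unfolding cone_box_frame B_def by (auto simp: field_simps abs_mult)
      then show ?thesis unfolding ftu by (rule w(2))
    qed
    show "\<xi> \<in> cone_box c t (2 * a1) (2 * a2) (2 * a3)" if "ft u \<xi> \<noteq> 0" for \<xi>
    proof -
      have "\<bar>B (\<xi> - c) $ i\<bar> < 2" for i using w(3)[of "B (\<xi> - c)" i] that unfolding ftu by force
      then have "\<bar>frame t (\<xi> - c) $ i\<bar> / l$i < 2" for i
        using lpos[of i] by (simp add: B_def abs_divide abs_of_pos[OF lpos] del: frame_components')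
      then have "\<bar>frame t (\<xi> - c) $ i\<bar> < 2 * l$i" for i
        unfolding pos_divide_less_eq[OF lpos] .
      from this[of 1] this[of 2] this[of 3] show ?thesis unfolding cone_box_frame l by simp
    qed
    have "(LINT x|lborel. norm (w x)) = J *\<^sub>R (LINT x|lborel. norm (w (A x)))"
      by (rule lborel_integral_linear[OF lin inj J_def]) (use schwartz_measurable[OF w(1)] in measurable)
    then show "(LINT x|lborel. norm (u x)) = (LINT x|lborel. norm (w x))"
      using J by (simp add: u_def norm_mult)
  qed
qed

text \<open>The signed vertical distance to the full cone, a substitute for the true distance that is additive under vertical translations.\<close>

definition cone_defect :: "real^3 \<Rightarrow> real" where
  "cone_defect \<xi> = \<xi>$3 - sqrt ((\<xi>$1)\<^sup>2 + (\<xi>$2)\<^sup>2)"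

lemma trunc_cone_nonempty: "vector [1, 0, 1] \<in> trunc_cone"
  by (simp add: trunc_cone_def vector_3)

lemma cone_nbhd_near:
  assumes "\<delta> > 0" "\<xi> \<in> cone_nbhd \<delta>"
  obtains \<zeta> where "\<zeta> \<in> trunc_cone" "norm (\<xi> - \<zeta>) \<le> 2 * \<delta>"
proof -
  have "infdist \<xi> trunc_cone < 2 * \<delta>" using assms by (simp add: cone_nbhd_def)
  then have "\<exists>\<zeta>\<in>trunc_cone. dist \<xi> \<zeta> < 2 * \<delta>"
  proof -
    have ne: "trunc_cone \<noteq> {}" using trunc_cone_nonempty by blast
    have "bdd_below (dist \<xi> ` trunc_cone)" by (rule bdd_belowI[of _ 0]) auto
    with \<open>infdist \<xi> trunc_cone < 2 * \<delta>\<close> show ?thesis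
      unfolding infdist_notempty[OF ne] by (simp only: cINF_less_iff[OF ne])
  qed
  then show thesis using that by (auto simp: dist_norm intro: less_imp_le)
qed

lemma planar_norm_diff:
  "\<bar>sqrt ((x$1)\<^sup>2 + (x$2)\<^sup>2) - sqrt ((y$1)\<^sup>2 + (y$2)\<^sup>2)\<bar> \<le> norm (x - y)" for x y :: "real^3"
proof -
  have *: "sqrt ((z$1)\<^sup>2 + (z$2)\<^sup>2) = norm (z - (z$3) *\<^sub>R axis 3 1)" for z :: "real^3"
    by (simp add: norm_3 axis_def)
  have "\<bar>norm (x - (x$3) *\<^sub>R axis 3 1) - norm (y - (y$3) *\<^sub>R axis 3 1)\<bar> \<le> norm ((x - (x$3) *\<^sub>R axis 3 1) - (y - (y$3) *\<^sub>R axis 3 1))"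
    by (rule norm_triangle_ineq3)
  also have "\<dots> \<le> norm (x - y)"
    by (simp add: norm_3 axis_def)
  finally show ?thesis unfolding * .
qed

text \<open>A point of the neighbourhood has a cone point within \<open>2 \<delta>\<close>; the factor \<open>2\<close> avoids the question of whether the infimum is attained.\<close>

lemma cone_nbhd_bounds:
  assumes "\<delta> > 0" "\<xi> \<in> cone_nbhd \<delta>"
  shows "\<bar>cone_defect \<xi>\<bar> \<le> 4 * \<delta>" "1 - 2 * \<delta> \<le> sqrt ((\<xi>$1)\<^sup>2 + (\<xi>$2)\<^sup>2)" "sqrt ((\<xi>$1)\<^sup>2 + (\<xi>$2)\<^sup>2) \<le> sqrt 2 + 2 * \<delta>"
proof -
  obtain \<zeta> where \<zeta>: "\<zeta> \<in> trunc_cone" "norm (\<xi> - \<zeta>) \<le> 2 * \<delta>" using cone_nbhd_near[OF assms] .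
  have r: "\<zeta>$3 = sqrt ((\<zeta>$1)\<^sup>2 + (\<zeta>$2)\<^sup>2)" "1 \<le> sqrt ((\<zeta>$1)\<^sup>2 + (\<zeta>$2)\<^sup>2)" "sqrt ((\<zeta>$1)\<^sup>2 + (\<zeta>$2)\<^sup>2) \<le> sqrt 2"
    using \<zeta>(1) by (auto simp: trunc_cone_def)
  have "\<bar>\<xi>$3 - \<zeta>$3\<bar> \<le> norm (\<xi> - \<zeta>)" using component_le_norm_cart[of "\<xi> - \<zeta>" 3] by simp
  then show "\<bar>cone_defect \<xi>\<bar> \<le> 4 * \<delta>" "1 - 2 * \<delta> \<le> sqrt ((\<xi>$1)\<^sup>2 + (\<xi>$2)\<^sup>2)" "sqrt ((\<xi>$1)\<^sup>2 + (\<xi>$2)\<^sup>2) \<le> sqrt 2 + 2 * \<delta>"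
    unfolding cone_defect_def using planar_norm_diff[of \<xi> \<zeta>] \<zeta>(2) r by linarith+
qed

section \<open>Packing of small caps\<close>

text \<open>Comparing volumes of the cores in a ball of radius \<open>s = sqrt \<delta>\<close> would lose a factor \<open>1 / s\<close>, since the cores have volume
  about \<open>s\<^sup>4\<close> and not \<open>s\<^sup>3\<close>. But all cores lie within \<open>O(\<delta>)\<close> of one surface. Translates of the whole family
  by multiples of \<open>9 \<delta>\<close> in the vertical direction are therefore disjoint from each other, and about \<open>1 / s\<close> of them
  still fit into a cube of size \<open>O(s)\<close>.\<close>

theorem packing:
  fixes G :: "(real^3) set set" and c :: "(real^3) set \<Rightarrow> real^3" and t :: "(real^3) set \<Rightarrow> real"
  assumes K: "K \<ge> 1" and \<delta>: "0 < \<delta>" "\<delta> \<le> 1" and D: "D \<ge> 0"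
    and disj: "disjoint G"
    and core: "\<And>\<gamma>. \<gamma> \<in> G \<Longrightarrow> cone_box (c \<gamma>) (t \<gamma>) (sqrt \<delta> / K\<^sup>2) (\<delta> / K\<^sup>2) (sqrt \<delta> / K\<^sup>2) \<subseteq> \<gamma>"
    and sub: "\<And>\<gamma>. \<gamma> \<in> G \<Longrightarrow> \<gamma> \<subseteq> cone_nbhd \<delta>"
    and loc: "\<And>\<gamma>. \<gamma> \<in> G \<Longrightarrow> norm (c \<gamma> - p) \<le> D * sqrt \<delta>"
  shows "finite G \<and> card G \<le> nat \<lfloor>8 * (D + 20) ^ 3 * K ^ 6\<rfloor>"
proof -
  define s where "s = sqrt \<delta>"
  have s: "0 < s" "s \<le> 1" "\<delta> = s\<^sup>2" using \<delta> by (auto simp: s_def)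
  define z where "z = (axis 3 1 :: real^3)"
  have z: "z$1 = 0" "z$2 = 0" "z$3 = 1" by (simp_all add: z_def axis_def)
  define core where "core \<gamma> = cone_box (c \<gamma>) (t \<gamma>) (s / K\<^sup>2) (\<delta> / K\<^sup>2) (s / K\<^sup>2)" for \<gamma>
  define M where "M = nat \<lceil>1 / s\<rceil>"
  have M: "1 / s \<le> real M" "real M \<le> 1 / s + 1"
  proof -
    have "0 \<le> 1 / s" using s by simp
    then have "0 \<le> \<lceil>1 / s\<rceil>" unfolding zero_le_ceiling by linarith
    then have "real M = of_int \<lceil>1 / s\<rceil>" by (simp add: M_def)
    then show "1 / s \<le> real M" "real M \<le> 1 / s + 1"
      using of_int_ceiling_le_add_one[of "1 / s"] le_of_int_ceiling[of "1 / s"] by linarith+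
  qed
  \<comment> \<open>Vertical copies of the cores; the step \<open>9 \<delta>\<close> exceeds the oscillation \<open>8 \<delta>\<close> of \<open>cone_defect\<close> on the caps.\<close>
  define S where "S x = (case x of (\<gamma>, m) \<Rightarrow> (+) ((9 * \<delta> * real m) *\<^sub>R z) ` core \<gamma>)" for x :: "(real^3) set \<times> nat"
  define L where "L = (D + 20) * s"
  have L: "L \<ge> 0" using s D by (simp add: L_def)
  define Q where "Q = cbox (p - L *\<^sub>R vector [1, 1, 1]) (p + L *\<^sub>R (vector [1, 1, 1]) :: real^3)"
  have Km: "s / K\<^sup>2 \<le> s" "\<delta> / K\<^sup>2 \<le> \<delta>" "0 \<le> s / K\<^sup>2" "0 \<le> \<delta> / K\<^sup>2"
  proof -
    have "K\<^sup>2 \<ge> 1" using K by simp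
    then show "s / K\<^sup>2 \<le> s" "\<delta> / K\<^sup>2 \<le> \<delta>" "0 \<le> s / K\<^sup>2" "0 \<le> \<delta> / K\<^sup>2"
      using s \<delta> by (simp_all add: divide_le_eq)
  qed
  have bound: "real (card F) \<le> 8 * (D + 20) ^ 3 * K ^ 6" if F: "F \<subseteq> G" "finite F" for F
  proof -
    have meas: "S x \<in> sets lborel" for x
      unfolding S_def core_def by (auto split: prod.split intro!: closed_translation closed_cone_box borel_closed)
    have em: "emeasure lborel (S x) = ennreal (s ^ 4 / K ^ 6)" for x
    proof -
      obtain \<gamma> m where x: "x = (\<gamma>, m)" by (cases x)
      have "emeasure lborel (S x) = emeasure lborel (core \<gamma>)"
      proof -
        have "emeasure lborel (core \<gamma>) = emeasure (distr lborel borel ((+) (- ((9 * \<delta> * real m) *\<^sub>R z)))) (core \<gamma>)"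
          by (simp only: lborel_distr_plus)
        also have "\<dots> = emeasure lborel ((+) (- ((9 * \<delta> * real m) *\<^sub>R z)) -` core \<gamma>)"
          by (subst emeasure_distr) (auto simp: core_def cone_box_measurable)
        also have "(+) (- ((9 * \<delta> * real m) *\<^sub>R z)) -` core \<gamma> = S x"
          by (force simp: S_def x image_iff algebra_simps)
        finally show ?thesis by simp
      qed
      also have "\<dots> = ennreal ((s / K\<^sup>2) * (\<delta> / K\<^sup>2) * (s / K\<^sup>2))"
        unfolding core_def using Km by (intro emeasure_cone_box) auto
      also have "(s / K\<^sup>2) * (\<delta> / K\<^sup>2) * (s / K\<^sup>2) = s ^ 4 / K ^ 6"
        unfolding s(3) by (simp add: power2_eq_square eval_nat_numeral)
      finally show ?thesis .
    qed
    have dj: "disjoint_family_on S (F \<times> {..<M})"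
      unfolding disjoint_family_on_def
    proof (intro ballI impI equals0I)
      fix w w' x
      assume w: "w \<in> F \<times> {..<M}" "w' \<in> F \<times> {..<M}" "w \<noteq> w'" and "x \<in> S w \<inter> S w'"
      then obtain \<gamma> m \<gamma>' m' where g: "\<gamma> \<in> F" "\<gamma>' \<in> F" and x: "x \<in> S (\<gamma>, m)" "x \<in> S (\<gamma>', m')" and ne: "\<not> (\<gamma> = \<gamma>' \<and> m = m')"
        by (cases w; cases w') auto
      obtain y where y: "y \<in> core \<gamma>" "x = (9 * \<delta> * real m) *\<^sub>R z + y" using x(1) by (auto simp: S_def)
      obtain y' where y': "y' \<in> core \<gamma>'" "x = (9 * \<delta> * real m') *\<^sub>R z + y'" using x(2) by (auto simp: S_def)
      have yg: "y \<in> \<gamma>" "y' \<in> \<gamma>'" using y(1) y'(1) assms(6)[of \<gamma>] assms(6)[of \<gamma>'] g F(1) by (auto simp: core_def s_def)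
      have "\<bar>cone_defect y\<bar> \<le> 4 * \<delta>" "\<bar>cone_defect y'\<bar> \<le> 4 * \<delta>"
        using yg sub g F(1) cone_nbhd_bounds(1)[OF \<delta>(1)] by blast+
      moreover have "cone_defect x = cone_defect y + 9 * \<delta> * real m"
        unfolding y(2) by (simp add: cone_defect_def z)
      moreover have "cone_defect x = cone_defect y' + 9 * \<delta> * real m'"
        unfolding y'(2) by (simp add: cone_defect_def z)
      moreover have "9 * \<delta> * (real m - real m') = 9 * \<delta> * real m - 9 * \<delta> * real m'" by (rule right_diff_distrib)
      ultimately have "\<bar>9 * \<delta> * (real m - real m')\<bar> \<le> 8 * \<delta>" by linarith
      then have "9 * \<delta> * \<bar>real m - real m'\<bar> \<le> 8 * \<delta>"
        using \<delta> by (simp add: abs_mult)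
      then have "\<bar>real m - real m'\<bar> < 1" using \<delta> by (simp add: field_simps)
      then have mm: "m = m'" by linarith
      then have "y = y'" using y(2) y'(2) by simp
      then have "\<gamma> \<inter> \<gamma>' \<noteq> {}" using yg by blast
      then have "\<gamma> = \<gamma>'" using disj g F(1) by (meson disjointD subsetD)
      then show False using ne mm by simp
    qed
    have inQ: "(\<Union>x\<in>F \<times> {..<M}. S x) \<subseteq> Q"
    proof safe
      fix \<gamma> m x assume g: "\<gamma> \<in> F" and m: "m < M" and x: "x \<in> S (\<gamma>, m)"
      obtain y where y: "y \<in> core \<gamma>" "x = (9 * \<delta> * real m) *\<^sub>R z + y" using x by (auto simp: S_def)
      have "norm (y - c \<gamma>) \<le> (s / K\<^sup>2 + \<delta> / K\<^sup>2 + s / K\<^sup>2) / 2" using y(1) unfolding core_def by (rule cone_box_norm)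
      also have "\<dots> \<le> (s + s + s) / 2"
      proof -
        have "\<delta> \<le> s" using s by (simp add: power2_eq_square mult_left_le_one_le)
        then show ?thesis using Km by (intro divide_right_mono add_mono) linarith+
      qed
      finally have 1: "norm (y - c \<gamma>) \<le> 2 * s" using s by simp
      have "norm ((9 * \<delta> * real m) *\<^sub>R z) \<le> 18 * s"
      proof -
        have "\<delta> * real m \<le> \<delta> * (1 / s + 1)" using m M \<delta> by (intro mult_left_mono) auto
        also have "\<dots> = s + s\<^sup>2" using s by (simp add: s(3) power2_eq_square field_simps)
        also have "\<dots> \<le> 2 * s" using s by (simp add: power2_eq_square mult_left_le_one_le)
        finally show ?thesis using \<delta> by (simp add: z_def)
      qed
      moreover have "norm (c \<gamma> - p) \<le> D * s" using loc[of \<gamma>] g F(1) by (auto simp: s_def)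
      moreover have "norm (x - p) \<le> norm ((9 * \<delta> * real m) *\<^sub>R z) + norm (y - c \<gamma>) + norm (c \<gamma> - p)"
      proof -
        have "x - p = (9 * \<delta> * real m) *\<^sub>R z + (y - c \<gamma>) + (c \<gamma> - p)" unfolding y(2) by simp
        from arg_cong[OF this, of norm] show ?thesis
          using norm_triangle_ineq[of "(9 * \<delta> * real m) *\<^sub>R z + (y - c \<gamma>)" "c \<gamma> - p"]
            norm_triangle_ineq[of "(9 * \<delta> * real m) *\<^sub>R z" "y - c \<gamma>"] by linarith
      qed
      ultimately have "norm (x - p) \<le> L" using 1 by (simp add: L_def algebra_simps)
      then have "\<bar>(x - p) $ i\<bar> \<le> L" for i using component_le_norm_cart[of "x - p" i] by linarith
      then have "p $ i - L \<le> x $ i \<and> x $ i \<le> p $ i + L" for i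
        unfolding vector_minus_component abs_le_iff by (metis add.commute diff_le_eq minus_diff_eq)
      then show "x \<in> Q" unfolding Q_def mem_box_cart forall_3 by (simp add: vector_3)
    qed
    have emQ: "emeasure lborel Q = ennreal ((2 * L) ^ 3)"
    proof -
      have "emeasure lborel Q = (\<Prod>b\<in>Basis. ((p + L *\<^sub>R (vector [1, 1, 1])) - (p - L *\<^sub>R vector [1, 1, 1])) \<bullet> (b :: real^3))"
        unfolding Q_def
      proof (rule emeasure_lborel_cbox)
        fix b :: "real^3" assume "b \<in> Basis"
        then obtain i where "b = axis i 1" unfolding Basis_real3 by blast
        then show "(p - L *\<^sub>R vector [1, 1, 1]) \<bullet> b \<le> (p + L *\<^sub>R vector [1, 1, 1]) \<bullet> b"
          using L exhaust_3[of i] by (auto simp: inner_axis vector_3)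
      qed
      also have "(\<Prod>b\<in>Basis. ((p + L *\<^sub>R (vector [1, 1, 1])) - (p - L *\<^sub>R vector [1, 1, 1])) \<bullet> (b :: real^3)) = (\<Prod>b\<in>(Basis::(real^3) set). 2 * L)"
      proof (rule prod.cong[OF refl])
        fix b :: "real^3" assume "b \<in> Basis"
        then obtain i where "b = axis i 1" unfolding Basis_real3 by blast
        then show "((p + L *\<^sub>R (vector [1, 1, 1])) - (p - L *\<^sub>R vector [1, 1, 1])) \<bullet> b = 2 * L"
          using exhaust_3[of i] by (auto simp: inner_axis vector_3)
      qed
      finally show ?thesis by simp
    qed
    have "ennreal (real (card F) * real M * (s ^ 4 / K ^ 6)) = (\<Sum>x\<in>F \<times> {..<M}. emeasure lborel (S x))"
      unfolding em using s K by (subst sum_ennreal) (auto simp: card_cartesian_product)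
    also have "\<dots> = emeasure lborel (\<Union>x\<in>F \<times> {..<M}. S x)"
      by (rule sum_emeasure) (use meas dj F(2) in auto)
    also have "\<dots> \<le> emeasure lborel Q" by (rule emeasure_mono[OF inQ]) (simp add: Q_def)
    finally have "real (card F) * real M * (s ^ 4 / K ^ 6) \<le> (2 * L) ^ 3"
      unfolding emQ using L by (simp add: ennreal_le_iff)
    moreover have "real (card F) * (1 / s) * (s ^ 4 / K ^ 6) \<le> real (card F) * real M * (s ^ 4 / K ^ 6)"
      using M s K by (intro mult_right_mono mult_left_mono) auto
    ultimately have "real (card F) * (1 / s) * (s ^ 4 / K ^ 6) \<le> (2 * L) ^ 3" by linarith
    then have "real (card F) * s ^ 3 \<le> (2 * L) ^ 3 * K ^ 6"
      using s K by (simp add: field_simps eval_nat_numeral)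
    also have "\<dots> = (8 * (D + 20) ^ 3 * K ^ 6) * s ^ 3" by (simp add: L_def power_mult_distrib)
    finally show ?thesis using s by simp
  qed
  have "card F \<le> nat \<lfloor>8 * (D + 20) ^ 3 * K ^ 6\<rfloor>" if "F \<subseteq> G" "finite F" for F
    using bound[OF that] by (simp add: le_nat_floor)
  then show ?thesis using finite_if_finite_subsets_card_bdd[of G "nat \<lfloor>8 * (D + 20) ^ 3 * K ^ 6\<rfloor>"] by blast
qed

section \<open>Counting frequency quadruples\<close>

definition ray :: "real \<Rightarrow> real^3" where
  "ray t = vector [cos t, sin t, 1]"

lemma ray_components [simp]: "ray t $ 1 = cos t" "ray t $ 2 = sin t" "ray t $ 3 = 1"
  by (simp_all add: ray_def vector_3)

lemma norm_ray_sq: "(norm (x::real^3))\<^sup>2 = (x$1)\<^sup>2 + (x$2)\<^sup>2 + (x$3)\<^sup>2"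
  unfolding power2_norm_eq_inner by (simp add: inner_vec_def sum_3 power2_eq_square)

lemma ray_diff: "(norm (ray s - ray t))\<^sup>2 = (2 * sin ((s - t) / 2))\<^sup>2"
proof -
  have "(norm (ray s - ray t))\<^sup>2 = (cos s - cos t)\<^sup>2 + (sin s - sin t)\<^sup>2" by (simp add: norm_ray_sq)
  also have "\<dots> = ((sin s)\<^sup>2 + (cos s)\<^sup>2) + ((sin t)\<^sup>2 + (cos t)\<^sup>2) - 2 * (cos s * cos t + sin s * sin t)"
    by (simp add: power2_eq_square algebra_simps)
  also have "\<dots> = 2 - 2 * cos (s - t)" by (simp add: cos_diff)
  also have "cos (s - t) = 1 - 2 * (sin ((s - t) / 2))\<^sup>2"
  proof -
    have "2 * ((s - t) / 2) = s - t" by simp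
    then show ?thesis using cos_double_sin[of "(s - t) / 2"] by (simp only:)
  qed
  also have "2 - 2 * (1 - 2 * (sin ((s - t) / 2))\<^sup>2) = (2 * sin ((s - t) / 2))\<^sup>2"
    by (simp add: power_mult_distrib)
  finally show ?thesis .
qed

lemma norm_ray_diff: "norm (ray s - ray t) = 2 * \<bar>sin ((s - t) / 2)\<bar>"
  using ray_diff[of s t] power2_eq_imp_eq[of "norm (ray s - ray t)" "2 * \<bar>sin ((s - t) / 2)\<bar>"]
  by (simp add: power_mult_distrib)

lemma ray_diff_upper: "norm (ray s - ray t) \<le> \<bar>s - t\<bar>"
  using abs_sin_x_le_abs_x[of "(s - t) / 2"] by (simp add: norm_ray_diff)

text \<open>On an arc of angle at most \<open>1\<close>, chords are comparable with angles.\<close>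

lemma ray_diff_lower:
  assumes "\<bar>s - t\<bar> \<le> 1"
  shows "\<bar>s - t\<bar> / 2 \<le> norm (ray s - ray t)"
proof -
  have half: "x / 2 \<le> sin x" if "0 \<le> x" "x \<le> 1" for x :: real
  proof -
    have "\<bar>sin x - x\<bar> \<le> \<bar>x\<bar> ^ 3 / 6" using Maclaurin_sin_bound[of x 3] by (simp add: sin_coeff_def eval_nat_numeral)
    moreover have "x ^ 3 \<le> x" using that power_decreasing[of 1 3 x] by simp
    ultimately show ?thesis using that by (simp add: abs_if split: if_splits)
  qed
  have "\<bar>(s - t) / 2\<bar> / 2 \<le> \<bar>sin ((s - t) / 2)\<bar>"
  proof -
    have "\<bar>sin \<bar>y\<bar>\<bar> = \<bar>sin y\<bar>" for y :: real by (simp add: abs_if)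
    moreover have "\<bar>(s - t) / 2\<bar> \<le> 1" using assms by simp
    from half[OF abs_ge_zero this] have "\<bar>(s - t) / 2\<bar> / 2 \<le> \<bar>sin \<bar>(s - t) / 2\<bar>\<bar>" by linarith
    ultimately show ?thesis by (simp only:)
  qed
  then show ?thesis by (simp add: norm_ray_diff)
qed

lemma norm_ray: "norm (ray t) \<le> 2"
proof -
  have "(norm (ray t))\<^sup>2 = 2" by (simp add: norm_ray_sq)
  then have "(norm (ray t))\<^sup>2 \<le> 2\<^sup>2" by simp
  then show ?thesis by (rule power2_le_imp_le) simp
qed

lemma card_covered:
  assumes fin: "finite I" "finite S" and N: "\<And>p. card {i\<in>I. norm (c i - p) \<le> D} \<le> (N::nat)"
    and cov: "\<And>i. i \<in> A \<Longrightarrow> i \<in> I \<and> (\<exists>k\<in>S. norm (c i - p k) \<le> D)"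
  shows "card A \<le> card S * N"
proof -
  have "A \<subseteq> (\<Union>k\<in>S. {i\<in>I. norm (c i - p k) \<le> D})" using cov by blast
  then have "card A \<le> card (\<Union>k\<in>S. {i\<in>I. norm (c i - p k) \<le> D})" using fin by (intro card_mono) auto
  also have "\<dots> \<le> (\<Sum>k\<in>S. card {i\<in>I. norm (c i - p k) \<le> D})" by (rule card_UN_le[OF fin(2)])
  also have "\<dots> \<le> (\<Sum>k\<in>S. N)" by (intro sum_mono N)
  finally show ?thesis by simp
qed

text \<open>Points near a segment of length \<open>2 L\<close> are near one of about \<open>2 L / s\<close> equally spaced points of it. The rounding goes towards
  \<open>0\<close>, so that the chosen points stay inside the segment.\<close>

lemma segment_cover:
  fixes v :: "real^3"
  assumes s: "s > 0" and a: "\<bar>a\<bar> \<le> L" and v: "norm v \<le> 2" and near: "norm (x - (p + a *\<^sub>R v)) \<le> E"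
  shows "\<exists>k\<in>{-\<lceil>L / s\<rceil>..\<lceil>L / s\<rceil>}. norm (x - (p + (s * of_int k) *\<^sub>R v)) \<le> E + 2 * s"
proof -
  define k where "k = (if a \<ge> 0 then \<lfloor>a / s\<rfloor> else - \<lfloor>- a / s\<rfloor>)"
  have fl: "\<bar>x - s * of_int \<lfloor>x / s\<rfloor>\<bar> \<le> s" "0 \<le> x \<Longrightarrow> 0 \<le> \<lfloor>x / s\<rfloor>" for x
  proof -
    have "of_int \<lfloor>x / s\<rfloor> \<le> x / s" "x / s < of_int \<lfloor>x / s\<rfloor> + 1" by linarith+
    then have "of_int \<lfloor>x / s\<rfloor> * s \<le> x" "x < (of_int \<lfloor>x / s\<rfloor> + 1) * s"
      unfolding pos_le_divide_eq[OF s] pos_divide_less_eq[OF s] .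
    then have "s * of_int \<lfloor>x / s\<rfloor> \<le> x" "x < s * of_int \<lfloor>x / s\<rfloor> + s" by (simp_all add: algebra_simps)
    then show "\<bar>x - s * of_int \<lfloor>x / s\<rfloor>\<bar> \<le> s" by linarith
    show "0 \<le> x \<Longrightarrow> 0 \<le> \<lfloor>x / s\<rfloor>" using s by simp
  qed
  have flc: "\<lfloor>x / s\<rfloor> \<le> \<lceil>L / s\<rceil>" if "x \<le> L" for x
  proof -
    have "x / s \<le> L / s" using that s by (simp add: divide_right_mono)
    then show ?thesis by linarith
  qed
  have k: "\<bar>a - s * of_int k\<bar> \<le> s"
    using fl(1)[of a] fl(1)[of "- a"] by (auto simp: k_def abs_if split: if_splits)
  have kr: "k \<in> {-\<lceil>L / s\<rceil>..\<lceil>L / s\<rceil>}"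
  proof -
    have "0 \<le> L / s" using a s by simp
    then have "0 \<le> \<lceil>L / s\<rceil>" unfolding zero_le_ceiling by linarith
    then show ?thesis
    proof (cases "a \<ge> 0")
      case True
      then have "k = \<lfloor>a / s\<rfloor>" by (simp add: k_def)
      then show ?thesis
        using fl(2)[OF True] flc[of a] a \<open>0 \<le> \<lceil>L / s\<rceil>\<close> unfolding atLeastAtMost_iff by linarith
    next
      case False
      then have "k = - \<lfloor>- a / s\<rfloor>" "0 \<le> - a" by (simp_all add: k_def)
      then show ?thesis
        using fl(2)[of "- a"] flc[of "- a"] a \<open>0 \<le> \<lceil>L / s\<rceil>\<close> unfolding atLeastAtMost_iff by linarith
    qed
  qed
  have "norm (x - (p + (s * of_int k) *\<^sub>R v)) \<le> norm (x - (p + a *\<^sub>R v)) + norm ((a - s * of_int k) *\<^sub>R v)"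
  proof -
    have "x - (p + (s * of_int k) *\<^sub>R v) = (x - (p + a *\<^sub>R v)) + (a - s * of_int k) *\<^sub>R v"
      by (simp add: algebra_simps)
    then show ?thesis by (simp only: norm_triangle_ineq)
  qed
  moreover have "norm ((a - s * of_int k) *\<^sub>R v) \<le> s * 2"
    unfolding norm_scaleR using k v by (intro mult_mono) auto
  ultimately show ?thesis using near kr by (intro bexI[of _ k]) auto
qed

text \<open>Centres of small caps in one angular sector of width \<open>1\<close>, viewed as points on light rays up to an error \<open>O(s)\<close>. At
  most \<open>N\<close> of them lie in any ball of radius \<open>O(s)\<close>.\<close>

locale cone_points =
  fixes I :: "'i set" and c :: "'i \<Rightarrow> real^3" and t \<rho> :: "'i \<Rightarrow> real" and s B q :: real and N :: nat
  assumes fin: "finite I" and s: "0 < s" "s \<le> 1" and B: "B \<ge> 1"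
    and t: "\<And>i. i \<in> I \<Longrightarrow> q \<le> t i \<and> t i \<le> q + 1"
    and \<rho>: "\<And>i. i \<in> I \<Longrightarrow> 0 \<le> \<rho> i \<and> \<rho> i \<le> 4"
    and c: "\<And>i. i \<in> I \<Longrightarrow> norm (c i - \<rho> i *\<^sub>R ray (t i)) \<le> B * s"
    and pack: "\<And>p. card {i\<in>I. norm (c i - p) \<le> 8 * B * s} \<le> N"
begin

definition near :: "'i \<Rightarrow> 'i \<Rightarrow> bool" where
  "near i j \<longleftrightarrow> norm (ray (t i) - ray (t j)) \<le> B * s"

text \<open>The angular distance of two points in units of \<open>s\<close>, rounded down.\<close>

definition cell :: "'i \<Rightarrow> 'i \<Rightarrow> nat" where
  "cell i j = nat \<lfloor>\<bar>t i - t j\<bar> / s\<rfloor>"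

definition partners :: "'i \<Rightarrow> 'i \<Rightarrow> 'i set" where
  "partners i k = {j\<in>I. near i j \<and> (\<exists>l\<in>I. near k l \<and> norm (c i - c j - c k + c l) \<le> B * s)}"

definition quads :: "('i \<times> 'i \<times> 'i \<times> 'i) set" where
  "quads = {(i, j, k, l). i \<in> I \<and> j \<in> I \<and> k \<in> I \<and> l \<in> I \<and> near i j \<and> near k l \<and> norm (c i - c j - c k + c l) \<le> B * s}"

lemma cell_bounds:
  "real (cell i j) * s \<le> \<bar>t i - t j\<bar>" "\<bar>t i - t j\<bar> \<le> (real (cell i j) + 1) * s"
proof -
  have "0 \<le> \<bar>t i - t j\<bar> / s" using s by simp
  then have "real (cell i j) = of_int \<lfloor>\<bar>t i - t j\<bar> / s\<rfloor>" unfolding cell_def by simp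
  then have "real (cell i j) \<le> \<bar>t i - t j\<bar> / s" "\<bar>t i - t j\<bar> / s \<le> real (cell i j) + 1" by linarith+
  then show "real (cell i j) * s \<le> \<bar>t i - t j\<bar>" "\<bar>t i - t j\<bar> \<le> (real (cell i j) + 1) * s"
    using s by (simp_all add: field_simps)
qed

text \<open>Two points on nearly the same ray differ by nearly a multiple of this ray.\<close>

lemma near_difference:
  assumes "i \<in> I" "j \<in> I" "near i j"
  shows "norm (c i - c j - (\<rho> i - \<rho> j) *\<^sub>R ray (t i)) \<le> 6 * B * s"
proof -
  have "c i - c j - (\<rho> i - \<rho> j) *\<^sub>R ray (t i) = (c i - \<rho> i *\<^sub>R ray (t i)) - (c j - \<rho> j *\<^sub>R ray (t j)) + \<rho> j *\<^sub>R (ray (t i) - ray (t j))"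
    by (simp add: algebra_simps)
  also have "norm \<dots> \<le> norm (c i - \<rho> i *\<^sub>R ray (t i)) + norm (c j - \<rho> j *\<^sub>R ray (t j)) + norm (\<rho> j *\<^sub>R (ray (t i) - ray (t j)))"
    by (meson add_right_mono norm_triangle_ineq norm_triangle_ineq4 order_trans)
  also have "norm (\<rho> j *\<^sub>R (ray (t i) - ray (t j))) \<le> 4 * (B * s)"
    unfolding norm_scaleR using \<rho>[OF assms(2)] assms(3) by (intro mult_mono) (auto simp: near_def)
  finally show ?thesis using c[OF assms(1)] c[OF assms(2)] by simp
qed

text \<open>Transversality of light rays. If \<open>a ray(t\<^sub>i)\<close> and \<open>b ray(t\<^sub>k)\<close> agree up to \<open>O(s)\<close>, then their third coordinates show that \<open>a\<close> and \<open>b\<close> agree up to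
  \<open>O(s)\<close>, and so \<open>|a|\<close> times the distance of the two rays is \<open>O(s)\<close>.\<close>

lemma partner_offset:
  assumes i: "i \<in> I" and k: "k \<in> I" and j: "j \<in> partners i k"
  shows "\<bar>\<rho> i - \<rho> j\<bar> * \<bar>t i - t k\<bar> \<le> 78 * B * s"
proof -
  obtain l where l: "l \<in> I" "near k l" "norm (c i - c j - c k + c l) \<le> B * s" and j': "j \<in> I" "near i j"
    using j by (auto simp: partners_def)
  define a b where "a = \<rho> i - \<rho> j" and "b = \<rho> k - \<rho> l"
  have "a *\<^sub>R ray (t i) - b *\<^sub>R ray (t k) = (c i - c j - c k + c l) - (c i - c j - a *\<^sub>R ray (t i)) + (c k - c l - b *\<^sub>R ray (t k))"
    by (simp add: algebra_simps)
  also have "norm \<dots> \<le> norm (c i - c j - c k + c l) + norm (c i - c j - a *\<^sub>R ray (t i)) + norm (c k - c l - b *\<^sub>R ray (t k))"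
    by (meson add_right_mono norm_triangle_ineq norm_triangle_ineq4 order_trans)
  finally have ab: "norm (a *\<^sub>R ray (t i) - b *\<^sub>R ray (t k)) \<le> 13 * B * s"
    using near_difference[OF i j'(1,2)] near_difference[OF k l(1,2)] l(3) by (simp add: a_def b_def)
  have "\<bar>(a *\<^sub>R ray (t i) - b *\<^sub>R ray (t k)) $ 3\<bar> \<le> 13 * B * s"
    by (rule order_trans[OF component_le_norm_cart ab])
  then have d: "\<bar>a - b\<bar> \<le> 13 * B * s" by simp
  have "a *\<^sub>R (ray (t i) - ray (t k)) = (a *\<^sub>R ray (t i) - b *\<^sub>R ray (t k)) - (a - b) *\<^sub>R ray (t k)"
    by (simp add: algebra_simps)
  then have "norm (a *\<^sub>R (ray (t i) - ray (t k))) \<le> norm (a *\<^sub>R ray (t i) - b *\<^sub>R ray (t k)) + norm ((a - b) *\<^sub>R ray (t k))"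
    by (simp only: norm_triangle_ineq4)
  also have "norm ((a - b) *\<^sub>R ray (t k)) \<le> (13 * B * s) * 2"
    unfolding norm_scaleR using d norm_ray B s by (intro mult_mono) auto
  finally have *: "\<bar>a\<bar> * norm (ray (t i) - ray (t k)) \<le> 39 * B * s" using ab by simp
  have "\<bar>t i - t k\<bar> \<le> 1" using t[OF i] t[OF k] by linarith
  from ray_diff_lower[OF this] have "\<bar>a\<bar> * (\<bar>t i - t k\<bar> / 2) \<le> \<bar>a\<bar> * norm (ray (t i) - ray (t k))"
    by (intro mult_left_mono) auto
  with * show ?thesis by (simp add: a_def)
qed

text \<open>By transversality the partners of \<open>i\<close> lie near a segment of the ray through \<open>i\<close> of length \<open>O(1 / (cell i k + 1))\<close>. Cover it by points
  with spacing \<open>s\<close>.\<close>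

lemma card_partners:
  assumes i: "i \<in> I" and k: "k \<in> I"
  shows "real (card (partners i k)) \<le> (320 * B / (s * (real (cell i k) + 1))) * N"
proof -
  define m where "m = real (cell i k)"
  define L where "L = (if cell i k = 0 then 4 else 78 * B / m)"
  have L: "\<bar>\<rho> j - \<rho> i\<bar> \<le> L" if j: "j \<in> partners i k" for j
  proof (cases "cell i k = 0")
    case True
    have "j \<in> I" using j by (auto simp: partners_def)
    then show ?thesis using \<rho>[OF i] \<rho>[of j] by (auto simp: L_def True)
  next
    case False
    then have m: "m \<ge> 1" by (simp add: m_def)
    have "\<bar>\<rho> i - \<rho> j\<bar> * (m * s) \<le> \<bar>\<rho> i - \<rho> j\<bar> * \<bar>t i - t k\<bar>"
      using cell_bounds(1)[of i k] by (intro mult_left_mono) (auto simp: m_def)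
    then have "\<bar>\<rho> i - \<rho> j\<bar> * m * s \<le> 78 * B * s" using partner_offset[OF i k j] by (simp add: mult.assoc)
    then have "\<bar>\<rho> i - \<rho> j\<bar> * m \<le> 78 * B" using s by simp
    then show ?thesis using m False by (simp add: L_def field_simps abs_minus_commute)
  qed
  have L0: "L \<ge> 0" using B by (auto simp: L_def m_def)
  let ?S = "{-\<lceil>L / s\<rceil>..\<lceil>L / s\<rceil>}"
  have "card (partners i k) \<le> card ?S * N"
  proof (rule card_covered[OF fin _ pack])
    fix j assume j: "j \<in> partners i k"
    then have j': "j \<in> I" "near i j" by (auto simp: partners_def)
    have "norm (c j - (c i + (\<rho> j - \<rho> i) *\<^sub>R ray (t i))) = norm (c i - c j - (\<rho> i - \<rho> j) *\<^sub>R ray (t i))"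
    proof -
      have "c j - (c i + (\<rho> j - \<rho> i) *\<^sub>R ray (t i)) = - (c i - c j - (\<rho> i - \<rho> j) *\<^sub>R ray (t i))"
        by (simp add: algebra_simps)
      then show ?thesis by (simp only: norm_minus_cancel)
    qed
    also have "\<dots> \<le> 6 * B * s" by (rule near_difference[OF i j'])
    finally have "norm (c j - (c i + (\<rho> j - \<rho> i) *\<^sub>R ray (t i))) \<le> 6 * B * s" .
    from segment_cover[OF s(1) L[OF j] norm_ray this]
    obtain n where n: "n \<in> ?S" "norm (c j - (c i + (s * of_int n) *\<^sub>R ray (t i))) \<le> 6 * B * s + 2 * s" by blast
    have "2 * s \<le> 2 * B * s" using B s by simp
    with n j' show "j \<in> I \<and> (\<exists>n\<in>?S. norm (c j - (c i + (s * of_int n) *\<^sub>R ray (t i))) \<le> 8 * B * s)"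
      by (intro conjI bexI[of _ n]) auto
  qed simp
  then have "real (card (partners i k)) \<le> real (card ?S) * N"
    by (simp only: of_nat_mult[symmetric] of_nat_le_iff)
  also have "real (card ?S) \<le> 2 * (L / s) + 3"
  proof -
    have "L / s \<ge> 0" using L0 s by simp
    then have "\<lceil>L / s\<rceil> \<ge> 0" unfolding zero_le_ceiling by linarith
    then have "real (card ?S) = 2 * of_int \<lceil>L / s\<rceil> + 1" by simp
    then show ?thesis using of_int_ceiling_le_add_one[of "L / s"] by linarith
  qed
  also have "2 * (L / s) + 3 \<le> 320 * B / (s * (m + 1))"
  proof (cases "cell i k = 0")
    case True
    have "2 * (L / s) + 3 \<le> 11 / s" using s by (simp add: L_def True field_simps)
    also have "\<dots> \<le> 320 * B / s" using B s by (intro divide_right_mono) auto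
    finally show ?thesis by (simp add: m_def True)
  next
    case False
    then have m: "m \<ge> 1" by (simp add: m_def)
    have "\<bar>t i - t k\<bar> \<le> 1" using t[OF i] t[OF k] by linarith
    then have "m * s \<le> 1" using cell_bounds(1)[of i k] by (simp add: m_def)
    then have "3 \<le> 3 / (m * s)" using m s by (simp add: field_simps)
    also have "\<dots> \<le> 4 * B / (m * s)" using B m s by (intro divide_right_mono) auto
    finally have "2 * (L / s) + 3 \<le> 160 * B / (m * s)"
      using False m s by (simp add: L_def field_simps)
    also have "\<dots> = 320 * B / (2 * m * s)" by simp
    also have "\<dots> \<le> 320 * B / (s * (m + 1))"
    proof (rule divide_left_mono)
      have "s * 1 \<le> s * m" using m s by (intro mult_left_mono) auto
      then show "s * (m + 1) \<le> 2 * m * s" by (simp add: algebra_simps)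
    qed (use m s B in \<open>auto intro!: mult_pos_pos\<close>)
    finally show ?thesis .
  qed
  finally show ?thesis by (simp add: m_def mult_right_mono)
qed

text \<open>The points at a given angular distance from \<open>i\<close> lie near one of two rays, of length at most \<open>4\<close>.\<close>

lemma card_cell:
  assumes i: "i \<in> I"
  shows "real (card {k\<in>I. cell i k = m}) \<le> (22 / s) * N"
proof -
  let ?S = "{True, False} \<times> {-\<lceil>4 / s\<rceil>..\<lceil>4 / s\<rceil>}"
  let ?u = "\<lambda>b. ray (t i + (if b then 1 else -1) * (real m * s))"
  have "card {k\<in>I. cell i k = m} \<le> card ?S * N"
  proof (rule card_covered[OF fin _ pack])
    fix k assume "k \<in> {k\<in>I. cell i k = m}"
    then have k: "k \<in> I" "cell i k = m" by auto
    define b where "b = (t k \<ge> t i)"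
    have "\<bar>t k - (t i + (if b then 1 else -1) * (real m * s))\<bar> \<le> s"
      using cell_bounds[of i k] by (auto simp: b_def k(2) abs_if algebra_simps split: if_splits)
    then have u: "norm (ray (t k) - ?u b) \<le> s" using ray_diff_upper order_trans by blast
    have "c k - (0 + \<rho> k *\<^sub>R ?u b) = (c k - \<rho> k *\<^sub>R ray (t k)) + \<rho> k *\<^sub>R (ray (t k) - ?u b)"
      by (simp add: algebra_simps)
    also have "norm \<dots> \<le> norm (c k - \<rho> k *\<^sub>R ray (t k)) + norm (\<rho> k *\<^sub>R (ray (t k) - ?u b))"
      by (rule norm_triangle_ineq)
    also have "norm (\<rho> k *\<^sub>R (ray (t k) - ?u b)) \<le> 4 * s"
      unfolding norm_scaleR using \<rho>[OF k(1)] u by (intro mult_mono) auto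
    finally have near: "norm (c k - (0 + \<rho> k *\<^sub>R ?u b)) \<le> B * s + 4 * s" using c[OF k(1)] by simp
    have "\<bar>\<rho> k\<bar> \<le> 4" using \<rho>[OF k(1)] by simp
    from segment_cover[OF s(1) this norm_ray near]
    obtain n where n: "n \<in> {-\<lceil>4 / s\<rceil>..\<lceil>4 / s\<rceil>}" "norm (c k - (0 + (s * of_int n) *\<^sub>R ?u b)) \<le> B * s + 4 * s + 2 * s" by blast
    have "s \<le> B * s" using B s by simp
    then have "B * s + 4 * s + 2 * s \<le> 8 * B * s" using s by linarith
    from order_trans[OF n(2) this] have "norm (c k - (case (b, n) of (b, n) \<Rightarrow> 0 + (s * of_int n) *\<^sub>R ?u b)) \<le> 8 * B * s" by (simp only: prod.case)
    with n(1) k(1) show "k \<in> I \<and> (\<exists>x\<in>?S. norm (c k - (case x of (b, n) \<Rightarrow> 0 + (s * of_int n) *\<^sub>R ?u b)) \<le> 8 * B * s)"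
      by (intro conjI bexI[of _ "(b, n)"]) auto
  qed simp
  then have "real (card {k\<in>I. cell i k = m}) \<le> real (card ?S) * N"
    by (simp only: of_nat_mult[symmetric] of_nat_le_iff)
  also have "real (card ?S) \<le> 22 / s"
  proof -
    have "4 / s \<ge> 0" using s by simp
    then have "\<lceil>4 / s\<rceil> \<ge> 0" unfolding zero_le_ceiling by linarith
    then have "real (card ?S) = 2 * (2 * of_int \<lceil>4 / s\<rceil> + 1)" by (simp add: card_cartesian_product)
    also have "\<dots> \<le> 4 * (4 / s) + 6"
    proof -
      have "2 * (2 * x + 1) \<le> 4 * y + 6" if "x \<le> y + 1" for x y :: real using that by (simp add: algebra_simps)
      from this[OF of_int_ceiling_le_add_one] show ?thesis .
    qed
    also have "\<dots> \<le> 22 / s" using s by (simp add: field_simps)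
    finally show ?thesis .
  qed
  finally show ?thesis by (simp add: mult_right_mono)
qed

lemma harmonic_bound: "(\<Sum>m\<le>n. 1 / (real m + 1)) \<le> 1 + ln (real n + 1)"
proof (induction n)
  case (Suc n)
  have "1 / (real n + 2) \<le> ln (real n + 2) - ln (real n + 1)"
  proof -
    have "ln ((real n + 1) / (real n + 2)) \<le> (real n + 1) / (real n + 2) - 1"
      by (rule ln_le_minus_one) simp
    also have "\<dots> = - (1 / (real n + 2))" by (simp add: field_simps)
    finally show ?thesis by (simp add: ln_div)
  qed
  then show ?case using Suc by (simp add: add.commute)
qed simp

text \<open>Choose \<open>k\<close>, then \<open>j\<close> among the partners, then \<open>l\<close>, which is determined up to \<open>N\<close> choices. The
  sum of \<open>1 / (cell i k + 1)\<close> over \<open>k\<close> is a harmonic sum over about \<open>1 / s\<close> cells with \<open>O(1 / s)\<close> points each.\<close>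

theorem card_quads:
  assumes i: "i \<in> I"
  shows "real (card {(j, k, l). (i, j, k, l) \<in> quads}) \<le> 14080 * B * real N ^ 3 / s\<^sup>2 * (1 + ln (1 / s))"
proof -
  have T: "(\<Sum>k\<in>I. 1 / (real (cell i k) + 1)) \<le> (22 / s) * N * (2 * (1 + ln (1 / s)))"
  proof -
    define M where "M = nat \<lfloor>1 / s\<rfloor>"
    have M: "cell i k \<le> M" if "k \<in> I" for k
    proof -
      have "\<bar>t i - t k\<bar> \<le> 1" using t[OF i] t[OF that] by linarith
      then have "\<bar>t i - t k\<bar> / s \<le> 1 / s" using s by (intro divide_right_mono) auto
      then show ?thesis unfolding cell_def M_def by (intro nat_mono floor_mono)
    qed
    have H: "(\<Sum>m\<le>M. 1 / (real m + 1)) \<le> 2 * (1 + ln (1 / s))"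
    proof -
      have "real M \<le> 1 / s" unfolding M_def using s by simp
      moreover have "1 \<le> 1 / s" using s by simp
      ultimately have "real M + 1 \<le> 2 * (1 / s)" by linarith
      then have "ln (real M + 1) \<le> ln (2 * (1 / s))" using s by (subst ln_le_cancel_iff) auto
      also have "\<dots> = ln 2 + ln (1 / s)" using s by (subst ln_mult) auto
      also have "ln 2 \<le> (1::real)" using ln_2_less_1 by simp
      finally have "1 + ln (real M + 1) \<le> 2 + ln (1 / s)" by simp
      moreover have "ln (1 / s) \<ge> 0" using s by (simp add: ln_ge_zero)
      ultimately show ?thesis using harmonic_bound[of M] by simp
    qed
    have "(\<Sum>k\<in>I. 1 / (real (cell i k) + 1)) = (\<Sum>m\<le>M. \<Sum>k\<in>{k\<in>I. cell i k = m}. 1 / (real (cell i k) + 1))"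
      by (rule sum.group[symmetric]) (use M fin in auto)
    also have "\<dots> = (\<Sum>m\<le>M. real (card {k\<in>I. cell i k = m}) * (1 / (real m + 1)))"
      by (intro sum.cong) auto
    also have "\<dots> \<le> (\<Sum>m\<le>M. (22 / s) * N * (1 / (real m + 1)))"
      by (intro sum_mono mult_right_mono card_cell[OF i]) auto
    also have "\<dots> = (22 / s) * N * (\<Sum>m\<le>M. 1 / (real m + 1))" by (simp only: sum_distrib_left)
    also have "\<dots> \<le> (22 / s) * N * (2 * (1 + ln (1 / s)))"
      using s by (intro mult_left_mono H) auto
    finally show ?thesis .
  qed
  have sub: "{(j, k, l). (i, j, k, l) \<in> quads} \<subseteq> (\<Union>k\<in>I. \<Union>j\<in>partners i k. (\<lambda>l. (j, k, l)) ` {l\<in>I. norm (c l - (c k + c j - c i)) \<le> 8 * B * s})"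
  proof safe
    fix j k l assume "(i, j, k, l) \<in> quads"
    then have q: "j \<in> I" "k \<in> I" "l \<in> I" "near i j" "near k l" "norm (c i - c j - c k + c l) \<le> B * s"
      by (auto simp: quads_def)
    have eq: "c l - (c k + c j - c i) = c i - c j - c k + c l" by simp
    have "0 \<le> B * s" using B s by simp
    then have "norm (c l - (c k + c j - c i)) \<le> 8 * B * s" using q(6) unfolding eq by linarith
    then show "(j, k, l) \<in> (\<Union>k\<in>I. \<Union>j\<in>partners i k. (\<lambda>l. (j, k, l)) ` {l\<in>I. norm (c l - (c k + c j - c i)) \<le> 8 * B * s})"
      using q unfolding partners_def by blast
  qed
  have finp: "finite (partners i k)" for k unfolding partners_def using fin by simp
  have "card {(j, k, l). (i, j, k, l) \<in> quads} \<le> card (\<Union>k\<in>I. \<Union>j\<in>partners i k. (\<lambda>l. (j, k, l)) ` {l\<in>I. norm (c l - (c k + c j - c i)) \<le> 8 * B * s})"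
    using sub fin finp by (intro card_mono) auto
  also have "\<dots> \<le> (\<Sum>k\<in>I. card (\<Union>j\<in>partners i k. (\<lambda>l. (j, k, l)) ` {l\<in>I. norm (c l - (c k + c j - c i)) \<le> 8 * B * s}))"
    by (rule card_UN_le[OF fin])
  also have "\<dots> \<le> (\<Sum>k\<in>I. \<Sum>j\<in>partners i k. card ((\<lambda>l. (j, k, l)) ` {l\<in>I. norm (c l - (c k + c j - c i)) \<le> 8 * B * s}))"
    by (intro sum_mono card_UN_le finp)
  also have "\<dots> \<le> (\<Sum>k\<in>I. \<Sum>j\<in>partners i k. N)"
    by (intro sum_mono order_trans[OF card_image_le pack]) (use fin in simp)
  finally have "card {(j, k, l). (i, j, k, l) \<in> quads} \<le> (\<Sum>k\<in>I. card (partners i k) * N)" by simp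
  then have "real (card {(j, k, l). (i, j, k, l) \<in> quads}) \<le> real (\<Sum>k\<in>I. card (partners i k) * N)"
    by (rule of_nat_mono)
  also have "\<dots> = (\<Sum>k\<in>I. real (card (partners i k)) * N)" by simp
  also have "\<dots> \<le> (\<Sum>k\<in>I. (320 * B / (s * (real (cell i k) + 1))) * N * N)"
    by (intro sum_mono mult_right_mono card_partners[OF i]) auto
  also have "\<dots> = (320 * B * (real N)\<^sup>2 / s) * (\<Sum>k\<in>I. 1 / (real (cell i k) + 1))"
    unfolding sum_distrib_left by (intro sum.cong refl) (simp add: power2_eq_square mult_ac)
  also have "\<dots> \<le> (320 * B * (real N)\<^sup>2 / s) * ((22 / s) * N * (2 * (1 + ln (1 / s))))"
    using B s by (intro mult_left_mono T) auto
  also have "\<dots> = 14080 * B * real N ^ 3 / s\<^sup>2 * (1 + ln (1 / s))"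
    by (simp add: power2_eq_square power3_eq_cube)
  finally show ?thesis .
qed

end

section \<open>Almost orthogonality in \<open>L\<^sup>2\<close> and the square function in \<open>L\<^sup>4\<close>\<close>

text \<open>Applied once or twice, it yields the convolution bounds for the exponents \<open>2\<close> and \<open>4\<close> without general Young or Minkowski inequalities.\<close>

lemma nn_Cauchy_Schwarz_weighted:
  fixes a b :: "'a::euclidean_space \<Rightarrow> real"
  assumes [measurable]: "a \<in> borel_measurable borel" "b \<in> borel_measurable borel"
    and nn: "\<And>y. a y \<ge> 0" "\<And>y. b y \<ge> 0"
  shows "(\<integral>\<^sup>+y. ennreal (a y * b y) \<partial>lborel)\<^sup>2 \<le> (\<integral>\<^sup>+y. ennreal (b y) \<partial>lborel) * (\<integral>\<^sup>+y. ennreal ((a y)\<^sup>2 * b y) \<partial>lborel)"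
proof -
  have "(\<integral>\<^sup>+y. ennreal (sqrt (b y)) * ennreal (a y * sqrt (b y)) \<partial>lborel)\<^sup>2
      \<le> (\<integral>\<^sup>+y. (ennreal (sqrt (b y)))\<^sup>2 \<partial>lborel) * (\<integral>\<^sup>+y. (ennreal (a y * sqrt (b y)))\<^sup>2 \<partial>lborel)"
    by (rule Cauchy_Schwarz_nn_integral) measurable
  moreover have "ennreal (sqrt (b y)) * ennreal (a y * sqrt (b y)) = ennreal (a y * b y)" for y
    using nn[of y] by (simp add: ennreal_mult[symmetric] mult_ac)
  moreover have "(ennreal (sqrt (b y)))\<^sup>2 = ennreal (b y)" "(ennreal (a y * sqrt (b y)))\<^sup>2 = ennreal ((a y)\<^sup>2 * b y)" for y
    using nn[of y] by (simp_all add: ennreal_power power_mult_distrib)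
  ultimately show ?thesis by simp
qed

lemma nn_integral_conv:
  fixes a b :: "'a::euclidean_space \<Rightarrow> real"
  assumes [measurable]: "a \<in> borel_measurable borel" "b \<in> borel_measurable borel"
    and nn: "\<And>y. a y \<ge> 0" "\<And>y. b y \<ge> 0"
  shows "(\<integral>\<^sup>+x. (\<integral>\<^sup>+y. ennreal (a y * b (x - y)) \<partial>lborel) \<partial>lborel) = (\<integral>\<^sup>+y. ennreal (a y) \<partial>lborel) * (\<integral>\<^sup>+y. ennreal (b y) \<partial>lborel)"
proof -
  have sh: "(\<integral>\<^sup>+x. ennreal (b (x - y)) \<partial>lborel) = (\<integral>\<^sup>+x. ennreal (b x) \<partial>lborel)" for y
  proof -
    have "(\<integral>\<^sup>+x. ennreal (b x) \<partial>lborel) = (\<integral>\<^sup>+x. ennreal (b x) \<partial>distr lborel borel ((+) (- y)))"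
      by (simp only: lborel_distr_plus)
    then show ?thesis by (simp add: nn_integral_distr)
  qed
  have "(\<integral>\<^sup>+x. (\<integral>\<^sup>+y. ennreal (a y * b (x - y)) \<partial>lborel) \<partial>lborel) = (\<integral>\<^sup>+y. (\<integral>\<^sup>+x. ennreal (a y * b (x - y)) \<partial>lborel) \<partial>lborel)"
    by (rule lborel_pair.Fubini') measurable
  also have "\<dots> = (\<integral>\<^sup>+y. ennreal (a y) * (\<integral>\<^sup>+x. ennreal (b x) \<partial>lborel) \<partial>lborel)"
    using nn by (simp add: ennreal_mult nn_integral_cmult sh)
  also have "\<dots> = (\<integral>\<^sup>+y. ennreal (a y) \<partial>lborel) * (\<integral>\<^sup>+y. ennreal (b y) \<partial>lborel)"
    by (simp add: nn_integral_multc)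
  finally show ?thesis .
qed

lemma
  fixes f u :: "'a::euclidean_space \<Rightarrow> complex"
  assumes f [measurable]: "f \<in> borel_measurable borel" and u: "integrable lborel u"
  defines "A \<equiv> ennreal (LINT x|lborel. norm (u x))"
  shows conv_L2_bound: "(\<integral>\<^sup>+x. ennreal (norm (conv f u x) ^ 2) \<partial>lborel) \<le> A ^ 2 * (\<integral>\<^sup>+x. ennreal (norm (f x) ^ 2) \<partial>lborel)"
    and conv_L4_bound: "(\<integral>\<^sup>+x. ennreal (norm (conv f u x) ^ 4) \<partial>lborel) \<le> A ^ 4 * (\<integral>\<^sup>+x. ennreal (norm (f x) ^ 4) \<partial>lborel)"
proof -
  have [measurable]: "u \<in> borel_measurable borel" using u by auto
  define T where "T p x = (\<integral>\<^sup>+y. ennreal (norm (f y) ^ p * norm (u (x - y))) \<partial>lborel)" for p :: nat and x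
  have [measurable]: "T p \<in> borel_measurable borel" for p unfolding T_def by measurable
  have A: "(\<integral>\<^sup>+y. ennreal (norm (u y)) \<partial>lborel) = A"
    unfolding A_def using u by (intro nn_integral_eq_integral integrable_norm) auto
  have A': "(\<integral>\<^sup>+y. ennreal (norm (u (x - y))) \<partial>lborel) = A" for x
  proof -
    have "(\<integral>\<^sup>+y. ennreal (norm (u (x - y))) \<partial>lborel) = ennreal (LINT y|lborel. norm (u (x - y)))"
      using lborel_integrable_reflect[OF _ u, of x] by (intro nn_integral_eq_integral integrable_norm) auto
    then show ?thesis unfolding A_def by (subst (asm) lborel_integral_reflect[of "\<lambda>y. norm (u y)"]) auto
  qed
  have TT: "(\<integral>\<^sup>+x. T p x \<partial>lborel) = (\<integral>\<^sup>+x. ennreal (norm (f x) ^ p) \<partial>lborel) * A" for p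
    unfolding T_def by (subst nn_integral_conv) (auto simp: A)
  have CS: "(T p x)\<^sup>2 \<le> A * T (2 * p) x" for p x
  proof -
    have "(\<integral>\<^sup>+y. ennreal (norm (f y) ^ p * norm (u (x - y))) \<partial>lborel)\<^sup>2
       \<le> (\<integral>\<^sup>+y. ennreal (norm (u (x - y))) \<partial>lborel) * (\<integral>\<^sup>+y. ennreal ((norm (f y) ^ p)\<^sup>2 * norm (u (x - y))) \<partial>lborel)"
      by (rule nn_Cauchy_Schwarz_weighted) simp_all
    then show ?thesis unfolding A' T_def by (simp add: power_mult[symmetric] mult.commute)
  qed
  have le: "ennreal (norm (conv f u x)) \<le> T 1 x" for x
  proof (cases "integrable lborel (\<lambda>y. f y * u (x - y))")
    case True
    from integral_norm_bound_ennreal[OF this] show ?thesis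
      by (simp add: conv_def T_def norm_mult)
  next
    case False
    then show ?thesis by (simp add: conv_def not_integrable_integral_eq)
  qed
  have le2: "ennreal (norm (conv f u x) ^ 2) \<le> A * T 2 x" for x
  proof -
    have "ennreal (norm (conv f u x) ^ 2) = (ennreal (norm (conv f u x))) ^ 2" by (simp add: ennreal_power)
    also have "\<dots> \<le> (T 1 x) ^ 2" by (intro power_mono le) auto
    also have "\<dots> \<le> A * T 2 x" using CS[of 1 x] by simp
    finally show ?thesis .
  qed
  have le4: "ennreal (norm (conv f u x) ^ 4) \<le> A ^ 3 * T 4 x" for x
  proof -
    have "ennreal (norm (conv f u x) ^ 4) = (ennreal (norm (conv f u x) ^ 2)) ^ 2" by (simp add: ennreal_power power_mult[symmetric])
    also have "\<dots> \<le> (A * T 2 x) ^ 2" by (intro power_mono le2) auto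
    also have "\<dots> = A ^ 2 * (T 2 x) ^ 2" by (rule power_mult_distrib)
    also have "\<dots> \<le> A ^ 2 * (A * T 4 x)" using CS[of 2 x] by (intro mult_left_mono) auto
    also have "\<dots> = A ^ 3 * T 4 x" by (simp add: power2_eq_square power3_eq_cube mult.assoc)
    finally show ?thesis .
  qed
  have "(\<integral>\<^sup>+x. ennreal (norm (conv f u x) ^ 2) \<partial>lborel) \<le> (\<integral>\<^sup>+x. A * T 2 x \<partial>lborel)" by (intro nn_integral_mono le2)
  also have "\<dots> = A ^ 2 * (\<integral>\<^sup>+x. ennreal (norm (f x) ^ 2) \<partial>lborel)"
    by (simp add: nn_integral_cmult TT power2_eq_square mult_ac)
  finally show "(\<integral>\<^sup>+x. ennreal (norm (conv f u x) ^ 2) \<partial>lborel) \<le> A ^ 2 * (\<integral>\<^sup>+x. ennreal (norm (f x) ^ 2) \<partial>lborel)" .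
  have "(\<integral>\<^sup>+x. ennreal (norm (conv f u x) ^ 4) \<partial>lborel) \<le> (\<integral>\<^sup>+x. A ^ 3 * T 4 x \<partial>lborel)" by (intro nn_integral_mono le4)
  also have "\<dots> = A ^ 4 * (\<integral>\<^sup>+x. ennreal (norm (f x) ^ 4) \<partial>lborel)"
    by (simp add: nn_integral_cmult TT mult_ac eval_nat_numeral)
  finally show "(\<integral>\<^sup>+x. ennreal (norm (conv f u x) ^ 4) \<partial>lborel) \<le> A ^ 4 * (\<integral>\<^sup>+x. ennreal (norm (f x) ^ 4) \<partial>lborel)" .
qed

lemma schwartz_mult_integrable:
  assumes "schwartz F" "g \<in> borel_measurable borel" "\<And>x. norm (g x) \<le> C"
  shows "integrable lborel (\<lambda>x. F x * g x)"
  using assms by (intro integrable_mult_bounded[OF schwartz_integrable]) auto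

lemma schwartz_power_integrable:
  assumes "schwartz F" "n \<ge> 1"
  shows "integrable lborel (\<lambda>x. norm (F x) ^ n)"
proof -
  obtain B where B: "\<And>x. norm (F x) \<le> B" using schwartz_bounded[OF assms(1)] by blast
  have [measurable]: "F \<in> borel_measurable borel" by (rule schwartz_measurable[OF assms(1)])
  obtain k where n: "n = Suc k" using assms(2) by (cases n) auto
  have "integrable lborel (\<lambda>x. F x * of_real (norm (F x) ^ k))"
    by (rule schwartz_mult_integrable[OF assms(1), of _ "B ^ k"]) (auto simp: norm_power intro!: power_mono B)
  then have "integrable lborel (\<lambda>x. norm (F x * of_real (norm (F x) ^ k)))" by (rule integrable_norm)
  then show ?thesis by (simp add: n norm_mult norm_power)
qed

lemma spec_pair:
  "spec c r u \<Longrightarrow> spec d r v \<Longrightarrow> spec (c - d) (2 * r) (\<lambda>x. u x * cnj (v x))"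
  using spec_mult[of c r u "- d" r "\<lambda>x. cnj (v x)"] spec_cnj[of d r v] by simp

text \<open>The mixed terms vanish when the frequency balls are disjoint; the remaining ones are bounded by the arithmetic mean of
  the two squares, and every index occurs in at most \<open>N\<close> of them on either side.\<close>

lemma almost_orthogonality:
  assumes fin: "finite I" and G: "\<And>i. i \<in> I \<Longrightarrow> schwartz (G i)" and sp: "\<And>i. i \<in> I \<Longrightarrow> spec (c i) r (G i)"
    and N: "\<And>i. i \<in> I \<Longrightarrow> card {j\<in>I. norm (c j - c i) \<le> 2 * r} \<le> N"
  shows "(LINT x|lborel. norm (\<Sum>i\<in>I. G i x) ^ 2) \<le> real N * (\<Sum>i\<in>I. LINT x|lborel. norm (G i x) ^ 2)"
proof -
  define a where "a i = (LINT x|lborel. norm (G i x) ^ 2)" for i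
  have a0: "a i \<ge> 0" for i by (auto simp: a_def)
  define V where "V i j = (LINT x|lborel. G i x * cnj (G j x))" for i j
  have int: "integrable lborel (\<lambda>x. G i x * cnj (G j x))" if ij: "i \<in> I" "j \<in> I" for i j
  proof -
    obtain B where "\<And>x. norm (G j x) \<le> B" using schwartz_bounded[OF G[OF ij(2)]] by blast
    moreover have [measurable]: "G j \<in> borel_measurable borel" by (rule schwartz_measurable[OF G[OF ij(2)]])
    ultimately show ?thesis by (intro schwartz_mult_integrable[OF G[OF ij(1)]]) auto
  qed
  have V0: "V i j = 0" if "i \<in> I" "j \<in> I" "norm (c j - c i) > 2 * r" for i j
    unfolding V_def using that by (intro spec_integral_eq_0[OF spec_pair[OF sp sp] int]) (auto simp: norm_minus_commute)
  have Vle: "norm (V i j) \<le> (a i + a j) / 2" if ij: "i \<in> I" "j \<in> I" for i j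
  proof -
    have "norm (V i j) \<le> (LINT x|lborel. (norm (G i x) ^ 2 + norm (G j x) ^ 2) / 2)"
      unfolding V_def
    proof (rule Bochner_Integration.integral_norm_bound_integral[OF int[OF ij]])
      show "integrable lborel (\<lambda>x. (norm (G i x) ^ 2 + norm (G j x) ^ 2) / 2)"
        using schwartz_power_integrable[OF G[OF ij(1)], of 2] schwartz_power_integrable[OF G[OF ij(2)], of 2] by auto
      show "norm (G i x * cnj (G j x)) \<le> (norm (G i x) ^ 2 + norm (G j x) ^ 2) / 2" for x
        using sum_squares_bound[of "norm (G i x)" "norm (G j x)"] by (simp add: norm_mult)
    qed
    also have "\<dots> = (a i + a j) / 2"
      unfolding a_def using schwartz_power_integrable[OF G[OF ij(1)], of 2] schwartz_power_integrable[OF G[OF ij(2)], of 2] by simp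
    finally show ?thesis .
  qed
  have pt: "of_real (norm (\<Sum>i\<in>I. G i x) ^ 2) = (\<Sum>i\<in>I. \<Sum>j\<in>I. G i x * cnj (G j x))" for x
    unfolding complex_norm_square cnj_sum sum_product ..
  have "of_real (LINT x|lborel. norm (\<Sum>i\<in>I. G i x) ^ 2) = (LINT x|lborel. complex_of_real (norm (\<Sum>i\<in>I. G i x) ^ 2))"
    by (rule integral_complex_of_real[symmetric])
  also have "\<dots> = (\<Sum>i\<in>I. \<Sum>j\<in>I. V i j)"
    unfolding pt V_def using int by (simp add: Bochner_Integration.integral_sum)
  finally have eq: "complex_of_real (LINT x|lborel. norm (\<Sum>i\<in>I. G i x) ^ 2) = (\<Sum>i\<in>I. \<Sum>j\<in>I. V i j)" .
  have "(LINT x|lborel. norm (\<Sum>i\<in>I. G i x) ^ 2) \<le> norm (complex_of_real (LINT x|lborel. norm (\<Sum>i\<in>I. G i x) ^ 2))"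
    unfolding norm_of_real by (rule abs_ge_self)
  also have "\<dots> = norm (\<Sum>i\<in>I. \<Sum>j\<in>I. V i j)" unfolding eq ..
  also have "\<dots> \<le> (\<Sum>i\<in>I. \<Sum>j\<in>I. norm (V i j))"
    by (intro order_trans[OF norm_sum] sum_mono norm_sum)
  also have "\<dots> \<le> (\<Sum>i\<in>I. \<Sum>j\<in>I. if norm (c j - c i) \<le> 2 * r then (a i + a j) / 2 else 0)"
    using V0 Vle by (intro sum_mono) (auto simp: not_le)
  also have "\<dots> = (\<Sum>i\<in>I. \<Sum>j\<in>I. if norm (c j - c i) \<le> 2 * r then a i / 2 else 0)
      + (\<Sum>i\<in>I. \<Sum>j\<in>I. if norm (c j - c i) \<le> 2 * r then a j / 2 else 0)"
    unfolding sum.distrib[symmetric] by (intro sum.cong refl) (simp add: add_divide_distrib)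
  also have "(\<Sum>i\<in>I. \<Sum>j\<in>I. if norm (c j - c i) \<le> 2 * r then a j / 2 else 0)
      = (\<Sum>i\<in>I. \<Sum>j\<in>I. if norm (c j - c i) \<le> 2 * r then a i / 2 else 0)"
    by (subst sum.swap) (simp add: norm_minus_commute)
  also have "(\<Sum>i\<in>I. \<Sum>j\<in>I. if norm (c j - c i) \<le> 2 * r then a i / 2 else 0) = (\<Sum>i\<in>I. real (card {j\<in>I. norm (c j - c i) \<le> 2 * r}) * (a i / 2))"
    using fin by (intro sum.cong refl) (simp add: sum.If_cases Int_def)
  also have "\<dots> \<le> (\<Sum>i\<in>I. real N * (a i / 2))"
    using N a0 by (intro sum_mono mult_right_mono) auto
  finally show ?thesis
    by (simp add: a_def[symmetric] sum_distrib_left sum.distrib[symmetric])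
qed

text \<open>It replaces Hoelder's inequality for four factors.\<close>

lemma four_product_le: "(w::real) * x * y * z \<le> (w ^ 4 + x ^ 4 + y ^ 4 + z ^ 4) / 4"
proof -
  have "2 * (w * x) * (y * z) \<le> (w * x)\<^sup>2 + (y * z)\<^sup>2" by (rule sum_squares_bound)
  moreover have "2 * w\<^sup>2 * x\<^sup>2 \<le> (w\<^sup>2)\<^sup>2 + (x\<^sup>2)\<^sup>2" "2 * y\<^sup>2 * z\<^sup>2 \<le> (y\<^sup>2)\<^sup>2 + (z\<^sup>2)\<^sup>2" by (rule sum_squares_bound)+
  ultimately show ?thesis by (simp add: power_mult_distrib power_mult[symmetric] mult.assoc)
qed

context cone_points
begin

lemma finite_quads: "finite quads"
proof (rule finite_subset)
  show "quads \<subseteq> I \<times> I \<times> I \<times> I" by (auto simp: quads_def)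
qed (use fin in simp)

lemma near_commute: "near i j \<longleftrightarrow> near j i"
  by (simp add: near_def norm_minus_commute)

lemma quads_swap: "(i, j, k, l) \<in> quads \<longleftrightarrow> (j, i, l, k) \<in> quads" "(i, j, k, l) \<in> quads \<longleftrightarrow> (k, l, i, j) \<in> quads"
proof -
  have "c j - c i - c l + c k = - (c i - c j - c k + c l)" "c k - c l - c i + c j = - (c i - c j - c k + c l)" by simp_all
  then have "norm (c j - c i - c l + c k) = norm (c i - c j - c k + c l)" "norm (c k - c l - c i + c j) = norm (c i - c j - c k + c l)"
    by (simp_all only: norm_minus_cancel)
  then show "(i, j, k, l) \<in> quads \<longleftrightarrow> (j, i, l, k) \<in> quads" "(i, j, k, l) \<in> quads \<longleftrightarrow> (k, l, i, j) \<in> quads"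
    unfolding quads_def using near_commute by auto
qed

text \<open>The set of quadruples is symmetric enough to move each of the four entries to the front, so the count for a fixed
  first entry suffices.\<close>

lemma sum_quads_le:
  assumes a: "\<And>i. i \<in> I \<Longrightarrow> a i \<ge> 0"
  shows "(\<Sum>(i, j, k, l)\<in>quads. (a i + a j + a k + a l) / 4) \<le> 14080 * B * real N ^ 3 / s\<^sup>2 * (1 + ln (1 / s)) * (\<Sum>i\<in>I. a i)"
proof -
  let ?f = "\<lambda>(i, j, k, l). a i :: real"
  have 2: "(\<Sum>(i, j, k, l)\<in>quads. a j) = (\<Sum>q\<in>quads. ?f q)"
    by (rule sum.reindex_bij_witness[of _ "\<lambda>(i, j, k, l). (j, i, l, k)" "\<lambda>(i, j, k, l). (j, i, l, k)"])
       (auto simp: quads_swap(1)[symmetric])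
  have 3: "(\<Sum>(i, j, k, l)\<in>quads. a k) = (\<Sum>q\<in>quads. ?f q)"
    by (rule sum.reindex_bij_witness[of _ "\<lambda>(i, j, k, l). (k, l, i, j)" "\<lambda>(i, j, k, l). (k, l, i, j)"])
       (auto simp: quads_swap(2)[symmetric])
  have 4: "(\<Sum>(i, j, k, l)\<in>quads. a l) = (\<Sum>(i, j, k, l)\<in>quads. a k)"
    by (rule sum.reindex_bij_witness[of _ "\<lambda>(i, j, k, l). (j, i, l, k)" "\<lambda>(i, j, k, l). (j, i, l, k)"])
       (auto simp: quads_swap(1)[symmetric])
  have "(\<Sum>(i, j, k, l)\<in>quads. (a i + a j + a k + a l) / 4) =
      ((\<Sum>(i, j, k, l)\<in>quads. a i) + (\<Sum>(i, j, k, l)\<in>quads. a j) + (\<Sum>(i, j, k, l)\<in>quads. a k) + (\<Sum>(i, j, k, l)\<in>quads. a l)) / 4"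
    unfolding sum.distrib[symmetric] sum_divide_distrib by (intro sum.cong refl) (simp split: prod.split)
  also have "\<dots> = (\<Sum>q\<in>quads. ?f q)" unfolding 4 2 3 by simp
  also have "\<dots> = (\<Sum>i\<in>I. \<Sum>q\<in>{q\<in>quads. fst q = i}. ?f q)"
    by (rule sum.group[symmetric]) (use finite_quads fin in \<open>auto simp: quads_def\<close>)
  also have "\<dots> = (\<Sum>i\<in>I. real (card {(j, k, l). (i, j, k, l) \<in> quads}) * a i)"
  proof (rule sum.cong[OF refl])
    fix i
    have "{q\<in>quads. fst q = i} = Pair i ` {(j, k, l). (i, j, k, l) \<in> quads}" by (auto simp: image_iff)
    then have "card {q\<in>quads. fst q = i} = card {(j, k, l). (i, j, k, l) \<in> quads}"
      by (simp add: card_image inj_on_def)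
    moreover have "(\<Sum>q\<in>{q\<in>quads. fst q = i}. ?f q) = (\<Sum>q\<in>{q\<in>quads. fst q = i}. a i)"
      by (rule sum.cong) auto
    ultimately show "(\<Sum>q\<in>{q\<in>quads. fst q = i}. ?f q) = real (card {(j, k, l). (i, j, k, l) \<in> quads}) * a i" by simp
  qed
  also have "\<dots> \<le> (\<Sum>i\<in>I. 14080 * B * real N ^ 3 / s\<^sup>2 * (1 + ln (1 / s)) * a i)"
    by (intro sum_mono mult_right_mono card_quads a)
  finally show ?thesis by (simp add: sum_distrib_left)
qed

text \<open>Expand the square of the square function into products of four functions. The integral of a product vanishes unless the
  quadruple belongs to \<open>quads\<close>, and otherwise it is at most the mean of the four \<open>L\<^sup>4\<close> integrals.\<close>

theorem square_function_L4:
  assumes G: "\<And>i. i \<in> I \<Longrightarrow> schwartz (G i)" and sp: "\<And>i. i \<in> I \<Longrightarrow> spec (c i) (B * s / 4) (G i)"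
    and close: "\<And>i j. i \<in> I \<Longrightarrow> j \<in> I \<Longrightarrow> \<tau> i = \<tau> j \<Longrightarrow> near i j"
  shows "(LINT x|lborel. (\<Sum>k\<in>T. (norm (\<Sum>i\<in>{i\<in>I. \<tau> i = k}. G i x))\<^sup>2)\<^sup>2)
     \<le> 14080 * B * real N ^ 3 / s\<^sup>2 * (1 + ln (1 / s)) * (\<Sum>i\<in>I. LINT x|lborel. norm (G i x) ^ 4)"
proof (cases "finite T")
  case False
  have "1 \<le> 1 / s" using s by simp
  then have "ln (1 / s) \<ge> 0" by (rule ln_ge_zero)
  then have "0 \<le> 14080 * B * real N ^ 3 / s\<^sup>2 * (1 + ln (1 / s)) * (\<Sum>i\<in>I. LINT x|lborel. norm (G i x) ^ 4)"
    using B by (intro mult_nonneg_nonneg divide_nonneg_nonneg sum_nonneg) auto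
  moreover have "(LINT x|lborel. (\<Sum>k\<in>T. (norm (\<Sum>i\<in>{i\<in>I. \<tau> i = k}. G i x))\<^sup>2)\<^sup>2) = 0"
    using False by simp
  ultimately show ?thesis by (simp only:)
next
  case True
  define a where "a i = (LINT x|lborel. norm (G i x) ^ 4)" for i
  \<comment> \<open>The pairs that share a plank; the square function is a sum over them.\<close>
  define P where "P = {(i, j). i \<in> I \<and> j \<in> I \<and> \<tau> i = \<tau> j \<and> \<tau> i \<in> T}"
  define V where "V p q = (LINT x|lborel. (G (fst p) x * cnj (G (snd p) x)) * cnj (G (fst q) x * cnj (G (snd q) x)))" for p q
  define S where "S x = (\<Sum>k\<in>T. (norm (\<Sum>i\<in>{i\<in>I. \<tau> i = k}. G i x))\<^sup>2)" for x
  have finP: "finite P" by (rule finite_subset[of _ "I \<times> I"]) (auto simp: P_def fin)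
  have S: "of_real (S x) = (\<Sum>p\<in>P. G (fst p) x * cnj (G (snd p) x))" for x
  proof -
    have "of_real (S x) = (\<Sum>k\<in>T. \<Sum>i\<in>{i\<in>I. \<tau> i = k}. \<Sum>j\<in>{i\<in>I. \<tau> i = k}. G i x * cnj (G j x))"
      unfolding S_def of_real_sum complex_norm_square cnj_sum sum_product ..
    also have "\<dots> = (\<Sum>k\<in>T. \<Sum>p\<in>{i\<in>I. \<tau> i = k} \<times> {i\<in>I. \<tau> i = k}. G (fst p) x * cnj (G (snd p) x))"
      by (simp add: sum.cartesian_product case_prod_beta)
    also have "\<dots> = (\<Sum>p\<in>(\<Union>k\<in>T. {i\<in>I. \<tau> i = k} \<times> {i\<in>I. \<tau> i = k}). G (fst p) x * cnj (G (snd p) x))"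
      by (rule sum.UNION_disjoint[symmetric]) (use True fin in auto)
    also have "(\<Union>k\<in>T. {i\<in>I. \<tau> i = k} \<times> {i\<in>I. \<tau> i = k}) = P" by (auto simp: P_def)
    finally show ?thesis .
  qed
  have SS: "of_real ((S x)\<^sup>2) = (\<Sum>p\<in>P. \<Sum>q\<in>P. (G (fst p) x * cnj (G (snd p) x)) * cnj (G (fst q) x * cnj (G (snd q) x)))" for x
  proof -
    have "of_real ((S x)\<^sup>2) = of_real (S x) * cnj (of_real (S x))" by (simp add: power2_eq_square)
    then show ?thesis unfolding S cnj_sum sum_product .
  qed
  have meas: "G i \<in> borel_measurable borel" if "i \<in> I" for i by (rule schwartz_measurable[OF G[OF that]])
  have int: "integrable lborel (\<lambda>x. (G i x * cnj (G j x)) * cnj (G k x * cnj (G l x)))" if ijkl: "i \<in> I" "j \<in> I" "k \<in> I" "l \<in> I" for i j k l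
  proof -
    note [measurable] = meas[OF ijkl(1)] meas[OF ijkl(2)] meas[OF ijkl(3)] meas[OF ijkl(4)]
    obtain b2 b3 b4 where b: "\<And>x. norm (G j x) \<le> b2" "\<And>x. norm (G k x) \<le> b3" "\<And>x. norm (G l x) \<le> b4"
    proof -
      obtain b2 where "\<And>x. norm (G j x) \<le> b2" using schwartz_bounded[OF G[OF ijkl(2)]] by blast
      moreover obtain b3 where "\<And>x. norm (G k x) \<le> b3" using schwartz_bounded[OF G[OF ijkl(3)]] by blast
      moreover obtain b4 where "\<And>x. norm (G l x) \<le> b4" using schwartz_bounded[OF G[OF ijkl(4)]] by blast
      ultimately show thesis by (rule that)
    qed
    have "norm (cnj (G j x) * cnj (G k x * cnj (G l x))) \<le> b2 * (b3 * b4)" for x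
      unfolding norm_mult complex_mod_cnj by (intro mult_mono b) (auto intro: order_trans[OF norm_ge_zero b(1)] order_trans[OF norm_ge_zero b(2)])
    from schwartz_mult_integrable[OF G[OF ijkl(1)] _ this] show ?thesis by (simp add: mult.assoc)
  qed
  have V0: "(fst p, snd p, fst q, snd q) \<in> quads" if "p \<in> P" "q \<in> P" "V p q \<noteq> 0" for p q
  proof -
    obtain i j k l where pq: "p = (i, j)" "q = (k, l)" by (cases p; cases q)
    then have I: "i \<in> I" "j \<in> I" "k \<in> I" "l \<in> I" and nr: "near i j" "near k l"
      using that(1,2) close by (auto simp: P_def)
    have "spec ((c i - c j) - (c k - c l)) (2 * (2 * (B * s / 4))) (\<lambda>x. (G i x * cnj (G j x)) * cnj (G k x * cnj (G l x)))"
      by (intro spec_pair sp I)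
    then have "spec (c i - c j - c k + c l) (B * s) (\<lambda>x. (G i x * cnj (G j x)) * cnj (G k x * cnj (G l x)))"
      by (simp add: algebra_simps)
    from spec_integral_eq_0[OF this int[OF I]] have "\<not> norm (c i - c j - c k + c l) > B * s"
      using that(3) by (auto simp: V_def pq)
    then show ?thesis using I nr by (auto simp: quads_def pq)
  qed
  have Vle: "norm (V p q) \<le> (a (fst p) + a (snd p) + a (fst q) + a (snd q)) / 4" if "p \<in> P" "q \<in> P" for p q
  proof -
    obtain i j k l where pq: "p = (i, j)" "q = (k, l)" by (cases p; cases q)
    then have I: "i \<in> I" "j \<in> I" "k \<in> I" "l \<in> I" using that by (auto simp: P_def)
    note pw = schwartz_power_integrable[OF G[OF I(1)], of 4] schwartz_power_integrable[OF G[OF I(2)], of 4]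
      schwartz_power_integrable[OF G[OF I(3)], of 4] schwartz_power_integrable[OF G[OF I(4)], of 4]
    have "norm (V p q) \<le> (LINT x|lborel. (norm (G i x) ^ 4 + norm (G j x) ^ 4 + norm (G k x) ^ 4 + norm (G l x) ^ 4) / 4)"
      unfolding V_def pq fst_conv snd_conv
    proof (rule Bochner_Integration.integral_norm_bound_integral[OF int[OF I]])
      show "integrable lborel (\<lambda>x. (norm (G i x) ^ 4 + norm (G j x) ^ 4 + norm (G k x) ^ 4 + norm (G l x) ^ 4) / 4)"
        using pw by auto
      show "norm (G i x * cnj (G j x) * cnj (G k x * cnj (G l x))) \<le> (norm (G i x) ^ 4 + norm (G j x) ^ 4 + norm (G k x) ^ 4 + norm (G l x) ^ 4) / 4" for x
        using four_product_le[of "norm (G i x)" "norm (G j x)" "norm (G k x)" "norm (G l x)"] by (simp add: norm_mult mult.assoc)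
    qed
    also have "\<dots> = (a i + a j + a k + a l) / 4" unfolding a_def using pw by simp
    finally show ?thesis by (simp add: pq)
  qed
  have "of_real (LINT x|lborel. (S x)\<^sup>2) = (LINT x|lborel. complex_of_real ((S x)\<^sup>2))"
    by (rule integral_complex_of_real[symmetric])
  also have "\<dots> = (\<Sum>p\<in>P. \<Sum>q\<in>P. V p q)"
  proof -
    have "integrable lborel (\<lambda>x. (G (fst p) x * cnj (G (snd p) x)) * cnj (G (fst q) x * cnj (G (snd q) x)))" if "p \<in> P" "q \<in> P" for p q
      using that by (intro int) (auto simp: P_def)
    then show ?thesis unfolding SS V_def by (simp add: Bochner_Integration.integral_sum)
  qed
  finally have eq: "complex_of_real (LINT x|lborel. (S x)\<^sup>2) = (\<Sum>p\<in>P. \<Sum>q\<in>P. V p q)" .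
  have "(LINT x|lborel. (S x)\<^sup>2) \<le> norm (complex_of_real (LINT x|lborel. (S x)\<^sup>2))"
    unfolding norm_of_real by (rule abs_ge_self)
  also have "\<dots> = norm (\<Sum>p\<in>P. \<Sum>q\<in>P. V p q)" unfolding eq ..
  also have "\<dots> \<le> (\<Sum>p\<in>P. \<Sum>q\<in>P. norm (V p q))"
    by (intro order_trans[OF norm_sum] sum_mono norm_sum)
  also have "\<dots> = (\<Sum>z\<in>P \<times> P. norm (V (fst z) (snd z)))"
    by (simp add: sum.cartesian_product case_prod_beta)
  also have "\<dots> = (\<Sum>z\<in>{z\<in>P \<times> P. V (fst z) (snd z) \<noteq> 0}. norm (V (fst z) (snd z)))"
    by (rule sum.mono_neutral_right) (use finP in auto)
  also have "\<dots> \<le> (\<Sum>z\<in>{z\<in>P \<times> P. V (fst z) (snd z) \<noteq> 0}. (\<lambda>(i, j, k, l). (a i + a j + a k + a l) / 4) ((\<lambda>((i, j), (k, l)). (i, j, k, l)) z))"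
    using Vle by (intro sum_mono) (fastforce split: prod.split)
  also have "\<dots> = (\<Sum>z\<in>(\<lambda>((i, j), (k, l)). (i, j, k, l)) ` {z\<in>P \<times> P. V (fst z) (snd z) \<noteq> 0}. (\<lambda>(i, j, k, l). (a i + a j + a k + a l) / 4) z)"
    by (subst sum.reindex) (auto simp: inj_on_def comp_def)
  also have "\<dots> \<le> (\<Sum>(i, j, k, l)\<in>quads. (a i + a j + a k + a l) / 4)"
    by (rule sum_mono2[OF finite_quads]) (use V0 in \<open>force simp: a_def\<close>)+
  also have "\<dots> \<le> 14080 * B * real N ^ 3 / s\<^sup>2 * (1 + ln (1 / s)) * (\<Sum>i\<in>I. a i)"
    by (rule sum_quads_le) (simp add: a_def)
  finally show ?thesis by (simp add: S_def a_def)
qed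

end

section \<open>The reverse square function estimate after an affine change of variables\<close>

lemma fourier_eq_ft: "fourier = ft"
  by (simp add: fun_eq_iff fourier_def ft_def ch_def)

lemma powr_4: "x \<ge> 0 \<Longrightarrow> x powr 4 = (x::real) ^ 4"
  by (cases "x = 0") (simp_all add: powr_numeral)

lemma powr_quarter_le:
  assumes "X powr (1 / 4) \<le> C * Y powr (1 / 4)" "X \<ge> 0" "Y \<ge> (0::real)"
  shows "X \<le> C ^ 4 * Y"
proof -
  have "(X powr (1 / 4)) ^ 4 = X" "(Y powr (1 / 4)) ^ 4 = Y"
    using assms(2,3) by (auto simp: powr_4[symmetric] powr_powr)
  moreover have "(X powr (1 / 4)) ^ 4 \<le> (C * Y powr (1 / 4)) ^ 4"
    using assms(1) by (intro power_mono) auto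
  ultimately show ?thesis by (simp add: power_mult_distrib)
qed

lemma freq_proj_lborel:
  assumes h: "(\<lambda>\<xi>. indicator k \<xi> *\<^sub>R fourier F \<xi>) = h" "h \<in> borel_measurable borel"
  shows "freq_proj k F x = ift h x"
proof -
  have "freq_proj k F x = (LINT \<xi>|lebesgue. h \<xi> * ch (\<xi> \<bullet> x))"
    unfolding freq_proj_def set_lebesgue_integral_def h(1)[symmetric] by (simp add: ch_def)
  also have "\<dots> = ift h x"
  proof -
    have [measurable]: "h \<in> borel_measurable borel" by (rule h(2))
    have "(\<lambda>\<xi>. h \<xi> * ch (\<xi> \<bullet> x)) \<in> borel_measurable borel" by measurable
    then show ?thesis unfolding ift_def by (intro integral_completion) simp
  qed
  finally show ?thesis .
qed

lemma ft_sum: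
  assumes "finite I" "\<And>i. i \<in> I \<Longrightarrow> integrable lborel (F i)"
  shows "ft (\<lambda>x. \<Sum>i\<in>I. F i x) \<xi> = (\<Sum>i\<in>I. ft (F i) \<xi>)"
  unfolding ft_def sum_distrib_right
  by (rule Bochner_Integration.integral_sum) (rule integrable_mult_ch_minus[OF assms(2)])

text \<open>The hypothesis controls a sum of functions whose frequency supports \<open>E i\<close> are each contained in a single
  plank \<open>\<tau> i\<close>: the projection to a plank then is the subsum with this \<open>\<tau> i\<close>. It is transferred to the \<open>G i\<close> by the substitution \<open>A\<close> and a modulation.
  These act on space by a linear map, so both sides change by the same power of the Jacobian.\<close>

theorem transformed_reverse_square_function:
  fixes A B :: "real^3 \<Rightarrow> real^3"
  assumes hyp: "\<And>F. schwartz F \<Longrightarrow> fourier_supp F \<subseteq> cone_nbhd \<delta> \<Longrightarrow>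
        Lp_norm 4 F \<le> C * Lp_norm 4 (\<lambda>x. sqrt (\<Sum>\<theta>\<in>T. (norm (freq_proj \<theta> F x))\<^sup>2))"
    and T: "partition_on (cone_nbhd \<delta>) T"
    and A: "linear A" "\<And>x. norm x \<le> m * norm (A x)" and dual: "\<And>\<xi> x. \<xi> \<bullet> x = B \<xi> \<bullet> A x"
    and I: "finite I" and G: "\<And>i. i \<in> I \<Longrightarrow> schwartz (G i)"
    and \<tau>: "\<And>i. i \<in> I \<Longrightarrow> \<tau> i \<in> T"
    and E: "\<And>i. i \<in> I \<Longrightarrow> closed (E i) \<and> bounded (E i) \<and> E i \<subseteq> \<tau> i"
    and supp: "\<And>i \<xi>. i \<in> I \<Longrightarrow> ft (G i) (B (\<xi> - c)) \<noteq> 0 \<Longrightarrow> \<xi> \<in> E i"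
  shows "(LINT x|lborel. norm (\<Sum>i\<in>I. G i x) ^ 4)
     \<le> C ^ 4 * (LINT x|lborel. (\<Sum>k\<in>T. (norm (\<Sum>i\<in>{i\<in>I. \<tau> i = k}. G i x))\<^sup>2)\<^sup>2)"
proof -
  have inj: "inj A"
    using A(2) linear_injective_0[OF A(1)] by (metis mult_zero_right norm_le_zero_iff norm_zero)
  define J where "J = \<bar>det (matrix A)\<bar>"
  note lin = A(1) inj J_def
  have J: "J > 0" by (rule linear_jacobian_pos[OF lin])
  \<comment> \<open>The modulation translates the frequencies by \<open>c\<close>, and \<open>J\<close> normalises the transform of \<open>H i\<close>.\<close>
  define H where "H i x = of_real J * (ch (c \<bullet> x) * G i (A x))" for i x
  define F where "F x = (\<Sum>i\<in>I. H i x)" for x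
  have H: "schwartz (H i)" if "i \<in> I" for i
    unfolding H_def by (rule schwartz_affine[OF G[OF that] A])
  have ftH: "ft (H i) \<xi> = ft (G i) (B (\<xi> - c))" if "i \<in> I" for i \<xi>
    unfolding H_def by (rule ft_affine[OF lin dual schwartz_measurable[OF G[OF that]]])
  have suppH: "\<xi> \<in> E i" if "i \<in> I" "ft (H i) \<xi> \<noteq> 0" for i \<xi>
    using supp[OF that(1)] that ftH by simp
  have Hint: "integrable lborel (H i)" if "i \<in> I" for i by (rule schwartz_integrable[OF H[OF that]])
  have Hmeas: "ft (H i) \<in> borel_measurable borel" if "i \<in> I" for i
    by (rule borel_measurable_ft[OF schwartz_measurable[OF H[OF that]]])
  have ftHint: "integrable lborel (ft (H i))" if i: "i \<in> I" for i
  proof -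
    have "bounded (E i)" using E[OF i] by (elim conjE)
    then obtain r where r: "\<forall>x\<in>E i. norm x \<le> r" unfolding bounded_iff by (elim exE)
    have "dist \<xi> 0 \<le> r" if "ft (H i) \<xi> \<noteq> 0" for \<xi>
      using bspec[OF r suppH[OF i that]] by simp
    then show ?thesis by (rule integrable_bounded_support[OF Hmeas[OF i] norm_ft_le])
  qed
  have F: "schwartz F" unfolding F_def[abs_def] by (rule schwartz_sum[OF I H])
  have ftF: "ft F \<xi> = (\<Sum>i\<in>I. ft (H i) \<xi>)" for \<xi>
    unfolding F_def[abs_def] by (rule ft_sum[where F=H, OF I Hint])
  have "closure {\<xi>. fourier F \<xi> \<noteq> 0} \<subseteq> (\<Union>i\<in>I. E i)"
  proof (rule closure_minimal)
    show "{\<xi>. fourier F \<xi> \<noteq> 0} \<subseteq> (\<Union>i\<in>I. E i)"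
    proof
      fix \<xi> assume "\<xi> \<in> {\<xi>. fourier F \<xi> \<noteq> 0}"
      then have "(\<Sum>i\<in>I. ft (H i) \<xi>) \<noteq> 0" by (simp add: fourier_eq_ft ftF)
      then obtain i where i: "i \<in> I" "ft (H i) \<xi> \<noteq> 0" by (rule sum.not_neutral_contains_not_neutral)
      from i(1) suppH[OF i] show "\<xi> \<in> (\<Union>i\<in>I. E i)" by (rule UN_I)
    qed
    show "closed (\<Union>i\<in>I. E i)" using I E by (intro closed_UN) auto
  qed
  moreover have "(\<Union>i\<in>I. E i) \<subseteq> cone_nbhd \<delta>"
    using E \<tau> T unfolding partition_on_def by blast
  ultimately have Fsupp: "fourier_supp F \<subseteq> cone_nbhd \<delta>" unfolding fourier_supp_def by blast
  have proj: "freq_proj k F x = (\<Sum>i\<in>{i\<in>I. \<tau> i = k}. H i x)" if k: "k \<in> T" for k x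
  proof -
    let ?h = "\<lambda>\<xi>. \<Sum>i\<in>{i\<in>I. \<tau> i = k}. ft (H i) \<xi>"
    have ind: "indicator k \<xi> *\<^sub>R ft (H i) \<xi> = (if \<tau> i = k then ft (H i) \<xi> else 0)" if i: "i \<in> I" for i \<xi>
    proof (cases "ft (H i) \<xi> = 0")
      case False
      then have "\<xi> \<in> \<tau> i" using suppH[OF i] E[OF i] by blast
      moreover have "\<tau> i \<inter> k = {}" if "\<tau> i \<noteq> k"
        using T k \<tau>[OF i] that unfolding partition_on_def disjoint_def by blast
      ultimately show ?thesis by (auto simp: indicator_def)
    qed simp
    have "freq_proj k F x = ift ?h x"
    proof (rule freq_proj_lborel)
      show "(\<lambda>\<xi>. indicator k \<xi> *\<^sub>R fourier F \<xi>) = ?h"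
      proof
        fix \<xi>
        have "indicator k \<xi> *\<^sub>R fourier F \<xi> = (\<Sum>i\<in>I. if \<tau> i = k then ft (H i) \<xi> else 0)"
          unfolding fourier_eq_ft ftF scaleR_sum_right by (intro sum.cong refl ind)
        also have "\<dots> = ?h \<xi>" by (rule sum.inter_filter[symmetric, OF I])
        finally show "indicator k \<xi> *\<^sub>R fourier F \<xi> = ?h \<xi>" .
      qed
      show "?h \<in> borel_measurable borel" using Hmeas by (intro borel_measurable_sum) auto
    qed
    also have "\<dots> = (\<Sum>i\<in>{i\<in>I. \<tau> i = k}. ift (ft (H i)) x)"
      unfolding ift_def sum_distrib_right
      by (rule Bochner_Integration.integral_sum) (use ftHint in \<open>auto intro: integrable_mult_ch\<close>)
    also have "\<dots> = (\<Sum>i\<in>{i\<in>I. \<tau> i = k}. H i x)"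
      by (intro sum.cong refl) (use schwartz_ft_inversion[OF H ftHint] in auto)
    finally show ?thesis .
  qed
  define S where "S x = (\<Sum>k\<in>T. (norm (\<Sum>i\<in>{i\<in>I. \<tau> i = k}. G i x))\<^sup>2)" for x
  have S0: "S x \<ge> 0" for x by (auto simp: S_def intro: sum_nonneg)
  have Gm: "(\<lambda>x. \<Sum>i\<in>I'. G i x) \<in> borel_measurable borel" if "I' \<subseteq> I" for I'
    using that schwartz_measurable[OF G] by (intro borel_measurable_sum) auto
  have Sm: "S \<in> borel_measurable borel"
  proof -
    have "(\<lambda>x. (norm (\<Sum>i\<in>{i\<in>I. \<tau> i = k}. G i x))\<^sup>2) \<in> borel_measurable borel" for k
    proof -
      have [measurable]: "(\<lambda>x. \<Sum>i\<in>{i\<in>I. \<tau> i = k}. G i x) \<in> borel_measurable borel" by (rule Gm) auto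
      show ?thesis by measurable
    qed
    then show ?thesis unfolding S_def by (intro borel_measurable_sum)
  qed
  have sumH: "(\<Sum>i\<in>I'. H i x) = of_real J * ch (c \<bullet> x) * (\<Sum>i\<in>I'. G i (A x))" for I' x
    by (simp add: H_def sum_distrib_left mult_ac)
  have sq: "(\<Sum>\<theta>\<in>T. (norm (freq_proj \<theta> F x))\<^sup>2) = J\<^sup>2 * S (A x)" for x
    unfolding S_def sum_distrib_left
  proof (rule sum.cong[OF refl])
    fix k assume k: "k \<in> T"
    have "norm (freq_proj k F x) = J * norm (\<Sum>i\<in>{i\<in>I. \<tau> i = k}. G i (A x))"
      unfolding proj[OF k] sumH norm_mult using J by simp
    then show "(norm (freq_proj k F x))\<^sup>2 = J\<^sup>2 * (norm (\<Sum>i\<in>{i\<in>I. \<tau> i = k}. G i (A x)))\<^sup>2"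
      by (simp only: power_mult_distrib)
  qed
  have "Lp_norm 4 F = (J ^ 4 * (LINT x|lborel. norm (\<Sum>i\<in>I. G i (A x)) ^ 4)) powr (1 / 4)"
    unfolding Lp_norm_def F_def sumH using J by (simp add: powr_4 norm_mult power_mult_distrib)
  moreover have "Lp_norm 4 (\<lambda>x. sqrt (\<Sum>\<theta>\<in>T. (norm (freq_proj \<theta> F x))\<^sup>2)) = (J ^ 4 * (LINT x|lborel. (S (A x))\<^sup>2)) powr (1 / 4)"
  proof -
    have "norm (sqrt (J\<^sup>2 * S (A x))) powr 4 = J ^ 4 * (S (A x))\<^sup>2" for x
    proof -
      have "norm (sqrt (J\<^sup>2 * S (A x))) powr 4 = ((sqrt (J\<^sup>2 * S (A x)))\<^sup>2)\<^sup>2"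
        by (simp add: powr_4 power_mult[symmetric])
      also have "\<dots> = (J\<^sup>2 * S (A x))\<^sup>2" using S0[of "A x"] by simp
      finally show ?thesis by (simp add: power_mult_distrib power_mult[symmetric])
    qed
    then show ?thesis unfolding Lp_norm_def sq by simp
  qed
  ultimately have "(J ^ 4 * (LINT x|lborel. norm (\<Sum>i\<in>I. G i (A x)) ^ 4)) powr (1 / 4)
      \<le> C * (J ^ 4 * (LINT x|lborel. (S (A x))\<^sup>2)) powr (1 / 4)"
    using hyp[OF F Fsupp] by simp
  then have "J ^ 4 * (LINT x|lborel. norm (\<Sum>i\<in>I. G i (A x)) ^ 4) \<le> C ^ 4 * (J ^ 4 * (LINT x|lborel. (S (A x))\<^sup>2))"
    by (rule powr_quarter_le) (use J in auto)
  then have le: "(LINT x|lborel. norm (\<Sum>i\<in>I. G i (A x)) ^ 4) \<le> C ^ 4 * (LINT x|lborel. (S (A x))\<^sup>2)"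
    using J by (simp add: mult.left_commute)
  have "(LINT x|lborel. norm (\<Sum>i\<in>I. G i x) ^ 4) = J *\<^sub>R (LINT x|lborel. norm (\<Sum>i\<in>I. G i (A x)) ^ 4)"
  proof (rule lborel_integral_linear[OF lin])
    have [measurable]: "(\<lambda>x. \<Sum>i\<in>I. G i x) \<in> borel_measurable borel" by (rule Gm) auto
    show "(\<lambda>x. norm (\<Sum>i\<in>I. G i x) ^ 4) \<in> borel_measurable borel" by measurable
  qed
  also have "\<dots> \<le> J *\<^sub>R (C ^ 4 * (LINT x|lborel. (S (A x))\<^sup>2))"
    using le J by simp
  also have "\<dots> = C ^ 4 * (J *\<^sub>R (LINT x|lborel. (S (A x))\<^sup>2))" by simp
  also have "J *\<^sub>R (LINT x|lborel. (S (A x))\<^sup>2) = (LINT x|lborel. (S x)\<^sup>2)"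
    by (rule lborel_integral_linear[OF lin, symmetric]) (use Sm in auto)
  finally show ?thesis by (simp add: S_def)
qed

section \<open>Rotating, dilating and lifting caps\<close>

definition rot :: "real \<Rightarrow> real^3 \<Rightarrow> real^3" where
  "rot \<sigma> x = vector [x$1 * cos \<sigma> - x$2 * sin \<sigma>, x$1 * sin \<sigma> + x$2 * cos \<sigma>, x$3]"

lemma rot_components [simp]:
  "rot \<sigma> x $ 1 = x$1 * cos \<sigma> - x$2 * sin \<sigma>" "rot \<sigma> x $ 2 = x$1 * sin \<sigma> + x$2 * cos \<sigma>" "rot \<sigma> x $ 3 = x$3"
  by (simp_all add: rot_def vector_3)

lemma linear_rot: "linear (rot \<sigma>)"
  by (rule linearI) (simp_all add: vec_eq_iff forall_3 algebra_simps)

lemma rot_inner: "rot \<sigma> x \<bullet> rot \<sigma> y = x \<bullet> y"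
proof -
  have "rot \<sigma> x \<bullet> rot \<sigma> y = ((sin \<sigma>)\<^sup>2 + (cos \<sigma>)\<^sup>2) * (x$1 * y$1 + x$2 * y$2) + x$3 * y$3"
    by (simp add: inner_3 power2_eq_square algebra_simps del: sin_cos_squared_add sin_cos_squared_add2 sin_cos_squared_add3)
  then show ?thesis by (simp add: inner_3)
qed

lemma rot_norm: "norm (rot \<sigma> x) = norm x"
  by (simp add: norm_eq_sqrt_inner rot_inner)

lemma rot_minus: "rot \<sigma> (rot (- \<sigma>) x) = x"
proof -
  have "rot \<sigma> (rot (- \<sigma>) x) $ 1 = ((sin \<sigma>)\<^sup>2 + (cos \<sigma>)\<^sup>2) * x$1" "rot \<sigma> (rot (- \<sigma>) x) $ 2 = ((sin \<sigma>)\<^sup>2 + (cos \<sigma>)\<^sup>2) * x$2"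
    by (simp_all add: power2_eq_square algebra_simps del: sin_cos_squared_add sin_cos_squared_add2 sin_cos_squared_add3)
  then show ?thesis by (simp add: vec_eq_iff forall_3 del: rot_components(1,2))
qed

lemma rot_normal_dir: "rot \<sigma> (normal_dir t) = normal_dir (t + \<sigma>)"
  by (simp add: vec_eq_iff forall_3 cos_add sin_add diff_divide_distrib add_divide_distrib mult_ac)

lemma frame_unit [simp]: "norm (angular_dir t) = 1" "norm (normal_dir t) = 1" "norm (null_dir t) = 1"
proof -
  have "(cos t)\<^sup>2 / 2 + (sin t)\<^sup>2 / 2 = 1 / 2"
    using sin_cos_squared_add[of t] by (simp only: add_divide_distrib[symmetric] add.commute)
  note * = this
  show "norm (angular_dir t) = 1" "norm (normal_dir t) = 1" "norm (null_dir t) = 1"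
    by (simp_all add: norm_3 power_divide *)
qed

lemma inner_unit_le: "norm v = 1 \<Longrightarrow> \<bar>x \<bullet> v\<bar> \<le> norm x"
  using Cauchy_Schwarz_ineq2[of x v] by simp

lemma normal_dir_diff: "norm (normal_dir s - normal_dir t) \<le> \<bar>s - t\<bar>"
proof -
  have "normal_dir s - normal_dir t = (1 / sqrt 2) *\<^sub>R (ray s - ray t)"
    by (simp add: vec_eq_iff forall_3 diff_divide_distrib)
  then have "norm (normal_dir s - normal_dir t) = norm (ray s - ray t) / sqrt 2" by simp
  also have "\<dots> \<le> norm (ray s - ray t)" by (simp add: divide_le_eq mult_le_cancel_left1)
  also have "\<dots> \<le> \<bar>s - t\<bar>" by (rule ray_diff_upper)
  finally show ?thesis .
qed

lemma one_minus_cos_le: "1 - cos x \<le> x\<^sup>2 / 2" "0 \<le> 1 - cos x" for x :: real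
proof -
  have "1 - cos x = 2 * (sin (x / 2))\<^sup>2"
    using cos_double_sin[of "x / 2"] by simp
  moreover have "\<bar>sin (x / 2)\<bar> \<le> \<bar>x / 2\<bar>" by (rule abs_sin_x_le_abs_x)
  then have "(sin (x / 2))\<^sup>2 \<le> (x / 2)\<^sup>2" by (simp only: abs_le_square_iff)
  ultimately show "1 - cos x \<le> x\<^sup>2 / 2" "0 \<le> 1 - cos x" by (simp_all add: power_divide)
qed

text \<open>The action on frequencies of a rotation about the axis of the cone, a dilation and a vertical translation.\<close>

definition move :: "real \<Rightarrow> real \<Rightarrow> real \<Rightarrow> real^3 \<Rightarrow> real^3" where
  "move r \<sigma> \<tau> \<xi> = r *\<^sub>R rot \<sigma> \<xi> + \<tau> *\<^sub>R axis 3 1"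

lemma axis3 [simp]: "axis (3::3) (1::real) $ 1 = 0" "axis (3::3) (1::real) $ 2 = 0" "axis (3::3) (1::real) $ 3 = 1"
  by (simp_all add: axis_def)

text \<open>The displacement of the moved centre from \<open>c'\<close> in the frame at \<open>t'\<close>. The term \<open>r (\<rho> - c\<^sub>3) - (\<rho>' - c'\<^sub>3)\<close> compares
  the vertical offsets of both centres from the cone, and \<open>\<tau>\<close> can be chosen to cancel it.\<close>

lemma move_center:
  fixes c c' :: "real^3" and r \<sigma> \<tau> :: real
  assumes c: "c$1 = \<rho> * cos t" "c$2 = \<rho> * sin t" and c': "c'$1 = \<rho>' * cos t'" "c'$2 = \<rho>' * sin t'"
    and \<phi>: "\<phi> = t + \<sigma> - t'"
  defines "d \<equiv> move r \<sigma> \<tau> c - c'"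
  shows "d \<bullet> angular_dir t' = r * \<rho> * sin \<phi>"
    and "sqrt 2 * (d \<bullet> normal_dir t') = r * \<rho> * (cos \<phi> - 1) + (r * (\<rho> - c$3) - (\<rho>' - c'$3) - \<tau>)"
    and "sqrt 2 * (d \<bullet> null_dir t') = r * \<rho> * (cos \<phi> - 1) + 2 * (r * \<rho> - \<rho>') - (r * (\<rho> - c$3) - (\<rho>' - c'$3) - \<tau>)"
proof -
  have mc: "move r \<sigma> \<tau> c $ 1 = r * \<rho> * cos (t + \<sigma>)" "move r \<sigma> \<tau> c $ 2 = r * \<rho> * sin (t + \<sigma>)" "move r \<sigma> \<tau> c $ 3 = r * c$3 + \<tau>"
    by (simp_all add: move_def c cos_add sin_add algebra_simps)
  define S where "S = t + \<sigma>"
  have \<phi>': "\<phi> = S - t'" by (simp add: \<phi> S_def)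
  have sc: "(sin t')\<^sup>2 + (cos t')\<^sup>2 = 1" by simp
  have pl: "\<rho>' * cos t' * cos t' + \<rho>' * sin t' * sin t' = \<rho>'"
  proof -
    have "\<rho>' * cos t' * cos t' + \<rho>' * sin t' * sin t' = \<rho>' * ((sin t')\<^sup>2 + (cos t')\<^sup>2)"
      by (simp add: power2_eq_square algebra_simps del: sin_cos_squared_add sin_cos_squared_add2 sin_cos_squared_add3)
    then show ?thesis unfolding sc by simp
  qed
  have d: "d $ 1 = r * \<rho> * cos S - \<rho>' * cos t'" "d $ 2 = r * \<rho> * sin S - \<rho>' * sin t'" "d $ 3 = r * c$3 + \<tau> - c'$3"
    by (simp_all add: d_def mc c' S_def)
  show "d \<bullet> angular_dir t' = r * \<rho> * sin \<phi>"
    unfolding inner_3 d \<phi>' by (simp add: sin_diff algebra_simps)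
  have er: "d $ 1 * cos t' + d $ 2 * sin t' = r * \<rho> * cos \<phi> - \<rho>'"
  proof -
    have "d $ 1 * cos t' + d $ 2 * sin t' = r * \<rho> * (cos S * cos t' + sin S * sin t') - (\<rho>' * cos t' * cos t' + \<rho>' * sin t' * sin t')"
      unfolding d by (simp add: algebra_simps)
    then show ?thesis unfolding pl \<phi>' cos_diff .
  qed
  have "sqrt 2 * (d \<bullet> normal_dir t') = (d $ 1 * cos t' + d $ 2 * sin t') - d $ 3"
    by (simp add: inner_3 distrib_left right_diff_distrib)
  then show "sqrt 2 * (d \<bullet> normal_dir t') = r * \<rho> * (cos \<phi> - 1) + (r * (\<rho> - c$3) - (\<rho>' - c'$3) - \<tau>)"
    unfolding er d(3) by (simp add: algebra_simps)
  have "sqrt 2 * (d \<bullet> null_dir t') = (d $ 1 * cos t' + d $ 2 * sin t') + d $ 3"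
    by (simp add: inner_3 distrib_left)
  then show "sqrt 2 * (d \<bullet> null_dir t') = r * \<rho> * (cos \<phi> - 1) + 2 * (r * \<rho> - \<rho>') - (r * (\<rho> - c$3) - (\<rho>' - c'$3) - \<tau>)"
    unfolding er d(3) by (simp add: algebra_simps)
qed

text \<open>The three motions need to be correct only up to the fraction \<open>\<kappa>\<close> of the side lengths of the target. The
  enlargement of the cap, \<open>2 K\<^sup>2 s\<close>, is a small fraction of \<open>s' / K\<^sup>2\<close> by the choice of \<open>s'\<close>. In the normal direction, a tilt of the frames by \<open>\<phi>\<close> costs \<open>|\<phi>|\<close>
  times the size of the cap, which is again \<open>O(s\<^sup>2)\<close>.\<close>

lemma move_into_core:
  fixes c c' :: "real^3"
  assumes K: "K \<ge> 1" and s: "0 < s" and s': "s' = 100 * K ^ 4 * s" "s' \<le> 1"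
    and \<kappa>: "\<kappa> = 1 / (100 * K\<^sup>2)"
    and c: "c$1 = \<rho> * cos t" "c$2 = \<rho> * sin t" and c': "c'$1 = \<rho>' * cos t'" "c'$2 = \<rho>' * sin t'"
    and \<rho>: "0 \<le> \<rho>" "\<rho> \<le> 2" and r: "0 \<le> r" "r \<le> 2"
    and close: "\<bar>t + \<sigma> - t'\<bar> \<le> \<kappa> * s'" "\<bar>r * \<rho> - \<rho>'\<bar> \<le> 2 * \<kappa>"
      "\<bar>r * (\<rho> - c$3) - (\<rho>' - c'$3) - \<tau>\<bar> \<le> \<kappa> * s'\<^sup>2"
    and \<xi>: "\<xi> \<in> cone_box c t (2 * (K\<^sup>2 * s)) (2 * (K\<^sup>2 * s\<^sup>2)) (2 * (K\<^sup>2 * s))"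
  shows "move r \<sigma> \<tau> \<xi> \<in> cone_box c' t' (s' / K\<^sup>2) (s'\<^sup>2 / K\<^sup>2) (1 / K\<^sup>2)"
proof -
  define \<phi> where "\<phi> = t + \<sigma> - t'"
  define u where "u = \<xi> - c"
  define w where "w = r *\<^sub>R rot \<sigma> u"
  define d where "d = move r \<sigma> \<tau> c - c'"
  define \<beta> where "\<beta> = 1 / K\<^sup>2"
  have K2: "K\<^sup>2 \<ge> 1" using K by simp
  have \<beta>: "0 < \<beta>" "\<beta> \<le> 1" and \<kappa>\<beta>: "\<kappa> = \<beta> / 100" using K2 by (auto simp: \<beta>_def \<kappa> divide_le_eq)
  have Ks: "K\<^sup>2 * s = \<beta> * s' / 100"
    unfolding s'(1) \<beta>_def using K by (simp add: field_simps eval_nat_numeral)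
  have s'0: "s' > 0" unfolding s'(1) using K s by simp
  have sle: "s \<le> s' / 100"
  proof -
    have "1 * s \<le> K ^ 4 * s" using K s by (intro mult_right_mono) auto
    then show ?thesis unfolding s'(1) by simp
  qed
  have s1: "s \<le> 1" using sle s' s'0 by linarith
  have Ks2: "K\<^sup>2 * s\<^sup>2 \<le> \<beta> * s'\<^sup>2 / 10000"
  proof -
    have "K\<^sup>2 * s\<^sup>2 = (\<beta> * s' / 100) * s" unfolding power2_eq_square[of s] mult.assoc[symmetric] Ks ..
    also have "\<dots> \<le> (\<beta> * s' / 100) * (s' / 100)" using \<beta> s'0 sle by (intro mult_left_mono) auto
    finally show ?thesis by (simp add: power2_eq_square)
  qed
  have split: "move r \<sigma> \<tau> \<xi> - c' = w + d"
    by (simp add: move_def w_def d_def u_def linear_diff[OF linear_rot] algebra_simps)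
  have nu: "norm u \<le> 3 * (K\<^sup>2 * s)"
  proof -
    have "norm u \<le> (2 * (K\<^sup>2 * s) + 2 * (K\<^sup>2 * s\<^sup>2) + 2 * (K\<^sup>2 * s)) / 2" unfolding u_def by (rule cone_box_norm[OF \<xi>])
    moreover have "K\<^sup>2 * s\<^sup>2 \<le> K\<^sup>2 * s" using s s1 by (intro mult_left_mono) (auto simp: power2_eq_square mult_left_le_one_le)
    moreover have "(2 * p + 2 * q + 2 * p) / 2 = p + q + p" for p q :: real by simp
    ultimately have "norm u \<le> K\<^sup>2 * s + K\<^sup>2 * s + K\<^sup>2 * s" by (smt (verit))
    then show ?thesis by (simp add: mult.commute)
  qed
  have nw: "norm w \<le> 6 * (\<beta> * s' / 100)"
  proof -
    have "norm w = r * norm u" using r by (simp add: w_def rot_norm)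
    also have "\<dots> \<le> 2 * (3 * (K\<^sup>2 * s))" using r nu by (intro mult_mono) auto
    finally show ?thesis unfolding Ks by simp
  qed
  have \<phi>: "\<bar>\<phi>\<bar> \<le> \<beta> * s' / 100" using close(1) by (simp add: \<phi>_def \<kappa>\<beta>)
  have rr: "0 \<le> r * \<rho>" "r * \<rho> \<le> 4" using mult_mono[OF r(2) \<rho>(2)] r \<rho> by auto
  have bs: "\<beta> * s' \<le> \<beta>" "\<beta> * s'\<^sup>2 \<le> \<beta>" "0 < \<beta> * s'" "0 < \<beta> * s'\<^sup>2"
    using \<beta> s'(2) s'0 by (auto simp: mult_left_le power_le_one)
  have \<phi>2: "\<phi>\<^sup>2 \<le> \<beta> * s'\<^sup>2 / 10000"
  proof -
    have "\<phi>\<^sup>2 \<le> (\<beta> * s' / 100)\<^sup>2" using \<phi> by (metis abs_ge_zero power2_abs power_mono)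
    also have "\<dots> = (\<beta> * \<beta>) * s'\<^sup>2 / 10000" by (simp add: power2_eq_square)
    also have "\<dots> \<le> \<beta> * s'\<^sup>2 / 10000" using \<beta> by (intro divide_right_mono mult_right_mono) (auto simp: mult_left_le_one_le)
    finally show ?thesis .
  qed
  have cosb: "\<bar>r * \<rho> * (cos \<phi> - 1)\<bar> \<le> \<beta> * s'\<^sup>2 / 5000"
  proof -
    have "\<bar>r * \<rho> * (cos \<phi> - 1)\<bar> = r * \<rho> * (1 - cos \<phi>)" 
    proof -
      have "r * \<rho> * (cos \<phi> - 1) = - (r * \<rho> * (1 - cos \<phi>))" by (simp add: algebra_simps)
      moreover have "0 \<le> r * \<rho> * (1 - cos \<phi>)" by (rule mult_nonneg_nonneg[OF rr(1) one_minus_cos_le(2)])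
      ultimately show ?thesis by simp
    qed
    also have "\<dots> \<le> 4 * (\<phi>\<^sup>2 / 2)" using rr one_minus_cos_le[of \<phi>] by (intro mult_mono) auto
    finally show ?thesis using \<phi>2 by simp
  qed
  note mc = move_center[OF c c' \<phi>_def, of r \<tau>, folded d_def]
  have tb: "\<bar>r * (\<rho> - c$3) - (\<rho>' - c'$3) - \<tau>\<bar> \<le> \<beta> * s'\<^sup>2 / 100" using close(3) by (simp add: \<kappa>\<beta>)
  have from_sqrt2: "\<bar>x\<bar> \<le> \<bar>sqrt 2 * x\<bar>" for x :: real by (simp add: abs_mult mult_le_cancel_right1)
  have d1: "\<bar>d \<bullet> angular_dir t'\<bar> \<le> 4 * (\<beta> * s' / 100)"
  proof -
    have "\<bar>sin \<phi>\<bar> \<le> \<beta> * s' / 100" using abs_sin_x_le_abs_x[of \<phi>] \<phi> by linarith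
    then have "r * \<rho> * \<bar>sin \<phi>\<bar> \<le> 4 * (\<beta> * s' / 100)" using rr by (intro mult_mono) auto
    then show ?thesis unfolding mc(1) using r \<rho> by (simp add: abs_mult)
  qed
  have d2: "\<bar>d \<bullet> normal_dir t'\<bar> \<le> \<beta> * s'\<^sup>2 / 5000 + \<beta> * s'\<^sup>2 / 100"
    using from_sqrt2[of "d \<bullet> normal_dir t'"] cosb tb unfolding mc(2) by linarith
  have d3: "\<bar>d \<bullet> null_dir t'\<bar> \<le> \<beta> / 5000 + 4 * (\<beta> / 100) + \<beta> / 100"
  proof -
    have y: "\<bar>r * \<rho> - \<rho>'\<bar> \<le> 2 * (\<beta> / 100)" using close(2) by (simp add: \<kappa>\<beta>)
    have lin: "\<bar>x + 2 * y - z\<bar> \<le> \<beta> / 5000 + 4 * (\<beta> / 100) + \<beta> / 100"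
      if "\<bar>x\<bar> \<le> P / 5000" "\<bar>y\<bar> \<le> 2 * (\<beta> / 100)" "\<bar>z\<bar> \<le> P / 100" "P \<le> \<beta>" for x y z P
    proof -
      have "\<bar>x + 2 * y - z\<bar> \<le> \<bar>x\<bar> + 2 * \<bar>y\<bar> + \<bar>z\<bar>" by linarith
      then show ?thesis using that by linarith
    qed
    from lin[OF cosb y tb bs(2)] have "\<bar>sqrt 2 * (d \<bullet> null_dir t')\<bar> \<le> \<beta> / 5000 + 4 * (\<beta> / 100) + \<beta> / 100"
      unfolding mc(3) .
    with from_sqrt2 show ?thesis by (rule order_trans)
  qed
  have w1: "\<bar>w \<bullet> angular_dir t'\<bar> \<le> 6 * (\<beta> * s' / 100)" "\<bar>w \<bullet> null_dir t'\<bar> \<le> 6 * (\<beta> * s' / 100)"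
    using inner_unit_le[of "angular_dir t'" w] inner_unit_le[of "null_dir t'" w] nw by auto
  have w2: "\<bar>w \<bullet> normal_dir t'\<bar> \<le> 2 * (\<beta> * s'\<^sup>2 / 10000) + 6 * (\<beta> * s'\<^sup>2 / 10000)"
  proof -
    have "w \<bullet> normal_dir (t + \<sigma>) = r * (u \<bullet> normal_dir t)"
      unfolding w_def rot_normal_dir[symmetric] by (simp add: rot_inner)
    moreover have "\<bar>u \<bullet> normal_dir t\<bar> \<le> K\<^sup>2 * s\<^sup>2" using \<xi> by (simp add: cone_box_def u_def)
    ultimately have 1: "\<bar>w \<bullet> normal_dir (t + \<sigma>)\<bar> \<le> 2 * (K\<^sup>2 * s\<^sup>2)"
      using r by (simp add: abs_mult mult_mono)
    have "\<bar>w \<bullet> (normal_dir t' - normal_dir (t + \<sigma>))\<bar> \<le> norm w * norm (normal_dir t' - normal_dir (t + \<sigma>))"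
      by (rule Cauchy_Schwarz_ineq2)
    also have "\<dots> \<le> (6 * (\<beta> * s' / 100)) * (\<beta> * s' / 100)"
      using nw normal_dir_diff[of t' "t + \<sigma>"] \<phi> less_imp_le[OF bs(3)] by (intro mult_mono) (auto simp: \<phi>_def abs_minus_commute)
    also have "\<dots> = 6 * ((\<beta> * \<beta>) * s'\<^sup>2 / 10000)" by (simp add: power2_eq_square)
    also have "\<dots> \<le> 6 * (\<beta> * s'\<^sup>2 / 10000)"
      using \<beta> by (intro mult_left_mono divide_right_mono mult_right_mono) (auto simp: mult_left_le_one_le)
    finally have 2: "\<bar>w \<bullet> (normal_dir t' - normal_dir (t + \<sigma>))\<bar> \<le> 6 * (\<beta> * s'\<^sup>2 / 10000)" .
    have "w \<bullet> normal_dir t' = w \<bullet> normal_dir (t + \<sigma>) + w \<bullet> (normal_dir t' - normal_dir (t + \<sigma>))"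
      by (simp add: inner_diff_right)
    then show ?thesis using 1 2 Ks2 by linarith
  qed
  have "\<bar>(w + d) \<bullet> angular_dir t'\<bar> \<le> \<beta> * s' / 2" "\<bar>(w + d) \<bullet> normal_dir t'\<bar> \<le> \<beta> * s'\<^sup>2 / 2" "\<bar>(w + d) \<bullet> null_dir t'\<bar> \<le> \<beta> / 2"
    unfolding inner_add_left using d1 d2 d3 w1 w2 bs by linarith+
  then show ?thesis unfolding cone_box_def split[symmetric] by (simp add: \<beta>_def)
qed

text \<open>An angle modulo \<open>2 \<pi>\<close>, chosen of minimal size, so that it is controlled by the distance of the two rays.\<close>

lemma angle_representative:
  "\<exists>\<sigma>. cos \<sigma> = cos x \<and> sin \<sigma> = sin x \<and> \<bar>\<sigma>\<bar> \<le> 4 * \<bar>sin (x / 2)\<bar>" for x :: real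
proof -
  define \<sigma> where "\<sigma> = Arg (cis x)"
  have \<sigma>: "cis \<sigma> = cis x" "-pi < \<sigma>" "\<sigma> \<le> pi"
    using Arg_correct[of "cis x"] by (auto simp: \<sigma>_def sgn_div_norm cis_neq_zero)
  then have cs: "cos \<sigma> = cos x" "sin \<sigma> = sin x" by (metis cis.simps(1), metis cis.simps(2))
  have half: "y / 2 \<le> sin y" if "0 \<le> y" "y \<le> pi / 2" for y :: real
  proof -
    have s: "z / 2 \<le> sin z" "z - z ^ 3 / 6 \<le> sin z" if "0 \<le> z" "z \<le> 1" for z :: real
    proof -
      have "\<bar>sin z - z\<bar> \<le> \<bar>z\<bar> ^ 3 / 6" using Maclaurin_sin_bound[of z 3] by (simp add: sin_coeff_def eval_nat_numeral)
      then show "z - z ^ 3 / 6 \<le> sin z" using that by (simp add: abs_if split: if_splits)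
      moreover have "z ^ 3 \<le> z" using that power_decreasing[of 1 3 z] by simp
      ultimately show "z / 2 \<le> sin z" using that by linarith
    qed
    show ?thesis
    proof (cases "y \<le> 1")
      case False
      have pi_small: "pi \<le> 16 / 5" using pi_approx(2) by simp
      have "5 / 6 \<le> sin (1::real)" using s(2)[of 1] by simp
      also have "\<dots> \<le> sin y" using False that pi_gt3 by (intro sin_monotone_2pi_le) auto
      finally show ?thesis using that pi_small by linarith
    qed (use s that in auto)
  qed
  have "\<bar>\<sigma>\<bar> / 4 \<le> sin (\<bar>\<sigma>\<bar> / 2)" using half[of "\<bar>\<sigma>\<bar> / 2"] \<sigma> by auto
  moreover have "(sin (\<bar>\<sigma>\<bar> / 2))\<^sup>2 = (sin (x / 2))\<^sup>2"
  proof -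
    have "cos \<bar>\<sigma>\<bar> = cos x" using cs by (simp add: abs_if)
    moreover have "cos y = 1 - 2 * (sin (y / 2))\<^sup>2" for y :: real using cos_double_sin[of "y / 2"] by simp
    ultimately show ?thesis by (metis add_diff_cancel_left' diff_eq_eq mult_cancel_left zero_neq_numeral)
  qed
  then have "\<bar>sin (\<bar>\<sigma>\<bar> / 2)\<bar> = \<bar>sin (x / 2)\<bar>" by (simp only: power2_eq_iff abs_eq_iff)
  ultimately show ?thesis using cs by (intro exI[of _ \<sigma>]) auto
qed

lemma cos_sin_frame_cong:
  assumes "cos t = cos t'" "sin t = sin t'"
  shows "cone_box c t a1 a2 a3 = cone_box c t' a1 a2 a3" "ray t = ray t'"
  using assms by (simp_all add: cone_box_def angular_dir_def normal_dir_def null_dir_def ray_def)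

section \<open>Moving a cap into the core of a plank\<close>

text \<open>Rounding to a grid of spacing \<open>a\<close>, with a bound on the number of the grid point.\<close>

lemma floor_grid:
  assumes "a > (0::real)"
  shows "\<bar>x - a * of_int \<lfloor>x / a\<rfloor>\<bar> \<le> a" "a * of_int \<lfloor>x / a\<rfloor> \<le> x" "\<bar>of_int \<lfloor>x / a\<rfloor>\<bar> \<le> \<bar>x\<bar> / a + 1"
proof -
  have "of_int \<lfloor>x / a\<rfloor> \<le> x / a" "x / a < of_int \<lfloor>x / a\<rfloor> + 1" by linarith+
  then have 1: "of_int \<lfloor>x / a\<rfloor> * a \<le> x" "x < (of_int \<lfloor>x / a\<rfloor> + 1) * a"
    unfolding pos_le_divide_eq[OF assms] pos_divide_less_eq[OF assms] .
  then show "a * of_int \<lfloor>x / a\<rfloor> \<le> x" by (simp add: mult.commute)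
  have "x < a * of_int \<lfloor>x / a\<rfloor> + a" using 1(2) by (simp add: algebra_simps)
  then show "\<bar>x - a * of_int \<lfloor>x / a\<rfloor>\<bar> \<le> a" using \<open>a * of_int \<lfloor>x / a\<rfloor> \<le> x\<close> by linarith
  have "\<bar>x\<bar> / a = \<bar>x / a\<bar>" using assms by simp
  then show "\<bar>of_int \<lfloor>x / a\<rfloor>\<bar> \<le> \<bar>x\<bar> / a + 1" by linarith
qed

text \<open>Some plank \<open>\<theta>\<close> contains a point of the cone on the light ray of the cap, and this ray is then within \<open>O(s')\<close> of the ray of \<open>\<theta>\<close>.
  The ideal rotation, dilation and translation that take the centre of the cap to the centre of \<open>\<theta>\<close> are rounded to grids
  with \<open>O(K\<^sup>3)\<close> points. The grids do not depend on the cap, so this yields boundedly many classes of caps at every scale.\<close>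

theorem alignment:
  fixes c :: "real^3" and cc :: "(real^3) set \<Rightarrow> real^3" and tt rr :: "(real^3) set \<Rightarrow> real"
  assumes K: "K \<ge> 1" and s: "0 < s" and s': "s' = 100 * K ^ 4 * s" "10 * s'\<^sup>2 \<le> 1"
    and \<kappa>: "\<kappa> = 1 / (100 * K\<^sup>2)"
    and T: "partition_on (cone_nbhd (s'\<^sup>2)) T"
    and planks: "\<And>\<theta>. \<theta> \<in> T \<Longrightarrow> rr \<theta> \<ge> 0 \<and> cc \<theta> $ 1 = rr \<theta> * cos (tt \<theta>) \<and> cc \<theta> $ 2 = rr \<theta> * sin (tt \<theta>) \<and>
        cone_box (cc \<theta>) (tt \<theta>) (s' / K\<^sup>2) (s'\<^sup>2 / K\<^sup>2) (1 / K\<^sup>2) \<subseteq> \<theta> \<and>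
        \<theta> \<subseteq> cone_box (cc \<theta>) (tt \<theta>) (K\<^sup>2 * s') (K\<^sup>2 * s'\<^sup>2) (K\<^sup>2 * 1)"
    and c: "c \<in> cone_nbhd (s\<^sup>2)" "c$1 = \<rho> * cos t" "c$2 = \<rho> * sin t" "\<rho> \<ge> 0"
  shows "\<exists>\<theta>\<in>T. \<exists>k1 k2 k3 :: int.
      \<bar>of_int k1\<bar> \<le> 2000 * K ^ 3 \<and> \<bar>of_int k2\<bar> \<le> 2000 * K ^ 3 \<and> \<bar>of_int k3\<bar> \<le> 2000 * K ^ 3 \<and> 0 < k2 \<and>
      norm (ray t - ray (tt \<theta>)) \<le> 4 * K * s' \<and>
      (\<forall>\<xi>\<in>cone_box c t (2 * (K\<^sup>2 * s)) (2 * (K\<^sup>2 * s\<^sup>2)) (2 * (K\<^sup>2 * s)).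
         move (\<kappa> * of_int k2) (\<kappa> * s' * of_int k1) (\<kappa> * s'\<^sup>2 * of_int k3) \<xi>
           \<in> cone_box (cc \<theta>) (tt \<theta>) (s' / K\<^sup>2) (s'\<^sup>2 / K\<^sup>2) (1 / K\<^sup>2))"
proof -
  have s'0: "s' > 0" unfolding s'(1) using K s by simp
  have s'1: "s' \<le> 1"
  proof (rule power2_le_imp_le)
    show "s'\<^sup>2 \<le> 1\<^sup>2" unfolding power_one using s'(2) zero_le_power2[of s'] by linarith
  qed simp
  have K2: "K\<^sup>2 \<ge> 1" and K4: "K ^ 4 \<ge> 1" and K3: "K ^ 3 \<ge> 1" and K32: "K\<^sup>2 \<le> K ^ 3"
    using K by (auto intro: power_increasing)
  have ss': "100 * s \<le> s'" unfolding s'(1) using mult_right_mono[OF K4, of s] s by simp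
  have s2: "10000 * s\<^sup>2 \<le> s'\<^sup>2"
  proof -
    have "(100 * s)\<^sup>2 \<le> s'\<^sup>2" using ss' s by (intro power_mono) auto
    then show ?thesis by (simp add: power_mult_distrib)
  qed
  have \<kappa>0: "\<kappa> > 0" "\<kappa> \<le> 1 / 100" using K2 frac_le[of 1 1 100 "100 * K\<^sup>2"] by (auto simp: \<kappa>)
  have sq0: "(r * cos x)\<^sup>2 + (r * sin x)\<^sup>2 = r\<^sup>2" for r x :: real
    using distrib_left[of "r\<^sup>2" "(cos x)\<^sup>2" "(sin x)\<^sup>2"] by (simp add: power_mult_distrib)
  have sq: "sqrt ((r * cos x)\<^sup>2 + (r * sin x)\<^sup>2) = r" if "r \<ge> 0" for r x :: real
    unfolding sq0 using that by simp
  have sqrt2: "sqrt 2 \<le> 3 / 2" by (rule real_le_lsqrt) (auto simp: power2_eq_square)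
  have s20: "s\<^sup>2 > 0" "s'\<^sup>2 > 0" using s s'0 by auto
  have cb: "\<bar>c$3 - \<rho>\<bar> \<le> 4 * s\<^sup>2" "9 / 10 \<le> \<rho>" "\<rho> \<le> 16 / 10"
    using cone_nbhd_bounds[OF s20(1) c(1)] sqrt2 s2 s'(2) unfolding cone_defect_def c(2,3) sq[OF c(4)] by linarith+
  \<comment> \<open>The radius \<open>6/5\<close> lies strictly between \<open>1\<close> and \<open>sqrt 2\<close>.\<close>
  define \<xi>0 where "\<xi>0 = (6 / 5) *\<^sub>R ray t"
  have "\<xi>0 \<in> trunc_cone"
  proof -
    have v: "\<xi>0$1 = 6 / 5 * cos t" "\<xi>0$2 = 6 / 5 * sin t" "\<xi>0$3 = 6 / 5" by (simp_all add: \<xi>0_def ray_def)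
    show ?thesis unfolding trunc_cone_def mem_Collect_eq v sq0 real_sqrt_abs by (simp add: power2_eq_square)
  qed
  then have "\<xi>0 \<in> cone_nbhd (s'\<^sup>2)" using s20 by (simp add: cone_nbhd_def)
  then obtain \<theta> where \<theta>: "\<theta> \<in> T" "\<xi>0 \<in> \<theta>" using T unfolding partition_on_def by blast
  define c' t' \<rho>' where "c' = cc \<theta>" and "t' = tt \<theta>" and "\<rho>' = rr \<theta>"
  have pl: "\<rho>' \<ge> 0" "c'$1 = \<rho>' * cos t'" "c'$2 = \<rho>' * sin t'" "cone_box c' t' (s' / K\<^sup>2) (s'\<^sup>2 / K\<^sup>2) (1 / K\<^sup>2) \<subseteq> \<theta>"
      "\<theta> \<subseteq> cone_box c' t' (K\<^sup>2 * s') (K\<^sup>2 * s'\<^sup>2) (K\<^sup>2 * 1)"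
    using planks[OF \<theta>(1)] by (auto simp: c'_def t'_def \<rho>'_def)
  have "c' \<in> cone_box c' t' (s' / K\<^sup>2) (s'\<^sup>2 / K\<^sup>2) (1 / K\<^sup>2)"
    using s'0 by (simp add: cone_box_def)
  then have c'n: "c' \<in> cone_nbhd (s'\<^sup>2)" using pl(4) \<theta>(1) T unfolding partition_on_def by blast
  have cb': "\<bar>c'$3 - \<rho>'\<bar> \<le> 4 * s'\<^sup>2" "8 / 10 \<le> \<rho>'" "\<rho>' \<le> 17 / 10"
    using cone_nbhd_bounds[OF s20(2) c'n] sqrt2 s'(2) unfolding cone_defect_def pl(2,3) sq[OF pl(1)] by linarith+
  have ray: "norm (ray t - ray t') \<le> 4 * K * s'"
  proof -
    have m: "move 1 0 0 \<xi>0 = \<xi>0" by (simp add: vec_eq_iff forall_3 move_def)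
    \<comment> \<open>Leaving the ray of \<open>\<theta>\<close> by an angle \<open>\<alpha>\<close> moves a point of the cone by about \<open>\<alpha>\<^sup>2\<close> in the normal direction, and \<open>\<theta>\<close> has normal width \<open>O(s'\<^sup>2)\<close>.\<close>
    have "sqrt 2 * ((\<xi>0 - c') \<bullet> normal_dir t') = 6 / 5 * (cos (t - t') - 1) - (\<rho>' - c'$3)"
      using move_center(2)[of \<xi>0 "6 / 5" t c' \<rho>' t' "t + 0 - t'" 0 1 0] pl(2,3) unfolding m by (simp add: \<xi>0_def)
    moreover have "\<bar>(\<xi>0 - c') \<bullet> normal_dir t'\<bar> \<le> K\<^sup>2 * s'\<^sup>2 / 2" using pl(5) \<theta>(2) by (auto simp: cone_box_def)
    then have "\<bar>sqrt 2 * ((\<xi>0 - c') \<bullet> normal_dir t')\<bar> \<le> 3 / 2 * (K\<^sup>2 * s'\<^sup>2 / 2)"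
      unfolding abs_mult using sqrt2 by (intro mult_mono) auto
    moreover have "s'\<^sup>2 \<le> K\<^sup>2 * s'\<^sup>2" using K2 mult_right_mono[OF K2, of "s'\<^sup>2"] by simp
    moreover have "1 - y \<le> 4 * W" if "x = 6 / 5 * (y - 1) - (\<rho>' - c'$3)" "\<bar>x\<bar> \<le> 3 / 2 * (W / 2)" "\<bar>c'$3 - \<rho>'\<bar> \<le> 4 * W" for x y W :: real
      using that unfolding abs_le_iff by argo
    ultimately have "1 - cos (t - t') \<le> 4 * (K\<^sup>2 * s'\<^sup>2)" using cb'(1) by (meson mult_left_mono order_trans zero_le_numeral)
    moreover have "(norm (ray t - ray t'))\<^sup>2 = 2 * (1 - cos (t - t'))"
    proof -
      have "cos (2 * ((t - t') / 2)) = 1 - 2 * (sin ((t - t') / 2))\<^sup>2" by (rule cos_double_sin)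
      moreover have "2 * ((t - t') / 2) = t - t'" by simp
      ultimately have "cos (t - t') = 1 - 2 * (sin ((t - t') / 2))\<^sup>2" by (simp only:)
      then show ?thesis unfolding ray_diff by (simp add: power_mult_distrib)
    qed
    moreover have "(4 * K * s')\<^sup>2 = 16 * (K\<^sup>2 * s'\<^sup>2)" "0 \<le> K\<^sup>2 * s'\<^sup>2" by (simp_all add: power_mult_distrib)
    moreover have "a \<le> b" if "p \<le> 4 * W" "a = 2 * p" "b = 16 * W" "0 \<le> W" for a b p W :: real
      using that by linarith
    ultimately have "(norm (ray t - ray t'))\<^sup>2 \<le> (4 * K * s')\<^sup>2" by blast
    then show ?thesis by (rule power2_le_imp_le) (use K s'0 in auto)
  qed
  obtain \<sigma> where \<sigma>: "cos \<sigma> = cos (t' - t)" "sin \<sigma> = sin (t' - t)" "\<bar>\<sigma>\<bar> \<le> 4 * \<bar>sin ((t' - t) / 2)\<bar>"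
    using angle_representative by blast
  have \<sigma>b: "\<bar>\<sigma>\<bar> \<le> 8 * K * s'"
    using \<sigma>(3) norm_ray_diff[of t' t] ray by (simp add: norm_minus_commute)
  define t2 where "t2 = t + \<sigma>"
  have t2: "cos t2 = cos t'" "sin t2 = sin t'"
  proof -
    have "cos t2 = cos (t + (t' - t))" "sin t2 = sin (t + (t' - t))"
      unfolding t2_def cos_add sin_add \<sigma>(1,2) by (simp_all add: cos_add[symmetric] sin_add[symmetric])
    then show "cos t2 = cos t'" "sin t2 = sin t'" by simp_all
  qed
  define k1 where "k1 = \<lfloor>\<sigma> / (\<kappa> * s')\<rfloor>"
  define r0 where "r0 = \<rho>' / \<rho>"
  define k2 where "k2 = \<lfloor>r0 / \<kappa>\<rfloor>"
  define r where "r = \<kappa> * of_int k2"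
  \<comment> \<open>The translation is rounded last, because it has to compensate the vertical offset after the rounded dilation.\<close>
  define \<tau>0 where "\<tau>0 = r * (\<rho> - c$3) - (\<rho>' - c'$3)"
  define k3 where "k3 = \<lfloor>\<tau>0 / (\<kappa> * s'\<^sup>2)\<rfloor>"
  have g: "\<kappa> * s' > 0" "\<kappa> * s'\<^sup>2 > 0" using \<kappa>0 s'0 by auto
  have r0: "1 / 2 \<le> r0" "r0 \<le> 19 / 10"
    using cb cb' by (auto simp: r0_def field_simps)
  have r: "\<bar>r0 - r\<bar> \<le> \<kappa>" "r \<le> 19 / 10" "49 / 100 \<le> r"
    using floor_grid(1,2)[OF \<kappa>0(1), of r0] r0 \<kappa>0 by (auto simp: r_def k2_def)
  have \<tau>0: "\<bar>\<tau>0\<bar> \<le> 5 * s'\<^sup>2"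
  proof -
    have "\<bar>r * (\<rho> - c$3)\<bar> \<le> 2 * (4 * s\<^sup>2)"
      unfolding abs_mult using r cb(1) by (intro mult_mono) auto
    then show ?thesis using cb'(1) s2 unfolding \<tau>0_def by linarith
  qed
  have \<kappa>i: "1 / \<kappa> = 100 * K\<^sup>2" by (simp add: \<kappa>)
  have b1: "\<bar>of_int k1\<bar> \<le> 2000 * K ^ 3"
  proof -
    have "\<bar>of_int k1\<bar> \<le> \<bar>\<sigma>\<bar> / (\<kappa> * s') + 1" unfolding k1_def by (rule floor_grid(3)[OF g(1)])
    also have "\<bar>\<sigma>\<bar> / (\<kappa> * s') \<le> (8 * K * s') / (\<kappa> * s')" using \<sigma>b g by (intro divide_right_mono) auto
    also have "(8 * K * s') / (\<kappa> * s') = 8 * K * (1 / \<kappa>)" using s'0 by simp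
    also have "\<dots> = 800 * K ^ 3" unfolding \<kappa>i by (simp add: power2_eq_square power3_eq_cube)
    finally show ?thesis using K3 by linarith
  qed
  have b2: "\<bar>of_int k2\<bar> \<le> 2000 * K ^ 3"
  proof -
    have "\<bar>of_int k2\<bar> \<le> \<bar>r0\<bar> / \<kappa> + 1" unfolding k2_def by (rule floor_grid(3)[OF \<kappa>0(1)])
    also have "\<bar>r0\<bar> / \<kappa> = \<bar>r0\<bar> * (100 * K\<^sup>2)" by (simp add: \<kappa>)
    also have "\<dots> \<le> 2 * (100 * K\<^sup>2)" using r0 by (intro mult_right_mono) auto
    finally show ?thesis using K3 K32 by linarith
  qed
  have b3: "\<bar>of_int k3\<bar> \<le> 2000 * K ^ 3"
  proof -
    have "\<bar>of_int k3\<bar> \<le> \<bar>\<tau>0\<bar> / (\<kappa> * s'\<^sup>2) + 1" unfolding k3_def by (rule floor_grid(3)[OF g(2)])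
    also have "\<bar>\<tau>0\<bar> / (\<kappa> * s'\<^sup>2) \<le> (5 * s'\<^sup>2) / (\<kappa> * s'\<^sup>2)" using \<tau>0 g by (intro divide_right_mono) auto
    also have "(5 * s'\<^sup>2) / (\<kappa> * s'\<^sup>2) = 5 * (1 / \<kappa>)" using s'0 by simp
    also have "\<dots> = 500 * K\<^sup>2" unfolding \<kappa>i by simp
    finally show ?thesis using K3 K32 by linarith
  qed
  have k2: "0 < k2"
  proof -
    have "0 < \<kappa> * of_int k2" using r(3) by (simp add: r_def)
    then show ?thesis using \<kappa>0 by (simp add: zero_less_mult_iff)
  qed
  have mv: "move r (\<kappa> * s' * of_int k1) (\<kappa> * s'\<^sup>2 * of_int k3) \<xi> \<in> cone_box c' t2 (s' / K\<^sup>2) (s'\<^sup>2 / K\<^sup>2) (1 / K\<^sup>2)"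
    if \<xi>: "\<xi> \<in> cone_box c t (2 * (K\<^sup>2 * s)) (2 * (K\<^sup>2 * s\<^sup>2)) (2 * (K\<^sup>2 * s))" for \<xi>
  proof (rule move_into_core[OF K s s'(1) s'1 \<kappa> c(2,3) _ _ c(4) _ _ _ _ _ _ \<xi>])
    show "c'$1 = \<rho>' * cos t2" "c'$2 = \<rho>' * sin t2" using pl t2 by simp_all
    show "\<rho> \<le> 2" "0 \<le> r" "r \<le> 2" using cb r by auto
    show "\<bar>t + \<kappa> * s' * of_int k1 - t2\<bar> \<le> \<kappa> * s'"
      using floor_grid(1)[OF g(1), of \<sigma>] by (simp add: t2_def k1_def abs_minus_commute)
    show "\<bar>r * \<rho> - \<rho>'\<bar> \<le> 2 * \<kappa>"
    proof -
      have "\<rho>' = r0 * \<rho>" using cb by (simp add: r0_def)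
      then have "r * \<rho> - \<rho>' = (r - r0) * \<rho>" by (simp add: left_diff_distrib)
      then have "\<bar>r * \<rho> - \<rho>'\<bar> = \<bar>r0 - r\<bar> * \<rho>" using cb by (simp add: abs_mult abs_minus_commute)
      also have "\<dots> \<le> \<kappa> * 2" using r cb \<kappa>0 by (intro mult_mono) auto
      finally show ?thesis by simp
    qed
    show "\<bar>r * (\<rho> - c$3) - (\<rho>' - c'$3) - \<kappa> * s'\<^sup>2 * of_int k3\<bar> \<le> \<kappa> * s'\<^sup>2"
      using floor_grid(1)[OF g(2), of \<tau>0] by (simp add: \<tau>0_def k3_def)
  qed
  have box_eq: "cone_box c' t2 (s' / K\<^sup>2) (s'\<^sup>2 / K\<^sup>2) (1 / K\<^sup>2) = cone_box (cc \<theta>) (tt \<theta>) (s' / K\<^sup>2) (s'\<^sup>2 / K\<^sup>2) (1 / K\<^sup>2)"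
    using cos_sin_frame_cong(1)[OF t2] by (simp add: c'_def t'_def)
  show ?thesis
    using \<theta>(1) b1 b2 b3 k2 ray mv unfolding box_eq r_def t'_def
    by (intro bexI[of _ \<theta>] exI[of _ k1] exI[of _ k2] exI[of _ k3]) auto
qed

section \<open>Interpolation between \<open>L\<^sup>2\<close> and \<open>L\<^sup>4\<close>\<close>

text \<open>Families for which all convolutions with Schwartz kernels are Schwartz functions. The class is stable under truncation by size, as
  interpolation requires.\<close>

definition test_family :: "'i set \<Rightarrow> ('i \<Rightarrow> real^3 \<Rightarrow> complex) \<Rightarrow> bool" where
  "test_family I f \<longleftrightarrow> (\<forall>i\<in>I. f i \<in> borel_measurable borel \<and> (\<exists>B. \<forall>x. norm (f i x) \<le> B) \<and> (\<exists>M. \<forall>x. f i x \<noteq> 0 \<longrightarrow> norm x \<le> M))"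

definition superpose :: "'i set \<Rightarrow> ('i \<Rightarrow> real^3 \<Rightarrow> complex) \<Rightarrow> ('i \<Rightarrow> real^3 \<Rightarrow> complex) \<Rightarrow> real^3 \<Rightarrow> complex" where
  "superpose I u f x = (\<Sum>i\<in>I. conv (f i) (u i) x)"

lemma test_familyD:
  assumes "test_family I f" "i \<in> I"
  shows "f i \<in> borel_measurable borel" "integrable lborel (f i)" "\<exists>M. \<forall>x. f i x \<noteq> 0 \<longrightarrow> norm x \<le> M"
proof -
  obtain B M where BM: "\<And>x. norm (f i x) \<le> B" "\<And>x. f i x \<noteq> 0 \<Longrightarrow> norm x \<le> M"
    using assms unfolding test_family_def by metis
  show m: "f i \<in> borel_measurable borel" using assms by (auto simp: test_family_def)
  show "integrable lborel (f i)"
    by (rule integrable_bounded_support[OF m BM(1), of 0 M]) (use BM(2) in auto)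
  show "\<exists>M. \<forall>x. f i x \<noteq> 0 \<longrightarrow> norm x \<le> M" using BM by blast
qed

lemma nn_integral_powr_below:
  assumes "q > -1" "c \<ge> 0"
  shows "(\<integral>\<^sup>+lv. ennreal (indicator {0..c} lv * lv powr q) \<partial>lborel) = ennreal (c powr (q + 1) / (q + 1))"
proof -
  have "((\<lambda>x. x powr q) has_integral (c powr (q + 1) / (q + 1))) {0..c}"
    by (rule has_integral_powr_from_0[OF assms])
  then show ?thesis by (intro nn_integral_has_integral_lebesgue) auto
qed

lemma nn_integral_powr_above:
  assumes "q < -1" "c > 0"
  shows "(\<integral>\<^sup>+lv. ennreal (indicator {c..} lv * lv powr q) \<partial>lborel) = ennreal (- (c powr (q + 1)) / (q + 1))"
proof -
  have "((\<lambda>x. x powr q) has_integral (- (c powr (q + 1)) / (q + 1))) {c..}"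
    by (rule has_integral_powr_to_inf[OF assms])
  then show ?thesis by (intro nn_integral_has_integral_lebesgue) auto
qed

lemma powr_diff_2: "(lv::real) > 0 \<Longrightarrow> lv powr (p - 1) / lv ^ 2 = lv powr (p - 3)"
  using powr_diff[of lv "p - 1" 2] by (simp add: powr_numeral)

lemma powr_diff_4: "(lv::real) > 0 \<Longrightarrow> lv powr (p - 1) / lv ^ 4 = lv powr (p - 5)"
  using powr_diff[of lv "p - 1" 4] by (simp add: powr_numeral)

lemma level_integral:
  assumes p: "p > 0" and a: "a \<ge> 0"
  shows "(\<integral>\<^sup>+lv. ennreal (indicator {0<..} lv * (p * lv powr (p - 1))) * indicator {..<a} lv \<partial>lborel) = ennreal (a powr p)"
proof -
  have "(\<integral>\<^sup>+lv. ennreal (indicator {0<..} lv * (p * lv powr (p - 1))) * indicator {..<a} lv \<partial>lborel)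
      = (\<integral>\<^sup>+lv. ennreal p * ennreal (indicator {0..a} lv * lv powr (p - 1)) \<partial>lborel)"
  proof (rule nn_integral_cong_AE)
    have "AE x in lborel. x \<noteq> (0::real) \<and> x \<noteq> a"
      by (intro AE_conjI AE_lborel_singleton)
    then show "AE lv in lborel. ennreal (indicator {0<..} lv * (p * lv powr (p - 1))) * indicator {..<a} lv
        = ennreal p * ennreal (indicator {0..a} lv * lv powr (p - 1))"
      by (rule AE_mp) (rule AE_I2, use p in \<open>auto simp: indicator_def ennreal_mult[symmetric]\<close>)
  qed
  also have "\<dots> = ennreal p * ennreal (a powr p / p)"
    using nn_integral_powr_below[of "p - 1" a] p a by (subst nn_integral_cmult) auto
  also have "\<dots> = ennreal (a powr p)" using p by (simp add: ennreal_mult[symmetric])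
  finally show ?thesis .
qed

text \<open>The contribution of the large values: the condition \<open>b lv < a\<close> restricts \<open>lv\<close> to a bounded interval, on which \<open>lv powr (p - 3)\<close> is integrable because \<open>p > 2\<close>.\<close>

lemma high_integral:
  assumes p: "2 < p" and a: "a \<ge> 0" and b: "b > 0"
  shows "(\<integral>\<^sup>+lv. ennreal (indicator {0<..} lv * (p * lv powr (p - 1)) * (4 / lv ^ 2)) * ennreal (if b * lv < a then a ^ 2 else 0) \<partial>lborel)
     \<le> ennreal (4 * p / (p - 2) * b powr (2 - p) * a powr p)"
proof (cases "a = 0")
  case True
  have "(\<lambda>lv. ennreal (indicator {0<..} lv * (p * lv powr (p - 1)) * (4 / lv ^ 2)) * ennreal (if b * lv < a then a ^ 2 else 0)) = (\<lambda>_. 0)"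
    using True by (auto simp: fun_eq_iff)
  then show ?thesis by simp
next
  case False
  then have a: "a > 0" using a by simp
  have "(\<integral>\<^sup>+lv. ennreal (indicator {0<..} lv * (p * lv powr (p - 1)) * (4 / lv ^ 2)) * ennreal (if b * lv < a then a ^ 2 else 0) \<partial>lborel)
      \<le> (\<integral>\<^sup>+lv. ennreal (4 * p * a ^ 2) * ennreal (indicator {0..a / b} lv * lv powr (p - 3)) \<partial>lborel)"
  proof (rule nn_integral_mono)
    fix lv :: real
    show "ennreal (indicator {0<..} lv * (p * lv powr (p - 1)) * (4 / lv ^ 2)) * ennreal (if b * lv < a then a ^ 2 else 0)
       \<le> ennreal (4 * p * a ^ 2) * ennreal (indicator {0..a / b} lv * lv powr (p - 3))"
    proof (cases "0 < lv \<and> b * lv < a")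
      case True
      then have "lv \<le> a / b" using b by (simp add: pos_le_divide_eq mult.commute)
      moreover have "p * lv powr (p - 1) * (4 / lv ^ 2) * a ^ 2 = 4 * p * a ^ 2 * lv powr (p - 3)"
        using True by (simp add: powr_diff_2[symmetric])
      ultimately show ?thesis using True p by (simp add: ennreal_mult[symmetric])
    qed (auto simp: indicator_def)
  qed
  also have "\<dots> = ennreal (4 * p * a ^ 2) * ennreal ((a / b) powr (p - 2) / (p - 2))"
    using nn_integral_powr_below[of "p - 3" "a / b"] p a b by (subst nn_integral_cmult) auto
  also have "\<dots> = ennreal (4 * p / (p - 2) * b powr (2 - p) * a powr p)"
  proof -
    have "a ^ 2 * (a / b) powr (p - 2) = b powr (2 - p) * a powr p"
    proof -
      have "(a / b) powr (p - 2) = a powr (p - 2) * b powr (2 - p)"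
      proof -
        have "b powr (2 - p) = 1 / b powr (p - 2)" using powr_minus_divide[of b "p - 2"] by simp
        then show ?thesis using a b by (simp add: powr_divide)
      qed
      moreover have "a ^ 2 * a powr (p - 2) = a powr p"
        using a powr_add[of a 2 "p - 2"] by (simp add: powr_numeral)
      ultimately show ?thesis by (metis mult.assoc mult.commute)
    qed
    then have "4 * p * a ^ 2 * ((a / b) powr (p - 2) / (p - 2)) = 4 * p / (p - 2) * b powr (2 - p) * a powr p"
      by (simp add: mult.assoc)
    then show ?thesis using p by (simp add: ennreal_mult[symmetric])
  qed
  finally show ?thesis .
qed

text \<open>The contribution of the small values: \<open>lv powr (p - 5)\<close> is integrable at infinity because \<open>p < 4\<close>.\<close>

lemma low_integral:
  assumes p: "0 < p" "p < 4" and a: "a \<ge> 0" and b: "b > 0"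
  shows "(\<integral>\<^sup>+lv. ennreal (indicator {0<..} lv * (p * lv powr (p - 1)) * (16 / lv ^ 4)) * ennreal (if a \<le> b * lv then a ^ 4 else 0) \<partial>lborel)
     \<le> ennreal (16 * p / (4 - p) * b powr (4 - p) * a powr p)"
proof (cases "a = 0")
  case True
  have "(\<lambda>lv. ennreal (indicator {0<..} lv * (p * lv powr (p - 1)) * (16 / lv ^ 4)) * ennreal (if a \<le> b * lv then a ^ 4 else 0)) = (\<lambda>_. 0)"
    using True by (auto simp: fun_eq_iff)
  then show ?thesis by simp
next
  case False
  then have a: "a > 0" using a by simp
  have "(\<integral>\<^sup>+lv. ennreal (indicator {0<..} lv * (p * lv powr (p - 1)) * (16 / lv ^ 4)) * ennreal (if a \<le> b * lv then a ^ 4 else 0) \<partial>lborel)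
      \<le> (\<integral>\<^sup>+lv. ennreal (16 * p * a ^ 4) * ennreal (indicator {a / b..} lv * lv powr (p - 5)) \<partial>lborel)"
  proof (rule nn_integral_mono)
    fix lv :: real
    show "ennreal (indicator {0<..} lv * (p * lv powr (p - 1)) * (16 / lv ^ 4)) * ennreal (if a \<le> b * lv then a ^ 4 else 0)
       \<le> ennreal (16 * p * a ^ 4) * ennreal (indicator {a / b..} lv * lv powr (p - 5))"
    proof (cases "0 < lv \<and> a \<le> b * lv")
      case True
      then have "a / b \<le> lv" using b by (simp add: pos_divide_le_eq mult.commute)
      moreover have "p * lv powr (p - 1) * (16 / lv ^ 4) * a ^ 4 = 16 * p * a ^ 4 * lv powr (p - 5)"
        using True by (simp add: powr_diff_4[symmetric])
      ultimately show ?thesis using True p by (simp add: ennreal_mult[symmetric])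
    qed (auto simp: indicator_def)
  qed
  also have "\<dots> = ennreal (16 * p * a ^ 4) * ennreal (- ((a / b) powr (p - 4)) / (p - 4))"
    using nn_integral_powr_above[of "p - 5" "a / b"] p a b by (subst nn_integral_cmult) auto
  also have "\<dots> = ennreal (16 * p / (4 - p) * b powr (4 - p) * a powr p)"
  proof -
    have "a ^ 4 * (a / b) powr (p - 4) = b powr (4 - p) * a powr p"
    proof -
      have "(a / b) powr (p - 4) = a powr (p - 4) * b powr (4 - p)"
      proof -
        have "b powr (4 - p) = 1 / b powr (p - 4)" using powr_minus_divide[of b "p - 4"] by simp
        then show ?thesis using a b by (simp add: powr_divide)
      qed
      moreover have "a ^ 4 * a powr (p - 4) = a powr p"
        using a powr_add[of a 4 "p - 4"] by (simp add: powr_numeral)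
      ultimately show ?thesis by (metis mult.assoc mult.commute)
    qed
    moreover have "- ((a / b) powr (p - 4)) / (p - 4) = (a / b) powr (p - 4) / (4 - p)"
      using p by (simp add: field_simps)
    ultimately have "16 * p * a ^ 4 * (- ((a / b) powr (p - 4)) / (p - 4)) = 16 * p / (4 - p) * b powr (4 - p) * a powr p"
      by (simp add: mult.assoc)
    then show ?thesis using p by (simp add: ennreal_mult[symmetric] divide_nonneg_neg)
  qed
  finally show ?thesis .
qed

lemma superpose_measurable:
  assumes "\<And>i. i \<in> I \<Longrightarrow> f i \<in> borel_measurable borel" "\<And>i. i \<in> I \<Longrightarrow> u i \<in> borel_measurable borel"
  shows "superpose I u f \<in> borel_measurable borel"
  unfolding superpose_def[abs_def] using assms by (intro borel_measurable_sum borel_measurable_conv)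

text \<open>Real interpolation. At the level \<open>lv\<close>, split every \<open>f i\<close> at the height \<open>b lv\<close>, estimate the large part in \<open>L\<^sup>2\<close> and the small
  part in \<open>L\<^sup>4\<close>, and integrate over the levels. The choice \<open>b = sqrt (A2 / A4)\<close> balances the two contributions.\<close>

theorem marcinkiewicz_superpose:
  assumes I: "finite I" and u: "\<And>i. i \<in> I \<Longrightarrow> u i \<in> borel_measurable borel" "\<And>i x. i \<in> I \<Longrightarrow> norm (u i x) \<le> U i"
    and A: "A2 > 0" "A4 > 0"
    and L2: "\<And>f. test_family I f \<Longrightarrow>
       (\<integral>\<^sup>+x. ennreal (norm (superpose I u f x) ^ 2) \<partial>lborel) \<le> ennreal A2 * (\<Sum>i\<in>I. \<integral>\<^sup>+x. ennreal (norm (f i x) ^ 2) \<partial>lborel)"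
    and L4: "\<And>f. test_family I f \<Longrightarrow>
       (\<integral>\<^sup>+x. ennreal (norm (superpose I u f x) ^ 4) \<partial>lborel) \<le> ennreal A4 * (\<Sum>i\<in>I. \<integral>\<^sup>+x. ennreal (norm (f i x) ^ 4) \<partial>lborel)"
    and p: "2 < p" "p < 4" and f: "test_family I f"
  shows "(\<integral>\<^sup>+x. ennreal (norm (superpose I u f x) powr p) \<partial>lborel)
     \<le> ennreal ((4 * p / (p - 2) + 16 * p / (4 - p)) * A2 powr ((4 - p) / 2) * A4 powr ((p - 2) / 2))
        * (\<Sum>i\<in>I. \<integral>\<^sup>+x. ennreal (norm (f i x) powr p) \<partial>lborel)"
proof -
  define b where "b = sqrt (A2 / A4)"
  have b: "b > 0" using A by (simp add: b_def)
  define fh where "fh lv i x = (if b * lv < norm (f i x) then f i x else 0)" for lv i x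
  define fl where "fl lv i x = (if norm (f i x) \<le> b * lv then f i x else 0)" for lv i x
  have fm: "f i \<in> borel_measurable borel" if "i \<in> I" for i using test_familyD(1)[OF f that] .
  have tf: "test_family I (fh lv)" "test_family I (fl lv)" for lv
  proof -
    have "fh lv i \<in> borel_measurable borel \<and> fl lv i \<in> borel_measurable borel \<and> (\<exists>B. \<forall>x. norm (fh lv i x) \<le> B) \<and> (\<exists>B. \<forall>x. norm (fl lv i x) \<le> B)
       \<and> (\<exists>M. \<forall>x. fh lv i x \<noteq> 0 \<longrightarrow> norm x \<le> M) \<and> (\<exists>M. \<forall>x. fl lv i x \<noteq> 0 \<longrightarrow> norm x \<le> M)" if i: "i \<in> I" for i
    proof -
      have [measurable]: "f i \<in> borel_measurable borel" by (rule fm[OF i])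
      obtain B M where BM: "\<And>x. norm (f i x) \<le> B" "\<And>x. f i x \<noteq> 0 \<Longrightarrow> norm x \<le> M"
        using f i unfolding test_family_def by metis
      have B0: "0 \<le> B" using order_trans[OF norm_ge_zero BM(1)] .
      have "norm (fh lv i x) \<le> B" "norm (fl lv i x) \<le> B" for x using BM(1)[of x] B0 by (auto simp: fh_def fl_def)
      moreover have "fh lv i x \<noteq> 0 \<longrightarrow> norm x \<le> M" "fl lv i x \<noteq> 0 \<longrightarrow> norm x \<le> M" for x using BM(2)[of x] by (auto simp: fh_def fl_def)
      moreover have "fh lv i \<in> borel_measurable borel" "fl lv i \<in> borel_measurable borel"
        unfolding fh_def[abs_def] fl_def[abs_def] by measurable
      ultimately show ?thesis by blast
    qed
    then show "test_family I (fh lv)" "test_family I (fl lv)" unfolding test_family_def by blast+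
  qed
  have split: "superpose I u f x = superpose I u (fh lv) x + superpose I u (fl lv) x" for lv x
  proof -
    have "conv (f i) (u i) x = conv (fh lv i) (u i) x + conv (fl lv i) (u i) x" if i: "i \<in> I" for i
    proof -
      have [measurable]: "u i \<in> borel_measurable borel" by (rule u(1)[OF i])
      have int: "integrable lborel (\<lambda>y. g i y * u i (x - y))" if "test_family I g" for g
        by (rule integrable_mult_bounded[OF test_familyD(2)[OF that i], of _ "U i"]) (auto simp: u(2)[OF i])
      have "f i y * u i (x - y) = fh lv i y * u i (x - y) + fl lv i y * u i (x - y)" for y
        by (auto simp: fh_def fl_def)
      then show ?thesis unfolding conv_def using int[OF tf(1)] int[OF tf(2)] by simp
    qed
    then show ?thesis unfolding superpose_def by (simp add: sum.distrib)
  qed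
  have sm: "superpose I u g \<in> borel_measurable borel" if "test_family I g" for g
    by (rule superpose_measurable[OF test_familyD(1)[OF that] u(1)])
  let ?g = "superpose I u f"
  have [measurable]: "?g \<in> borel_measurable borel" by (rule sm[OF f])
  let ?w = "\<lambda>lv. indicator {0<..} lv * (p * lv powr (p - 1)) :: real"
  let ?H = "\<lambda>i x lv. ennreal (?w lv * (4 / lv ^ 2)) * ennreal (if b * lv < norm (f i x) then norm (f i x) ^ 2 else 0)"
  let ?L = "\<lambda>i x lv. ennreal (?w lv * (16 / lv ^ 4)) * ennreal (if norm (f i x) \<le> b * lv then norm (f i x) ^ 4 else 0)"
  have level: "ennreal (?w lv) * (\<integral>\<^sup>+x. indicator {..<norm (?g x)} lv \<partial>lborel)
      \<le> (\<Sum>i\<in>I. ennreal A2 * (\<integral>\<^sup>+x. ?H i x lv \<partial>lborel)) + (\<Sum>i\<in>I. ennreal A4 * (\<integral>\<^sup>+x. ?L i x lv \<partial>lborel))" for lv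
  proof (cases "lv > 0")
    case True
    have [measurable]: "superpose I u (fh lv) \<in> borel_measurable borel" "superpose I u (fl lv) \<in> borel_measurable borel"
      by (rule sm[OF tf(1)], rule sm[OF tf(2)])
    \<comment> \<open>If the sum exceeds \<open>lv\<close>, then one of its two parts is at least \<open>lv / 2\<close>.\<close>
    have pt: "indicator {..<norm (?g x)} lv \<le> ennreal (4 / lv ^ 2) * ennreal (norm (superpose I u (fh lv) x) ^ 2) + ennreal (16 / lv ^ 4) * ennreal (norm (superpose I u (fl lv) x) ^ 4)" for x
    proof (cases "lv < norm (?g x)")
      case lt: True
      have "norm (?g x) \<le> norm (superpose I u (fh lv) x) + norm (superpose I u (fl lv) x)"
        unfolding split[of x lv] by (rule norm_triangle_ineq)
      then consider "lv / 2 \<le> norm (superpose I u (fh lv) x)" | "lv / 2 \<le> norm (superpose I u (fl lv) x)" using lt by linarith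
      then have "1 \<le> 4 / lv ^ 2 * norm (superpose I u (fh lv) x) ^ 2 + 16 / lv ^ 4 * norm (superpose I u (fl lv) x) ^ 4"
      proof cases
        case 1
        then have "(lv / 2) ^ 2 \<le> norm (superpose I u (fh lv) x) ^ 2" using True by (intro power_mono) auto
        then have "1 \<le> 4 / lv ^ 2 * norm (superpose I u (fh lv) x) ^ 2" using True by (simp add: power_divide field_simps)
        moreover have "0 \<le> 16 / lv ^ 4 * norm (superpose I u (fl lv) x) ^ 4" by simp
        ultimately show ?thesis by linarith
      next
        case 2
        then have "(lv / 2) ^ 4 \<le> norm (superpose I u (fl lv) x) ^ 4" using True by (intro power_mono) auto
        then have "1 \<le> 16 / lv ^ 4 * norm (superpose I u (fl lv) x) ^ 4" using True by (simp add: power_divide field_simps)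
        moreover have "0 \<le> 4 / lv ^ 2 * norm (superpose I u (fh lv) x) ^ 2" by simp
        ultimately show ?thesis by linarith
      qed
      then have "ennreal 1 \<le> ennreal (4 / lv ^ 2 * norm (superpose I u (fh lv) x) ^ 2 + 16 / lv ^ 4 * norm (superpose I u (fl lv) x) ^ 4)"
        by (rule ennreal_leI)
      then show ?thesis using lt by (simp add: ennreal_mult[symmetric] ennreal_plus[symmetric] del: ennreal_plus)
    qed simp
    have "(\<integral>\<^sup>+x. indicator {..<norm (?g x)} lv \<partial>lborel) \<le>
       (\<integral>\<^sup>+x. ennreal (4 / lv ^ 2) * ennreal (norm (superpose I u (fh lv) x) ^ 2) + ennreal (16 / lv ^ 4) * ennreal (norm (superpose I u (fl lv) x) ^ 4) \<partial>lborel)"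
      by (intro nn_integral_mono pt)
    also have "\<dots> = ennreal (4 / lv ^ 2) * (\<integral>\<^sup>+x. ennreal (norm (superpose I u (fh lv) x) ^ 2) \<partial>lborel)
        + ennreal (16 / lv ^ 4) * (\<integral>\<^sup>+x. ennreal (norm (superpose I u (fl lv) x) ^ 4) \<partial>lborel)"
      by (simp add: nn_integral_add nn_integral_cmult)
    also have "\<dots> \<le> ennreal (4 / lv ^ 2) * (ennreal A2 * (\<Sum>i\<in>I. \<integral>\<^sup>+x. ennreal (norm (fh lv i x) ^ 2) \<partial>lborel))
        + ennreal (16 / lv ^ 4) * (ennreal A4 * (\<Sum>i\<in>I. \<integral>\<^sup>+x. ennreal (norm (fl lv i x) ^ 4) \<partial>lborel))"
      by (intro add_mono mult_left_mono L2 L4 tf) auto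
    finally have "ennreal (?w lv) * (\<integral>\<^sup>+x. indicator {..<norm (?g x)} lv \<partial>lborel) \<le> ennreal (?w lv) * \<dots>"
      by (intro mult_left_mono) auto
    also have "\<dots> = (\<Sum>i\<in>I. ennreal A2 * (\<integral>\<^sup>+x. ?H i x lv \<partial>lborel)) + (\<Sum>i\<in>I. ennreal A4 * (\<integral>\<^sup>+x. ?L i x lv \<partial>lborel))"
    proof -
      have w0: "?w lv \<ge> 0" using p by auto
      have H: "(\<integral>\<^sup>+x. ?H i x lv \<partial>lborel) = ennreal (?w lv) * (ennreal (4 / lv ^ 2) * (\<integral>\<^sup>+x. ennreal (norm (fh lv i x) ^ 2) \<partial>lborel))" if i: "i \<in> I" for i
      proof -
        have [measurable]: "f i \<in> borel_measurable borel" by (rule fm[OF i])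
        have eq: "(if b * lv < norm (f i x) then norm (f i x) ^ 2 else 0) = norm (fh lv i x) ^ 2" for x by (simp add: fh_def)
        have [measurable]: "fh lv i \<in> borel_measurable borel" unfolding fh_def[abs_def] by measurable
        have A: "(\<integral>\<^sup>+x. ?H i x lv \<partial>lborel) = ennreal (?w lv * (4 / lv ^ 2)) * (\<integral>\<^sup>+x. ennreal (norm (fh lv i x) ^ 2) \<partial>lborel)"
          unfolding eq by (rule nn_integral_cmult) measurable
        have "ennreal (?w lv * (4 / lv ^ 2)) = ennreal (?w lv) * ennreal (4 / lv ^ 2)"
          using w0 by (intro ennreal_mult) auto
        then show ?thesis by (intro trans[OF A]) (simp only: mult.assoc)
      qed
      have L: "(\<integral>\<^sup>+x. ?L i x lv \<partial>lborel) = ennreal (?w lv) * (ennreal (16 / lv ^ 4) * (\<integral>\<^sup>+x. ennreal (norm (fl lv i x) ^ 4) \<partial>lborel))" if i: "i \<in> I" for i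
      proof -
        have [measurable]: "f i \<in> borel_measurable borel" by (rule fm[OF i])
        have eq: "(if norm (f i x) \<le> b * lv then norm (f i x) ^ 4 else 0) = norm (fl lv i x) ^ 4" for x by (simp add: fl_def)
        have [measurable]: "fl lv i \<in> borel_measurable borel" unfolding fl_def[abs_def] by measurable
        have A: "(\<integral>\<^sup>+x. ?L i x lv \<partial>lborel) = ennreal (?w lv * (16 / lv ^ 4)) * (\<integral>\<^sup>+x. ennreal (norm (fl lv i x) ^ 4) \<partial>lborel)"
          unfolding eq by (rule nn_integral_cmult) measurable
        have "ennreal (?w lv * (16 / lv ^ 4)) = ennreal (?w lv) * ennreal (16 / lv ^ 4)"
          using w0 by (intro ennreal_mult) auto
        then show ?thesis by (intro trans[OF A]) (simp only: mult.assoc)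
      qed
      have "(\<Sum>i\<in>I. ennreal A2 * (\<integral>\<^sup>+x. ?H i x lv \<partial>lborel)) = (\<Sum>i\<in>I. ennreal A2 * (ennreal (?w lv) * (ennreal (4 / lv ^ 2) * (\<integral>\<^sup>+x. ennreal (norm (fh lv i x) ^ 2) \<partial>lborel))))"
        by (intro sum.cong refl) (simp only: H)
      moreover have "(\<Sum>i\<in>I. ennreal A4 * (\<integral>\<^sup>+x. ?L i x lv \<partial>lborel)) = (\<Sum>i\<in>I. ennreal A4 * (ennreal (?w lv) * (ennreal (16 / lv ^ 4) * (\<integral>\<^sup>+x. ennreal (norm (fl lv i x) ^ 4) \<partial>lborel))))"
        by (intro sum.cong refl) (simp only: L)
      ultimately show ?thesis by (simp only: distrib_left sum_distrib_left mult_ac)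
    qed
    finally show ?thesis .
  qed simp
  have "(\<integral>\<^sup>+x. ennreal (norm (?g x) powr p) \<partial>lborel) = (\<integral>\<^sup>+x. (\<integral>\<^sup>+lv. ennreal (?w lv) * indicator {..<norm (?g x)} lv \<partial>lborel) \<partial>lborel)"
    using p by (subst level_integral) auto
  also have "\<dots> = (\<integral>\<^sup>+lv. (\<integral>\<^sup>+x. ennreal (?w lv) * indicator {..<norm (?g x)} lv \<partial>lborel) \<partial>lborel)"
    by (rule lborel_pair.Fubini') (simp add: lessThan_def indicator_def[abs_def])
  also have "\<dots> = (\<integral>\<^sup>+lv. ennreal (?w lv) * (\<integral>\<^sup>+x. indicator {..<norm (?g x)} lv \<partial>lborel) \<partial>lborel)"
    by (intro nn_integral_cong nn_integral_cmult) (simp add: lessThan_def indicator_def[abs_def])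
  also have "\<dots> \<le> (\<integral>\<^sup>+lv. (\<Sum>i\<in>I. ennreal A2 * (\<integral>\<^sup>+x. ?H i x lv \<partial>lborel)) + (\<Sum>i\<in>I. ennreal A4 * (\<integral>\<^sup>+x. ?L i x lv \<partial>lborel)) \<partial>lborel)"
    by (intro nn_integral_mono level)
  also have "\<dots> = (\<Sum>i\<in>I. ennreal A2 * (\<integral>\<^sup>+lv. (\<integral>\<^sup>+x. ?H i x lv \<partial>lborel) \<partial>lborel)) + (\<Sum>i\<in>I. ennreal A4 * (\<integral>\<^sup>+lv. (\<integral>\<^sup>+x. ?L i x lv \<partial>lborel) \<partial>lborel))"
  proof -
    have mH: "(\<lambda>lv. \<integral>\<^sup>+x. ?H i x lv \<partial>lborel) \<in> borel_measurable lborel" and mL: "(\<lambda>lv. \<integral>\<^sup>+x. ?L i x lv \<partial>lborel) \<in> borel_measurable lborel" if i: "i \<in> I" for i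
    proof -
      have [measurable]: "f i \<in> borel_measurable borel" by (rule fm[OF i])
      show "(\<lambda>lv. \<integral>\<^sup>+x. ?H i x lv \<partial>lborel) \<in> borel_measurable lborel" by measurable
      show "(\<lambda>lv. \<integral>\<^sup>+x. ?L i x lv \<partial>lborel) \<in> borel_measurable lborel" by measurable
    qed
    show ?thesis
      using mH mL by (subst nn_integral_add) (auto simp: nn_integral_sum nn_integral_cmult)
  qed
  also have "\<dots> \<le> (\<Sum>i\<in>I. ennreal A2 * (ennreal (4 * p / (p - 2) * b powr (2 - p)) * (\<integral>\<^sup>+x. ennreal (norm (f i x) powr p) \<partial>lborel)))
       + (\<Sum>i\<in>I. ennreal A4 * (ennreal (16 * p / (4 - p) * b powr (4 - p)) * (\<integral>\<^sup>+x. ennreal (norm (f i x) powr p) \<partial>lborel)))"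
  proof (intro add_mono sum_mono mult_left_mono)
    fix i assume i: "i \<in> I"
    have [measurable]: "f i \<in> borel_measurable borel" by (rule fm[OF i])
    have "(\<integral>\<^sup>+lv. (\<integral>\<^sup>+x. ?H i x lv \<partial>lborel) \<partial>lborel) = (\<integral>\<^sup>+x. (\<integral>\<^sup>+lv. ?H i x lv \<partial>lborel) \<partial>lborel)"
      by (rule lborel_pair.Fubini') measurable
    also have "\<dots> \<le> (\<integral>\<^sup>+x. ennreal (4 * p / (p - 2) * b powr (2 - p) * norm (f i x) powr p) \<partial>lborel)"
      by (intro nn_integral_mono high_integral p b) auto
    also have "\<dots> = (\<integral>\<^sup>+x. ennreal (4 * p / (p - 2) * b powr (2 - p)) * ennreal (norm (f i x) powr p) \<partial>lborel)"
      using p by (intro nn_integral_cong ennreal_mult) auto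
    also have "\<dots> = ennreal (4 * p / (p - 2) * b powr (2 - p)) * (\<integral>\<^sup>+x. ennreal (norm (f i x) powr p) \<partial>lborel)"
      by (rule nn_integral_cmult) measurable
    finally show "(\<integral>\<^sup>+lv. (\<integral>\<^sup>+x. ?H i x lv \<partial>lborel) \<partial>lborel) \<le> ennreal (4 * p / (p - 2) * b powr (2 - p)) * (\<integral>\<^sup>+x. ennreal (norm (f i x) powr p) \<partial>lborel)" .
    have "(\<integral>\<^sup>+lv. (\<integral>\<^sup>+x. ?L i x lv \<partial>lborel) \<partial>lborel) = (\<integral>\<^sup>+x. (\<integral>\<^sup>+lv. ?L i x lv \<partial>lborel) \<partial>lborel)"
      by (rule lborel_pair.Fubini') measurable
    also have "\<dots> \<le> (\<integral>\<^sup>+x. ennreal (16 * p / (4 - p) * b powr (4 - p) * norm (f i x) powr p) \<partial>lborel)"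
      using p by (intro nn_integral_mono low_integral b) auto
    also have "\<dots> = (\<integral>\<^sup>+x. ennreal (16 * p / (4 - p) * b powr (4 - p)) * ennreal (norm (f i x) powr p) \<partial>lborel)"
      using p by (intro nn_integral_cong ennreal_mult) auto
    also have "\<dots> = ennreal (16 * p / (4 - p) * b powr (4 - p)) * (\<integral>\<^sup>+x. ennreal (norm (f i x) powr p) \<partial>lborel)"
      by (rule nn_integral_cmult) measurable
    finally show "(\<integral>\<^sup>+lv. (\<integral>\<^sup>+x. ?L i x lv \<partial>lborel) \<partial>lborel) \<le> ennreal (16 * p / (4 - p) * b powr (4 - p)) * (\<integral>\<^sup>+x. ennreal (norm (f i x) powr p) \<partial>lborel)" .
  qed auto
  also have "\<dots> = (ennreal (A2 * (4 * p / (p - 2) * b powr (2 - p))) + ennreal (A4 * (16 * p / (4 - p) * b powr (4 - p)))) * (\<Sum>i\<in>I. \<integral>\<^sup>+x. ennreal (norm (f i x) powr p) \<partial>lborel)"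
  proof -
    have "ennreal (A2 * (4 * p / (p - 2) * b powr (2 - p))) = ennreal A2 * ennreal (4 * p / (p - 2) * b powr (2 - p))"
      using A p by (intro ennreal_mult) auto
    moreover have "ennreal (A4 * (16 * p / (4 - p) * b powr (4 - p))) = ennreal A4 * ennreal (16 * p / (4 - p) * b powr (4 - p))"
      using A p by (intro ennreal_mult) auto
    ultimately show ?thesis by (simp only: sum_distrib_left distrib_right mult.assoc sum.distrib)
  qed
  also have "ennreal (A2 * (4 * p / (p - 2) * b powr (2 - p))) + ennreal (A4 * (16 * p / (4 - p) * b powr (4 - p)))
      = ennreal ((4 * p / (p - 2) + 16 * p / (4 - p)) * A2 powr ((4 - p) / 2) * A4 powr ((p - 2) / 2))"
  proof -
    have "b powr q = A2 powr (q / 2) * A4 powr (- q / 2)" for q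
    proof -
      have "b = (A2 / A4) powr (1 / 2)" using A by (simp add: b_def powr_half_sqrt)
      then have "b powr q = (A2 / A4) powr (q / 2)" by (simp add: powr_powr)
      also have "\<dots> = A2 powr (q / 2) * A4 powr (- (q / 2))" using A powr_minus_divide[of A4 "q / 2"] by (simp add: powr_divide)
      finally show ?thesis by simp
    qed
    note bq = this
    have 1: "b powr (2 - p) = A2 powr ((2 - p) / 2) * A4 powr ((p - 2) / 2)" "b powr (4 - p) = A2 powr ((4 - p) / 2) * A4 powr ((p - 4) / 2)"
      by (simp_all only: bq minus_diff_eq)
    have 2: "A2 * A2 powr ((2 - p) / 2) = A2 powr ((4 - p) / 2)" "A4 * A4 powr ((p - 4) / 2) = A4 powr ((p - 2) / 2)"
    proof -
      have "(4 - p) / 2 = 1 + (2 - p) / 2" "(p - 2) / 2 = 1 + (p - 4) / 2" by (simp_all add: field_simps)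
      then show "A2 * A2 powr ((2 - p) / 2) = A2 powr ((4 - p) / 2)" "A4 * A4 powr ((p - 4) / 2) = A4 powr ((p - 2) / 2)"
        using A by (simp_all only: powr_add powr_one less_imp_le)
    qed
    define X where "X = A2 powr ((4 - p) / 2) * A4 powr ((p - 2) / 2)"
    have X: "X \<ge> 0" by (simp add: X_def)
    have re: "a * (c * (u * v)) = c * (a * u * v)" "a * (c * (u * v)) = c * (u * (a * v))" for a c u v :: real
      by simp_all
    have 3: "A2 * (4 * p / (p - 2) * b powr (2 - p)) = 4 * p / (p - 2) * X"
      unfolding 1(1) X_def 2(1)[symmetric] by (rule re(1))
    have 4: "A4 * (16 * p / (4 - p) * b powr (4 - p)) = 16 * p / (4 - p) * X"
      unfolding 1(2) X_def 2(2)[symmetric] by (rule re(2))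
    have nn: "4 * p / (p - 2) * X \<ge> 0" "16 * p / (4 - p) * X \<ge> 0" using p X by auto
    show ?thesis unfolding 3 4 ennreal_plus[OF nn, symmetric] by (simp only: X_def distrib_right mult.assoc)
  qed
  finally show ?thesis .
qed

text \<open>Restrict the family to growing balls and apply Fatou's lemma. The cap projections of a Schwartz function are bounded but not
  compactly supported.\<close>

theorem superpose_bounded_extension:
  assumes I: "finite I" and u: "\<And>i. i \<in> I \<Longrightarrow> integrable lborel (u i)"
    and bound: "\<And>f. test_family I f \<Longrightarrow>
       (\<integral>\<^sup>+x. ennreal (norm (superpose I u f x) powr p) \<partial>lborel) \<le> ennreal C * (\<Sum>i\<in>I. \<integral>\<^sup>+x. ennreal (norm (f i x) powr p) \<partial>lborel)"
    and p: "p > 0"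
    and f: "\<And>i. i \<in> I \<Longrightarrow> f i \<in> borel_measurable borel" "\<And>i. i \<in> I \<Longrightarrow> \<exists>B. \<forall>x. norm (f i x) \<le> B"
  shows "(\<integral>\<^sup>+x. ennreal (norm (superpose I u f x) powr p) \<partial>lborel) \<le> ennreal C * (\<Sum>i\<in>I. \<integral>\<^sup>+x. ennreal (norm (f i x) powr p) \<partial>lborel)"
proof -
  define g where "g n i x = (if norm x \<le> real n then f i x else 0)" for n i x
  have um: "u i \<in> borel_measurable borel" if "i \<in> I" for i using u[OF that] by auto
  have gm: "g n i \<in> borel_measurable borel" if "i \<in> I" for n i
  proof -
    have [measurable]: "f i \<in> borel_measurable borel" by (rule f(1)[OF that])
    show ?thesis unfolding g_def[abs_def] by measurable
  qed
  have tf: "test_family I (g n)" for n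
    unfolding test_family_def
  proof (intro ballI conjI)
    fix i assume i: "i \<in> I"
    show "g n i \<in> borel_measurable borel" by (rule gm[OF i])
    obtain B where B: "\<And>x. norm (f i x) \<le> B" using f(2)[OF i] by blast
    have "0 \<le> B" using order_trans[OF norm_ge_zero B] .
    then show "\<exists>B. \<forall>x. norm (g n i x) \<le> B" using B by (intro exI[of _ B]) (auto simp: g_def)
    show "\<exists>M. \<forall>x. g n i x \<noteq> 0 \<longrightarrow> norm x \<le> M" by (intro exI[of _ "real n"]) (auto simp: g_def)
  qed
  have lim: "(\<lambda>n. superpose I u (g n) x) \<longlonglongrightarrow> superpose I u f x" for x
    unfolding superpose_def
  proof (rule tendsto_sum)
    fix i assume i: "i \<in> I"
    obtain B where B: "\<And>x. norm (f i x) \<le> B" using f(2)[OF i] by blast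
    have B0: "0 \<le> B" using order_trans[OF norm_ge_zero B] .
    have [measurable]: "u i \<in> borel_measurable borel" "f i \<in> borel_measurable borel" "\<And>n. g n i \<in> borel_measurable borel"
      by (rule um[OF i], rule f(1)[OF i], rule gm[OF i])
    show "(\<lambda>n. conv (g n i) (u i) x) \<longlonglongrightarrow> conv (f i) (u i) x"
      unfolding conv_def
    proof (rule integral_dominated_convergence[of _ _ _ "\<lambda>y. B * norm (u i (x - y))"])
      show "integrable lborel (\<lambda>y. B * norm (u i (x - y)))"
        using lborel_integrable_reflect[OF um[OF i] u[OF i], of x] by (auto intro: integrable_norm)
      show "AE y in lborel. norm (g n i y * u i (x - y)) \<le> B * norm (u i (x - y))" for n
        using B B0 by (auto simp: norm_mult g_def intro!: AE_I2 mult_right_mono)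
      show "AE y in lborel. (\<lambda>n. g n i y * u i (x - y)) \<longlonglongrightarrow> f i y * u i (x - y)"
      proof (rule AE_I2)
        fix y :: "real^3"
        obtain N where N: "norm y \<le> real N" using real_arch_simple by blast
        have "\<forall>\<^sub>F n in sequentially. f i y * u i (x - y) = g n i y * u i (x - y)"
          using eventually_ge_at_top[of N] by eventually_elim (use N in \<open>auto simp: g_def\<close>)
        then show "(\<lambda>n. g n i y * u i (x - y)) \<longlonglongrightarrow> f i y * u i (x - y)"
          by (rule Lim_transform_eventually[OF tendsto_const])
      qed
    qed measurable
  qed
  have sm: "superpose I u (g n) \<in> borel_measurable borel" for n
    by (rule superpose_measurable[OF gm um])
  have lim2: "(\<lambda>n. ennreal (norm (superpose I u (g n) x) powr p)) \<longlonglongrightarrow> ennreal (norm (superpose I u f x) powr p)" for x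
  proof (rule tendsto_ennrealI)
    have "continuous_on {0..} (\<lambda>t::real. t powr p)" using p by (intro continuous_on_powr' continuous_intros) auto
    then show "(\<lambda>n. norm (superpose I u (g n) x) powr p) \<longlonglongrightarrow> norm (superpose I u f x) powr p"
      by (rule continuous_on_tendsto_compose[OF _ tendsto_norm[OF lim]]) auto
  qed
  have "(\<integral>\<^sup>+x. ennreal (norm (superpose I u f x) powr p) \<partial>lborel) = (\<integral>\<^sup>+x. liminf (\<lambda>n. ennreal (norm (superpose I u (g n) x) powr p)) \<partial>lborel)"
    using lim_imp_Liminf[OF _ lim2] by simp
  also have "\<dots> \<le> liminf (\<lambda>n. \<integral>\<^sup>+x. ennreal (norm (superpose I u (g n) x) powr p) \<partial>lborel)"
    using sm by (intro nn_integral_liminf) auto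
  also have "\<dots> \<le> ennreal C * (\<Sum>i\<in>I. \<integral>\<^sup>+x. ennreal (norm (f i x) powr p) \<partial>lborel)"
  proof (rule order_trans[OF Liminf_le_Limsup Limsup_bounded])
    show "\<forall>\<^sub>F n in sequentially. (\<integral>\<^sup>+x. ennreal (norm (superpose I u (g n) x) powr p) \<partial>lborel) \<le> ennreal C * (\<Sum>i\<in>I. \<integral>\<^sup>+x. ennreal (norm (f i x) powr p) \<partial>lborel)"
    proof (intro always_eventually allI)
      fix n
      have "(\<integral>\<^sup>+x. ennreal (norm (superpose I u (g n) x) powr p) \<partial>lborel) \<le> ennreal C * (\<Sum>i\<in>I. \<integral>\<^sup>+x. ennreal (norm (g n i x) powr p) \<partial>lborel)"
        by (rule bound[OF tf])
      also have "\<dots> \<le> ennreal C * (\<Sum>i\<in>I. \<integral>\<^sup>+x. ennreal (norm (f i x) powr p) \<partial>lborel)"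
        by (intro mult_left_mono sum_mono nn_integral_mono ennreal_leI) (auto simp: g_def)
      finally show "(\<integral>\<^sup>+x. ennreal (norm (superpose I u (g n) x) powr p) \<partial>lborel) \<le> ennreal C * (\<Sum>i\<in>I. \<integral>\<^sup>+x. ennreal (norm (f i x) powr p) \<partial>lborel)" .
    qed
  qed simp
  finally show ?thesis .
qed

section \<open>Superpositions adapted to a family of caps\<close>

lemma sum_power4_le:
  fixes a :: "'i \<Rightarrow> real"
  shows "(\<Sum>i\<in>A. a i) ^ 4 \<le> real (card A) ^ 3 * (\<Sum>i\<in>A. a i ^ 4)"
proof -
  have 1: "(\<Sum>i\<in>A. a i)\<^sup>2 \<le> (\<Sum>i\<in>A. (a i)\<^sup>2) * real (card A)"
    by (rule sum_squared_le_sum_of_squares)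
  have 2: "(\<Sum>i\<in>A. (a i)\<^sup>2)\<^sup>2 \<le> (\<Sum>i\<in>A. ((a i)\<^sup>2)\<^sup>2) * real (card A)"
    by (rule sum_squared_le_sum_of_squares)
  have "(\<Sum>i\<in>A. a i) ^ 4 = ((\<Sum>i\<in>A. a i)\<^sup>2)\<^sup>2" by simp
  also have "\<dots> \<le> ((\<Sum>i\<in>A. (a i)\<^sup>2) * real (card A))\<^sup>2" by (intro power_mono 1) simp
  also have "\<dots> = (\<Sum>i\<in>A. (a i)\<^sup>2)\<^sup>2 * (real (card A))\<^sup>2" by (simp add: power_mult_distrib)
  also have "\<dots> \<le> (\<Sum>i\<in>A. ((a i)\<^sup>2)\<^sup>2) * real (card A) * (real (card A))\<^sup>2" by (intro mult_right_mono 2) simp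
  also have "\<dots> = real (card A) ^ 3 * (\<Sum>i\<in>A. a i ^ 4)"
  proof -
    have "((a i)\<^sup>2)\<^sup>2 = a i ^ 4" for i by simp
    moreover have "X * n * n\<^sup>2 = n ^ 3 * X" for X n :: real by (simp add: power2_eq_square power3_eq_cube)
    ultimately show ?thesis by (simp only:)
  qed
  finally show ?thesis .
qed

lemma norm_sum_power4_le:
  fixes g :: "'i \<Rightarrow> 'a::real_normed_vector"
  shows "norm (\<Sum>i\<in>A. g i) ^ 4 \<le> real (card A) ^ 3 * (\<Sum>i\<in>A. norm (g i) ^ 4)"
proof -
  have "norm (\<Sum>i\<in>A. g i) ^ 4 \<le> (\<Sum>i\<in>A. norm (g i)) ^ 4" by (intro power_mono norm_sum) simp
  also have "\<dots> \<le> real (card A) ^ 3 * (\<Sum>i\<in>A. norm (g i) ^ 4)" by (rule sum_power4_le)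
  finally show ?thesis .
qed

lemma spec_mono: "spec c r u \<Longrightarrow> r \<le> r' \<Longrightarrow> spec c r' u"
  unfolding spec_def by (erule exE, rule exI) (auto intro: order_trans)

text \<open>Small caps at scale \<open>s\<close> with their centres in polar form and kernels for their doubled outer boxes. Angles are taken in \<open>[0, 7)\<close>, which contains \<open>[0, 2 \<pi>)\<close>, and all kernels
  have the same \<open>L\<^sup>1\<close> norm \<open>V\<close>.\<close>

locale cap_kernels =
  fixes K s V :: real and G :: "(real^3) set set" and c :: "(real^3) set \<Rightarrow> real^3" and t \<rho> :: "(real^3) set \<Rightarrow> real"
    and u :: "(real^3) set \<Rightarrow> real^3 \<Rightarrow> complex"
  assumes K: "K \<ge> 1" and s: "0 < s" "s \<le> 1"
    and disj: "disjoint G" and sub: "\<And>\<gamma>. \<gamma> \<in> G \<Longrightarrow> \<gamma> \<subseteq> cone_nbhd (s\<^sup>2)"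
    and polar: "\<And>\<gamma>. \<gamma> \<in> G \<Longrightarrow> 0 \<le> t \<gamma> \<and> t \<gamma> < 7 \<and> \<rho> \<gamma> \<ge> 0 \<and> c \<gamma> $ 1 = \<rho> \<gamma> * cos (t \<gamma>) \<and> c \<gamma> $ 2 = \<rho> \<gamma> * sin (t \<gamma>)"
    and core: "\<And>\<gamma>. \<gamma> \<in> G \<Longrightarrow> cone_box (c \<gamma>) (t \<gamma>) (s / K\<^sup>2) (s\<^sup>2 / K\<^sup>2) (s / K\<^sup>2) \<subseteq> \<gamma>"
    and kernel: "\<And>\<gamma>. \<gamma> \<in> G \<Longrightarrow> schwartz (u \<gamma>)"
    and kernel_supp: "\<And>\<gamma> \<xi>. \<gamma> \<in> G \<Longrightarrow> ft (u \<gamma>) \<xi> \<noteq> 0 \<Longrightarrow>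
        \<xi> \<in> cone_box (c \<gamma>) (t \<gamma>) (2 * (K\<^sup>2 * s)) (2 * (K\<^sup>2 * s\<^sup>2)) (2 * (K\<^sup>2 * s))"
    and kernel_mass: "\<And>\<gamma>. \<gamma> \<in> G \<Longrightarrow> (LINT x|lborel. norm (u \<gamma> x)) = V"
begin

lemma s2: "0 < s\<^sup>2" "s\<^sup>2 \<le> 1" "s\<^sup>2 \<le> s"
  using s by (auto simp: power2_eq_square mult_le_one)

lemma center_in_nbhd: "\<gamma> \<in> G \<Longrightarrow> c \<gamma> \<in> cone_nbhd (s\<^sup>2)"
proof -
  assume \<gamma>: "\<gamma> \<in> G"
  have "c \<gamma> \<in> cone_box (c \<gamma>) (t \<gamma>) (s / K\<^sup>2) (s\<^sup>2 / K\<^sup>2) (s / K\<^sup>2)" using s by (simp add: cone_box_def)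
  then show ?thesis using core[OF \<gamma>] sub[OF \<gamma>] by blast
qed

lemma center_bounds:
  assumes "\<gamma> \<in> G"
  shows "0 \<le> \<rho> \<gamma>" "\<rho> \<gamma> \<le> 4" "norm (c \<gamma> - \<rho> \<gamma> *\<^sub>R ray (t \<gamma>)) \<le> 4 * s" "norm (c \<gamma>) \<le> 12"
proof -
  note p = polar[OF assms]
  have sq: "sqrt ((\<rho> \<gamma> * cos (t \<gamma>))\<^sup>2 + (\<rho> \<gamma> * sin (t \<gamma>))\<^sup>2) = \<rho> \<gamma>"
    using distrib_left[of "(\<rho> \<gamma>)\<^sup>2" "(cos (t \<gamma>))\<^sup>2" "(sin (t \<gamma>))\<^sup>2"] p by (simp add: power_mult_distrib)
  have sqrt2: "sqrt 2 \<le> 2" by (rule real_le_lsqrt) auto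
  have cc: "c \<gamma> $ 1 = \<rho> \<gamma> * cos (t \<gamma>)" "c \<gamma> $ 2 = \<rho> \<gamma> * sin (t \<gamma>)" using p by auto
  note b = cone_nbhd_bounds[OF s2(1) center_in_nbhd[OF assms], unfolded cone_defect_def cc sq]
  show r: "0 \<le> \<rho> \<gamma>" "\<rho> \<gamma> \<le> 4" using b(3) sqrt2 s2(2) p by linarith+
  have "c \<gamma> - \<rho> \<gamma> *\<^sub>R ray (t \<gamma>) = (c \<gamma> $ 3 - \<rho> \<gamma>) *\<^sub>R axis 3 1"
    by (simp add: vec_eq_iff forall_3 cc)
  then have "norm (c \<gamma> - \<rho> \<gamma> *\<^sub>R ray (t \<gamma>)) = \<bar>c \<gamma> $ 3 - \<rho> \<gamma>\<bar>" by simp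
  then show d: "norm (c \<gamma> - \<rho> \<gamma> *\<^sub>R ray (t \<gamma>)) \<le> 4 * s" using b(1) s2(3) by linarith
  have "norm (ray (t \<gamma>)) \<le> 2" 
  proof -
    have "(norm (ray (t \<gamma>)))\<^sup>2 = 2" unfolding norm_3 by simp
    then have "(norm (ray (t \<gamma>)))\<^sup>2 \<le> 2\<^sup>2" by simp
    then show ?thesis by (rule power2_le_imp_le) simp
  qed
  then have "norm (\<rho> \<gamma> *\<^sub>R ray (t \<gamma>)) \<le> 4 * 2" unfolding norm_scaleR using r by (intro mult_mono) auto
  moreover have "norm (c \<gamma>) \<le> norm (c \<gamma> - \<rho> \<gamma> *\<^sub>R ray (t \<gamma>)) + norm (\<rho> \<gamma> *\<^sub>R ray (t \<gamma>))"
    using norm_triangle_ineq[of "c \<gamma> - \<rho> \<gamma> *\<^sub>R ray (t \<gamma>)" "\<rho> \<gamma> *\<^sub>R ray (t \<gamma>)"] by simp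
  ultimately show "norm (c \<gamma>) \<le> 12" using d s by linarith
qed

lemma packing_caps:
  assumes "D \<ge> 0"
  shows "finite {\<gamma>\<in>G. norm (c \<gamma> - p) \<le> D * s}" "card {\<gamma>\<in>G. norm (c \<gamma> - p) \<le> D * s} \<le> nat \<lfloor>8 * (D + 20) ^ 3 * K ^ 6\<rfloor>"
proof -
  have "finite {\<gamma>\<in>G. norm (c \<gamma> - p) \<le> D * s} \<and> card {\<gamma>\<in>G. norm (c \<gamma> - p) \<le> D * s} \<le> nat \<lfloor>8 * (D + 20) ^ 3 * K ^ 6\<rfloor>"
  proof (rule packing[OF K s2(1,2) assms, of _ c t p])
    show "disjoint {\<gamma>\<in>G. norm (c \<gamma> - p) \<le> D * s}" using disj unfolding disjoint_def by blast
  qed (use core sub s in auto)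
  then show "finite {\<gamma>\<in>G. norm (c \<gamma> - p) \<le> D * s}" "card {\<gamma>\<in>G. norm (c \<gamma> - p) \<le> D * s} \<le> nat \<lfloor>8 * (D + 20) ^ 3 * K ^ 6\<rfloor>"
    by auto
qed

text \<open>The constant \<open>12\<close> bounds the norms of the centres, so the packing bound applies to the whole family.\<close>

lemma all_caps: "{\<gamma>\<in>G. norm (c \<gamma> - 0) \<le> 12 / s * s} = G"
  using center_bounds(4) s by auto

lemma finite_caps: "finite G"
  using packing_caps(1)[of "12 / s" 0] s unfolding all_caps by simp

lemma card_caps: "card G \<le> nat \<lfloor>8 * (12 / s + 20) ^ 3 * K ^ 6\<rfloor>"
  using packing_caps(2)[of "12 / s" 0] s unfolding all_caps by simp

text \<open>The constant of the light ray approximation in \<open>cone_points\<close>: the kernels have frequency radius \<open>3 K\<^sup>2 s \<le> Bw s / 4\<close>, and two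
  caps in the same plank have rays at distance at most \<open>800 K\<^sup>5 s\<close>. The packing bound \<open>Np\<close> is for balls of radius \<open>8 Bw s\<close>.\<close>

definition Bw where "Bw = 1000 * K ^ 5"
definition Np where "Np = nat \<lfloor>8 * (8 * Bw + 20) ^ 3 * K ^ 6\<rfloor>"

lemma Kpow: "1 \<le> K ^ n" "K\<^sup>2 \<le> K ^ 5"
  using K by (auto intro: one_le_power power_increasing)

lemma Bw: "Bw \<ge> 1" "3 * (K\<^sup>2 * s) \<le> Bw * s / 4" "4 \<le> Bw" "2 * (3 * (K\<^sup>2 * s)) \<le> 8 * Bw * s"
proof -
  show 1: "Bw \<ge> 1" "4 \<le> Bw" using Kpow(1)[of 5] by (auto simp: Bw_def)
  have "3 * K\<^sup>2 \<le> 250 * K ^ 5" "3 * K\<^sup>2 \<le> 4000 * K ^ 5" using Kpow(1)[of 5] Kpow(2) by linarith+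
  then show "3 * (K\<^sup>2 * s) \<le> Bw * s / 4" "2 * (3 * (K\<^sup>2 * s)) \<le> 8 * Bw * s" 
    using s by (auto simp: Bw_def)
qed

lemma pack: "card {\<gamma>\<in>I. norm (c \<gamma> - p) \<le> 8 * Bw * s} \<le> Np" if "I \<subseteq> G"
proof -
  have D: "0 \<le> 8 * Bw" using Bw(1) by simp
  have "card {\<gamma>\<in>I. norm (c \<gamma> - p) \<le> 8 * Bw * s} \<le> card {\<gamma>\<in>G. norm (c \<gamma> - p) \<le> 8 * Bw * s}"
    using packing_caps(1)[OF D, of p] that by (intro card_mono) auto
  also have "\<dots> \<le> Np" unfolding Np_def by (rule packing_caps(2)[OF D])
  finally show ?thesis .
qed

lemma kernel_integrable: "\<gamma> \<in> G \<Longrightarrow> integrable lborel (u \<gamma>)"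
  by (rule schwartz_integrable[OF kernel])

lemma kernel_ft_dist:
  assumes "\<gamma> \<in> G" "ft (u \<gamma>) \<xi> \<noteq> 0"
  shows "dist \<xi> (c \<gamma>) \<le> 3 * (K\<^sup>2 * s)"
proof -
  have "norm (\<xi> - c \<gamma>) \<le> (2 * (K\<^sup>2 * s) + 2 * (K\<^sup>2 * s\<^sup>2) + 2 * (K\<^sup>2 * s)) / 2"
    by (rule cone_box_norm[OF kernel_supp[OF assms]])
  moreover have "K\<^sup>2 * s\<^sup>2 \<le> K\<^sup>2 * s" using s2(3) by (intro mult_left_mono) auto
  moreover have "(2 * a + 2 * b + 2 * a) / 2 \<le> 3 * a" if "b \<le> a" for a b :: real using that by simp
  ultimately show ?thesis unfolding dist_norm by (blast intro: order_trans)
qed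

lemma kernel_ft_integrable:
  assumes \<gamma>: "\<gamma> \<in> G"
  shows "integrable lborel (ft (u \<gamma>))"
proof (rule integrable_bounded_support)
  show "ft (u \<gamma>) \<in> borel_measurable borel"
    by (rule borel_measurable_ft[OF schwartz_measurable[OF kernel[OF \<gamma>]]])
  show "norm (ft (u \<gamma>) \<xi>) \<le> (LINT x|lborel. norm (u \<gamma> x))" for \<xi>
    by (rule norm_ft_le)
  show "dist \<xi> (c \<gamma>) \<le> 3 * (K\<^sup>2 * s)" if "ft (u \<gamma>) \<xi> \<noteq> 0" for \<xi>
    by (rule kernel_ft_dist[OF \<gamma> that])
qed

lemma kernel_eq: "\<gamma> \<in> G \<Longrightarrow> u \<gamma> = ift (ft (u \<gamma>))"
  by (rule schwartz_ft_inversion[symmetric, OF kernel kernel_ft_integrable])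

lemma component_schwartz:
  assumes "test_family G f" "\<gamma> \<in> G"
  shows "schwartz (conv (f \<gamma>) (u \<gamma>))"
proof -
  obtain M where "\<And>x. f \<gamma> x \<noteq> 0 \<Longrightarrow> norm x \<le> M" using test_familyD(3)[OF assms] by blast
  then show ?thesis by (intro schwartz_conv[OF kernel[OF assms(2)] test_familyD(2)[OF assms]])
qed

lemma component_ft:
  assumes "test_family G f" "\<gamma> \<in> G"
  shows "ft (conv (f \<gamma>) (u \<gamma>)) \<xi> = ft (f \<gamma>) \<xi> * ft (u \<gamma>) \<xi>"
  by (rule ft_conv[OF test_familyD(2)[OF assms] kernel_integrable[OF assms(2)]])

lemma component_spec:
  assumes "test_family G f" "\<gamma> \<in> G"
  shows "spec (c \<gamma>) (3 * (K\<^sup>2 * s)) (conv (f \<gamma>) (u \<gamma>))"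
  unfolding spec_def
proof (intro exI[of _ "\<lambda>\<xi>. ft (u \<gamma>) \<xi> * ft (f \<gamma>) \<xi>"] conjI allI impI)
  show "integrable lborel (\<lambda>\<xi>. ft (u \<gamma>) \<xi> * ft (f \<gamma>) \<xi>)"
    using norm_ft_le[of "f \<gamma>"] test_familyD(1)[OF assms]
    by (intro integrable_mult_bounded[OF kernel_ft_integrable[OF assms(2)]]) (auto intro: borel_measurable_ft)
  show "conv (f \<gamma>) (u \<gamma>) = ift (\<lambda>\<xi>. ft (u \<gamma>) \<xi> * ft (f \<gamma>) \<xi>)"
    by (subst kernel_eq[OF assms(2)]) (rule conv_ift[OF test_familyD(2)[OF assms] kernel_ft_integrable[OF assms(2)]])
  show "dist \<xi> (c \<gamma>) \<le> 3 * (K\<^sup>2 * s)" if "ft (u \<gamma>) \<xi> * ft (f \<gamma>) \<xi> \<noteq> 0" for \<xi>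
    using kernel_ft_dist[OF assms(2), of \<xi>] that by auto
qed

lemma nn_integral_eq_power:
  assumes "schwartz g" "n \<ge> 1"
  shows "(\<integral>\<^sup>+x. ennreal (norm (g x) ^ n) \<partial>lborel) = ennreal (LINT x|lborel. norm (g x) ^ n)"
  by (rule nn_integral_eq_integral[OF schwartz_power_integrable[OF assms]]) auto

lemma superpose_schwartz: "test_family G f \<Longrightarrow> schwartz (superpose G u f)"
  unfolding superpose_def[abs_def] using finite_caps component_schwartz by (intro schwartz_sum) auto

text \<open>Bounds in terms of the convolutions are bounds in terms of the family, by the \<open>L\<^sup>p\<close> bounds for convolution
  with a kernel of mass \<open>V\<close>.\<close>

lemma from_component_bound:
  assumes f: "test_family G f" and n: "n = 2 \<or> n = 4" and A: "A \<ge> 0"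
    and le: "(LINT x|lborel. norm (superpose G u f x) ^ n) \<le> A * (\<Sum>\<gamma>\<in>G. LINT x|lborel. norm (conv (f \<gamma>) (u \<gamma>) x) ^ n)"
  shows "(\<integral>\<^sup>+x. ennreal (norm (superpose G u f x) ^ n) \<partial>lborel) \<le> ennreal (A * V ^ n) * (\<Sum>\<gamma>\<in>G. \<integral>\<^sup>+x. ennreal (norm (f \<gamma> x) ^ n) \<partial>lborel)"
proof (cases "G = {}")
  case True
  then show ?thesis using n by (auto simp: superpose_def)
next
  case False
  then have V: "V \<ge> 0" using kernel_mass by (metis Bochner_Integration.integral_nonneg ex_in_conv norm_ge_zero)
  have n1: "n \<ge> 1" using n by auto
  have "(\<integral>\<^sup>+x. ennreal (norm (superpose G u f x) ^ n) \<partial>lborel) = ennreal (LINT x|lborel. norm (superpose G u f x) ^ n)"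
    by (rule nn_integral_eq_power[OF superpose_schwartz[OF f] n1])
  also have "\<dots> \<le> ennreal (A * (\<Sum>\<gamma>\<in>G. LINT x|lborel. norm (conv (f \<gamma>) (u \<gamma>) x) ^ n))" by (rule ennreal_leI[OF le])
  also have "\<dots> = ennreal A * (\<Sum>\<gamma>\<in>G. ennreal (LINT x|lborel. norm (conv (f \<gamma>) (u \<gamma>) x) ^ n))"
    using A by (simp add: ennreal_mult sum_nonneg)
  also have "\<dots> = ennreal A * (\<Sum>\<gamma>\<in>G. \<integral>\<^sup>+x. ennreal (norm (conv (f \<gamma>) (u \<gamma>) x) ^ n) \<partial>lborel)"
    using nn_integral_eq_power[OF component_schwartz[OF f] n1] by (simp cong: sum.cong)
  also have "\<dots> \<le> ennreal A * (\<Sum>\<gamma>\<in>G. ennreal V ^ n * (\<integral>\<^sup>+x. ennreal (norm (f \<gamma> x) ^ n) \<partial>lborel))"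
  proof (intro mult_left_mono sum_mono)
    fix \<gamma> assume \<gamma>: "\<gamma> \<in> G"
    note b = conv_L2_bound[OF test_familyD(1)[OF f \<gamma>] kernel_integrable[OF \<gamma>]] conv_L4_bound[OF test_familyD(1)[OF f \<gamma>] kernel_integrable[OF \<gamma>]]
    show "(\<integral>\<^sup>+x. ennreal (norm (conv (f \<gamma>) (u \<gamma>) x) ^ n) \<partial>lborel) \<le> ennreal V ^ n * (\<integral>\<^sup>+x. ennreal (norm (f \<gamma> x) ^ n) \<partial>lborel)"
      using b n unfolding kernel_mass[OF \<gamma>] by auto
  qed simp
  also have "\<dots> = ennreal (A * V ^ n) * (\<Sum>\<gamma>\<in>G. \<integral>\<^sup>+x. ennreal (norm (f \<gamma> x) ^ n) \<partial>lborel)"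
    using A V by (simp add: sum_distrib_left[symmetric] ennreal_mult ennreal_power mult.assoc)
  finally show ?thesis .
qed

lemma superpose_L2:
  assumes f: "test_family G f"
  shows "(\<integral>\<^sup>+x. ennreal (norm (superpose G u f x) ^ 2) \<partial>lborel) \<le> ennreal (real Np * V ^ 2) * (\<Sum>\<gamma>\<in>G. \<integral>\<^sup>+x. ennreal (norm (f \<gamma> x) ^ 2) \<partial>lborel)"
proof (rule from_component_bound[OF f])
  show "(LINT x|lborel. norm (superpose G u f x) ^ 2) \<le> real Np * (\<Sum>\<gamma>\<in>G. LINT x|lborel. norm (conv (f \<gamma>) (u \<gamma>) x) ^ 2)"
    unfolding superpose_def
  proof (rule almost_orthogonality[OF finite_caps component_schwartz[OF f] component_spec[OF f]])
    fix \<gamma> assume "\<gamma> \<in> G"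
    have "card {j\<in>G. norm (c j - c \<gamma>) \<le> 2 * (3 * (K\<^sup>2 * s))} \<le> card {j\<in>G. norm (c j - c \<gamma>) \<le> 8 * Bw * s}"
      by (intro card_mono finite_subset[OF _ finite_caps] Collect_mono) (use Bw(4) in \<open>auto intro: order_trans\<close>)
    also have "\<dots> \<le> Np" by (rule pack) simp
    finally show "card {j\<in>G. norm (c j - c \<gamma>) \<le> 2 * (3 * (K\<^sup>2 * s))} \<le> Np" .
  qed
qed auto

text \<open>For \<open>s\<close> bounded below, the number of caps is bounded.\<close>

lemma superpose_L4_crude:
  assumes f: "test_family G f"
  shows "(\<integral>\<^sup>+x. ennreal (norm (superpose G u f x) ^ 4) \<partial>lborel) \<le> ennreal (real (card G) ^ 3 * V ^ 4) * (\<Sum>\<gamma>\<in>G. \<integral>\<^sup>+x. ennreal (norm (f \<gamma> x) ^ 4) \<partial>lborel)"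
proof (rule from_component_bound[OF f])
  have i4: "integrable lborel (\<lambda>x. norm (conv (f \<gamma>) (u \<gamma>) x) ^ 4)" if "\<gamma> \<in> G" for \<gamma>
    by (rule schwartz_power_integrable[OF component_schwartz[OF f that]]) simp
  have "(LINT x|lborel. norm (superpose G u f x) ^ 4) \<le> (LINT x|lborel. real (card G) ^ 3 * (\<Sum>\<gamma>\<in>G. norm (conv (f \<gamma>) (u \<gamma>) x) ^ 4))"
  proof (rule integral_mono)
    show "integrable lborel (\<lambda>x. norm (superpose G u f x) ^ 4)"
      by (rule schwartz_power_integrable[OF superpose_schwartz[OF f]]) simp
    show "integrable lborel (\<lambda>x. real (card G) ^ 3 * (\<Sum>\<gamma>\<in>G. norm (conv (f \<gamma>) (u \<gamma>) x) ^ 4))"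
      using i4 by auto
  qed (auto simp: superpose_def intro: norm_sum_power4_le)
  also have "\<dots> = real (card G) ^ 3 * (\<Sum>\<gamma>\<in>G. LINT x|lborel. norm (conv (f \<gamma>) (u \<gamma>) x) ^ 4)"
    using i4 by (simp add: Bochner_Integration.integral_sum)
  finally show "(LINT x|lborel. norm (superpose G u f x) ^ 4) \<le> real (card G) ^ 3 * (\<Sum>\<gamma>\<in>G. LINT x|lborel. norm (conv (f \<gamma>) (u \<gamma>) x) ^ 4)" .
qed auto

end

context cap_kernels
begin

text \<open>The classes of caps: the integer part of the angle together with the grid numbers of the three motions in \<open>alignment\<close>. Their number depends on \<open>K\<close> only.\<close>

definition keys :: "(int \<times> int \<times> int \<times> int) set" where
  "keys = {0..6} \<times> {-\<lfloor>2000 * K ^ 3\<rfloor>..\<lfloor>2000 * K ^ 3\<rfloor>} \<times> {-\<lfloor>2000 * K ^ 3\<rfloor>..\<lfloor>2000 * K ^ 3\<rfloor>} \<times> {-\<lfloor>2000 * K ^ 3\<rfloor>..\<lfloor>2000 * K ^ 3\<rfloor>}"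

lemma finite_keys: "finite keys"
  by (simp add: keys_def)

text \<open>Within a class, all caps are moved by the same motion into cores of planks at scale \<open>s'\<close>, so the transformed reverse square function
  estimate and then \<open>square_function_L4\<close> apply; caps assigned to the same plank have nearly the same ray. The classes are recombined
  by Hoelder's inequality.\<close>

theorem superpose_L4:
  fixes cc :: "(real^3) set \<Rightarrow> real^3" and tt rr :: "(real^3) set \<Rightarrow> real"
  assumes f: "test_family G f" and s': "s' = 100 * K ^ 4 * s" "10 * s'\<^sup>2 \<le> 1"
    and T: "partition_on (cone_nbhd (s'\<^sup>2)) T"
    and planks: "\<And>\<theta>. \<theta> \<in> T \<Longrightarrow> rr \<theta> \<ge> 0 \<and> cc \<theta> $ 1 = rr \<theta> * cos (tt \<theta>) \<and> cc \<theta> $ 2 = rr \<theta> * sin (tt \<theta>) \<and>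
        cone_box (cc \<theta>) (tt \<theta>) (s' / K\<^sup>2) (s'\<^sup>2 / K\<^sup>2) (1 / K\<^sup>2) \<subseteq> \<theta> \<and>
        \<theta> \<subseteq> cone_box (cc \<theta>) (tt \<theta>) (K\<^sup>2 * s') (K\<^sup>2 * s'\<^sup>2) (K\<^sup>2 * 1)"
    and hyp: "\<And>F. schwartz F \<Longrightarrow> fourier_supp F \<subseteq> cone_nbhd (s'\<^sup>2) \<Longrightarrow>
        Lp_norm 4 F \<le> C * Lp_norm 4 (\<lambda>x. sqrt (\<Sum>\<theta>\<in>T. (norm (freq_proj \<theta> F x))\<^sup>2))"
  shows "(\<integral>\<^sup>+x. ennreal (norm (superpose G u f x) ^ 4) \<partial>lborel)
     \<le> ennreal (real (card keys) ^ 3 * (C ^ 4 * (14080 * Bw * real Np ^ 3 / s\<^sup>2 * (1 + ln (1 / s)))) * V ^ 4)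
        * (\<Sum>\<gamma>\<in>G. \<integral>\<^sup>+x. ennreal (norm (f \<gamma> x) ^ 4) \<partial>lborel)"
proof (rule from_component_bound[OF f])
  define D where "D = 14080 * Bw * real Np ^ 3 / s\<^sup>2 * (1 + ln (1 / s))"
  have D: "D \<ge> 0" using s Bw by (auto simp: D_def intro!: mult_nonneg_nonneg divide_nonneg_nonneg add_nonneg_nonneg ln_ge_zero)
  show "0 \<le> real (card keys) ^ 3 * (C ^ 4 * (14080 * Bw * real Np ^ 3 / s\<^sup>2 * (1 + ln (1 / s))))"
    using D unfolding D_def[symmetric] by simp
  define L where "L = \<lfloor>2000 * K ^ 3\<rfloor>"
  define \<kappa> where "\<kappa> = 1 / (100 * K\<^sup>2)"
  have \<kappa>0: "\<kappa> > 0" using K by (simp add: \<kappa>_def)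
  define good where "good \<gamma> q \<longleftrightarrow> (case q of (\<theta>, k1 :: int, k2 :: int, k3 :: int) \<Rightarrow> \<theta> \<in> T \<and>
      \<bar>of_int k1\<bar> \<le> 2000 * K ^ 3 \<and> \<bar>of_int k2\<bar> \<le> 2000 * K ^ 3 \<and> \<bar>of_int k3\<bar> \<le> 2000 * K ^ 3 \<and> 0 < k2 \<and>
      norm (ray (t \<gamma>) - ray (tt \<theta>)) \<le> 4 * K * s' \<and>
      (\<forall>\<xi>\<in>cone_box (c \<gamma>) (t \<gamma>) (2 * (K\<^sup>2 * s)) (2 * (K\<^sup>2 * s\<^sup>2)) (2 * (K\<^sup>2 * s)).
         move (\<kappa> * of_int k2) (\<kappa> * s' * of_int k1) (\<kappa> * s'\<^sup>2 * of_int k3) \<xi>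
           \<in> cone_box (cc \<theta>) (tt \<theta>) (s' / K\<^sup>2) (s'\<^sup>2 / K\<^sup>2) (1 / K\<^sup>2)))" for \<gamma> q
  have "\<exists>q. good \<gamma> q" if \<gamma>: "\<gamma> \<in> G" for \<gamma>
  proof -
    note p = polar[OF \<gamma>]
    have "c \<gamma> $ 1 = \<rho> \<gamma> * cos (t \<gamma>)" "c \<gamma> $ 2 = \<rho> \<gamma> * sin (t \<gamma>)" "\<rho> \<gamma> \<ge> 0" using p by auto
    from alignment[where \<kappa>=\<kappa> and cc=cc and tt=tt and rr=rr, OF K s(1) s' \<kappa>_def T planks center_in_nbhd[OF \<gamma>] this]
    obtain \<theta> k1 k2 k3 where "good \<gamma> (\<theta>, k1, k2, k3)" unfolding good_def prod.case by blast
    then show ?thesis by blast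
  qed
  then obtain q where q: "\<And>\<gamma>. \<gamma> \<in> G \<Longrightarrow> good \<gamma> (q \<gamma>)" using bchoice[of G good] by blast
  define \<tau> where "\<tau> \<gamma> = fst (q \<gamma>)" for \<gamma>
  define key where "key \<gamma> = (\<lfloor>t \<gamma>\<rfloor>, snd (q \<gamma>))" for \<gamma>
  have goodD: "good \<gamma> (\<tau> \<gamma>, k1, k2, k3)" if "\<gamma> \<in> G" "key \<gamma> = (m, k1, k2, k3)" for \<gamma> m k1 k2 k3
    using q[OF that(1)] that(2) unfolding key_def \<tau>_def by (metis Pair_inject prod.collapse)
  have key: "key \<gamma> \<in> keys" if \<gamma>: "\<gamma> \<in> G" for \<gamma>
  proof -
    obtain m k1 k2 k3 where k: "key \<gamma> = (m, k1, k2, k3)" by (metis prod_cases4)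
    have "\<bar>of_int k1\<bar> \<le> 2000 * K ^ 3" "\<bar>of_int k2\<bar> \<le> 2000 * K ^ 3" "\<bar>of_int k3\<bar> \<le> 2000 * K ^ 3"
      using goodD[OF \<gamma> k] by (auto simp: good_def)
    then have "\<bar>k1\<bar> \<le> L" "\<bar>k2\<bar> \<le> L" "\<bar>k3\<bar> \<le> L" by (auto simp: L_def le_floor_iff)
    moreover have "m = \<lfloor>t \<gamma>\<rfloor>" using k by (simp add: key_def)
    then have "0 \<le> m" "m \<le> 6" using polar[OF \<gamma>] by (auto simp: floor_le_iff)
    ultimately show ?thesis unfolding k keys_def L_def[symmetric] by auto
  qed
  define g where "g \<gamma> = conv (f \<gamma>) (u \<gamma>)" for \<gamma>
  have g: "schwartz (g \<gamma>)" if "\<gamma> \<in> G" for \<gamma> unfolding g_def by (rule component_schwartz[OF f that])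
  define block where "block k = {\<gamma>\<in>G. key \<gamma> = k}" for k
  define S where "S k x = (\<Sum>\<gamma>\<in>block k. g \<gamma> x)" for k x
  have fb: "finite (block k)" for k using finite_caps by (simp add: block_def)
  have Ss: "schwartz (S k)" for k
    unfolding S_def[abs_def] using fb g by (intro schwartz_sum) (auto simp: block_def)
  have blk: "(LINT x|lborel. norm (S k x) ^ 4) \<le> C ^ 4 * (D * (\<Sum>\<gamma>\<in>block k. LINT x|lborel. norm (g \<gamma> x) ^ 4))" for k
  proof (cases "block k = {}")
    case True
    then show ?thesis by (simp add: S_def)
  next
    case False
    obtain m k1 k2 k3 where k: "k = (m, k1, k2, k3)" by (metis prod_cases4)
    have bG: "\<gamma> \<in> G" "key \<gamma> = (m, k1, k2, k3)" if "\<gamma> \<in> block k" for \<gamma> using that by (auto simp: block_def k)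
    have good: "good \<gamma> (\<tau> \<gamma>, k1, k2, k3)" if "\<gamma> \<in> block k" for \<gamma> by (rule goodD[OF bG[OF that]])
    have k2: "k2 > 0" using False good by (auto simp: good_def)
    define r where "r = \<kappa> * of_int k2"
    have r: "r > 0" using k2 \<kappa>0 by (simp add: r_def)
    define \<sigma> where "\<sigma> = \<kappa> * s' * of_int k1"
    define h where "h = \<kappa> * s'\<^sup>2 * of_int k3"
    interpret cp: cone_points "block k" c t \<rho> s Bw "of_int m" Np
    proof
      fix \<gamma> assume \<gamma>: "\<gamma> \<in> block k"
      have "\<lfloor>t \<gamma>\<rfloor> = m" using bG(2)[OF \<gamma>] by (simp add: key_def)
      then show "of_int m \<le> t \<gamma> \<and> t \<gamma> \<le> of_int m + 1" by linarith
      show "0 \<le> \<rho> \<gamma> \<and> \<rho> \<gamma> \<le> 4" using center_bounds[OF bG(1)[OF \<gamma>]] by auto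
      have "4 * s \<le> Bw * s" using Bw(3) s by (intro mult_right_mono) auto
      then show "norm (c \<gamma> - \<rho> \<gamma> *\<^sub>R ray (t \<gamma>)) \<le> Bw * s" using center_bounds(3)[OF bG(1)[OF \<gamma>]] by linarith
    next
      show "card {i \<in> block k. norm (c i - p) \<le> 8 * Bw * s} \<le> Np" for p
        by (rule pack) (auto simp: block_def)
    qed (use fb s Bw in auto)
    have "(LINT x|lborel. norm (S k x) ^ 4)
        \<le> C ^ 4 * (LINT x|lborel. (\<Sum>\<theta>\<in>T. (norm (\<Sum>\<gamma>\<in>{\<gamma>\<in>block k. \<tau> \<gamma> = \<theta>}. g \<gamma> x))\<^sup>2)\<^sup>2)"
      unfolding S_def
    proof (rule transformed_reverse_square_function[where A="\<lambda>x. r *\<^sub>R rot (- \<sigma>) x" and B="\<lambda>\<xi>. (1 / r) *\<^sub>R rot (- \<sigma>) \<xi>"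
          and m="1 / r" and c="h *\<^sub>R axis 3 1" and E="\<lambda>\<gamma>. cone_box (cc (\<tau> \<gamma>)) (tt (\<tau> \<gamma>)) (s' / K\<^sup>2) (s'\<^sup>2 / K\<^sup>2) (1 / K\<^sup>2)",
          OF hyp T])
      show "linear (\<lambda>x. r *\<^sub>R rot (- \<sigma>) x)" by (intro linear_compose_scale_right linear_rot)
      show "norm x \<le> 1 / r * norm (r *\<^sub>R rot (- \<sigma>) x)" for x using r by (simp add: rot_norm)
      show "\<xi> \<bullet> x = (1 / r) *\<^sub>R rot (- \<sigma>) \<xi> \<bullet> r *\<^sub>R rot (- \<sigma>) x" for \<xi> x using r by (simp add: rot_inner)
      show "finite (block k)" by (rule fb)
      show "schwartz (g \<gamma>)" if "\<gamma> \<in> block k" for \<gamma> by (rule g[OF bG(1)[OF that]])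
      show tT: "\<tau> \<gamma> \<in> T" if "\<gamma> \<in> block k" for \<gamma> using good[OF that] by (simp add: good_def)
      show "closed (cone_box (cc (\<tau> \<gamma>)) (tt (\<tau> \<gamma>)) (s' / K\<^sup>2) (s'\<^sup>2 / K\<^sup>2) (1 / K\<^sup>2)) \<and>
          bounded (cone_box (cc (\<tau> \<gamma>)) (tt (\<tau> \<gamma>)) (s' / K\<^sup>2) (s'\<^sup>2 / K\<^sup>2) (1 / K\<^sup>2)) \<and>
          cone_box (cc (\<tau> \<gamma>)) (tt (\<tau> \<gamma>)) (s' / K\<^sup>2) (s'\<^sup>2 / K\<^sup>2) (1 / K\<^sup>2) \<subseteq> \<tau> \<gamma>" if "\<gamma> \<in> block k" for \<gamma>
      proof (intro conjI closed_cone_box)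
        show "bounded (cone_box (cc (\<tau> \<gamma>)) (tt (\<tau> \<gamma>)) (s' / K\<^sup>2) (s'\<^sup>2 / K\<^sup>2) (1 / K\<^sup>2))"
          unfolding bounded_def dist_norm using cone_box_norm by (metis norm_minus_commute)
        show "cone_box (cc (\<tau> \<gamma>)) (tt (\<tau> \<gamma>)) (s' / K\<^sup>2) (s'\<^sup>2 / K\<^sup>2) (1 / K\<^sup>2) \<subseteq> \<tau> \<gamma>"
          using planks[OF tT[OF that]] by blast
      qed
      fix \<gamma> \<xi> assume \<gamma>: "\<gamma> \<in> block k" and ne: "ft (g \<gamma>) ((1 / r) *\<^sub>R rot (- \<sigma>) (\<xi> - h *\<^sub>R axis 3 1)) \<noteq> 0"
      define \<eta> where "\<eta> = (1 / r) *\<^sub>R rot (- \<sigma>) (\<xi> - h *\<^sub>R axis 3 1)"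
      have "ft (u \<gamma>) \<eta> \<noteq> 0" using ne component_ft[OF f bG(1)[OF \<gamma>]] unfolding g_def \<eta>_def[symmetric] by auto
      then have "\<eta> \<in> cone_box (c \<gamma>) (t \<gamma>) (2 * (K\<^sup>2 * s)) (2 * (K\<^sup>2 * s\<^sup>2)) (2 * (K\<^sup>2 * s))"
        by (rule kernel_supp[OF bG(1)[OF \<gamma>]])
      then have "move r \<sigma> h \<eta> \<in> cone_box (cc (\<tau> \<gamma>)) (tt (\<tau> \<gamma>)) (s' / K\<^sup>2) (s'\<^sup>2 / K\<^sup>2) (1 / K\<^sup>2)"
        using good[OF \<gamma>] unfolding good_def prod.case r_def \<sigma>_def h_def by blast
      moreover have "move r \<sigma> h \<eta> = \<xi>"
        using r unfolding move_def \<eta>_def by (simp add: linear_scale[OF linear_rot] rot_minus)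
      ultimately show "\<xi> \<in> cone_box (cc (\<tau> \<gamma>)) (tt (\<tau> \<gamma>)) (s' / K\<^sup>2) (s'\<^sup>2 / K\<^sup>2) (1 / K\<^sup>2)" by simp
    qed
    also have "\<dots> \<le> C ^ 4 * (D * (\<Sum>\<gamma>\<in>block k. LINT x|lborel. norm (g \<gamma> x) ^ 4))"
    proof (rule mult_left_mono)
      show "(LINT x|lborel. (\<Sum>\<theta>\<in>T. (norm (\<Sum>\<gamma>\<in>{\<gamma>\<in>block k. \<tau> \<gamma> = \<theta>}. g \<gamma> x))\<^sup>2)\<^sup>2) \<le> D * (\<Sum>\<gamma>\<in>block k. LINT x|lborel. norm (g \<gamma> x) ^ 4)"
        unfolding D_def
      proof (rule cp.square_function_L4)
        show "schwartz (g \<gamma>)" if "\<gamma> \<in> block k" for \<gamma> by (rule g[OF bG(1)[OF that]])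
        show "spec (c \<gamma>) (Bw * s / 4) (g \<gamma>)" if "\<gamma> \<in> block k" for \<gamma>
          unfolding g_def by (rule spec_mono[OF component_spec[OF f bG(1)[OF that]] Bw(2)])
        show "cp.near \<gamma> \<gamma>'" if "\<gamma> \<in> block k" "\<gamma>' \<in> block k" "\<tau> \<gamma> = \<tau> \<gamma>'" for \<gamma> \<gamma>'
        proof -
          have "norm (ray (t \<gamma>) - ray (tt (\<tau> \<gamma>))) \<le> 4 * K * s'" "norm (ray (t \<gamma>') - ray (tt (\<tau> \<gamma>))) \<le> 4 * K * s'"
            using good[OF that(1)] good[OF that(2)] that(3) by (auto simp: good_def)
          then have "norm (ray (t \<gamma>) - ray (t \<gamma>')) \<le> 4 * K * s' + 4 * K * s'"
            by (smt (verit) norm_triangle_ineq4 diff_diff_eq2 diff_add_cancel)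
          also have "\<dots> = 800 * (K ^ 5 * s)" unfolding s'(1) by (simp add: power_numeral_reduce)
          also have "\<dots> \<le> 1000 * (K ^ 5 * s)" using s K by simp
          finally show ?thesis unfolding cp.near_def unfolding Bw_def by (simp add: mult.assoc)
        qed
      qed
    qed simp
    finally show ?thesis .
  qed
  have Sg: "superpose G u f x = (\<Sum>k\<in>keys. S k x)" for x
    unfolding superpose_def S_def block_def g_def
    by (rule sum.group[symmetric]) (use finite_caps finite_keys key in auto)
  have "(LINT x|lborel. norm (superpose G u f x) ^ 4) \<le> (LINT x|lborel. real (card keys) ^ 3 * (\<Sum>k\<in>keys. norm (S k x) ^ 4))"
  proof (rule integral_mono)
    show "integrable lborel (\<lambda>x. norm (superpose G u f x) ^ 4)"
      by (rule schwartz_power_integrable[OF superpose_schwartz[OF f]]) simp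
    show "integrable lborel (\<lambda>x. real (card keys) ^ 3 * (\<Sum>k\<in>keys. norm (S k x) ^ 4))"
      using schwartz_power_integrable[OF Ss] by auto
  qed (simp add: Sg norm_sum_power4_le)
  also have "\<dots> = real (card keys) ^ 3 * (\<Sum>k\<in>keys. LINT x|lborel. norm (S k x) ^ 4)"
    using schwartz_power_integrable[OF Ss] by (simp add: Bochner_Integration.integral_sum)
  also have "\<dots> \<le> real (card keys) ^ 3 * (\<Sum>k\<in>keys. C ^ 4 * (D * (\<Sum>\<gamma>\<in>block k. LINT x|lborel. norm (g \<gamma> x) ^ 4)))"
    by (intro mult_left_mono sum_mono blk) simp
  also have "\<dots> = real (card keys) ^ 3 * (C ^ 4 * D) * (\<Sum>k\<in>keys. \<Sum>\<gamma>\<in>block k. LINT x|lborel. norm (g \<gamma> x) ^ 4)"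
    by (simp add: sum_distrib_left mult.assoc)
  also have "(\<Sum>k\<in>keys. \<Sum>\<gamma>\<in>block k. LINT x|lborel. norm (g \<gamma> x) ^ 4) = (\<Sum>\<gamma>\<in>G. LINT x|lborel. norm (g \<gamma> x) ^ 4)"
    unfolding block_def by (rule sum.group) (use finite_caps finite_keys key in auto)
  finally show "(LINT x|lborel. norm (superpose G u f x) ^ 4)
     \<le> real (card keys) ^ 3 * (C ^ 4 * (14080 * Bw * real Np ^ 3 / s\<^sup>2 * (1 + ln (1 / s)))) * (\<Sum>\<gamma>\<in>G. LINT x|lborel. norm (conv (f \<gamma>) (u \<gamma>) x) ^ 4)"
    unfolding D_def g_def .
qed simp

end

section \<open>Recovering a function from its cap projections\<close>

text \<open>The sides may vary by the factor \<open>K\<close>, and the box by another dilation with \<open>K\<close>; nominal sides with a margin \<open>K\<^sup>2\<close> absorb both.\<close>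

lemma almost_cone_box_normalized:
  assumes K: "K \<ge> 1" and d: "d1 > 0" "d2 > 0" "d3 > 0" and B: "almost_cone_box K d1 d2 d3 B"
  shows "\<exists>c t \<rho>. 0 \<le> t \<and> t < 7 \<and> \<rho> \<ge> 0 \<and> c$1 = \<rho> * cos t \<and> c$2 = \<rho> * sin t \<and>
      cone_box c t (d1 / K\<^sup>2) (d2 / K\<^sup>2) (d3 / K\<^sup>2) \<subseteq> B \<and> B \<subseteq> cone_box c t (K\<^sup>2 * d1) (K\<^sup>2 * d2) (K\<^sup>2 * d3)"
proof -
  obtain c t \<rho> a1 a2 a3 where h: "\<rho> \<ge> 0" "c$1 = \<rho> * cos t" "c$2 = \<rho> * sin t"
      "a1 \<in> {d1 / K..K * d1}" "a2 \<in> {d2 / K..K * d2}" "a3 \<in> {d3 / K..K * d3}"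
      "cone_box c t (a1 / K) (a2 / K) (a3 / K) \<subseteq> B" "B \<subseteq> cone_box c t (K * a1) (K * a2) (K * a3)"
    using B unfolding almost_cone_box_def by blast
  define n where "n = \<lfloor>t / (2 * pi)\<rfloor>"
  define t' where "t' = t - 2 * pi * of_int n"
  have cs: "cos t' = cos t" "sin t' = sin t" by (simp_all add: t'_def cos_diff sin_diff)
  have "of_int n \<le> t / (2 * pi)" "t / (2 * pi) < of_int n + 1" unfolding n_def by linarith+
  then have "2 * pi * of_int n \<le> t" "t < 2 * pi * of_int n + 2 * pi" by (simp_all add: field_simps)
  then have "0 \<le> t'" "t' < 2 * pi" unfolding t'_def by simp_all
  moreover have "2 * pi < 7" using pi_approx by simp
  ultimately have t': "0 \<le> t'" "t' < 7" by linarith+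
  have div: "d / K\<^sup>2 \<le> a / K" "K * a \<le> K\<^sup>2 * d" if "a \<in> {d / K..K * d}" for a d
    using that K mult_left_mono[of a "K * d" K] divide_right_mono[of "d / K" a K] by (auto simp: power2_eq_square mult.assoc)
  have "cone_box c t' (d1 / K\<^sup>2) (d2 / K\<^sup>2) (d3 / K\<^sup>2) \<subseteq> B"
    unfolding cos_sin_frame_cong(1)[OF cs] using cone_box_mono[OF div(1)[OF h(4)] div(1)[OF h(5)] div(1)[OF h(6)]] h(7) by blast
  moreover have "B \<subseteq> cone_box c t' (K\<^sup>2 * d1) (K\<^sup>2 * d2) (K\<^sup>2 * d3)"
    unfolding cos_sin_frame_cong(1)[OF cs] using cone_box_mono[OF div(2)[OF h(4)] div(2)[OF h(5)] div(2)[OF h(6)]] h(8) by blast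
  ultimately show ?thesis using t' h(1-3) unfolding cs[symmetric] by blast
qed

text \<open>A Lebesgue measurable set differs from a Borel set by a null set, so the projection is an integral over a Borel set.\<close>

lemma freq_proj_main_part:
  assumes B: "B \<in> sets lebesgue" and F: "schwartz F"
  shows "freq_proj B F = ift (\<lambda>\<xi>. indicator (main_part lborel B) \<xi> *\<^sub>R ft F \<xi>)"
proof
  fix x
  define M where "M = main_part lborel B"
  have M[measurable]: "M \<in> sets lborel" unfolding M_def using B by (rule main_part_sets)
  obtain N where N: "N \<in> null_sets lborel" "null_part lborel B \<subseteq> N" using null_part[OF B] by blast
  have BM: "B = M \<union> null_part lborel B" unfolding M_def using B by (rule main_part_null_part_Un[symmetric])
  have [measurable]: "ft F \<in> borel_measurable borel" by (rule borel_measurable_ft[OF schwartz_measurable[OF F]])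
  have "AE \<xi> in lebesgue. \<xi> \<notin> N"
    by (rule AE_not_in) (use N(1) in \<open>auto intro: null_sets_completionI\<close>)
  then have ae: "AE \<xi> in lebesgue. indicator B \<xi> *\<^sub>R (ft F \<xi> * ch (\<xi> \<bullet> x)) = indicator M \<xi> *\<^sub>R ft F \<xi> * ch (\<xi> \<bullet> x)"
    by eventually_elim (use BM N(2) in \<open>auto simp: indicator_def\<close>)
  have m1: "(\<lambda>\<xi>. indicator M \<xi> *\<^sub>R ft F \<xi> * ch (\<xi> \<bullet> x)) \<in> borel_measurable lborel" by measurable
  have m2: "(\<lambda>\<xi>. indicator B \<xi> *\<^sub>R (ft F \<xi> * ch (\<xi> \<bullet> x))) \<in> borel_measurable lebesgue"
    using B by (intro borel_measurable_scaleR borel_measurable_indicator measurable_completion) auto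
  have "freq_proj B F x = (LINT \<xi>|lebesgue. indicator B \<xi> *\<^sub>R (ft F \<xi> * ch (\<xi> \<bullet> x)))"
    unfolding freq_proj_def set_lebesgue_integral_def fourier_eq_ft ch_def ..
  also have "\<dots> = (LINT \<xi>|lebesgue. indicator M \<xi> *\<^sub>R ft F \<xi> * ch (\<xi> \<bullet> x))"
    by (rule integral_cong_AE[OF m2 measurable_completion[OF m1] ae])
  also have "\<dots> = (LINT \<xi>|lborel. indicator M \<xi> *\<^sub>R ft F \<xi> * ch (\<xi> \<bullet> x))" by (rule integral_completion[OF m1])
  finally show "freq_proj B F x = ift (\<lambda>\<xi>. indicator (main_part lborel B) \<xi> *\<^sub>R ft F \<xi>) x"
    unfolding ift_def M_def .
qed

lemma cone_nbhd_norm_le: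
  assumes "0 < \<delta>" "\<delta> \<le> 1" "\<xi> \<in> cone_nbhd \<delta>"
  shows "norm \<xi> \<le> 12"
proof -
  have sqrt2: "sqrt 2 \<le> 2" by (rule real_le_lsqrt) auto
  define r where "r = sqrt ((\<xi>$1)\<^sup>2 + (\<xi>$2)\<^sup>2)"
  have r: "0 \<le> r" "r \<le> 4" "\<bar>\<xi>$3\<bar> \<le> 8"
    using cone_nbhd_bounds[OF assms(1,3)] sqrt2 assms(2) real_sqrt_ge_zero[of "(\<xi>$1)\<^sup>2 + (\<xi>$2)\<^sup>2"] unfolding cone_defect_def r_def[symmetric] by auto
  have "norm \<xi> = sqrt (r\<^sup>2 + (\<xi>$3)\<^sup>2)" unfolding norm_3 r_def by simp
  also have "\<dots> \<le> \<bar>r\<bar> + \<bar>\<xi>$3\<bar>" by (rule sqrt_sum_squares_le_sum_abs)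
  finally show ?thesis using r by linarith
qed

lemma schwartz_ft_integrable:
  assumes F: "schwartz F" and supp: "\<And>\<xi>. ft F \<xi> \<noteq> 0 \<Longrightarrow> norm \<xi> \<le> b"
  shows "integrable lborel (ft F)"
proof (rule integrable_bounded_support[where c=0 and r=b])
  show "ft F \<in> borel_measurable borel" by (rule borel_measurable_ft[OF schwartz_measurable[OF F]])
qed (auto intro: norm_ft_le supp)

text \<open>The projection is bounded and square integrable, so the norms on the right-hand side of the decoupling inequality are
  finite and their Bochner integrals are the true ones.\<close>

lemma freq_proj_Lp:
  assumes B: "B \<in> sets lebesgue" and F: "schwartz F" and supp: "\<And>\<xi>. ft F \<xi> \<noteq> 0 \<Longrightarrow> norm \<xi> \<le> b" and p: "p \<ge> 2"
  shows "freq_proj B F \<in> borel_measurable borel" "\<exists>C. \<forall>x. norm (freq_proj B F x) \<le> C"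
    and "(\<integral>\<^sup>+x. ennreal (norm (freq_proj B F x) powr p) \<partial>lborel) = ennreal (LINT x|lborel. norm (freq_proj B F x) powr p)"
proof -
  define h where "h \<xi> = indicator (main_part lborel B) \<xi> *\<^sub>R ft F \<xi>" for \<xi>
  have P: "freq_proj B F = ift h" unfolding h_def[abs_def] by (rule freq_proj_main_part[OF B F])
  have M: "main_part lborel B \<in> sets borel" using main_part_sets[OF B] by simp
  have h: "integrable lborel h"
    unfolding h_def[abs_def] using M by (intro integrable_mult_indicator schwartz_ft_integrable[OF F supp]) auto
  have hb: "norm (h \<xi>) \<le> (LINT x|lborel. norm (F x))" for \<xi>
    using norm_ft_le[of F \<xi>] order_trans[OF norm_ge_zero norm_ft_le[of F \<xi>]] by (auto simp: h_def indicator_def)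
  show m[measurable]: "freq_proj B F \<in> borel_measurable borel"
    unfolding P using h by (intro borel_measurable_ift) auto
  define C where "C = (LINT \<xi>|lborel. norm (h \<xi>))"
  have C: "norm (freq_proj B F x) \<le> C" for x unfolding P C_def by (rule norm_ift_le)
  then show "\<exists>C. \<forall>x. norm (freq_proj B F x) \<le> C" by blast
  have C0: "C \<ge> 0" by (simp add: C_def)
  have "norm (freq_proj B F x) powr p \<le> C powr (p - 2) * (norm (freq_proj B F x))\<^sup>2" for x
  proof (cases "freq_proj B F x = 0")
    case False
    have "norm (freq_proj B F x) powr p = norm (freq_proj B F x) powr (p - 2) * norm (freq_proj B F x) powr 2"
      using powr_add[of "norm (freq_proj B F x)" "p - 2" 2] by simp
    also have "\<dots> \<le> C powr (p - 2) * (norm (freq_proj B F x))\<^sup>2"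
      using p C False by (intro mult_mono powr_mono2) (auto simp: powr_numeral)
    finally show ?thesis .
  qed (use p in simp)
  then have "(\<integral>\<^sup>+x. ennreal (norm (freq_proj B F x) powr p) \<partial>lborel)
      \<le> (\<integral>\<^sup>+x. ennreal (C powr (p - 2)) * ennreal ((norm (freq_proj B F x))\<^sup>2) \<partial>lborel)"
    by (intro nn_integral_mono) (simp add: ennreal_mult[symmetric])
  also have "\<dots> = ennreal (C powr (p - 2)) * (\<integral>\<^sup>+x. ennreal ((norm (freq_proj B F x))\<^sup>2) \<partial>lborel)"
    by (rule nn_integral_cmult) measurable
  also have "\<dots> \<le> ennreal (C powr (p - 2)) * ennreal ((LINT x|lborel. norm (F x)) * (LINT \<xi>|lborel. norm (h \<xi>)))"
    unfolding P by (intro mult_left_mono nn_integral_ift_square[OF h hb]) simp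
  also have "\<dots> < \<infinity>" by (simp add: ennreal_mult_less_top)
  finally have "integrable lborel (\<lambda>x. norm (freq_proj B F x) powr p)" by (intro integrableI_bounded) auto
  then show "(\<integral>\<^sup>+x. ennreal (norm (freq_proj B F x) powr p) \<partial>lborel) = ennreal (LINT x|lborel. norm (freq_proj B F x) powr p)"
    by (rule nn_integral_eq_integral) auto
qed

context cap_kernels
begin

text \<open>The multiplier \<open>ft (u \<gamma>)\<close> is \<open>1\<close> on \<open>\<gamma>\<close> and so fixes \<open>P\<^sub>\<gamma> F\<close>. The caps partition the Fourier support up to the null sets by which they
  fail to be Borel sets.\<close>

theorem superpose_freq_proj:
  assumes one: "\<And>\<gamma> \<xi>. \<gamma> \<in> G \<Longrightarrow> \<xi> \<in> \<gamma> \<Longrightarrow> ft (u \<gamma>) \<xi> = 1"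
    and leb: "\<And>\<gamma>. \<gamma> \<in> G \<Longrightarrow> \<gamma> \<in> sets lebesgue" and cover: "\<Union>G = cone_nbhd (s\<^sup>2)"
    and F: "schwartz F" and supp: "\<And>\<xi>. ft F \<xi> \<noteq> 0 \<Longrightarrow> \<xi> \<in> cone_nbhd (s\<^sup>2)"
  shows "superpose G u (\<lambda>\<gamma>. freq_proj \<gamma> F) = F"
proof
  fix x
  have supp12: "norm \<xi> \<le> 12" if "ft F \<xi> \<noteq> 0" for \<xi>
    by (rule cone_nbhd_norm_le[OF s2(1,2) supp[OF that]])
  have Fi: "integrable lborel (ft F)" by (rule schwartz_ft_integrable[OF F supp12])
  define M where "M \<gamma> = main_part lborel \<gamma>" for \<gamma> :: "(real^3) set"
  have M: "M \<gamma> \<in> sets borel" "M \<gamma> \<subseteq> \<gamma>" "\<gamma> - M \<gamma> \<subseteq> null_part lborel \<gamma>" if "\<gamma> \<in> G" for \<gamma>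
    using main_part_sets[OF leb[OF that]] main_part_null_part_Un[OF leb[OF that]] by (auto simp: M_def)
  define h where "h \<gamma> \<xi> = indicator (M \<gamma>) \<xi> *\<^sub>R ft F \<xi>" for \<gamma> \<xi>
  have hi: "integrable lborel (h \<gamma>)" if "\<gamma> \<in> G" for \<gamma>
    unfolding h_def[abs_def] using M(1)[OF that] Fi by (intro integrable_mult_indicator) auto
  have P: "freq_proj \<gamma> F = ift (h \<gamma>)" if "\<gamma> \<in> G" for \<gamma>
    unfolding h_def[abs_def] M_def by (rule freq_proj_main_part[OF leb[OF that] F])
  have reproduce: "conv (freq_proj \<gamma> F) (u \<gamma>) = freq_proj \<gamma> F" if \<gamma>: "\<gamma> \<in> G" for \<gamma>
  proof -
    have "conv (freq_proj \<gamma> F) (u \<gamma>) = conv (u \<gamma>) (ift (h \<gamma>))"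
      unfolding P[OF \<gamma>] using hi[OF \<gamma>] kernel_integrable[OF \<gamma>] by (intro conv_commute borel_measurable_ift) auto
    also have "\<dots> = ift (\<lambda>\<xi>. h \<gamma> \<xi> * ft (u \<gamma>) \<xi>)" by (rule conv_ift[OF kernel_integrable[OF \<gamma>] hi[OF \<gamma>]])
    also have "(\<lambda>\<xi>. h \<gamma> \<xi> * ft (u \<gamma>) \<xi>) = h \<gamma>"
      using one[OF \<gamma>] M(2)[OF \<gamma>] by (auto simp: fun_eq_iff h_def indicator_def)
    finally show ?thesis unfolding P[OF \<gamma>] .
  qed
  have "superpose G u (\<lambda>\<gamma>. freq_proj \<gamma> F) x = (\<Sum>\<gamma>\<in>G. ift (h \<gamma>) x)"
    unfolding superpose_def using reproduce P by (intro sum.cong) auto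
  also have "\<dots> = (LINT \<xi>|lborel. (\<Sum>\<gamma>\<in>G. h \<gamma> \<xi> * ch (\<xi> \<bullet> x)))"
    unfolding ift_def by (rule Bochner_Integration.integral_sum[symmetric]) (rule integrable_mult_ch[OF hi])
  also have "\<dots> = (LINT \<xi>|lborel. ft F \<xi> * ch (\<xi> \<bullet> x))"
  proof (rule integral_cong_AE)
    show "(\<lambda>\<xi>. \<Sum>\<gamma>\<in>G. h \<gamma> \<xi> * ch (\<xi> \<bullet> x)) \<in> borel_measurable lborel"
      using integrable_mult_ch[OF hi] by (intro borel_measurable_sum) auto
    show "(\<lambda>\<xi>. ft F \<xi> * ch (\<xi> \<bullet> x)) \<in> borel_measurable lborel"
      using integrable_mult_ch[OF Fi] by auto
    have "AE \<xi> in lborel. \<xi> \<notin> null_part lborel \<gamma>" if \<gamma>: "\<gamma> \<in> G" for \<gamma>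
    proof -
      obtain N where N: "N \<in> null_sets lborel" "null_part lborel \<gamma> \<subseteq> N" using null_part[OF leb[OF \<gamma>]] by blast
      show ?thesis using AE_not_in[OF N(1)] by eventually_elim (use N(2) in auto)
    qed
    then have "AE \<xi> in lborel. \<forall>\<gamma>\<in>G. \<xi> \<notin> null_part lborel \<gamma>"
      using finite_caps by (simp add: AE_finite_all)
    then show "AE \<xi> in lborel. (\<Sum>\<gamma>\<in>G. h \<gamma> \<xi> * ch (\<xi> \<bullet> x)) = ft F \<xi> * ch (\<xi> \<bullet> x)"
    proof eventually_elim
      case (elim \<xi>)
      show ?case
      proof (cases "ft F \<xi> = 0")
        case True
        then show ?thesis by (simp add: h_def)
      next
        case False
        then obtain \<gamma>0 where \<gamma>0: "\<gamma>0 \<in> G" "\<xi> \<in> \<gamma>0" using supp cover by blast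
        have "h \<gamma> \<xi> * ch (\<xi> \<bullet> x) = (if \<gamma> = \<gamma>0 then ft F \<xi> * ch (\<xi> \<bullet> x) else 0)" if \<gamma>: "\<gamma> \<in> G" for \<gamma>
        proof (cases "\<gamma> = \<gamma>0")
          case True
          then have "\<xi> \<in> M \<gamma>" using M(3)[OF \<gamma>] \<gamma>0(2) elim \<gamma> by blast
          then show ?thesis using True by (simp add: h_def)
        next
          case False
          then have "\<xi> \<notin> \<gamma>" using disj \<gamma> \<gamma>0 unfolding disjoint_def by blast
          then show ?thesis using False M(2)[OF \<gamma>] by (auto simp: h_def indicator_def)
        qed
        then have "(\<Sum>\<gamma>\<in>G. h \<gamma> \<xi> * ch (\<xi> \<bullet> x)) = (\<Sum>\<gamma>\<in>G. if \<gamma> = \<gamma>0 then ft F \<xi> * ch (\<xi> \<bullet> x) else 0)"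
          by (intro sum.cong) auto
        then show ?thesis using \<gamma>0(1) finite_caps by simp
      qed
    qed
  qed
  also have "\<dots> = F x" using fun_cong[OF schwartz_ft_inversion[OF F Fi], of x] unfolding ift_def .
  finally show "superpose G u (\<lambda>\<gamma>. freq_proj \<gamma> F) x = F x" .
qed

end

section \<open>Small cap decoupling\<close>

lemma almost_cone_box_choice:
  assumes K: "K \<ge> 1" and d: "d1 > 0" "d2 > 0" "d3 > 0" and T: "\<And>B. B \<in> T \<Longrightarrow> almost_cone_box K d1 d2 d3 B"
  obtains c t \<rho> where "\<And>B. B \<in> T \<Longrightarrow> 0 \<le> t B \<and> t B < 7 \<and> \<rho> B \<ge> 0 \<and> c B $ 1 = \<rho> B * cos (t B) \<and> c B $ 2 = \<rho> B * sin (t B) \<and>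
      cone_box (c B) (t B) (d1 / K\<^sup>2) (d2 / K\<^sup>2) (d3 / K\<^sup>2) \<subseteq> B \<and> B \<subseteq> cone_box (c B) (t B) (K\<^sup>2 * d1) (K\<^sup>2 * d2) (K\<^sup>2 * d3)"
proof -
  have "\<forall>B\<in>T. \<exists>c t \<rho>. 0 \<le> t \<and> t < 7 \<and> \<rho> \<ge> 0 \<and> c $ 1 = \<rho> * cos t \<and> c $ 2 = \<rho> * sin t \<and>
      cone_box c t (d1 / K\<^sup>2) (d2 / K\<^sup>2) (d3 / K\<^sup>2) \<subseteq> B \<and> B \<subseteq> cone_box c t (K\<^sup>2 * d1) (K\<^sup>2 * d2) (K\<^sup>2 * d3)"
    using almost_cone_box_normalized[OF K d T] by blast
  then show thesis unfolding bchoice_iff by (elim exE) (rule that, erule bspec)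
qed

text \<open>The loss at the coarser scale, the logarithm of the quadruple count and the factor \<open>1 / s\<^sup>2 = R\<close> combine to \<open>R powr (1 + \<epsilon>)\<close>.\<close>

lemma cap_L4_bound:
  fixes \<Theta> :: "real \<Rightarrow> (real^3) set set" and K V \<epsilon> :: real
  assumes K: "K \<ge> 1" and V: "V \<ge> 0" and \<epsilon>: "\<epsilon> > 0"
    and planks: "\<And>\<delta>. 0 < \<delta> \<Longrightarrow> \<delta> \<le> 1 \<Longrightarrow> plank_partition K \<delta> (\<Theta> \<delta>)"
    and reverse_square_function:
      "\<forall>\<epsilon>>0. \<exists>C::real. \<forall>R\<ge>1. \<forall>F. schwartz F \<and> fourier_supp F \<subseteq> cone_nbhd (1 / R) \<longrightarrow>
         Lp_norm 4 F \<le> C * R powr \<epsilon> *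
           Lp_norm 4 (\<lambda>x. sqrt (\<Sum>\<theta>\<in>\<Theta> (1 / R). (norm (freq_proj \<theta> F x))\<^sup>2))"
  shows "\<exists>A\<ge>0. \<forall>R\<ge>1. \<forall>G c t \<rho> u f. cap_kernels K (1 / sqrt R) V G c t \<rho> u \<longrightarrow> test_family G f \<longrightarrow>
      (\<integral>\<^sup>+x. ennreal (norm (superpose G u f x) ^ 4) \<partial>lborel) \<le> ennreal (A * R powr (1 + \<epsilon>)) * (\<Sum>\<gamma>\<in>G. \<integral>\<^sup>+x. ennreal (norm (f \<gamma> x) ^ 4) \<partial>lborel)"
proof -
  \<comment> \<open>The loss \<open>R powr \<eta>\<close> enters to the fourth power through the hypothesis and once through the logarithm.\<close>
  define \<eta> where "\<eta> = \<epsilon> / 5"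
  have \<eta>: "\<eta> > 0" using \<epsilon> by (simp add: \<eta>_def)
  obtain C where C: "\<And>R F. R \<ge> 1 \<Longrightarrow> schwartz F \<Longrightarrow> fourier_supp F \<subseteq> cone_nbhd (1 / R) \<Longrightarrow>
         Lp_norm 4 F \<le> C * R powr \<eta> * Lp_norm 4 (\<lambda>x. sqrt (\<Sum>\<theta>\<in>\<Theta> (1 / R). (norm (freq_proj \<theta> F x))\<^sup>2))"
    using reverse_square_function \<eta> by blast
  define C' where "C' = max C 1"
  define P where "P = real (card (cap_kernels.keys K))"
  define W where "W = cap_kernels.Bw K"
  define N where "N = real (cap_kernels.Np K)"
  have N0: "N \<ge> 0" "P \<ge> 0" by (simp_all add: N_def P_def)
  define Al where "Al = P ^ 3 * (C' ^ 4 * (14080 * W * N ^ 3 * (1 + 1 / \<eta>))) * V ^ 4"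
  define As where "As = (8 * (12 * (400 * K ^ 4) + 20) ^ 3 * K ^ 6) ^ 3 * V ^ 4"
  define A where "A = max 0 (max Al As)"
  have A: "0 \<le> A" "Al \<le> A" "As \<le> A" by (auto simp: A_def)
  show ?thesis
  proof (intro exI[of _ A] conjI A(1) allI impI)
    fix R :: real and G c t \<rho> u and f :: "(real^3) set \<Rightarrow> real^3 \<Rightarrow> complex"
    assume R: "R \<ge> 1" and ck: "cap_kernels K (1 / sqrt R) V G c t \<rho> u" and f: "test_family G f"
    define s where "s = 1 / sqrt R"
    interpret cap_kernels K s V G c t \<rho> u using ck unfolding s_def .
    have s2R: "1 / s\<^sup>2 = R" using R by (simp add: s_def power_divide)
    have R1: "1 \<le> R powr (1 + \<epsilon>)" using R \<epsilon> by (simp add: ge_one_powr_ge_zero)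
    define s' where "s' = 100 * K ^ 4 * s"
    have s'0: "s' > 0" using K s by (simp add: s'_def)
    show "(\<integral>\<^sup>+x. ennreal (norm (superpose G u f x) ^ 4) \<partial>lborel) \<le> ennreal (A * R powr (1 + \<epsilon>)) * (\<Sum>\<gamma>\<in>G. \<integral>\<^sup>+x. ennreal (norm (f \<gamma> x) ^ 4) \<partial>lborel)"
    \<comment> \<open>The coarser scale requires \<open>s'\<close> to be small; otherwise \<open>1 / s\<close> is bounded in terms of \<open>K\<close>.\<close>
    proof (cases "10 * s'\<^sup>2 \<le> 1")
      case True
      define \<delta> where "\<delta> = s'\<^sup>2"
      have \<delta>: "0 < \<delta>" "\<delta> \<le> 1" "sqrt \<delta> = s'" using s'0 True by (auto simp: \<delta>_def)
      have T: "partition_on (cone_nbhd \<delta>) (\<Theta> \<delta>)" and pl: "\<And>\<theta>. \<theta> \<in> \<Theta> \<delta> \<Longrightarrow> almost_cone_box K s' \<delta> 1 \<theta>"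
        using planks[OF \<delta>(1,2)] \<delta>(3) by (auto simp: plank_partition_def)
      obtain cc tt rr where cc: "\<And>\<theta>. \<theta> \<in> \<Theta> \<delta> \<Longrightarrow> 0 \<le> tt \<theta> \<and> tt \<theta> < 7 \<and> rr \<theta> \<ge> 0 \<and> cc \<theta> $ 1 = rr \<theta> * cos (tt \<theta>) \<and> cc \<theta> $ 2 = rr \<theta> * sin (tt \<theta>) \<and>
          cone_box (cc \<theta>) (tt \<theta>) (s' / K\<^sup>2) (\<delta> / K\<^sup>2) (1 / K\<^sup>2) \<subseteq> \<theta> \<and> \<theta> \<subseteq> cone_box (cc \<theta>) (tt \<theta>) (K\<^sup>2 * s') (K\<^sup>2 * \<delta>) (K\<^sup>2 * 1)"
        by (rule almost_cone_box_choice[OF K s'0 \<delta>(1) zero_less_one pl]) (assumption, rule that, assumption)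
      define R' where "R' = 1 / \<delta>"
      have R': "1 / R' = \<delta>" "R' \<ge> 1" using \<delta> by (auto simp: R'_def)
      have "1 \<le> 100 * K ^ 4" using one_le_power[OF K, of 4] by linarith
      then have "1 * s \<le> 100 * K ^ 4 * s" using s by (intro mult_right_mono) auto
      then have "s \<le> s'" by (simp only: s'_def mult_1)
      then have "s\<^sup>2 \<le> \<delta>" unfolding \<delta>_def using s by (intro power_mono) auto
      then have "R' \<le> R" unfolding R'_def s2R[symmetric] using s \<delta>(1) by (intro divide_left_mono) auto
      then have RR: "R' powr \<eta> \<le> R powr \<eta>" using R' \<eta> by (intro powr_mono2) auto
      have hyp: "Lp_norm 4 F \<le> (C' * R powr \<eta>) * Lp_norm 4 (\<lambda>x. sqrt (\<Sum>\<theta>\<in>\<Theta> \<delta>. (norm (freq_proj \<theta> F x))\<^sup>2))"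
        if "schwartz F" "fourier_supp F \<subseteq> cone_nbhd \<delta>" for F
      proof -
        have "Lp_norm 4 F \<le> C * R' powr \<eta> * Lp_norm 4 (\<lambda>x. sqrt (\<Sum>\<theta>\<in>\<Theta> \<delta>. (norm (freq_proj \<theta> F x))\<^sup>2))"
          using C[OF R'(2) that(1)] that(2) unfolding R'(1) by blast
        also have "\<dots> \<le> (C' * R powr \<eta>) * Lp_norm 4 (\<lambda>x. sqrt (\<Sum>\<theta>\<in>\<Theta> \<delta>. (norm (freq_proj \<theta> F x))\<^sup>2))"
        proof (rule mult_right_mono)
          have "C * R' powr \<eta> \<le> C' * R' powr \<eta>" by (intro mult_right_mono) (auto simp: C'_def)
          also have "\<dots> \<le> C' * R powr \<eta>" using RR by (intro mult_left_mono) (auto simp: C'_def)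
          finally show "C * R' powr \<eta> \<le> C' * R powr \<eta>" .
        qed (simp add: Lp_norm_def)
        finally show ?thesis .
      qed
      have "(\<integral>\<^sup>+x. ennreal (norm (superpose G u f x) ^ 4) \<partial>lborel)
         \<le> ennreal (P ^ 3 * ((C' * R powr \<eta>) ^ 4 * (14080 * W * N ^ 3 / s\<^sup>2 * (1 + ln (1 / s)))) * V ^ 4)
            * (\<Sum>\<gamma>\<in>G. \<integral>\<^sup>+x. ennreal (norm (f \<gamma> x) ^ 4) \<partial>lborel)"
        unfolding P_def W_def N_def
      proof (rule superpose_L4[where T="\<Theta> \<delta>" and cc=cc and tt=tt and rr=rr, OF f s'_def True])
        show "partition_on (cone_nbhd (s'\<^sup>2)) (\<Theta> \<delta>)" using T unfolding \<delta>_def .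
        show "0 \<le> rr \<theta> \<and> cc \<theta> $ 1 = rr \<theta> * cos (tt \<theta>) \<and> cc \<theta> $ 2 = rr \<theta> * sin (tt \<theta>) \<and>
            cone_box (cc \<theta>) (tt \<theta>) (s' / K\<^sup>2) (s'\<^sup>2 / K\<^sup>2) (1 / K\<^sup>2) \<subseteq> \<theta> \<and>
            \<theta> \<subseteq> cone_box (cc \<theta>) (tt \<theta>) (K\<^sup>2 * s') (K\<^sup>2 * s'\<^sup>2) (K\<^sup>2 * 1)" if "\<theta> \<in> \<Theta> \<delta>" for \<theta>
          using cc[OF that] unfolding \<delta>_def by blast
        show "Lp_norm 4 F \<le> (C' * R powr \<eta>) * Lp_norm 4 (\<lambda>x. sqrt (\<Sum>\<theta>\<in>\<Theta> \<delta>. (norm (freq_proj \<theta> F x))\<^sup>2))"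
          if "schwartz F" "fourier_supp F \<subseteq> cone_nbhd (s'\<^sup>2)" for F
          using hyp[OF that(1)] that(2) unfolding \<delta>_def by blast
      qed
      moreover have "P ^ 3 * ((C' * R powr \<eta>) ^ 4 * (14080 * W * N ^ 3 / s\<^sup>2 * (1 + ln (1 / s)))) * V ^ 4 \<le> A * R powr (1 + \<epsilon>)"
      proof -
        have ln: "1 + ln (1 / s) \<le> (1 + 1 / \<eta>) * R powr \<eta>"
        proof -
          have "ln (1 / s) = ln R / 2" using R by (simp add: s_def ln_sqrt)
          also have "\<dots> \<le> ln R" using ln_ge_zero[OF R] by simp
          also have "\<dots> \<le> R powr \<eta> / \<eta>" by (rule ln_powr_bound[OF R \<eta>])
          finally have 1: "ln (1 / s) \<le> R powr \<eta> / \<eta>" .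
          have 2: "1 \<le> R powr \<eta>" using R \<eta> by (simp add: ge_one_powr_ge_zero)
          have "(1 + 1 / \<eta>) * R powr \<eta> = R powr \<eta> + R powr \<eta> / \<eta>" by (simp add: distrib_right)
          then show ?thesis using 1 2 by linarith
        qed
        have W0: "W \<ge> 0" using Bw(1) by (simp add: W_def)
        have "P ^ 3 * ((C' * R powr \<eta>) ^ 4 * (14080 * W * N ^ 3 / s\<^sup>2 * (1 + ln (1 / s)))) * V ^ 4
            \<le> P ^ 3 * ((C' * R powr \<eta>) ^ 4 * (14080 * W * N ^ 3 / s\<^sup>2 * ((1 + 1 / \<eta>) * R powr \<eta>))) * V ^ 4"
          using ln W0 N0 V by (intro mult_right_mono mult_left_mono) (auto intro!: divide_nonneg_nonneg mult_nonneg_nonneg)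
        also have "\<dots> = Al * ((R powr \<eta>) ^ 4 * (1 / s\<^sup>2) * R powr \<eta>)"
          by (simp add: Al_def power_mult_distrib mult_ac)
        also have "(R powr \<eta>) ^ 4 * (1 / s\<^sup>2) * R powr \<eta> = R powr (1 + \<epsilon>)"
        proof -
          have "(R powr \<eta>) ^ 4 = R powr (4 * \<eta>)" using R by (simp add: powr_4[symmetric] powr_powr mult.commute)
          then have "(R powr \<eta>) ^ 4 * (1 / s\<^sup>2) * R powr \<eta> = R powr (4 * \<eta>) * R powr 1 * R powr \<eta>"
            using R unfolding s2R by simp
          also have "\<dots> = R powr (4 * \<eta> + 1 + \<eta>)" by (simp only: powr_add)
          also have "4 * \<eta> + 1 + \<eta> = 1 + \<epsilon>" by (simp add: \<eta>_def)
          finally show ?thesis .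
        qed
        also have "Al * R powr (1 + \<epsilon>) \<le> A * R powr (1 + \<epsilon>)" by (intro mult_right_mono A) simp
        finally show ?thesis .
      qed
      ultimately show ?thesis
        by (rule order_trans[OF _ mult_right_mono[OF ennreal_leI]]) simp
    next
      case False
      have "1 / s \<le> 400 * K ^ 4"
      proof -
        have "1\<^sup>2 \<le> (4 * s')\<^sup>2" using False by (simp add: power_mult_distrib)
        then have "1 \<le> 4 * s'" by (rule power2_le_imp_le) (use s'0 in simp)
        then show ?thesis using s by (simp add: s'_def field_simps)
      qed
      then have mono: "8 * (12 / s + 20) ^ 3 * K ^ 6 \<le> 8 * (12 * (400 * K ^ 4) + 20) ^ 3 * K ^ 6"
        using s K by (intro mult_right_mono mult_left_mono power_mono) auto
      have pos: "0 \<le> 8 * (12 / s + 20) ^ 3 * K ^ 6" using s K by simp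
      have "real (card G) \<le> real (nat \<lfloor>8 * (12 / s + 20) ^ 3 * K ^ 6\<rfloor>)" using card_caps by simp
      also have "\<dots> \<le> 8 * (12 / s + 20) ^ 3 * K ^ 6" using pos by (rule of_nat_floor)
      finally have "real (card G) ^ 3 * V ^ 4 \<le> As" unfolding As_def
        using V mono by (intro mult_right_mono power_mono) auto
      also have "As \<le> A * R powr (1 + \<epsilon>)" using A R1 mult_mono[of As A 1 "R powr (1 + \<epsilon>)"] by simp
      finally show ?thesis
        by (rule order_trans[OF superpose_L4_crude[OF f] mult_right_mono[OF ennreal_leI]]) simp
    qed
  qed
qed

text \<open>The end points are the two bounds themselves; for \<open>2 < p < 4\<close> the constants are increased by \<open>1\<close>, since the
  interpolation balances them by their quotient.\<close>

theorem cap_Lp_bound: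
  fixes \<Theta> :: "real \<Rightarrow> (real^3) set set" and K V \<epsilon> p :: real
  assumes K: "K \<ge> 1" and V: "V \<ge> 0" and \<epsilon>: "\<epsilon> > 0"
    and planks: "\<And>\<delta>. 0 < \<delta> \<Longrightarrow> \<delta> \<le> 1 \<Longrightarrow> plank_partition K \<delta> (\<Theta> \<delta>)"
    and reverse_square_function:
      "\<forall>\<epsilon>>0. \<exists>C::real. \<forall>R\<ge>1. \<forall>F. schwartz F \<and> fourier_supp F \<subseteq> cone_nbhd (1 / R) \<longrightarrow>
         Lp_norm 4 F \<le> C * R powr \<epsilon> *
           Lp_norm 4 (\<lambda>x. sqrt (\<Sum>\<theta>\<in>\<Theta> (1 / R). (norm (freq_proj \<theta> F x))\<^sup>2))"
    and p: "2 \<le> p" "p \<le> 4"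
  shows "\<exists>A\<ge>0. \<forall>R\<ge>1. \<forall>G c t \<rho> u f. cap_kernels K (1 / sqrt R) V G c t \<rho> u \<longrightarrow>
      (\<forall>\<gamma>\<in>G. f \<gamma> \<in> borel_measurable borel \<and> (\<exists>B. \<forall>x. norm (f \<gamma> x) \<le> B)) \<longrightarrow>
      (\<integral>\<^sup>+x. ennreal (norm (superpose G u f x) powr p) \<partial>lborel)
        \<le> ennreal (A * R powr ((1 + \<epsilon>) * ((p - 2) / 2))) * (\<Sum>\<gamma>\<in>G. \<integral>\<^sup>+x. ennreal (norm (f \<gamma> x) powr p) \<partial>lborel)"
proof -
  obtain A4 where A4: "A4 \<ge> 0" and L4: "\<And>R G c t \<rho> u f. R \<ge> 1 \<Longrightarrow> cap_kernels K (1 / sqrt R) V G c t \<rho> u \<Longrightarrow> test_family G f \<Longrightarrow>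
      (\<integral>\<^sup>+x. ennreal (norm (superpose G u f x) ^ 4) \<partial>lborel) \<le> ennreal (A4 * R powr (1 + \<epsilon>)) * (\<Sum>\<gamma>\<in>G. \<integral>\<^sup>+x. ennreal (norm (f \<gamma> x) ^ 4) \<partial>lborel)"
    using cap_L4_bound[OF K V \<epsilon> planks reverse_square_function] by blast
  define A2 where "A2 = real (cap_kernels.Np K) * V\<^sup>2"
  have A2: "A2 \<ge> 0" by (simp add: A2_def)
  define A where "A = (if p = 2 then A2 else if p = 4 then A4 else
      (4 * p / (p - 2) + 16 * p / (4 - p)) * (A2 + 1) powr ((4 - p) / 2) * (A4 + 1) powr ((p - 2) / 2))"
  have A: "A \<ge> 0" unfolding A_def using p A2 A4 by auto
  have pw: "norm z powr 2 = norm z ^ 2" "norm z powr 4 = norm z ^ 4" for z :: complex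
    by (cases "z = 0"; simp)+
  show ?thesis
  proof (intro exI[of _ A] conjI A allI impI)
    fix R :: real and G c t \<rho> u and f :: "(real^3) set \<Rightarrow> real^3 \<Rightarrow> complex"
    assume R: "R \<ge> 1" and ck: "cap_kernels K (1 / sqrt R) V G c t \<rho> u"
      and f: "\<forall>\<gamma>\<in>G. f \<gamma> \<in> borel_measurable borel \<and> (\<exists>B. \<forall>x. norm (f \<gamma> x) \<le> B)"
    interpret cap_kernels K "1 / sqrt R" V G c t \<rho> u by (rule ck)
    have L2: "(\<integral>\<^sup>+x. ennreal (norm (superpose G u g x) ^ 2) \<partial>lborel) \<le> ennreal A2 * (\<Sum>\<gamma>\<in>G. \<integral>\<^sup>+x. ennreal (norm (g \<gamma> x) ^ 2) \<partial>lborel)"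
      if "test_family G g" for g
      unfolding A2_def by (rule superpose_L2[OF that])
    show "(\<integral>\<^sup>+x. ennreal (norm (superpose G u f x) powr p) \<partial>lborel)
        \<le> ennreal (A * R powr ((1 + \<epsilon>) * ((p - 2) / 2))) * (\<Sum>\<gamma>\<in>G. \<integral>\<^sup>+x. ennreal (norm (f \<gamma> x) powr p) \<partial>lborel)"
    proof (rule superpose_bounded_extension[OF finite_caps kernel_integrable])
      fix g assume g: "test_family G g"
      consider "p = 2" | "p = 4" | "2 < p" "p < 4" using p by linarith
      then show "(\<integral>\<^sup>+x. ennreal (norm (superpose G u g x) powr p) \<partial>lborel)
        \<le> ennreal (A * R powr ((1 + \<epsilon>) * ((p - 2) / 2))) * (\<Sum>\<gamma>\<in>G. \<integral>\<^sup>+x. ennreal (norm (g \<gamma> x) powr p) \<partial>lborel)"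
      proof cases
        case 1
        have "A * R powr ((1 + \<epsilon>) * ((p - 2) / 2)) = A2" using R 1 by (simp add: A_def)
        then show ?thesis using L2[OF g] unfolding 1 pw by simp
      next
        case 2
        have "A * R powr ((1 + \<epsilon>) * ((p - 2) / 2)) = A4 * R powr (1 + \<epsilon>)" using 2 by (simp add: A_def)
        note e = this
        show ?thesis using L4[OF R ck g] unfolding e unfolding 2 pw .
      next
        case 3
        have "\<forall>\<gamma>\<in>G. \<exists>U. \<forall>x. norm (u \<gamma> x) \<le> U" using schwartz_bounded[OF kernel] by blast
        then obtain U where U: "\<And>\<gamma> x. \<gamma> \<in> G \<Longrightarrow> norm (u \<gamma> x) \<le> U \<gamma>" unfolding bchoice_iff by blast
        have RR: "R powr (1 + \<epsilon>) > 0" using R by simp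
        have "(\<integral>\<^sup>+x. ennreal (norm (superpose G u g x) powr p) \<partial>lborel)
          \<le> ennreal ((4 * p / (p - 2) + 16 * p / (4 - p)) * (A2 + 1) powr ((4 - p) / 2) * ((A4 + 1) * R powr (1 + \<epsilon>)) powr ((p - 2) / 2))
             * (\<Sum>\<gamma>\<in>G. \<integral>\<^sup>+x. ennreal (norm (g \<gamma> x) powr p) \<partial>lborel)"
        proof (rule marcinkiewicz_superpose[OF finite_caps _ U])
          show "u \<gamma> \<in> borel_measurable borel" if "\<gamma> \<in> G" for \<gamma> by (rule schwartz_measurable[OF kernel[OF that]])
          show "0 < A2 + 1" "0 < (A4 + 1) * R powr (1 + \<epsilon>)" using A2 A4 RR by auto
          show "(\<integral>\<^sup>+x. ennreal (norm (superpose G u h x) ^ 2) \<partial>lborel) \<le> ennreal (A2 + 1) * (\<Sum>\<gamma>\<in>G. \<integral>\<^sup>+x. ennreal (norm (h \<gamma> x) ^ 2) \<partial>lborel)"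
            if "test_family G h" for h
            using L2[OF that] by (rule order_trans) (intro mult_right_mono ennreal_leI, auto)
          show "(\<integral>\<^sup>+x. ennreal (norm (superpose G u h x) ^ 4) \<partial>lborel) \<le> ennreal ((A4 + 1) * R powr (1 + \<epsilon>)) * (\<Sum>\<gamma>\<in>G. \<integral>\<^sup>+x. ennreal (norm (h \<gamma> x) ^ 4) \<partial>lborel)"
            if "test_family G h" for h
            using L4[OF R ck that] by (rule order_trans) (intro mult_right_mono ennreal_leI, auto)
        qed (use 3 g in auto)
        also have "(4 * p / (p - 2) + 16 * p / (4 - p)) * (A2 + 1) powr ((4 - p) / 2) * ((A4 + 1) * R powr (1 + \<epsilon>)) powr ((p - 2) / 2)
            = A * R powr ((1 + \<epsilon>) * ((p - 2) / 2))"
          using 3 A4 R by (simp add: A_def powr_mult powr_powr)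
        finally show ?thesis .
      qed
    qed (use p f in auto)
  qed
qed

theorem theorem3p6:
  fixes \<Theta> \<Gamma> :: "real \<Rightarrow> (real^3) set set" and K :: real
  assumes K: "K \<ge> 1"
    and planks: "\<And>\<delta>. 0 < \<delta> \<Longrightarrow> \<delta> \<le> 1 \<Longrightarrow> plank_partition K \<delta> (\<Theta> \<delta>)"
    and small_caps: "\<And>\<delta>. 0 < \<delta> \<Longrightarrow> \<delta> \<le> 1 \<Longrightarrow> small_cap_partition K \<delta> (\<Theta> \<delta>) (\<Gamma> \<delta>)"
    and reverse_square_function:
      "\<forall>\<epsilon>>0. \<exists>C::real. \<forall>R\<ge>1. \<forall>F. schwartz F \<and> fourier_supp F \<subseteq> cone_nbhd (1 / R) \<longrightarrow>
         Lp_norm 4 F \<le> C * R powr \<epsilon> *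
           Lp_norm 4 (\<lambda>x. sqrt (\<Sum>\<theta>\<in>\<Theta> (1 / R). (norm (freq_proj \<theta> F x))\<^sup>2))"
  shows "\<forall>p::real. 2 \<le> p \<and> p \<le> 4 \<longrightarrow> (\<forall>\<epsilon>>0. \<exists>C::real. \<forall>R\<ge>1. \<forall>F.
         schwartz F \<and> fourier_supp F \<subseteq> cone_nbhd (1 / R) \<longrightarrow>
         Lp_norm p F \<le> C * R powr (1 / 2 - 1 / p + \<epsilon>) *
           (\<Sum>\<gamma>\<in>\<Gamma> (1 / R). Lp_norm p (freq_proj \<gamma> F) powr p) powr (1 / p))"
proof (intro allI impI, elim conjE)
  fix p \<epsilon> :: real
  assume p: "2 \<le> p" "p \<le> 4" and \<epsilon>: "\<epsilon> > 0"
  obtain w where w: "schwartz w" "\<And>\<xi>. (\<And>i. \<bar>\<xi>$i\<bar> \<le> 1) \<Longrightarrow> ft w \<xi> = 1" "\<And>\<xi> i. \<bar>\<xi>$i\<bar> \<ge> 2 \<Longrightarrow> ft w \<xi> = 0"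
    using mother_kernel_exists by blast
  define V where "V = (LINT x|lborel. norm (w x))"
  have V: "V \<ge> 0" by (simp add: V_def)
  obtain A where A: "A \<ge> 0" and bound: "\<And>R G c t \<rho> u f. R \<ge> 1 \<Longrightarrow> cap_kernels K (1 / sqrt R) V G c t \<rho> u \<Longrightarrow>
      (\<forall>\<gamma>\<in>G. f \<gamma> \<in> borel_measurable borel \<and> (\<exists>B. \<forall>x. norm (f \<gamma> x) \<le> B)) \<Longrightarrow>
      (\<integral>\<^sup>+x. ennreal (norm (superpose G u f x) powr p) \<partial>lborel)
        \<le> ennreal (A * R powr ((1 + \<epsilon>) * ((p - 2) / 2))) * (\<Sum>\<gamma>\<in>G. \<integral>\<^sup>+x. ennreal (norm (f \<gamma> x) powr p) \<partial>lborel)"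
    using cap_Lp_bound[OF K V \<epsilon> planks reverse_square_function p] by blast
  show "\<exists>C::real. \<forall>R\<ge>1. \<forall>F. schwartz F \<and> fourier_supp F \<subseteq> cone_nbhd (1 / R) \<longrightarrow>
         Lp_norm p F \<le> C * R powr (1 / 2 - 1 / p + \<epsilon>) * (\<Sum>\<gamma>\<in>\<Gamma> (1 / R). Lp_norm p (freq_proj \<gamma> F) powr p) powr (1 / p)"
  proof (intro exI[of _ "A powr (1 / p)"] allI impI, elim conjE)
    fix R :: real and F
    assume R: "R \<ge> 1" and F: "schwartz F" and fs: "fourier_supp F \<subseteq> cone_nbhd (1 / R)"
    define s where "s = 1 / sqrt R"
    have sR: "0 < s" "s \<le> 1" "1 / R = s\<^sup>2" "sqrt (s\<^sup>2) = s" using R by (auto simp: s_def power_divide real_sqrt_divide)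
    have s20: "0 < s\<^sup>2" "s\<^sup>2 \<le> 1" using sR by (auto simp: power_le_one)
    define G where "G = \<Gamma> (s\<^sup>2)"
    have T: "partition_on (cone_nbhd (s\<^sup>2)) (\<Theta> (s\<^sup>2))" using planks[OF s20] by (simp add: plank_partition_def)
    obtain Q where Q: "\<And>\<theta>. \<theta> \<in> \<Theta> (s\<^sup>2) \<Longrightarrow> partition_on \<theta> (Q \<theta>)" "G = (\<Union>\<theta>\<in>\<Theta> (s\<^sup>2). Q \<theta>)"
      and box: "\<And>\<gamma>. \<gamma> \<in> G \<Longrightarrow> almost_cone_box K s (s\<^sup>2) s \<gamma>"
      using small_caps[OF s20] unfolding small_cap_partition_def sR(4) G_def by blast
    have cover: "\<Union>G = cone_nbhd (s\<^sup>2)"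
    proof -
      have "\<Union>(Q \<theta>) = \<theta>" if "\<theta> \<in> \<Theta> (s\<^sup>2)" for \<theta> using Q(1)[OF that] by (simp add: partition_on_def)
      then have "\<Union>G = \<Union>(\<Theta> (s\<^sup>2))" unfolding Q(2) by blast
      then show ?thesis using T by (simp add: partition_on_def)
    qed
    have disj: "disjoint G"
      unfolding disjoint_def
    proof (intro ballI impI)
      fix a b assume ab: "a \<in> G" "b \<in> G" "a \<noteq> b"
      obtain \<theta> \<theta>' where th: "\<theta> \<in> \<Theta> (s\<^sup>2)" "a \<in> Q \<theta>" "\<theta>' \<in> \<Theta> (s\<^sup>2)" "b \<in> Q \<theta>'" using ab(1,2) unfolding Q(2) by blast
      show "a \<inter> b = {}"
      proof (cases "\<theta> = \<theta>'")
        case True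
        then show ?thesis using Q(1)[OF th(1)] th ab(3) unfolding partition_on_def disjoint_def by blast
      next
        case False
        then have "\<theta> \<inter> \<theta>' = {}" using T th unfolding partition_on_def disjoint_def by blast
        moreover have "a \<subseteq> \<theta>" "b \<subseteq> \<theta>'" using Q(1)[OF th(1)] Q(1)[OF th(3)] th unfolding partition_on_def by blast+
        ultimately show ?thesis by blast
      qed
    qed
    obtain c t \<rho> where ct: "\<And>\<gamma>. \<gamma> \<in> G \<Longrightarrow> 0 \<le> t \<gamma> \<and> t \<gamma> < 7 \<and> \<rho> \<gamma> \<ge> 0 \<and> c \<gamma> $ 1 = \<rho> \<gamma> * cos (t \<gamma>) \<and> c \<gamma> $ 2 = \<rho> \<gamma> * sin (t \<gamma>) \<and>
        cone_box (c \<gamma>) (t \<gamma>) (s / K\<^sup>2) (s\<^sup>2 / K\<^sup>2) (s / K\<^sup>2) \<subseteq> \<gamma> \<and> \<gamma> \<subseteq> cone_box (c \<gamma>) (t \<gamma>) (K\<^sup>2 * s) (K\<^sup>2 * s\<^sup>2) (K\<^sup>2 * s)"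
      by (rule almost_cone_box_choice[OF K sR(1) s20(1) sR(1) box]) (assumption, rule that, assumption)
    have a: "K\<^sup>2 * s > 0" "K\<^sup>2 * s\<^sup>2 > 0" using K sR by auto
    have "\<forall>\<gamma>\<in>G. \<exists>v. schwartz v \<and> (\<forall>\<xi>\<in>cone_box (c \<gamma>) (t \<gamma>) (K\<^sup>2 * s) (K\<^sup>2 * s\<^sup>2) (K\<^sup>2 * s). ft v \<xi> = 1) \<and>
        (\<forall>\<xi>. ft v \<xi> \<noteq> 0 \<longrightarrow> \<xi> \<in> cone_box (c \<gamma>) (t \<gamma>) (2 * (K\<^sup>2 * s)) (2 * (K\<^sup>2 * s\<^sup>2)) (2 * (K\<^sup>2 * s))) \<and>
        (LINT x|lborel. norm (v x)) = V"
      unfolding V_def by (intro ballI box_kernel_exists w a)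
    then obtain u where u: "\<And>\<gamma>. \<gamma> \<in> G \<Longrightarrow> schwartz (u \<gamma>) \<and> (\<forall>\<xi>\<in>cone_box (c \<gamma>) (t \<gamma>) (K\<^sup>2 * s) (K\<^sup>2 * s\<^sup>2) (K\<^sup>2 * s). ft (u \<gamma>) \<xi> = 1) \<and>
        (\<forall>\<xi>. ft (u \<gamma>) \<xi> \<noteq> 0 \<longrightarrow> \<xi> \<in> cone_box (c \<gamma>) (t \<gamma>) (2 * (K\<^sup>2 * s)) (2 * (K\<^sup>2 * s\<^sup>2)) (2 * (K\<^sup>2 * s))) \<and>
        (LINT x|lborel. norm (u \<gamma> x)) = V"
      unfolding bchoice_iff by blast
    have ck: "cap_kernels K s V G c t \<rho> u"
    proof
      show "\<gamma> \<subseteq> cone_nbhd (s\<^sup>2)" if "\<gamma> \<in> G" for \<gamma> using cover that by blast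
    qed (use K sR disj ct u in auto)
    interpret cap_kernels K s V G c t \<rho> u by (rule ck)
    have leb: "\<gamma> \<in> sets lebesgue" if "\<gamma> \<in> G" for \<gamma> using box[OF that] by (simp add: almost_cone_box_def)
    have supp: "\<xi> \<in> cone_nbhd (s\<^sup>2)" if "ft F \<xi> \<noteq> 0" for \<xi>
    proof -
      have "\<xi> \<in> fourier_supp F" unfolding fourier_supp_def fourier_eq_ft
        by (rule subsetD[OF closure_subset]) (simp add: that)
      then show ?thesis using subsetD[OF fs] unfolding sR(3) by simp
    qed
    have supp12: "norm \<xi> \<le> 12" if "ft F \<xi> \<noteq> 0" for \<xi> by (rule cone_nbhd_norm_le[OF s20 supp[OF that]])
    have rec: "superpose G u (\<lambda>\<gamma>. freq_proj \<gamma> F) = F"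
    proof (rule superpose_freq_proj[OF _ leb cover F supp])
      show "ft (u \<gamma>) \<xi> = 1" if "\<gamma> \<in> G" "\<xi> \<in> \<gamma>" for \<gamma> \<xi>
      proof -
        have "\<gamma> \<subseteq> cone_box (c \<gamma>) (t \<gamma>) (K\<^sup>2 * s) (K\<^sup>2 * s\<^sup>2) (K\<^sup>2 * s)" using ct[OF that(1)] by (elim conjE)
        then have "\<xi> \<in> cone_box (c \<gamma>) (t \<gamma>) (K\<^sup>2 * s) (K\<^sup>2 * s\<^sup>2) (K\<^sup>2 * s)" using that(2) by (rule subsetD)
        then show ?thesis using u[OF that(1)] by simp
      qed
    qed
    define X where "X = (LINT x|lborel. norm (F x) powr p)"
    define Y where "Y \<gamma> = (LINT x|lborel. norm (freq_proj \<gamma> F x) powr p)" for \<gamma>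
    have X0: "X \<ge> 0" and Y0: "Y \<gamma> \<ge> 0" for \<gamma> by (simp_all add: X_def Y_def)
    note Fp = freq_proj_Lp[OF leb F supp12 p(1)]
    have XY: "X \<le> A * R powr ((1 + \<epsilon>) * ((p - 2) / 2)) * (\<Sum>\<gamma>\<in>G. Y \<gamma>)"
    proof -
      have "(\<integral>\<^sup>+x. ennreal (norm (superpose G u (\<lambda>\<gamma>. freq_proj \<gamma> F) x) powr p) \<partial>lborel)
        \<le> ennreal (A * R powr ((1 + \<epsilon>) * ((p - 2) / 2))) * (\<Sum>\<gamma>\<in>G. \<integral>\<^sup>+x. ennreal (norm (freq_proj \<gamma> F x) powr p) \<partial>lborel)"
        by (rule bound[OF R ck[unfolded s_def]]) (use Fp(1,2) in blast)
      also have "(\<Sum>\<gamma>\<in>G. \<integral>\<^sup>+x. ennreal (norm (freq_proj \<gamma> F x) powr p) \<partial>lborel) = (\<Sum>\<gamma>\<in>G. ennreal (Y \<gamma>))"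
        using Fp(3) by (intro sum.cong) (auto simp: Y_def)
      also have "ennreal (A * R powr ((1 + \<epsilon>) * ((p - 2) / 2))) * (\<Sum>\<gamma>\<in>G. ennreal (Y \<gamma>)) = ennreal (A * R powr ((1 + \<epsilon>) * ((p - 2) / 2)) * (\<Sum>\<gamma>\<in>G. Y \<gamma>))"
        using A Y0 by (simp add: ennreal_mult sum_nonneg)
      finally show ?thesis
        unfolding rec X_def by (intro integral_real_bounded) (auto intro!: mult_nonneg_nonneg sum_nonneg A Y0)
    qed
    have "Lp_norm p F = X powr (1 / p)" by (simp add: Lp_norm_def X_def)
    also have "\<dots> \<le> (A * R powr ((1 + \<epsilon>) * ((p - 2) / 2)) * (\<Sum>\<gamma>\<in>G. Y \<gamma>)) powr (1 / p)"
      using XY X0 p by (intro powr_mono2) auto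
    also have "\<dots> = A powr (1 / p) * R powr ((1 + \<epsilon>) * ((p - 2) / 2) * (1 / p)) * (\<Sum>\<gamma>\<in>G. Y \<gamma>) powr (1 / p)"
      using A Y0 by (simp add: powr_mult powr_powr sum_nonneg)
    also have "\<dots> \<le> A powr (1 / p) * R powr (1 / 2 - 1 / p + \<epsilon>) * (\<Sum>\<gamma>\<in>G. Y \<gamma>) powr (1 / p)"
    proof (intro mult_right_mono mult_left_mono powr_mono R)
      have e: "(p - 2) / 2 * (1 / p) = 1 / 2 - 1 / p" using p by (simp add: field_simps)
      have "1 / 2 - 1 / p \<le> 1" "0 \<le> 1 / 2 - 1 / p" using p by (auto simp: field_simps)
      then have "\<epsilon> * (1 / 2 - 1 / p) \<le> \<epsilon> * 1" using \<epsilon> by (intro mult_left_mono) auto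
      then show "(1 + \<epsilon>) * ((p - 2) / 2) * (1 / p) \<le> 1 / 2 - 1 / p + \<epsilon>"
        unfolding mult.assoc e distrib_right by simp
    qed auto
    also have "(\<Sum>\<gamma>\<in>G. Y \<gamma>) = (\<Sum>\<gamma>\<in>\<Gamma> (1 / R). Lp_norm p (freq_proj \<gamma> F) powr p)"
      unfolding G_def sR(3) using p Y0 by (intro sum.cong) (auto simp: Lp_norm_def Y_def powr_powr)
    finally show "Lp_norm p F \<le> A powr (1 / p) * R powr (1 / 2 - 1 / p + \<epsilon>) * (\<Sum>\<gamma>\<in>\<Gamma> (1 / R). Lp_norm p (freq_proj \<gamma> F) powr p) powr (1 / p)" .
  qed
qed

end
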